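(* Let $G$ be a compact abelian group with Haar probability measure $\mu$ and let $\underline\ell\mapsto A^{\underline\ell}$ be a totally ergodic $\mathbb{Z}^d$-action on $G$ by commuting automorphisms which is mixing of all orders. Let $(R_n)_{n\ge1}$ be a summation sequence on $\mathbb{Z}^d$ which is $\zeta$-regular. Let $f\in AC_0(G)$ with spectral density $\varphi_f$. If $$\Big(\sup_{\underline\ell}R_n(\underline\ell)\Big)^{r-1}\sum_{\underline\ell}R_n(\underline\ell)=o\Big(\Big(\sum_{\underline\ell\in\mathbb{Z}^d}R_n(\underline\ell)^2\Big)^{r/2}\Big)\quad\text{for every integer } r\ge3,$$ then, in distribution with respect to $\mu$, $$\Big(\sum_{\underline\ell\in\mathbb{Z}^d}R_n(\underline\ell)^2\Big)^{-1/2}\sum_{\underline\ell\in\mathbb{Z}^d}R_n(\underline\ell)\,f(A^{\underline\ell}\,\cdot)\ \underset{n\to\infty}{\longrightarrow}\ \mathcal N(0,\zeta(\varphi_f)),$$ with the convention that the limiting distribution is $\delta_0$ if $\zeta(\varphi_f)=0$.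
   Context: $A^{\underline\ell}=A_1^{\ell_1}\cdots A_d^{\ell_d}$ for commuting automorphisms $A_1,\dots,A_d$ of $G$. Totally ergodic: $A^{\underline\ell}$ is ergodic for every $\underline\ell\ne\underline 0$. Mixing of all orders: for every $r\ge 2$ and Borel sets $B_1,\dots,B_r$, $\mu(\bigcap_{i}A^{-\underline n_i}B_i)\to\prod_i\mu(B_i)$ as $\min_{i\ne i'}\|\underline n_i-\underline n_{i'}\|\to\infty$ (this holds automatically when $G$ is connected). A summation sequence is a sequence of functions $R_n:\mathbb{Z}^d\to\mathbb{R}^+$ with $0<\sum_{\underline\ell}R_n(\underline\ell)<\infty$. Its normalized kernel is $\tilde R_n(\underline t)=|\sum_{\underline\ell}R_n(\underline\ell)e^{2\pi i\langle\underline\ell,\underline t\rangle}|^2/\sum_{\underline\ell}R_n(\underline\ell)^2$, $\underline t\in\mathbb{T}^d$. It is $\zeta$-regular, for a probability measure $\zeta$ on $\mathbb{T}^d$, if $\int\tilde R_n\varphi\,d\underline t\to\int\varphi\,d\zeta$ for every continuous $\varphi$ on $\mathbb{T}^d$. $AC_0(G)$: real functions on $G$ with zero mean and $\sum_{\chi\in\hat G}|c_f(\chi)|<\infty$, $c_f(\chi)=\int\overline\chi f\,d\mu$. $\varphi_f$ is the continuous function on $\mathbb{T}^d$ with Fourier coefficients $\langle f\circ A^{\underline n},f\rangle$; $\zeta(\varphi_f)=\int\varphi_f\,d\zeta$. *)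

theory Defs
  imports "HOL-Probability.Probability"
begin

section \<open>Compact abelian groups and actions by automorphisms\<close>

text \<open>The group need not be metrizable, so regularity is part of the definition of the Haar
  measure on the Borel sets (it is what makes this measure unique).\<close>

definition haar_probability :: "'a::{topological_ab_group_add,t2_space} measure \<Rightarrow> bool" where
  "haar_probability M \<longleftrightarrow>
     sets M = sets borel \<and> prob_space M \<and>
     (\<forall>a. distr M borel (\<lambda>x. a + x) = M) \<and>
     (\<forall>B\<in>sets borel. emeasure M B = (SUP K\<in>{K. K \<subseteq> B \<and> compact K}. emeasure M K))"

definition group_automorphism :: "('a::topological_ab_group_add \<Rightarrow> 'a) \<Rightarrow> bool" where
  "group_automorphism T \<longleftrightarrow>
     (\<forall>x y. T (x + y) = T x + T y) \<and> bij T \<and> continuous_on UNIV T \<and> continuous_on UNIV (inv T)"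

definition int_iterate :: "('a \<Rightarrow> 'a) \<Rightarrow> int \<Rightarrow> 'a \<Rightarrow> 'a" where
  "int_iterate T k = (if k \<ge> 0 then T ^^ nat k else inv T ^^ nat (- k))"

lemma comm_funpow: "S \<circ> T = T \<circ> S \<Longrightarrow> S \<circ> T ^^ n = T ^^ n \<circ> S"
  by (induction n) (auto simp: fun_eq_iff)

lemma comm_inv: "bij T \<Longrightarrow> S \<circ> T = T \<circ> S \<Longrightarrow> S \<circ> inv T = inv T \<circ> S"
  by (rule ext, simp add: fun_eq_iff) (metis bij_inv_eq_iff)

lemma comm_int_iterate: "bij T \<Longrightarrow> S \<circ> T = T \<circ> S \<Longrightarrow> S \<circ> int_iterate T k = int_iterate T k \<circ> S"
  unfolding int_iterate_def by (auto intro: comm_funpow comm_inv)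

lemma int_iterate_comm:
  assumes "bij S" "bij T" "S \<circ> T = T \<circ> S"
  shows "int_iterate S k \<circ> int_iterate T m = int_iterate T m \<circ> int_iterate S k"
  by (rule comm_int_iterate[OF assms(1) comm_int_iterate[OF assms(2,3), symmetric], symmetric])

lemma int_iterate_0 [simp]: "int_iterate T 0 = id"
  by (simp add: int_iterate_def)

lemma int_iterate_1 [simp]: "int_iterate T 1 = T"
  by (simp add: int_iterate_def)

lemma int_iterate_Suc:
  assumes "bij T"
  shows "int_iterate T (k + 1) x = T (int_iterate T k x)"
proof (cases "k \<ge> 0")
  case True
  then have "nat (k + 1) = Suc (nat k)" by simp
  with True show ?thesis by (simp add: int_iterate_def)
next
  case False
  then have *: "nat (- k) = Suc (nat (- (k + 1)))" by simp
  have "int_iterate T k x = inv T ((inv T ^^ nat (- (k + 1))) x)"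
    using False unfolding int_iterate_def * by simp
  then have "T (int_iterate T k x) = (inv T ^^ nat (- (k + 1))) x"
    by (simp add: bij_is_surj[OF assms] surj_f_inv_f)
  then show ?thesis
    using False by (cases "k = - 1") (simp_all add: int_iterate_def)
qed

lemma int_iterate_add:
  assumes "bij T"
  shows "int_iterate T (k + m) x = int_iterate T k (int_iterate T m x)"
proof (induction k rule: int_induct[where k = 0])
  case base
  show ?case by simp
next
  case (step1 i)
  have "int_iterate T (i + 1 + m) x = T (int_iterate T (i + m) x)"
    using int_iterate_Suc[OF assms, of "i + m"] by (simp add: algebra_simps)
  with step1 show ?case by (simp add: int_iterate_Suc[OF assms])
next
  case (step2 i)
  have "T (int_iterate T (i - 1 + m) x) = int_iterate T (i + m) x"
    using int_iterate_Suc[OF assms, of "i - 1 + m" x] by (simp add: algebra_simps)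
  also have "\<dots> = T (int_iterate T (i - 1) (int_iterate T m x))"
    using step2 int_iterate_Suc[OF assms, of "i - 1"] by simp
  finally show ?case
    using bij_is_inj[OF assms] by (simp add: inj_eq)
qed

text \<open>The composition of the maps \<open>int_iterate (A i) (l $ i)\<close> over all \<open>i\<close>; the order
  is irrelevant when the \<open>A i\<close> are commuting bijections.\<close>

definition act :: "('d::finite \<Rightarrow> 'a \<Rightarrow> 'a) \<Rightarrow> int ^ 'd \<Rightarrow> 'a \<Rightarrow> 'a" where
  "act A l = Finite_Set.fold (\<lambda>i g. int_iterate (A i) (l $ i) \<circ> g) id UNIV"

locale commuting_bijections =
  fixes A :: "'d::finite \<Rightarrow> 'a \<Rightarrow> 'a"
  assumes bij: "bij (A i)"
    and comm: "A i \<circ> A j = A j \<circ> A i"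
begin

lemma comp_fun_commute_step: "comp_fun_commute (\<lambda>i g. int_iterate (A i) (l $ i) \<circ> g)"
proof
  fix i j :: 'd
  show "(\<lambda>g. int_iterate (A j) (l $ j) \<circ> g) \<circ> (\<lambda>g. int_iterate (A i) (l $ i) \<circ> g)
      = (\<lambda>g. int_iterate (A i) (l $ i) \<circ> g) \<circ> (\<lambda>g. int_iterate (A j) (l $ j) \<circ> g)"
    using int_iterate_comm[OF bij bij comm, of j "l $ j" i "l $ i"]
    by (simp add: fun_eq_iff)
qed

definition partial_act :: "'d set \<Rightarrow> int ^ 'd \<Rightarrow> 'a \<Rightarrow> 'a" where
  "partial_act I l = Finite_Set.fold (\<lambda>i g. int_iterate (A i) (l $ i) \<circ> g) id I"

lemma partial_act_empty [simp]: "partial_act {} l x = x"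
  by (simp add: partial_act_def)

lemma partial_act_insert [simp]:
  assumes "i \<notin> I"
  shows "partial_act (insert i I) l x = int_iterate (A i) (l $ i) (partial_act I l x)"
proof -
  interpret comp_fun_commute "\<lambda>i g. int_iterate (A i) (l $ i) \<circ> g"
    by (rule comp_fun_commute_step)
  show ?thesis
    unfolding partial_act_def using assms by (subst fold_insert) simp_all
qed

lemma partial_act_comm:
  "int_iterate (A i) k (partial_act I l x) = partial_act I l (int_iterate (A i) k x)"
proof (induction I rule: finite_induct[OF finite])
  case 1
  show ?case by simp
next
  case (2 j I)
  then show ?case
    using fun_cong[OF int_iterate_comm[OF bij bij comm, of i k j "l $ j"]] by simp
qed

lemma act_0: "act A 0 = id"
proof -
  have "partial_act I 0 x = x" for I x
    by (induction I rule: finite_induct[OF finite]) simp_all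
  then show ?thesis unfolding act_def partial_act_def[symmetric] by (simp add: fun_eq_iff)
qed

lemma act_add: "act A (l + m) = act A l \<circ> act A m"
proof -
  have "partial_act I (l + m) x = partial_act I l (partial_act I m x)" for I x
    by (induction I rule: finite_induct[OF finite])
      (simp_all add: int_iterate_add[OF bij] partial_act_comm)
  then show ?thesis unfolding act_def partial_act_def[symmetric] by (simp add: fun_eq_iff)
qed

lemma act_axis: "act A (axis i 1) = A i"
proof -
  have "partial_act I (axis i 1) x = (if i \<in> I then A i x else x)" for I x
    by (induction I rule: finite_induct[OF finite]) (auto simp: axis_def)
  then show ?thesis unfolding act_def partial_act_def[symmetric] by (simp add: fun_eq_iff)
qed

end

definition ergodic_map :: "'a measure \<Rightarrow> ('a \<Rightarrow> 'a) \<Rightarrow> bool" where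
  "ergodic_map M T \<longleftrightarrow>
     (\<forall>B\<in>sets M. T -` B \<inter> space M = B \<longrightarrow> measure M B = 0 \<or> measure M B = 1)"

definition totally_ergodic :: "'a measure \<Rightarrow> ('d::finite \<Rightarrow> 'a \<Rightarrow> 'a) \<Rightarrow> bool" where
  "totally_ergodic M A \<longleftrightarrow> (\<forall>l. l \<noteq> 0 \<longrightarrow> ergodic_map M (act A l))"

definition real_vec :: "int ^ 'd \<Rightarrow> real ^ 'd" where
  "real_vec l = (\<chi> i. real_of_int (l $ i))"

definition min_gap :: "nat \<Rightarrow> (nat \<Rightarrow> int ^ 'd::finite) \<Rightarrow> real" where
  "min_gap r n = Min {norm (real_vec (n i) - real_vec (n j)) |i j.
                        i \<in> {1..r} \<and> j \<in> {1..r} \<and> i \<noteq> j}"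

definition mixing_all_orders :: "'a measure \<Rightarrow> ('d::finite \<Rightarrow> 'a \<Rightarrow> 'a) \<Rightarrow> bool" where
  "mixing_all_orders M A \<longleftrightarrow>
     (\<forall>r\<ge>2. \<forall>B :: nat \<Rightarrow> 'a set. (\<forall>i\<in>{1..r}. B i \<in> sets M) \<longrightarrow>
        ((\<lambda>n. measure M (\<Inter>i\<in>{1..r}. act A (n i) -` B i \<inter> space M))
           \<longlongrightarrow> (\<Prod>i\<in>{1..r}. measure M (B i))) (filtercomap (min_gap r) at_top))"

section \<open>The torus\<close>

text \<open>The torus is represented by the fundamental domain \<open>[0,1)\<close>-cube; continuous functions
  on it are the continuous functions on the Euclidean space that are 1-periodic in each
  coordinate. Borel measures on the torus are Borel measures on the cube.\<close>

definition torus :: "(real ^ 'd::finite) set" where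
  "torus = {t. \<forall>i. 0 \<le> t $ i \<and> t $ i < 1}"

definition torus_haar :: "(real ^ 'd::finite) measure" where
  "torus_haar = restrict_space lborel torus"

definition torus_continuous :: "(real ^ 'd::finite \<Rightarrow> real) \<Rightarrow> bool" where
  "torus_continuous \<phi> \<longleftrightarrow> continuous_on UNIV \<phi> \<and> (\<forall>t i. \<phi> (t + axis i 1) = \<phi> t)"

definition torus_char :: "int ^ 'd::finite \<Rightarrow> real ^ 'd \<Rightarrow> complex" where
  "torus_char l t = cis (2 * pi * (real_vec l \<bullet> t))"

section \<open>Summation sequences\<close>

definition summation_sequence :: "(nat \<Rightarrow> int ^ 'd::finite \<Rightarrow> real) \<Rightarrow> bool" where
  "summation_sequence R \<longleftrightarrow>
     (\<forall>n. (\<forall>l. 0 \<le> R n l) \<and> R n summable_on UNIV \<and> 0 < (\<Sum>\<^sub>\<infinity>l. R n l))"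

definition normalized_kernel :: "(int ^ 'd::finite \<Rightarrow> real) \<Rightarrow> real ^ 'd \<Rightarrow> real" where
  "normalized_kernel \<rho> t =
     (cmod (\<Sum>\<^sub>\<infinity>l. of_real (\<rho> l) * torus_char l t))\<^sup>2 / (\<Sum>\<^sub>\<infinity>l. (\<rho> l)\<^sup>2)"

definition zeta_regular ::
    "(nat \<Rightarrow> int ^ 'd::finite \<Rightarrow> real) \<Rightarrow> (real ^ 'd) measure \<Rightarrow> bool" where
  "zeta_regular R \<zeta> \<longleftrightarrow>
     prob_space \<zeta> \<and> sets \<zeta> = sets (torus_haar :: (real ^ 'd) measure) \<and>
     (\<forall>\<phi>. torus_continuous \<phi> \<longrightarrow>
        (\<lambda>n. \<integral>t. normalized_kernel (R n) t * \<phi> t \<partial>torus_haar) \<longlonglongrightarrow> (\<integral>t. \<phi> t \<partial>\<zeta>))"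

section \<open>Fourier analysis on the group\<close>

definition dual_group :: "('a::topological_ab_group_add \<Rightarrow> complex) set" where
  "dual_group = {\<gamma>. continuous_on UNIV \<gamma> \<and> (\<forall>x. cmod (\<gamma> x) = 1) \<and>
                    (\<forall>x y. \<gamma> (x + y) = \<gamma> x * \<gamma> y)}"

definition fourier_coeff :: "'a measure \<Rightarrow> ('a \<Rightarrow> real) \<Rightarrow> ('a \<Rightarrow> complex) \<Rightarrow> complex" where
  "fourier_coeff M f \<gamma> = (\<integral>x. cnj (\<gamma> x) * of_real (f x) \<partial>M)"

definition AC0 :: "'a::topological_ab_group_add measure \<Rightarrow> ('a \<Rightarrow> real) set" where
  "AC0 M = {f. integrable M f \<and> (\<integral>x. f x \<partial>M) = 0 \<and>
               (\<lambda>\<gamma>. cmod (fourier_coeff M f \<gamma>)) summable_on dual_group}"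

text \<open>The sign convention for Fourier coefficients on the torus is immaterial here, since the
  correlations of a real function are even in \<open>n\<close>.\<close>

definition spectral_density ::
    "'a measure \<Rightarrow> ('d::finite \<Rightarrow> 'a \<Rightarrow> 'a) \<Rightarrow> ('a \<Rightarrow> real) \<Rightarrow> real ^ 'd \<Rightarrow> real" where
  "spectral_density M A f = (THE \<phi>. torus_continuous \<phi> \<and>
     (\<forall>n. (\<integral>t. of_real (\<phi> t) * cnj (torus_char n t) \<partial>torus_haar)
            = complex_of_real (\<integral>x. f (act A n x) * f x \<partial>M)))"

section \<open>Centered normal law, including the degenerate case\<close>

definition centered_normal :: "real \<Rightarrow> real measure" where
  "centered_normal v =
     (if v = 0 then return borel 0 else density lborel (\<lambda>x. ennreal (normal_density 0 (sqrt v) x)))"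

end

theory Submission
  imports Defs
begin

text \<open>Almost everywhere, \<open>f\<close> is an absolutely convergent series of nontrivial characters. This needs the
  completeness of the dual group, which is obtained without representation theory: the powers of a
  positive definite convolution kernel converge to a convolution idempotent, and a minimal
  idempotent is a multiple of a character.

  For a trigonometric polynomial, the moments of the normalized sums count families of characters
  \<open>\<gamma>\<^sub>i \<circ> act A l\<^sub>i\<close> with product 1. Mixing forces the members of such a family to form
  clusters of bounded diameter. The growth condition on \<open>R\<close> makes clusters with at least three members
  negligible, and the pairs lead to the moment recursion \<open>m\<^sub>r = (r - 1) v m\<^bsub>r-2\<^esub> + o(1)\<close> of
  the Gaussian law. The general case follows by approximation in \<open>L\<^sup>2\<close>: the correlations are
  summable because nontrivial characters have infinite orbits, so that \<open>R\<close> can be truncated to finite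
  sets and \<open>f\<close> to trigonometric polynomials, uniformly in \<open>n\<close>.\<close>

section \<open>Integration over a compact space\<close>

text \<open>Clusters have bounded diameter only for characters from a fixed finite set, so the
  moment method applies to trigonometric polynomials and not to \<open>f\<close> itself. The index
  \<open>k\<close> of the polynomial \<open>g k\<close> is therefore fixed before \<open>n\<close>
  tends to infinity, while the truncation of \<open>R n\<close> may depend on \<open>n\<close>. The
  two levels are linked by a bound for the \<open>L\<^sup>2\<close> norm of normalized weighted sums
  through the absolute sum of the Fourier coefficients, uniform in the weights. Regularity of
  \<open>R\<close> enters only through the limit of the variances: the variance of a finite sum is a
  quadratic form in the correlations, and this form is also the integral of the kernel against the
  density with these Fourier coefficients. It is applied to \<open>f\<close> only; for
  \<open>g k\<close> no limit of variances is sought. As the group need not be metrizable, simple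
  functions are built from finite subcovers, and passages between sets and continuous functions rest
  on the regularity of the Haar measure. Its invariance under automorphisms is itself a consequence
  of its uniqueness.\<close>

lemma norm_integral_le_integral:
  fixes f :: "'a \<Rightarrow> 'b::{banach,second_countable_topology}"
  assumes "integrable M f" "integrable M g" "\<And>x. norm (f x) \<le> g x"
  shows "norm (\<integral>x. f x \<partial>M) \<le> (\<integral>x. g x \<partial>M)"
  using assms by (intro order_trans[OF integral_norm_bound] integral_mono) auto

text \<open>A substitute for approximation by simple functions: finitely many of the neighbourhoods
  cover the space, they are listed, and each point is sent to the centre of the first one that
  contains it. Taking the first index makes the preimages Borel.\<close>

lemma finite_borel_selection:
  fixes Q :: "'a::topological_space \<Rightarrow> 'a \<Rightarrow> bool"
  assumes "compact (UNIV :: 'a set)"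
    and Q: "\<And>p. \<exists>U. open U \<and> p \<in> U \<and> (\<forall>x\<in>U. Q x p)"
  obtains \<pi> where "\<pi> \<in> borel \<rightarrow>\<^sub>M count_space UNIV" "finite (range \<pi>)" "\<And>x. Q x (\<pi> x)"
proof -
  from Q obtain U where U: "\<And>p. open (U p)" "\<And>p. p \<in> U p" "\<And>p x. x \<in> U p \<Longrightarrow> Q x p"
    by metis
  obtain P where P: "finite P" "UNIV \<subseteq> (\<Union>p\<in>P. U p)"
    using compactE_image[OF assms(1), of UNIV U] U by (metis UNIV_I UN_I subsetI)
  obtain ps where ps: "set ps = P" using P(1) finite_list by blast
  define N where "N x = (LEAST i. x \<in> U (ps ! i) \<and> i < length ps)" for x
  have N: "x \<in> U (ps ! N x) \<and> N x < length ps" for x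
  proof -
    obtain p where "p \<in> P" "x \<in> U p" using P by blast
    then have "\<exists>i. x \<in> U (ps ! i) \<and> i < length ps" using ps by (metis in_set_conv_nth)
    then show ?thesis unfolding N_def by (rule LeastI_ex)
  qed
  have "N \<in> borel \<rightarrow>\<^sub>M count_space UNIV"
    unfolding N_def
  proof (intro measurable_Least)
    fix i
    have "open {x. x \<in> U (ps ! i) \<and> i < length ps}" using U(1) by (cases "i < length ps") auto
    then show "Measurable.pred borel (\<lambda>x. x \<in> U (ps ! i) \<and> i < length ps)"
      unfolding pred_def space_borel by (simp add: borel_open)
  qed
  then have "(\<lambda>x. ps ! N x) \<in> borel \<rightarrow>\<^sub>M count_space UNIV"
    by (rule measurable_compose) simp
  moreover have "finite (range (\<lambda>x. ps ! N x))"
    by (rule finite_subset[of _ "set ps"]) (use N in auto)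
  moreover have "Q x (ps ! N x)" for x using N U(3) by blast
  ultimately show ?thesis by (rule that)
qed

text \<open>The tube lemma: compactness of the second factor makes continuity at \<open>p\<close>
  uniform in \<open>y\<close>.\<close>

lemma uniformly_near_slices:
  fixes K :: "'a::topological_space \<Rightarrow> 'b::topological_space \<Rightarrow> 'c::metric_space"
  assumes "compact (UNIV :: 'b set)" "continuous_on UNIV (\<lambda>(x, y). K x y)" "0 < e"
  shows "\<exists>U. open U \<and> p \<in> U \<and> (\<forall>x\<in>U. \<forall>y. dist (K x y) (K p y) \<le> e)"
proof -
  have "continuous_on (UNIV \<times> UNIV) (\<lambda>(x, y). K x y)" using assms(2) by simp
  from continuous_on_prod_compactE[OF this assms(1) UNIV_I assms(3), of p] show ?thesis
    by (simp, metis)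
qed

lemma continuous_on_slice:
  assumes "continuous_on UNIV (\<lambda>(x, y). K x y)"
  shows "continuous_on UNIV (K x)" "continuous_on UNIV (\<lambda>x. K x y)"
proof -
  show "continuous_on UNIV (K x)"
    using continuous_on_compose2[OF assms continuous_on_Pair[OF continuous_on_const continuous_on_id]] by simp
  show "continuous_on UNIV (\<lambda>x. K x y)"
    using continuous_on_compose2[OF assms continuous_on_Pair[OF continuous_on_id continuous_on_const]] by simp
qed

lemma bounded_continuous_on_compact_UNIV:
  fixes g :: "'a::topological_space \<Rightarrow> 'b::real_normed_vector"
  assumes "compact (UNIV :: 'a set)" "continuous_on UNIV g"
  obtains B where "0 < B" "\<And>x. norm (g x) \<le> B"
proof -
  have "bounded (range g)" using assms compact_continuous_image compact_imp_bounded by blast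
  then show ?thesis using that unfolding bounded_pos by blast
qed

lemma integrable_continuous_mult:
  fixes g :: "'a::topological_space \<Rightarrow> complex"
  assumes "compact (UNIV :: 'a set)" "continuous_on UNIV g" "sets \<nu> = sets borel" "integrable \<nu> u"
  shows "integrable \<nu> (\<lambda>y. g y * u y)"
proof -
  obtain B where B: "0 < B" "\<And>x. norm (g x) \<le> B"
    using bounded_continuous_on_compact_UNIV[OF assms(1,2)] by blast
  have [measurable]: "g \<in> borel_measurable \<nu>"
    unfolding measurable_cong_sets[OF assms(3) refl] using assms(2) by (rule borel_measurable_continuous_onI)
  have [measurable]: "u \<in> borel_measurable \<nu>" using assms(4) by simp
  show ?thesis
    by (rule Bochner_Integration.integrable_bound[of _ "\<lambda>y. B * norm (u y)"])
      (use assms(4) B in \<open>auto simp: norm_mult intro!: mult_right_mono\<close>)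
qed

lemma integral_kernel_diff_le:
  fixes K :: "'a \<Rightarrow> 'b::topological_space \<Rightarrow> complex"
  assumes "compact (UNIV :: 'b set)" "\<And>x. continuous_on UNIV (K x)"
    and "sets \<nu> = sets borel" "integrable \<nu> u" "\<And>y. dist (K x y) (K p y) \<le> e"
  shows "dist (\<integral>y. K x y * u y \<partial>\<nu>) (\<integral>y. K p y * u y \<partial>\<nu>) \<le> e * (\<integral>y. norm (u y) \<partial>\<nu>)"
proof -
  note int = integrable_continuous_mult[OF assms(1) assms(2) assms(3,4)]
  have "dist (\<integral>y. K x y * u y \<partial>\<nu>) (\<integral>y. K p y * u y \<partial>\<nu>) = norm (\<integral>y. (K x y - K p y) * u y \<partial>\<nu>)"
    by (simp add: dist_norm left_diff_distrib int)
  also have "\<dots> \<le> (\<integral>y. e * norm (u y) \<partial>\<nu>)"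
  proof (rule norm_integral_le_integral)
    show "integrable \<nu> (\<lambda>y. (K x y - K p y) * u y)" by (simp add: left_diff_distrib int)
    show "norm ((K x y - K p y) * u y) \<le> e * norm (u y)" for y
      using assms(5)[of y] by (simp add: norm_mult dist_norm mult_right_mono)
  qed (simp add: assms(4))
  finally show ?thesis by simp
qed

lemma continuous_on_integral_kernel:
  fixes K :: "'a::topological_space \<Rightarrow> 'b::topological_space \<Rightarrow> complex"
  assumes "compact (UNIV :: 'b set)" "continuous_on UNIV (\<lambda>(x, y). K x y)"
    and "sets \<nu> = sets borel" "integrable \<nu> u"
  shows "continuous_on UNIV (\<lambda>x. \<integral>y. K x y * u y \<partial>\<nu>)"
  unfolding continuous_on_def
proof
  fix p :: 'a
  let ?I = "\<integral>y. norm (u y) \<partial>\<nu>"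
  have "?I \<ge> 0" by simp
  show "((\<lambda>x. \<integral>y. K x y * u y \<partial>\<nu>) \<longlongrightarrow> (\<integral>y. K p y * u y \<partial>\<nu>)) (at p)"
    unfolding tendsto_iff
  proof (intro allI impI)
    fix e :: real assume "0 < e"
    \<comment> \<open>The 1 in the denominator covers the case that the integral of
      \<open>norm (u y)\<close> is 0, and it makes the final inequality strict.\<close>
    define d where "d = e / (?I + 1)"
    have d: "0 < d" "d * ?I < e"
      using \<open>0 < e\<close> \<open>?I \<ge> 0\<close> by (auto simp: d_def field_simps add_pos_nonneg)
    obtain U where U: "open U" "p \<in> U" "\<And>x y. x \<in> U \<Longrightarrow> dist (K x y) (K p y) \<le> d"
      using uniformly_near_slices[OF assms(1,2) d(1), of p] by blast
    have "dist (\<integral>y. K x y * u y \<partial>\<nu>) (\<integral>y. K p y * u y \<partial>\<nu>) < e" if "x \<in> U" for x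
      using integral_kernel_diff_le[OF assms(1) continuous_on_slice(1)[OF assms(2)] assms(3,4) U(3)[OF that]]
        d(2) by simp
    then show "\<forall>\<^sub>F x in at p. dist (\<integral>y. K x y * u y \<partial>\<nu>) (\<integral>y. K p y * u y \<partial>\<nu>) < e"
      using U(1,2) eventually_at_topological by blast
  qed
qed

text \<open>Fubini for a continuous kernel. The product theorem of the library is not applicable since
  the kernel need not be measurable for the product of the Borel algebras.\<close>

lemma integral_swap_kernel:
  fixes K :: "'a::topological_space \<Rightarrow> 'b::topological_space \<Rightarrow> complex"
  assumes ca: "compact (UNIV :: 'a set)" and cb: "compact (UNIV :: 'b set)"
    and K: "continuous_on UNIV (\<lambda>(x, y). K x y)"
    and \<mu>: "finite_measure \<mu>" "sets \<mu> = sets borel"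
    and \<nu>: "sets \<nu> = sets borel" "integrable \<nu> u"
  shows "(\<integral>x. (\<integral>y. K x y * u y \<partial>\<nu>) \<partial>\<mu>) = (\<integral>y. (\<integral>x. K x y \<partial>\<mu>) * u y \<partial>\<nu>)" (is "?L = ?R")
proof -
  interpret finite_measure \<mu> by fact
  have sp: "space \<mu> = UNIV" using sets_eq_imp_space_eq[OF \<mu>(2)] by simp
  let ?I = "\<integral>y. norm (u y) \<partial>\<nu>" and ?m = "measure \<mu> UNIV"
  let ?G = "\<lambda>x. \<integral>y. K x y * u y \<partial>\<nu>"
  note Kx = continuous_on_slice(1)[OF K] and Ky = continuous_on_slice(2)[OF K]
  have meas: "\<And>g::'a \<Rightarrow> complex. continuous_on UNIV g \<Longrightarrow> g \<in> borel_measurable \<mu>"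
    unfolding measurable_cong_sets[OF \<mu>(2) refl] by (rule borel_measurable_continuous_onI)
  have icont: "integrable \<mu> g" if g: "continuous_on UNIV g" for g :: "'a \<Rightarrow> complex"
  proof -
    obtain B where "0 < B" "\<And>x. norm (g x) \<le> B" using bounded_continuous_on_compact_UNIV[OF ca g] by blast
    then show ?thesis using meas[OF g] by (intro integrable_const_bound[of _ B]) auto
  qed
  note cG = continuous_on_integral_kernel[OF cb K \<nu>]
  have "continuous_on UNIV (\<lambda>(y, x). K x y)"
    using continuous_on_compose2[OF K continuous_on_swap] by (simp add: prod.swap_def case_prod_unfold)
  from continuous_on_integral_kernel[OF ca this \<mu>(2), of "\<lambda>_. 1"]
  have cR: "continuous_on UNIV (\<lambda>y. \<integral>x. K x y \<partial>\<mu>)" by simp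
  \<comment> \<open>Replacing \<open>x\<close> by the finitely valued \<open>\<pi> x\<close> turns
    the outer integral into a finite sum, for which the interchange is linearity. On either side of
    the identity the replacement costs at most \<open>d * (?m * ?I)\<close>.\<close>
  have est: "dist ?L ?R \<le> d * (2 * ?m * ?I)" if d: "0 < d" for d
  proof -
    obtain \<pi> where \<pi>: "\<pi> \<in> borel \<rightarrow>\<^sub>M count_space UNIV" "finite (range \<pi>)"
      "\<And>x y. dist (K x y) (K (\<pi> x) y) \<le> d"
      using finite_borel_selection[OF ca uniformly_near_slices[OF cb K d]] by blast
    let ?B = "\<lambda>p. \<pi> -` {p}"
    have \<pi>m[measurable]: "\<pi> \<in> \<mu> \<rightarrow>\<^sub>M count_space UNIV"
      unfolding measurable_cong_sets[OF \<mu>(2) refl] by fact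
    have B: "?B p \<in> sets \<mu>" for p using measurable_sets[OF \<pi>m, of "{p}"] sp by simp
    have step: "(\<Sum>p\<in>range \<pi>. indicator (?B p) x *\<^sub>R h p) = h (\<pi> x)" for x and h :: "'a \<Rightarrow> complex"
    proof -
      have "(\<Sum>p\<in>range \<pi>. indicator (?B p) x *\<^sub>R h p) = (\<Sum>p\<in>range \<pi>. if p = \<pi> x then h p else 0)"
        by (intro sum.cong) (auto simp: indicator_def)
      then show ?thesis using \<pi>(2) by simp
    qed
    have int_step: "integrable \<mu> (\<lambda>x. h (\<pi> x))"
      "(\<integral>x. h (\<pi> x) \<partial>\<mu>) = (\<Sum>p\<in>range \<pi>. measure \<mu> (?B p) *\<^sub>R h p)" for h :: "'a \<Rightarrow> complex"
    proof -
      have ind: "integrable \<mu> (indicat_real (?B p))" for p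
        using B[of p] by (intro integrable_real_indicator) (auto simp: emeasure_eq_measure)
      have i: "integrable \<mu> (\<lambda>x. indicator (?B p) x *\<^sub>R h p)" for p
        using ind by (rule integrable_scaleR_left)
      have eq: "(\<lambda>x. h (\<pi> x)) = (\<lambda>x. \<Sum>p\<in>range \<pi>. indicator (?B p) x *\<^sub>R h p)"
        using step[where h = h] by simp
      show "integrable \<mu> (\<lambda>x. h (\<pi> x))" unfolding eq using i by (rule Bochner_Integration.integrable_sum)
      show "(\<integral>x. h (\<pi> x) \<partial>\<mu>) = (\<Sum>p\<in>range \<pi>. measure \<mu> (?B p) *\<^sub>R h p)"
        unfolding eq using i ind sp by (simp add: Bochner_Integration.integral_sum integral_scaleR_left)
    qed
    have "dist ?L (\<integral>x. ?G (\<pi> x) \<partial>\<mu>) = norm (\<integral>x. ?G x - ?G (\<pi> x) \<partial>\<mu>)"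
      by (simp add: dist_norm icont[OF cG] int_step(1)[of ?G])
    also have "\<dots> \<le> (\<integral>x. d * ?I \<partial>\<mu>)"
      using integral_kernel_diff_le[where K = K, OF cb Kx \<nu> \<pi>(3)] icont[OF cG] int_step(1)[of ?G]
      by (intro norm_integral_le_integral) (auto simp: dist_norm)
    finally have 1: "dist ?L (\<integral>x. ?G (\<pi> x) \<partial>\<mu>) \<le> d * (?m * ?I)" using sp by (simp add: mult_ac)
    have "(\<integral>x. ?G (\<pi> x) \<partial>\<mu>) = (\<Sum>p\<in>range \<pi>. \<integral>y. measure \<mu> (?B p) *\<^sub>R (K p y * u y) \<partial>\<nu>)"
      by (simp add: int_step(2)[of ?G])
    also have "\<dots> = (\<integral>y. (\<Sum>p\<in>range \<pi>. measure \<mu> (?B p) *\<^sub>R (K p y * u y)) \<partial>\<nu>)"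
      by (intro Bochner_Integration.integral_sum[symmetric] integrable_scaleR_right
          integrable_continuous_mult[OF cb _ \<nu>] Kx)
    also have "\<dots> = (\<integral>y. (\<integral>x. K (\<pi> x) y \<partial>\<mu>) * u y \<partial>\<nu>)"
      by (simp add: int_step(2)[of "\<lambda>p. K p _"] sum_distrib_right)
    finally have 2: "(\<integral>x. ?G (\<pi> x) \<partial>\<mu>) = (\<integral>y. (\<integral>x. K (\<pi> x) y \<partial>\<mu>) * u y \<partial>\<nu>)" .
    have "norm ((\<integral>x. K x y \<partial>\<mu>) - (\<integral>x. K (\<pi> x) y \<partial>\<mu>)) \<le> d * ?m" for y
    proof -
      have "norm ((\<integral>x. K x y \<partial>\<mu>) - (\<integral>x. K (\<pi> x) y \<partial>\<mu>)) = norm (\<integral>x. K x y - K (\<pi> x) y \<partial>\<mu>)"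
        by (simp add: icont[OF Ky] int_step(1)[of "\<lambda>p. K p _"])
      also have "\<dots> \<le> (\<integral>x. d \<partial>\<mu>)"
        using \<pi>(3) icont[OF Ky] int_step(1)[of "\<lambda>p. K p _"]
        by (intro norm_integral_le_integral) (auto simp: dist_norm)
      finally show ?thesis using sp by (simp add: mult_ac)
    qed
    note 3 = this
    have iR: "integrable \<nu> (\<lambda>y. (\<integral>x. K x y \<partial>\<mu>) * u y)"
      by (rule integrable_continuous_mult[OF cb cR \<nu>])
    have iR': "integrable \<nu> (\<lambda>y. (\<integral>x. K (\<pi> x) y \<partial>\<mu>) * u y)"
      unfolding int_step(2)[of "\<lambda>p. K p _"] sum_distrib_right mult_scaleR_left
      by (intro Bochner_Integration.integrable_sum integrable_scaleR_right integrable_continuous_mult[OF cb _ \<nu>] Kx)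
    have "dist (\<integral>y. (\<integral>x. K (\<pi> x) y \<partial>\<mu>) * u y \<partial>\<nu>) ?R
        = norm (\<integral>y. ((\<integral>x. K x y \<partial>\<mu>) - (\<integral>x. K (\<pi> x) y \<partial>\<mu>)) * u y \<partial>\<nu>)"
      using iR iR' by (subst dist_commute) (simp add: dist_norm left_diff_distrib)
    also have "\<dots> \<le> (\<integral>y. d * ?m * norm (u y) \<partial>\<nu>)"
    proof (rule norm_integral_le_integral)
      show "integrable \<nu> (\<lambda>y. ((\<integral>x. K x y \<partial>\<mu>) - (\<integral>x. K (\<pi> x) y \<partial>\<mu>)) * u y)"
        using iR iR' by (simp add: left_diff_distrib)
      show "norm (((\<integral>x. K x y \<partial>\<mu>) - (\<integral>x. K (\<pi> x) y \<partial>\<mu>)) * u y) \<le> d * ?m * norm (u y)" for y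
        using 3[of y] by (simp add: norm_mult mult_right_mono)
    qed (simp add: \<nu>(2))
    finally have "dist (\<integral>y. (\<integral>x. K (\<pi> x) y \<partial>\<mu>) * u y \<partial>\<nu>) ?R \<le> d * (?m * ?I)" by simp
    with 1 2 show ?thesis
      using dist_triangle[of ?L ?R "\<integral>x. ?G (\<pi> x) \<partial>\<mu>"] by (simp add: algebra_simps)
  qed
  have C: "2 * ?m * ?I \<ge> 0" by simp
  have aux: "e / (c + 1) * c \<le> e" if "0 \<le> c" "0 < e" for c e :: real
    using that by (simp add: field_simps add_nonneg_pos)
  have "dist ?L ?R \<le> e" if "0 < e" for e
  proof -
    have "dist ?L ?R \<le> e / (2 * ?m * ?I + 1) * (2 * ?m * ?I)" using that C by (intro est) (simp add: add_nonneg_pos)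
    also have "\<dots> \<le> e" using aux[OF C that] .
    finally show ?thesis .
  qed
  then have "dist ?L ?R \<le> 0" by (rule field_le_epsilon) simp
  then show ?thesis by simp
qed

section \<open>Haar measure\<close>

lemma continuous_on_comp_UNIV:
  "continuous_on UNIV g \<Longrightarrow> continuous_on UNIV f \<Longrightarrow> continuous_on UNIV (\<lambda>x. g (f x))"
  by (rule continuous_on_compose2) auto

text \<open>A compact Hausdorff space is normal, so that Urysohn's lemma is available without a
  metric.\<close>

lemma Urysohn_compact_UNIV:
  fixes K C :: "'a::t2_space set"
  assumes "compact (UNIV :: 'a set)" "closed K" "closed C" "K \<inter> C = {}"
  obtains h :: "'a \<Rightarrow> real" where "continuous_on UNIV h" "\<And>x. 0 \<le> h x" "\<And>x. h x \<le> 1"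
    "\<And>x. x \<in> K \<Longrightarrow> h x = 1" "\<And>x. x \<in> C \<Longrightarrow> h x = 0"
proof -
  have "Hausdorff_space (euclidean :: 'a topology)"
    unfolding Hausdorff_space_def using hausdorff by (fastforce simp: disjnt_def)
  then have "normal_space (euclidean :: 'a topology)"
    using assms(1) by (intro compact_Hausdorff_or_regular_imp_normal_space) (auto simp: compact_space_def)
  then obtain h where "continuous_map euclidean (top_of_set {0..1::real}) h" "h ` C \<subseteq> {0}" "h ` K \<subseteq> {1}"
    using Urysohn_lemma[of "euclidean :: 'a topology" C K 0 1] assms by (auto simp: disjnt_def)
  then show ?thesis
    by (intro that[of h]) (auto simp: continuous_map_in_subtopology image_subset_iff)
qed

locale compact_haar_group =
  fixes M :: "'a::{topological_ab_group_add,t2_space} measure"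
  assumes compact_UNIV: "compact (UNIV :: 'a set)" and haar: "haar_probability M"
begin

sublocale prob_space M
  using haar by (simp add: haar_probability_def)

lemma sets_M: "sets M = sets borel"
  using haar by (simp add: haar_probability_def)

lemma space_M: "space M = UNIV"
  using sets_eq_imp_space_eq[OF sets_M] by simp

lemma measurable_continuous: "continuous_on UNIV g \<Longrightarrow> g \<in> borel_measurable M"
  unfolding measurable_cong_sets[OF sets_M refl] by (rule borel_measurable_continuous_onI)

lemma integrable_continuous:
  fixes g :: "'a \<Rightarrow> 'b::{banach,second_countable_topology}"
  assumes "continuous_on UNIV g"
  shows "integrable M g"
proof -
  obtain B where "0 < B" "\<And>x. norm (g x) \<le> B"
    using bounded_continuous_on_compact_UNIV[OF compact_UNIV assms] by blast
  then show ?thesis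
    using measurable_continuous[OF assms] by (intro integrable_const_bound[of _ B]) auto
qed

lemma integral_translate:
  fixes g :: "'a \<Rightarrow> 'b::{banach,second_countable_topology}"
  assumes "continuous_on UNIV g"
  shows "(\<integral>x. g (a + x) \<partial>M) = (\<integral>x. g x \<partial>M)"
proof -
  have "(\<lambda>x. a + x) \<in> M \<rightarrow>\<^sub>M borel"
    by (intro measurable_continuous continuous_intros)
  then have "(\<integral>x. g x \<partial>distr M borel (\<lambda>x. a + x)) = (\<integral>x. g (a + x) \<partial>M)"
    using borel_measurable_continuous_onI[OF assms] by (intro integral_distr)
  then show ?thesis using haar by (simp add: haar_probability_def)
qed

lemma inner_regular:
  assumes "B \<in> sets M" "0 < e"
  obtains K where "K \<subseteq> B" "compact K" "measure M B < measure M K + e"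
proof -
  have eq: "emeasure M B = (SUP K\<in>{K. K \<subseteq> B \<and> compact K}. emeasure M K)"
    using assms haar by (simp add: haar_probability_def)
  have "{K. K \<subseteq> B \<and> compact K} \<noteq> {}" by (auto intro: exI[of _ "{}"])
  then obtain K where K: "K \<subseteq> B" "compact K" "emeasure M B < emeasure M K + ennreal e"
    using SUP_approx_ennreal[OF assms(2) _ eq] emeasure_finite[of B] by auto
  then have "ennreal (measure M B) < ennreal (measure M K + e)"
    using assms(2) by (simp add: emeasure_eq_measure)
  then have "measure M B < measure M K + e"
    by (subst (asm) ennreal_less_iff) auto
  then show ?thesis using K that by blast
qed

text \<open>Outer regularity at closed sets is inner regularity of the complement: a compact
  \<open>C\<close> exhausts \<open>- K\<close> up to \<open>e\<close>, and the function is 1 on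
  \<open>K\<close> and 0 on \<open>C\<close>.\<close>

lemma closed_outer_function:
  assumes "closed K" "0 < e"
  obtains h :: "'a \<Rightarrow> real" where "continuous_on UNIV h" "\<And>x. 0 \<le> h x" "\<And>x. h x \<le> 1"
    "\<And>x. x \<in> K \<Longrightarrow> h x = 1" "(\<integral>x. h x \<partial>M) < measure M K + e"
proof -
  have K: "K \<in> sets M" using assms sets_M by auto
  obtain C where C: "C \<subseteq> - K" "compact C" "measure M (- K) < measure M C + e"
    using inner_regular[of "- K" e] assms sets_M by auto
  have "closed C" using C(2) compact_imp_closed by blast
  then have Cs: "C \<in> sets M" using sets_M by auto
  obtain h :: "'a \<Rightarrow> real" where h: "continuous_on UNIV h" "\<And>x. 0 \<le> h x" "\<And>x. h x \<le> 1"
    "\<And>x. x \<in> K \<Longrightarrow> h x = 1" "\<And>x. x \<in> C \<Longrightarrow> h x = 0"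
    using Urysohn_compact_UNIV[OF compact_UNIV assms(1) \<open>closed C\<close>] C(1) by (metis disjoint_eq_subset_Compl inf_commute)
  have "(\<integral>x. h x \<partial>M) \<le> (\<integral>x. indicator (- C) x \<partial>M)"
    using Cs sets.compl_sets[OF Cs] h integrable_continuous[OF h(1)] space_M
    by (intro integral_mono integrable_real_indicator)
      (auto simp: indicator_def emeasure_eq_measure Compl_eq_Diff_UNIV)
  also have "\<dots> = 1 - measure M C"
    using prob_compl[OF Cs] space_M by (simp add: Compl_eq_Diff_UNIV)
  also have "\<dots> < measure M K + e"
    using C(3) prob_compl[OF K] space_M by (simp add: Compl_eq_Diff_UNIV)
  finally show ?thesis using that h by blast
qed

end

text \<open>Integrating \<open>h (x + y)\<close> against both measures, in either order, yields the
  integral of \<open>h\<close> against either one. Equality on continuous functions passes to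
  compact sets through \<open>closed_outer_function\<close>, and from these to Borel sets by inner
  regularity.\<close>

lemma haar_probability_unique:
  fixes M :: "'a::{topological_ab_group_add,t2_space} measure"
  assumes c: "compact (UNIV :: 'a set)" and "haar_probability M" "haar_probability N"
  shows "M = N"
proof -
  interpret M: compact_haar_group M by standard fact+
  interpret N: compact_haar_group N by standard fact+
  have eq: "(\<integral>x. h x \<partial>M) = (\<integral>x. h x \<partial>N)" if h: "continuous_on UNIV h" for h :: "'a \<Rightarrow> complex"
  proof -
    have cont: "continuous_on UNIV (\<lambda>(x, y). h (x + y))"
      unfolding case_prod_unfold by (intro continuous_on_comp_UNIV[OF h] continuous_intros)
    have "(\<integral>x. (\<integral>y. h (x + y) * 1 \<partial>N) \<partial>M) = (\<integral>y. (\<integral>x. h (x + y) \<partial>M) * 1 \<partial>N)"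
      by (rule integral_swap_kernel[OF c c cont]) (auto simp: M.sets_M N.sets_M intro: M.finite_measure_axioms)
    moreover have "(\<integral>x. h (x + y) \<partial>M) = (\<integral>x. h x \<partial>M)" for y
      using M.integral_translate[OF h, of y] by (simp add: add.commute)
    ultimately show ?thesis
      by (simp add: N.integral_translate[OF h] M.prob_space N.prob_space)
  qed
  have le: "measure M' K \<le> measure N' K"
    if "compact_haar_group M'" "compact_haar_group N'" "compact K"
      and e: "\<And>h::'a \<Rightarrow> complex. continuous_on UNIV h \<Longrightarrow> (\<integral>x. h x \<partial>M') = (\<integral>x. h x \<partial>N')" for M' N' K
  proof (rule field_le_epsilon)
    interpret M': compact_haar_group M' by fact
    interpret N': compact_haar_group N' by fact
    fix d :: real assume "0 < d"
    have cl: "closed K" using that(3) compact_imp_closed by blast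
    then have K: "K \<in> sets M'" by (simp add: M'.sets_M)
    obtain h :: "'a \<Rightarrow> real" where h: "continuous_on UNIV h" "\<And>x. 0 \<le> h x" "\<And>x. h x \<le> 1"
      "\<And>x. x \<in> K \<Longrightarrow> h x = 1" "(\<integral>x. h x \<partial>N') < measure N' K + d"
      using N'.closed_outer_function[OF cl \<open>0 < d\<close>] by blast
    have "measure M' K = (\<integral>x. indicator K x \<partial>M')" by (simp add: M'.space_M)
    also have "\<dots> \<le> (\<integral>x. h x \<partial>M')"
      using K h M'.integrable_continuous[OF h(1)]
      by (intro integral_mono integrable_real_indicator) (auto simp: indicator_def M'.emeasure_eq_measure)
    also have "\<dots> = (\<integral>x. h x \<partial>N')"
      using e[of "\<lambda>x. of_real (h x)"] h(1) by (simp add: continuous_on_of_real)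
    finally show "measure M' K \<le> measure N' K + d" using h(5) by simp
  qed
  have "measure M K = measure N K" if "compact K" for K
    using le[OF M.compact_haar_group_axioms N.compact_haar_group_axioms that eq]
      le[OF N.compact_haar_group_axioms M.compact_haar_group_axioms that] eq by fastforce
  then have "emeasure M K = emeasure N K" if "compact K" for K
    using that by (simp add: M.emeasure_eq_measure N.emeasure_eq_measure)
  then show ?thesis
    using assms(2,3) M.sets_M N.sets_M
    by (intro measure_eqI) (auto simp: haar_probability_def intro!: SUP_cong)
qed

section \<open>Invariance under automorphisms and testing against continuous functions\<close>

context compact_haar_group
begin

text \<open>The image measure is again a Haar probability: translation by \<open>a\<close> after
  \<open>T\<close> is \<open>T\<close> after translation by \<open>inv T a\<close>, and
  \<open>T\<close> maps compact sets to compact sets. Uniqueness then identifies it with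
  \<open>M\<close>.\<close>

lemma distr_automorphism:
  assumes "group_automorphism T"
  shows "distr M borel T = M"
proof (rule haar_probability_unique[OF compact_UNIV _ haar])
  have T: "\<And>x y. T (x + y) = T x + T y" "bij T" "continuous_on UNIV T" "continuous_on UNIV (inv T)"
    using assms by (auto simp: group_automorphism_def)
  have Tm: "T \<in> M \<rightarrow>\<^sub>M borel" by (rule measurable_continuous) fact
  have tr: "(\<lambda>x. a + x) \<in> M \<rightarrow>\<^sub>M borel" "(\<lambda>x. a + x) \<in> borel \<rightarrow>\<^sub>M borel" for a
    by (intro measurable_continuous borel_measurable_continuous_onI continuous_intros)+
  have Tb: "T \<in> borel \<rightarrow>\<^sub>M borel" by (rule borel_measurable_continuous_onI) fact
  have TiT: "T (inv T x) = x" for x using T(2) by (simp add: bij_is_surj surj_f_inv_f)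
  show "haar_probability (distr M borel T)"
    unfolding haar_probability_def
  proof (intro conjI allI ballI)
    show "prob_space (distr M borel T)" by (rule prob_space_distr[OF Tm])
    fix a
    have "distr (distr M borel T) borel (\<lambda>x. a + x) = distr M borel ((\<lambda>x. a + x) \<circ> T)"
      by (rule distr_distr[OF tr(2) Tm])
    also have "(\<lambda>x. a + x) \<circ> T = T \<circ> (\<lambda>x. inv T a + x)"
      by (auto simp: T(1) TiT)
    also have "distr M borel \<dots> = distr (distr M borel (\<lambda>x. inv T a + x)) borel T"
      by (rule distr_distr[OF Tb tr(1), symmetric])
    also have "\<dots> = distr M borel T" using haar by (simp add: haar_probability_def)
    finally show "distr (distr M borel T) borel (\<lambda>x. a + x) = distr M borel T" .
  next
    fix B :: "'a set" assume B: "B \<in> sets borel"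
    let ?N = "distr M borel T"
    have N: "emeasure ?N C = emeasure M (T -` C)" if "C \<in> sets borel" for C
      using that Tm by (simp add: emeasure_distr space_M)
    show "emeasure ?N B = (SUP K\<in>{K. K \<subseteq> B \<and> compact K}. emeasure ?N K)"
    proof (rule antisym)
      have "T -` B \<in> sets M" using measurable_sets[OF Tm B] space_M by simp
      then have "emeasure M (T -` B) = (SUP K\<in>{K. K \<subseteq> T -` B \<and> compact K}. emeasure M K)"
        using haar sets_M by (simp add: haar_probability_def)
      also have "\<dots> \<le> (SUP K\<in>{K. K \<subseteq> B \<and> compact K}. emeasure ?N K)"
      proof (rule SUP_least)
        fix K assume "K \<in> {K. K \<subseteq> T -` B \<and> compact K}"
        then have K: "T ` K \<subseteq> B" "compact (T ` K)"
          using compact_continuous_image[OF continuous_on_subset[OF T(3)]] by auto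
        have "emeasure M K = emeasure ?N (T ` K)"
          using N[of "T ` K"] K(2) compact_imp_closed[OF K(2)] inj_vimage_image_eq[of T K] T(2)
          by (simp add: bij_is_inj)
        also have "\<dots> \<le> (SUP K\<in>{K. K \<subseteq> B \<and> compact K}. emeasure ?N K)"
          using K by (intro SUP_upper) simp
        finally show "emeasure M K \<le> (SUP K\<in>{K. K \<subseteq> B \<and> compact K}. emeasure ?N K)" .
      qed
      finally show "emeasure ?N B \<le> (SUP K\<in>{K. K \<subseteq> B \<and> compact K}. emeasure ?N K)"
        using N[OF B] by simp
    qed (use B in \<open>auto intro!: SUP_least emeasure_mono\<close>)
  qed simp
qed

lemma integral_automorphism:
  fixes g :: "'a \<Rightarrow> 'b::{banach,second_countable_topology}"
  assumes "group_automorphism T" "g \<in> borel_measurable M"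
  shows "(\<integral>x. g (T x) \<partial>M) = (\<integral>x. g x \<partial>M)"
proof -
  have "T \<in> M \<rightarrow>\<^sub>M borel"
    using assms(1) by (intro measurable_continuous) (simp add: group_automorphism_def)
  moreover have "g \<in> borel_measurable borel"
    using assms(2) unfolding measurable_cong_sets[OF sets_M refl] .
  ultimately show ?thesis
    using integral_distr[of T M borel g] distr_automorphism[OF assms(1)] by simp
qed

lemma group_automorphism_uminus: "group_automorphism (uminus :: 'a \<Rightarrow> 'a)"
proof -
  have "inv uminus = (uminus :: 'a \<Rightarrow> 'a)" by (rule inv_equality) auto
  then show ?thesis
    by (auto simp: group_automorphism_def bij_uminus intro!: continuous_intros)
qed

lemma integral_reflect:
  fixes g :: "'a \<Rightarrow> 'b::{banach,second_countable_topology}"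
  assumes "continuous_on UNIV g"
  shows "(\<integral>x. g (a - x) \<partial>M) = (\<integral>x. g x \<partial>M)"
proof -
  have "(\<integral>x. g (a - x) \<partial>M) = (\<integral>x. g (a + x) \<partial>M)"
    using integral_automorphism[OF group_automorphism_uminus, of "\<lambda>x. g (a + x)"]
    by (simp add: measurable_continuous continuous_on_comp_UNIV[OF assms] continuous_intros)
  then show ?thesis using integral_translate[OF assms] by simp
qed

text \<open>Since \<open>f\<close> is merely integrable, \<open>L\<^sup>1\<close> convergence of
  \<open>g n\<close> is not enough to pass to the limit directly. A subsequence converges almost
  everywhere, and the bound \<open>g n x \<le> 1\<close> makes \<open>norm (f x)\<close> a
  dominating function.\<close>

lemma integral_indicator_eq_0_limit:
  fixes f :: "'a \<Rightarrow> complex" and g :: "nat \<Rightarrow> 'a \<Rightarrow> real"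
  assumes f: "integrable M f" and B: "B \<in> sets M"
    and g: "\<And>n. g n \<in> borel_measurable M" "\<And>n x. 0 \<le> g n x" "\<And>n x. g n x \<le> 1"
    and lim: "(\<lambda>n. \<integral>x. \<bar>g n x - indicator B x\<bar> \<partial>M) \<longlonglongrightarrow> 0"
    and eq0: "\<And>n. (\<integral>x. of_real (g n x) * f x \<partial>M) = 0"
  shows "(\<integral>x. of_real (indicator B x) * f x \<partial>M) = 0"
proof -
  note [measurable] = g(1) B borel_measurable_integrable[OF f]
  have "integrable M (\<lambda>x. g n x - indicator B x)" for n
  proof (rule integrable_const_bound[of _ 1])
    have "norm (g n x - indicator B x) \<le> 1" for x
      using g(2)[of n x] g(3)[of n x] by (auto simp: indicator_def abs_le_iff)
    then show "AE x in M. norm (g n x - indicator B x) \<le> 1" by simp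
  qed measurable
  then obtain r where
    r: "strict_mono r" "AE x in M. (\<lambda>n. g (r n) x - indicator B x) \<longlonglongrightarrow> 0"
    using tendsto_L1_AE_subseq[of M "\<lambda>n x. g n x - indicator B x"] lim by auto
  have "(\<lambda>n. \<integral>x. of_real (g (r n) x) * f x \<partial>M) \<longlonglongrightarrow> (\<integral>x. of_real (indicator B x) * f x \<partial>M)"
  proof (rule integral_dominated_convergence)
    show "integrable M (\<lambda>x. norm (f x))" using f by simp
    show "AE x in M. (\<lambda>n. complex_of_real (g (r n) x) * f x) \<longlonglongrightarrow> of_real (indicator B x) * f x"
      using r(2)
    proof eventually_elim
      case (elim x)
      then have "(\<lambda>n. g (r n) x) \<longlonglongrightarrow> indicator B x" by (simp add: LIM_zero_iff)
      then show ?case by (intro tendsto_intros)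
    qed
    show "AE x in M. norm (complex_of_real (g (r n) x) * f x) \<le> norm (f x)" for n
      using g by (auto simp: norm_mult intro!: mult_left_le_one_le)
  qed measurable
  then show ?thesis by (simp add: eq0 LIMSEQ_const_iff)
qed

text \<open>The vanishing of the integral passes from continuous functions to indicators of closed
  sets from outside, then to indicators of Borel sets by compact subsets from inside.\<close>

lemma AE_eq_0_if_orthogonal_continuous:
  fixes f :: "'a \<Rightarrow> complex"
  assumes f: "integrable M f"
    and orth: "\<And>h::'a \<Rightarrow> real. continuous_on UNIV h \<Longrightarrow> (\<integral>x. of_real (h x) * f x \<partial>M) = 0"
  shows "AE x in M. f x = 0"
proof -
  note [measurable] = borel_measurable_integrable[OF f]
  have closed: "(\<integral>x. of_real (indicator K x) * f x \<partial>M) = 0" if K: "closed K" for K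
  proof -
    have Ks: "K \<in> sets M" using K sets_M by simp
    have "\<exists>h::'a \<Rightarrow> real. continuous_on UNIV h \<and> (\<forall>x. 0 \<le> h x) \<and> (\<forall>x. h x \<le> 1) \<and>
      (\<forall>x\<in>K. h x = 1) \<and> (\<integral>x. h x \<partial>M) < measure M K + inverse (real (Suc n))" for n
      using closed_outer_function[OF K, of "inverse (real (Suc n))"] by (metis inverse_positive_iff_positive of_nat_0_less_iff zero_less_Suc)
    then obtain h :: "nat \<Rightarrow> 'a \<Rightarrow> real" where h: "\<And>n. continuous_on UNIV (h n)" "\<And>n x. 0 \<le> h n x"
      "\<And>n x. h n x \<le> 1" "\<And>n x. x \<in> K \<Longrightarrow> h n x = 1"
      "\<And>n. (\<integral>x. h n x \<partial>M) < measure M K + inverse (real (Suc n))" by metis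
    have i: "integrable M (indicator K :: 'a \<Rightarrow> real)"
      using Ks by (intro integrable_real_indicator) (auto simp: emeasure_eq_measure)
    have "(\<integral>x. \<bar>h n x - indicator K x\<bar> \<partial>M) = (\<integral>x. h n x - indicator K x \<partial>M)" for n
      using h by (intro Bochner_Integration.integral_cong refl abs_of_nonneg) (auto simp: indicator_def)
    also have "\<dots> n \<le> inverse (real (Suc n))" for n
      using h(5)[of n] i integrable_continuous[OF h(1)] space_M by simp
    finally have bd: "(\<integral>x. \<bar>h n x - indicator K x\<bar> \<partial>M) \<le> inverse (real (Suc n))" for n .
    show ?thesis
    proof (rule integral_indicator_eq_0_limit[OF f Ks, of h])
      show "(\<lambda>n. \<integral>x. \<bar>h n x - indicator K x\<bar> \<partial>M) \<longlonglongrightarrow> 0"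
        by (rule tendsto_sandwich[OF _ always_eventually[OF allI[OF bd]] tendsto_const
              LIMSEQ_inverse_real_of_nat]) simp
    qed (use h in \<open>auto intro: measurable_continuous orth\<close>)
  qed
  have borel: "(\<integral>x. of_real (indicator B x) * f x \<partial>M) = 0" if B: "B \<in> sets M" for B
  proof -
    have "\<exists>K. K \<subseteq> B \<and> compact K \<and> measure M B < measure M K + inverse (real (Suc n))" for n
      using inner_regular[OF B, of "inverse (real (Suc n))"] by (metis inverse_positive_iff_positive of_nat_0_less_iff zero_less_Suc)
    then obtain K where K: "\<And>n. K n \<subseteq> B" "\<And>n. compact (K n)"
      "\<And>n. measure M B < measure M (K n) + inverse (real (Suc n))" by metis
    have cl: "closed (K n)" for n using K(2) compact_imp_closed by blast
    have Ks: "K n \<in> sets M" for n using cl sets_M by simp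
    have i: "integrable M (indicator C :: 'a \<Rightarrow> real)" if "C \<in> sets M" for C
      using that by (intro integrable_real_indicator) (auto simp: emeasure_eq_measure)
    have "(\<integral>x. \<bar>indicat_real (K n) x - indicat_real B x\<bar> \<partial>M) = (\<integral>x. indicat_real B x - indicat_real (K n) x \<partial>M)" for n
      using K(1)[of n] by (intro Bochner_Integration.integral_cong refl) (auto simp: indicator_def)
    also have "\<dots> n \<le> inverse (real (Suc n))" for n
      using K(3)[of n] i[OF B] i[OF Ks] space_M by simp
    finally have bd: "(\<integral>x. \<bar>indicat_real (K n) x - indicat_real B x\<bar> \<partial>M) \<le> inverse (real (Suc n))" for n .
    show ?thesis
    proof (rule integral_indicator_eq_0_limit[OF f B, of "\<lambda>n. indicator (K n)"])
      show "(\<lambda>n. \<integral>x. \<bar>indicat_real (K n) x - indicat_real B x\<bar> \<partial>M) \<longlonglongrightarrow> 0"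
        by (rule tendsto_sandwich[OF _ always_eventually[OF allI[OF bd]] tendsto_const
              LIMSEQ_inverse_real_of_nat]) simp
    qed (use Ks closed[OF cl] in \<open>auto simp: indicator_def\<close>)
  qed
  \<comment> \<open>\<open>L\<close> stands for \<open>Re\<close> and \<open>Im\<close>, which are
    treated by one argument.\<close>
  have real: "AE x in M. L (f x) = 0" if L: "bounded_linear L" for L :: "complex \<Rightarrow> real"
  proof -
    interpret L: bounded_linear L by fact
    have [measurable]: "(\<lambda>x. L (f x)) \<in> borel_measurable M"
      using borel_measurable_continuous_onI[OF L.continuous_on[OF continuous_on_id]] by measurable
    have Lf: "integrable M (\<lambda>x. L (f x))" using integrable_bounded_linear[OF L f] .
    have zero: "(\<integral>x. indicator B x * L (f x) \<partial>M) = 0" if B[measurable]: "B \<in> sets M" for B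
    proof -
      have "integrable M (\<lambda>x. of_real (indicator B x) * f x)"
        by (rule Bochner_Integration.integrable_bound[OF f]) (auto simp: indicator_def)
      from integral_bounded_linear[OF L this] borel[OF B]
      have "(\<integral>x. L (of_real (indicator B x) * f x) \<partial>M) = 0" by (simp add: L.zero)
      moreover have "L (of_real (indicator B x) * f x) = indicator B x * L (f x)" for x
        by (auto simp: indicator_def L.zero)
      ultimately show ?thesis by simp
    qed
    \<comment> \<open>On the set where \<open>c * L (f x)\<close> is positive the integrand is
      nonnegative, so that its vanishing integral forces it to be 0 almost everywhere; the two signs
      of \<open>c\<close> exclude both signs of \<open>L (f x)\<close>.\<close>
    have half: "AE x in M. \<not> 0 < c * L (f x)" if c: "c = 1 \<or> c = -1" for c :: real
    proof -
      let ?B = "{x \<in> space M. 0 < c * L (f x)}"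
      have "(\<integral>x. indicator ?B x * (c * L (f x)) \<partial>M) = c * (\<integral>x. indicator ?B x * L (f x) \<partial>M)"
        by (simp add: mult.left_commute)
      also have "\<dots> = 0" by (subst zero) auto
      finally have "(\<integral>x. indicator ?B x * (c * L (f x)) \<partial>M) = 0" .
      moreover have "integrable M (\<lambda>x. indicator ?B x * (c * L (f x)))"
        by (rule Bochner_Integration.integrable_bound[OF Lf]) (use c in \<open>auto simp: indicator_def\<close>)
      ultimately have "AE x in M. indicator ?B x * (c * L (f x)) = 0"
        by (subst (asm) integral_nonneg_eq_0_iff_AE) (auto simp: indicator_def)
      then show ?thesis by eventually_elim (auto simp: indicator_def space_M split: if_splits)
    qed
    have "AE x in M. \<not> 0 < 1 * L (f x)" "AE x in M. \<not> 0 < - 1 * L (f x)"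
      by (auto intro!: half[of 1, simplified] half[of "-1", simplified])
    then show ?thesis by eventually_elim auto
  qed
  show ?thesis
    using real[OF bounded_linear_Re] real[OF bounded_linear_Im]
    by eventually_elim (simp add: complex_eq_iff)
qed

end

section \<open>Convolution\<close>

context compact_haar_group
begin

abbreviation cts :: "('a \<Rightarrow> complex) \<Rightarrow> bool" where "cts p \<equiv> continuous_on UNIV p"

definition conv :: "('a \<Rightarrow> complex) \<Rightarrow> ('a \<Rightarrow> complex) \<Rightarrow> 'a \<Rightarrow> complex" where
  "conv p q x = (\<integral>y. p (x - y) * q y \<partial>M)"

text \<open>The involution of the group algebra: convolution with \<open>adj p\<close> is the
  adjoint of convolution with \<open>p\<close>, and evaluating \<open>conv p (adj p)\<close> at 0
  gives the squared norm of \<open>p\<close>.\<close>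

definition adj :: "('a \<Rightarrow> complex) \<Rightarrow> 'a \<Rightarrow> complex" where
  "adj p x = cnj (p (- x))"

definition l2sq :: "('a \<Rightarrow> complex) \<Rightarrow> real" where
  "l2sq p = (\<integral>x. (cmod (p x))\<^sup>2 \<partial>M)"

lemma cts_adj [intro]: "cts p \<Longrightarrow> cts (adj p)"
  unfolding adj_def by (rule continuous_on_cnj, rule continuous_on_comp_UNIV) (auto intro: continuous_intros)

lemma adj_adj [simp]: "adj (adj p) = p"
  by (simp add: adj_def fun_eq_iff)

lemma cts_conv_integrable:
  assumes p: "cts p" and u: "integrable M u"
  shows "cts (conv p u)"
proof -
  have "continuous_on UNIV (\<lambda>(x, y). p (x - y))"
    unfolding case_prod_unfold by (intro continuous_on_comp_UNIV[OF p] continuous_intros)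
  from continuous_on_integral_kernel[OF compact_UNIV this sets_M u]
  show ?thesis by (simp add: conv_def[abs_def])
qed

lemma cts_conv [intro]: "cts p \<Longrightarrow> cts q \<Longrightarrow> cts (conv p q)"
  by (intro cts_conv_integrable integrable_continuous)

lemma integrable_conv_integrand:
  assumes "cts p" "integrable M u"
  shows "integrable M (\<lambda>y. p (x - y) * u y)"
  by (intro integrable_continuous_mult[OF compact_UNIV _ sets_M] continuous_on_comp_UNIV[OF assms(1)]
      continuous_intros assms(2))

text \<open>The last factor is only integrable because \<open>f\<close> itself takes this place in
  the completeness argument. The continuous kernel to which the interchange of integrals is applied
  is \<open>p (x - w) * q (w - y)\<close>.\<close>

lemma conv_assoc:
  assumes p: "cts p" and q: "cts q" and r: "integrable M r"
  shows "conv (conv p q) r = conv p (conv q r)"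
proof
  fix x
  have shift: "conv p q (x - y) = (\<integral>w. p (x - w) * q (w - y) \<partial>M)" for y
  proof -
    have "cts (\<lambda>w. p (x - w) * q (w - y))"
      by (intro continuous_intros continuous_on_comp_UNIV[OF p] continuous_on_comp_UNIV[OF q])
    from integral_translate[OF this, of y] show ?thesis by (simp add: conv_def algebra_simps)
  qed
  have cont: "continuous_on UNIV (\<lambda>(w, y). p (x - w) * q (w - y))"
    unfolding case_prod_unfold
    by (intro continuous_intros continuous_on_comp_UNIV[OF p] continuous_on_comp_UNIV[OF q])
  have "conv p (conv q r) x = (\<integral>w. (\<integral>y. p (x - w) * q (w - y) * r y \<partial>M) \<partial>M)"
    by (simp add: conv_def mult.assoc)
  also have "\<dots> = (\<integral>y. (\<integral>w. p (x - w) * q (w - y) \<partial>M) * r y \<partial>M)"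
    by (rule integral_swap_kernel[OF compact_UNIV compact_UNIV cont finite_measure_axioms sets_M sets_M r])
  finally show "conv (conv p q) r x = conv p (conv q r) x"
    by (simp add: shift conv_def[of _ r])
qed

lemma conv_commute:
  assumes p: "cts p" and q: "cts q"
  shows "conv p q = conv q p"
proof
  fix x
  have "cts (\<lambda>y. p (x - y) * q y)"
    by (intro continuous_intros continuous_on_comp_UNIV[OF p] q)
  from integral_reflect[OF this, of x] show "conv p q x = conv q p x"
    by (simp add: conv_def mult.commute)
qed

lemma conv_add_right:
  assumes "cts p" "cts q" "cts r"
  shows "conv p (\<lambda>x. q x + r x) = (\<lambda>x. conv p q x + conv p r x)"
  using assms
  by (simp add: conv_def fun_eq_iff distrib_left integrable_conv_integrand integrable_continuous)

lemma conv_diff_right: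
  assumes "cts p" "cts q" "cts r"
  shows "conv p (\<lambda>x. q x - r x) = (\<lambda>x. conv p q x - conv p r x)"
  using assms
  by (simp add: conv_def fun_eq_iff right_diff_distrib integrable_conv_integrand integrable_continuous)

lemma conv_scale_right: "conv p (\<lambda>x. c * q x) = (\<lambda>x. c * conv p q x)"
  by (simp add: conv_def fun_eq_iff mult.left_commute)

lemma conv_scale_left: "conv (\<lambda>x. c * p x) q = (\<lambda>x. c * conv p q x)"
  by (simp add: conv_def fun_eq_iff mult.assoc)

lemma adj_conv:
  assumes p: "cts p" and q: "cts q"
  shows "adj (conv p q) = conv (adj p) (adj q)"
proof
  fix x
  have "cts (\<lambda>y. p (- x - y) * q y)"
    by (intro continuous_intros continuous_on_comp_UNIV[OF p] q)
  from integral_reflect[OF this, of 0]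
  have "conv p q (- x) = (\<integral>y. p (- x + y) * q (- y) \<partial>M)" by (simp add: conv_def)
  then have "adj (conv p q) x = (\<integral>y. cnj (p (- x + y) * q (- y)) \<partial>M)"
    unfolding adj_def by (simp only: Bochner_Integration.integral_cnj)
  then show "adj (conv p q) x = conv (adj p) (adj q) x"
    by (simp add: conv_def adj_def algebra_simps)
qed

lemma conv_adj_0:
  assumes p: "cts p"
  shows "conv p (adj p) 0 = of_real (l2sq p)"
proof -
  have "cts (\<lambda>y. of_real ((cmod (p y))\<^sup>2))"
    by (intro continuous_intros p)
  from integral_reflect[OF this, of 0] show ?thesis
    by (simp add: conv_def adj_def l2sq_def complex_norm_square[symmetric] del: of_real_power)
qed

lemma l2sq_nonneg [simp]: "0 \<le> l2sq p"
  by (simp add: l2sq_def)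

lemma Cauchy_Schwarz_cts:
  assumes p: "cts p" and q: "cts q"
  shows "(\<integral>x. cmod (p x) * cmod (q x) \<partial>M)\<^sup>2 \<le> l2sq p * l2sq q"
proof -
  note [measurable] = measurable_continuous[OF p] measurable_continuous[OF q]
  have i: "integrable M (\<lambda>x. cmod (p x) * cmod (q x))" "integrable M (\<lambda>x. (cmod (p x))\<^sup>2)"
    "integrable M (\<lambda>x. (cmod (q x))\<^sup>2)"
    by (intro integrable_continuous continuous_intros p q)+
  have "(\<integral>\<^sup>+x. ennreal (cmod (p x)) * ennreal (cmod (q x)) \<partial>M)\<^sup>2
      \<le> (\<integral>\<^sup>+x. ennreal (cmod (p x)) ^ 2 \<partial>M) * (\<integral>\<^sup>+x. ennreal (cmod (q x)) ^ 2 \<partial>M)"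
    by (intro Cauchy_Schwarz_nn_integral) measurable
  then have "ennreal ((\<integral>x. cmod (p x) * cmod (q x) \<partial>M)\<^sup>2) \<le> ennreal (l2sq p * l2sq q)"
    using i by (simp add: l2sq_def nn_integral_eq_integral ennreal_power flip: ennreal_mult)
  then show ?thesis by (simp add: ennreal_le_iff)
qed

lemma l2sq_reflect: "cts p \<Longrightarrow> l2sq (\<lambda>y. p (x - y)) = l2sq p"
  unfolding l2sq_def by (rule integral_reflect) (intro continuous_intros)

text \<open>One convolution turns \<open>L\<^sup>2\<close> bounds into uniform bounds; this is how
  an \<open>L\<^sup>2\<close> Cauchy sequence of convolution powers becomes uniformly
  Cauchy.\<close>

lemma norm_conv_le:
  assumes p: "cts p" and q: "cts q"
  shows "(cmod (conv p q x))\<^sup>2 \<le> l2sq p * l2sq q"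
proof -
  have c: "cts (\<lambda>y. p (x - y))" by (intro continuous_intros continuous_on_comp_UNIV[OF p])
  have "cmod (conv p q x) \<le> (\<integral>y. cmod (p (x - y)) * cmod (q y) \<partial>M)"
    unfolding conv_def using integral_norm_bound[of M "\<lambda>y. p (x - y) * q y"] by (simp add: norm_mult)
  then have "(cmod (conv p q x))\<^sup>2 \<le> (\<integral>y. cmod (p (x - y)) * cmod (q y) \<partial>M)\<^sup>2"
    by (intro power_mono) auto
  also have "\<dots> \<le> l2sq p * l2sq q"
    using Cauchy_Schwarz_cts[OF c q] l2sq_reflect[OF p] by simp
  finally show ?thesis .
qed

text \<open>Finitely many translates of \<open>U\<close> cover the compact group and all have the
  measure of \<open>U\<close>, while the total mass is 1.\<close>

lemma measure_open_pos:
  assumes "open U" "U \<noteq> {}"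
  shows "0 < measure M U"
proof -
  obtain u where u: "u \<in> U" using assms by blast
  have op: "open ((\<lambda>x. a + x) -` U)" for a
    by (intro open_vimage assms continuous_intros)
  have "UNIV \<subseteq> (\<Union>a. (\<lambda>x. a + x) -` U)"
  proof
    fix x show "x \<in> (\<Union>a. (\<lambda>x. a + x) -` U)" by (rule UN_I[of "u - x"]) (use u in auto)
  qed
  then obtain F where F: "finite F" "UNIV \<subseteq> (\<Union>a\<in>F. (\<lambda>x. a + x) -` U)"
    using compactE_image[OF compact_UNIV, of UNIV "\<lambda>a. (\<lambda>x. a + x) -` U"] op by (metis subset_UNIV)
  have tr: "measure M ((\<lambda>x. a + x) -` U) = measure M U" for a
  proof -
    have "measure (distr M borel (\<lambda>x. a + x)) U = measure M ((\<lambda>x. a + x) -` U \<inter> space M)"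
      using assms(1) by (intro measure_distr measurable_continuous continuous_intros) auto
    then show ?thesis using haar by (simp add: haar_probability_def space_M)
  qed
  have "1 = measure M (\<Union>a\<in>F. (\<lambda>x. a + x) -` U)"
    using F(2) prob_space space_M by (metis top.extremum_uniqueI)
  also have "\<dots> \<le> (\<Sum>a\<in>F. measure M ((\<lambda>x. a + x) -` U))"
    using F(1) op by (intro measure_UNION_le) (auto simp: sets_M)
  also have "\<dots> = real (card F) * measure M U" by (simp add: tr)
  finally show ?thesis by (metis measure_nonneg mult_zero_right not_one_le_zero order_le_less)
qed

lemma l2sq_pos:
  assumes p: "cts p" and "p x \<noteq> 0"
  shows "0 < l2sq p"
proof -
  let ?c = "(cmod (p x))\<^sup>2 / 2"
  let ?U = "{y. ?c < (cmod (p y))\<^sup>2}"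
  have c: "0 < ?c" using assms(2) by simp
  have U: "open ?U" using p by (intro open_Collect_less continuous_intros)
  moreover have "x \<in> ?U" using c by simp
  ultimately have "0 < measure M ?U" using measure_open_pos by blast
  then have "0 < ?c * measure M ?U" using c by simp
  also have "\<dots> = (\<integral>y. ?c * indicator ?U y \<partial>M)" using U space_M by simp
  also have "\<dots> \<le> l2sq p"
    unfolding l2sq_def
  proof (rule integral_mono)
    show "integrable M (\<lambda>y. ?c * indicator ?U y)"
      using U by (intro integrable_mult_right integrable_real_indicator)
        (auto simp: sets_M emeasure_eq_measure)
    show "integrable M (\<lambda>y. (cmod (p y))\<^sup>2)" by (intro integrable_continuous continuous_intros p)
  qed (auto simp: indicator_def)
  finally show ?thesis .
qed

lemma tendsto_integral_uniform:
  fixes g :: "nat \<Rightarrow> 'a \<Rightarrow> complex"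
  assumes "uniform_limit UNIV g l sequentially" "\<And>n. cts (g n)"
  shows "(\<lambda>n. \<integral>x. g n x \<partial>M) \<longlonglongrightarrow> (\<integral>x. l x \<partial>M)"
  unfolding tendsto_iff
proof (intro allI impI)
  fix e :: real assume "0 < e"
  have l: "cts l"
    by (rule uniform_limit_theorem[OF _ assms(1)]) (use assms(2) in auto)
  have "\<forall>\<^sub>F n in sequentially. \<forall>x\<in>UNIV. dist (g n x) (l x) < e / 2"
    using assms(1) \<open>0 < e\<close> unfolding uniform_limit_iff by (meson half_gt_zero)
  then show "\<forall>\<^sub>F n in sequentially. dist (\<integral>x. g n x \<partial>M) (\<integral>x. l x \<partial>M) < e"
  proof eventually_elim
    case (elim n)
    have "dist (\<integral>x. g n x \<partial>M) (\<integral>x. l x \<partial>M) = norm (\<integral>x. g n x - l x \<partial>M)"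
      by (simp add: dist_norm integrable_continuous assms(2) l)
    also have "\<dots> \<le> (\<integral>x. e / 2 \<partial>M)"
      using elim by (intro norm_integral_le_integral)
        (auto simp: integrable_continuous assms(2) l dist_norm intro!: less_imp_le)
    also have "\<dots> < e" using \<open>0 < e\<close> by (simp add: prob_space)
    finally show ?case .
  qed
qed

lemma uniform_limit_comp:
  "uniform_limit UNIV g l F \<Longrightarrow> uniform_limit UNIV (\<lambda>n x. g n (h x)) (\<lambda>x. l (h x)) F"
  unfolding uniform_limit_iff by (fast elim: eventually_mono)

lemma tendsto_conv:
  assumes p: "uniform_limit UNIV p p' sequentially" "\<And>n. cts (p n)"
    and q: "uniform_limit UNIV q q' sequentially" "\<And>n. cts (q n)"
  shows "(\<lambda>n. conv (p n) (q n) x) \<longlonglongrightarrow> conv p' q' x"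
  unfolding conv_def
proof (rule tendsto_integral_uniform)
  have c: "cts p'" "cts q'"
    by (rule uniform_limit_theorem[OF _ p(1)] uniform_limit_theorem[OF _ q(1)]; use p q in auto)+
  have b: "bounded (range g)" if "cts g" for g
    using compact_continuous_image[OF that compact_UNIV] compact_imp_bounded by blast
  have c': "cts (\<lambda>y. p' (x - y))" by (intro continuous_on_comp_UNIV[OF c(1)] continuous_intros)
  show "uniform_limit UNIV (\<lambda>n y. p n (x - y) * q n y) (\<lambda>y. p' (x - y) * q' y) sequentially"
    by (rule uniform_lim_mult[OF uniform_limit_comp[OF p(1)] q(1)]) (rule b[OF c'] b[OF c(2)])+
  show "cts (\<lambda>y. p n (x - y) * q n y)" for n
    by (intro continuous_intros continuous_on_comp_UNIV[OF p(2)] q(2))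
qed

end

section \<open>Characters from minimal idempotents\<close>

context compact_haar_group
begin

text \<open>Convolution with such an \<open>e\<close> is an orthogonal projection that commutes with
  translations. Its rank is the trace \<open>e 0\<close>, which equals
  \<open>l2sq e\<close>.\<close>

definition idem :: "('a \<Rightarrow> complex) \<Rightarrow> bool" where
  "idem e \<longleftrightarrow> cts e \<and> adj e = e \<and> conv e e = e"

text \<open>The idempotent is the limit of the normalized even convolution powers of \<open>k\<close>. The squared
  norms \<open>a n\<close> of the powers are log-convex, so that the ratios increase to a limit \<open>c\<close>; they are also
  submultiplicative because \<open>M\<close> has mass one, which gives \<open>a n \<ge> c ^ (n + 1)\<close>, so that the
  limit does not vanish.\<close>

lemma exists_idempotent:
  assumes k: "cts k" "adj k = k" "k x0 \<noteq> 0"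
  obtains e c where "idem e" "e 0 \<noteq> 0" "c \<noteq> 0" "conv (conv k k) e = (\<lambda>x. c * e x)"
proof -
  \<comment> \<open>\<open>u n\<close> is the convolution power of exponent \<open>n + 1\<close>,
    whence the extra 1 in all index formulas.\<close>
  define u where "u n = (conv k ^^ n) k" for n
  have u0: "u 0 = k" and uS: "u (Suc n) = conv k (u n)" for n by (simp_all add: u_def)
  have uc: "cts (u n)" for n
    by (induction n) (auto simp: u0 uS intro: k)
  have ui: "integrable M (u n)" for n using uc by (rule integrable_continuous)
  have uu: "conv (u n) (u m) = u (n + m + 1)" for n m
  proof (induction n)
    case 0 then show ?case by (simp add: u0 uS)
  next
    case (Suc n) then show ?case by (simp add: uS conv_assoc[OF k(1) uc ui])
  qed
  have ua: "adj (u n) = u n" for n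
    by (induction n) (simp_all add: u0 uS adj_conv[OF k(1) uc] k(2))
  define a where "a n = l2sq (u n)" for n
  have ua0: "u (2 * n + 1) 0 = of_real (a n)" for n
    using conv_adj_0[OF uc, of n] by (simp add: a_def ua uu mult_2)
  have logconv: "(a (Suc n))\<^sup>2 \<le> a n * a (Suc (Suc n))" for n
  proof -
    have "conv (u n) (u (Suc (Suc n))) = u (2 * Suc n + 1)" by (simp add: uu mult_2)
    then show ?thesis
      using norm_conv_le[OF uc uc, of n "Suc (Suc n)" 0] by (simp only: ua0) (simp add: a_def)
  qed
  have a0: "0 \<le> a n" for n by (simp add: a_def)
  have apos: "0 < a n \<and> 0 < a (Suc n)" for n
  proof (induction n)
    case 0
    have 1: "0 < a 0" unfolding a_def using l2sq_pos[of k x0] k by (simp add: u_def)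
    moreover have "u 1 0 \<noteq> 0" using ua0[of 0] 1 by simp
    then have "0 < a 1" unfolding a_def by (rule l2sq_pos[OF uc])
    ultimately show ?case by simp
  next
    case (Suc n)
    then have "0 < (a (Suc n))\<^sup>2" by simp
    then have "0 < a n * a (Suc (Suc n))" using logconv[of n] by linarith
    then show ?case using Suc by (simp add: zero_less_mult_iff)
  qed
  then have apos: "0 < a n" for n by blast
  have usup: "cmod (u (2 * n + 1) x) \<le> a n" for n x
  proof -
    have "(cmod (u (2 * n + 1) x))\<^sup>2 \<le> (a n)\<^sup>2"
      using norm_conv_le[OF uc uc, of n n x] by (simp add: uu mult_2 a_def power2_eq_square)
    then show ?thesis using a0 power2_le_imp_le by blast
  qed
  have submult: "a (n + m + 1) \<le> a n * a m" for n m
  proof -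
    have "of_real (a (n + m + 1)) = conv (u (2 * n + 1)) (u (2 * m + 1)) 0"
      unfolding uu using ua0[of "n + m + 1"] by (simp add: algebra_simps mult_2)
    then have "a (n + m + 1) = cmod (conv (u (2 * n + 1)) (u (2 * m + 1)) 0)"
      by (metis a0 abs_of_nonneg norm_of_real)
    also have "\<dots> \<le> (\<integral>y. a n * a m \<partial>M)"
      unfolding conv_def
      using integrable_conv_integrand[OF uc[of "2 * n + 1"] ui[of "2 * m + 1"], of 0]
      by (intro norm_integral_le_integral)
        (auto simp: norm_mult intro!: mult_mono usup[simplified] a0)
    finally show ?thesis by (simp add: prob_space)
  qed
  define \<rho> where "\<rho> n = a (Suc n) / a n" for n
  have \<rho>mono: "incseq \<rho>"
  proof (rule incseq_SucI)
    fix n show "\<rho> n \<le> \<rho> (Suc n)"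
      using logconv[of n] apos[of n] apos[of "Suc n"]
      by (simp add: \<rho>_def divide_simps power2_eq_square mult.commute)
  qed
  have \<rho>bd: "\<rho> n \<le> a 0" for n
    using submult[of n 0] apos[of n] by (simp add: \<rho>_def divide_simps mult.commute)
  obtain c where c: "\<rho> \<longlonglongrightarrow> c" "\<And>n. \<rho> n \<le> c"
    using incseq_convergent[OF \<rho>mono] \<rho>bd by metis
  have cpos: "0 < c" using c(2)[of 0] apos[of 0] apos[of 1] by (simp add: \<rho>_def) (meson divide_pos_pos less_le_trans)
  \<comment> \<open>Since the ratios increase, \<open>\<rho> n ^ (m + 1) * a n\<close> is at most
    \<open>a (n + m + 1)\<close>, and this is at most \<open>a n * a m\<close>. Dividing by
    \<open>a n\<close> and letting \<open>n\<close> grow gives the bound.\<close>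
  have alower: "c ^ (m + 1) \<le> a m" for m
  proof (rule LIMSEQ_le_const2[OF tendsto_power[OF c(1)]], intro exI[of _ 0] allI impI)
    fix n
    have "\<rho> n ^ j * a n \<le> a (n + j)" for j
    proof (induction j)
      case (Suc j)
      have "\<rho> n ^ Suc j * a n = \<rho> n * (\<rho> n ^ j * a n)" by simp
      also have "\<dots> \<le> \<rho> (n + j) * a (n + j)"
        using Suc \<rho>mono a0 by (intro mult_mono) (auto simp: incseq_def \<rho>_def)
      also have "\<dots> = a (n + Suc j)" using apos[of "n + j"] by (simp add: \<rho>_def)
      finally show ?case .
    qed simp
    from order_trans[OF this[of "m + 1"]] submult[of n m]
    have "\<rho> n ^ (m + 1) * a n \<le> a m * a n" by (simp add: mult.commute add.assoc)
    then show "\<rho> n ^ (m + 1) \<le> a m" using apos[of n] by (rule mult_right_le_imp_le)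
  qed
  \<comment> \<open>The sequence decreases because the ratios of \<open>a\<close> stay below
    \<open>c\<close>, and \<open>alower\<close> keeps it above 1; its limit is therefore not
    0.\<close>
  define b where "b n = a n / c ^ (n + 1)" for n
  have b1: "1 \<le> b n" for n using alower[of n] cpos by (simp add: b_def)
  have "decseq b"
  proof (rule decseq_SucI)
    fix n
    have "a (Suc n) \<le> c * a n" using c(2)[of n] apos[of n] by (simp add: \<rho>_def field_simps)
    then show "b (Suc n) \<le> b n" using cpos by (simp add: b_def divide_simps mult.commute mult.left_commute)
  qed
  then obtain L where L: "b \<longlonglongrightarrow> L"
    using decseq_convergent[of b 1] b1 by blast
  \<comment> \<open>The scaled power of exponent \<open>2 * n + 2\<close>. The scaling gives
    \<open>conv (v n) (v m) = v (n + m + 1)\<close>, so a limit is idempotent, and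
    \<open>v n 0 = b n\<close>, so it is not 0.\<close>
  define v where "v n x = of_real (1 / c ^ (n + 1)) * u (2 * n + 1) x" for n x
  have vc: "cts (v n)" for n unfolding v_def by (intro continuous_intros uc)
  have vv: "conv (v n) (v m) = v (n + m + 1)" for n m
    unfolding v_def conv_scale_left conv_scale_right uu
    by (simp add: power_add algebra_simps mult_2)
  have v0: "v n 0 = of_real (b n)" for n unfolding v_def ua0 by (simp add: b_def)
  have va: "adj (v n) = v n" for n
    unfolding v_def using fun_cong[OF ua[of "2 * n + 1"]] by (auto simp: adj_def fun_eq_iff)
  have u1v: "conv (u 1) (v n) = (\<lambda>x. of_real c * v (Suc n) x)" for n
    unfolding v_def conv_scale_right uu using cpos by (auto simp: fun_eq_iff)
  \<comment> \<open>The \<open>L\<^sup>2\<close> distances are expressed by \<open>b\<close> alone,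
    so convergence of \<open>b\<close> makes \<open>v\<close> Cauchy in
    \<open>L\<^sup>2\<close>.\<close>
  have vdiff: "l2sq (\<lambda>x. v n x - v m x) = b (2 * n + 1) + b (2 * m + 1) - 2 * b (n + m + 1)" for n m
  proof -
    let ?d = "\<lambda>x. v n x - v m x"
    have dc: "cts ?d" by (intro continuous_intros vc)
    have "adj ?d = ?d" using fun_cong[OF va] by (auto simp: adj_def fun_eq_iff)
    then have "of_real (l2sq ?d) = conv ?d ?d 0" using conv_adj_0[OF dc] by simp
    also have "\<dots> = conv (v n) ?d 0 - conv (v m) ?d 0"
      by (simp only: conv_diff_right[OF dc vc vc] conv_commute[OF dc vc])
    also have "conv (v n) ?d 0 = of_real (b (n + n + 1)) - of_real (b (n + m + 1))"
      by (simp only: conv_diff_right[OF vc vc vc] vv v0)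
    also have "conv (v m) ?d 0 = of_real (b (m + n + 1)) - of_real (b (m + m + 1))"
      by (simp only: conv_diff_right[OF vc vc vc] vv v0)
    finally have "complex_of_real (l2sq ?d)
        = of_real (b (n + n + 1) - b (n + m + 1) - (b (m + n + 1) - b (m + m + 1)))"
      by (simp only: of_real_diff)
    then have "l2sq ?d = b (n + n + 1) - b (n + m + 1) - (b (m + n + 1) - b (m + m + 1))"
      by (simp only: of_real_eq_iff)
    moreover have "2 * n + 1 = n + n + 1" "2 * m + 1 = m + m + 1" "m + n + 1 = n + m + 1" by simp_all
    ultimately show ?thesis by (simp only:)
  qed
  \<comment> \<open>By \<open>u1v\<close>, \<open>v (Suc n)\<close> arises from \<open>v n\<close>
    by convolution with \<open>u 1\<close>, up to the factor \<open>c\<close>; hence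
    \<open>L\<^sup>2\<close> Cauchy becomes uniformly Cauchy. The number \<delta> is chosen such
    that \<open>a 1 * \<delta> = (c * \<epsilon>)\<^sup>2\<close>.\<close>
  have "uniformly_Cauchy_on UNIV (\<lambda>n. v (Suc n))"
    unfolding uniformly_Cauchy_on_def
  proof (intro allI impI)
    fix \<epsilon> :: real assume \<epsilon>: "0 < \<epsilon>"
    define \<delta> where "\<delta> = \<epsilon>\<^sup>2 * c\<^sup>2 / a 1"
    have \<delta>: "0 < \<delta>" using \<epsilon> cpos apos[of 1] by (simp add: \<delta>_def)
    obtain N where N: "\<And>n. n \<ge> N \<Longrightarrow> \<bar>b n - L\<bar> < \<delta> / 4"
      using L \<delta> unfolding LIMSEQ_iff by (metis divide_pos_pos real_norm_def zero_less_numeral)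
    show "\<exists>N. \<forall>x\<in>UNIV. \<forall>m\<ge>N. \<forall>n\<ge>N. dist (v (Suc m) x) (v (Suc n) x) < \<epsilon>"
    proof (intro exI[of _ N] ballI allI impI)
      fix x m n assume mn: "N \<le> m" "N \<le> n"
      let ?d = "\<lambda>x. v m x - v n x"
      have dc: "cts ?d" by (intro continuous_intros vc)
      have "\<bar>b (2 * m + 1) - L\<bar> < \<delta> / 4" "\<bar>b (2 * n + 1) - L\<bar> < \<delta> / 4" "\<bar>b (m + n + 1) - L\<bar> < \<delta> / 4"
        by (rule N, use mn in linarith)+
      then have "l2sq ?d < \<delta>" unfolding vdiff by linarith
      have "of_real c * (v (Suc m) x - v (Suc n) x) = conv (u 1) ?d x"
        by (simp only: conv_diff_right[OF uc vc vc] u1v right_diff_distrib)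
      then have "c * dist (v (Suc m) x) (v (Suc n) x) = cmod (conv (u 1) ?d x)"
        using cpos by (metis abs_of_pos dist_norm norm_mult norm_of_real)
      then have "(c * dist (v (Suc m) x) (v (Suc n) x))\<^sup>2 \<le> a 1 * l2sq ?d"
        using norm_conv_le[OF uc dc, of 1 x] by (simp add: a_def)
      also have "\<dots> < a 1 * \<delta>" using \<open>l2sq ?d < \<delta>\<close> apos[of 1] by simp
      also have "\<dots> = (c * \<epsilon>)\<^sup>2" using apos[of 1] by (simp add: \<delta>_def power_mult_distrib)
      finally have "c * dist (v (Suc m) x) (v (Suc n) x) < c * \<epsilon>"
        by (rule power2_less_imp_less) (use cpos \<epsilon> in simp)
      then show "dist (v (Suc m) x) (v (Suc n) x) < \<epsilon>" using cpos by simp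
    qed
  qed
  then obtain e where lim: "uniform_limit UNIV (\<lambda>n. v (Suc n)) e sequentially"
    using Cauchy_uniformly_convergent unfolding uniformly_convergent_on_def by blast
  have ptw: "(\<lambda>n. v (Suc n) x) \<longlonglongrightarrow> e x" for x
    using tendsto_uniform_limitI[OF lim] by blast
  have ec: "cts e" by (rule uniform_limit_theorem[OF _ lim]) (simp_all add: vc)
  have ea: "adj e = e"
  proof
    fix x
    have "(\<lambda>n. adj (v (Suc n)) x) \<longlonglongrightarrow> adj e x"
      unfolding adj_def by (intro tendsto_cnj ptw)
    then show "adj e x = e x" unfolding va using ptw LIMSEQ_unique by blast
  qed
  have ee: "conv e e = e"
  proof
    fix x
    have "(\<lambda>n. conv (v (Suc n)) (v (Suc n)) x) \<longlonglongrightarrow> conv e e x"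
      by (rule tendsto_conv[OF lim vc lim vc])
    moreover have "(\<lambda>n. conv (v (Suc n)) (v (Suc n)) x) = (\<lambda>n. v (Suc n) x) \<circ> (\<lambda>n. 2 * n + 2)"
      by (auto simp: vv mult_2)
    moreover have "((\<lambda>n. v (Suc n) x) \<circ> (\<lambda>n. 2 * n + 2)) \<longlonglongrightarrow> e x"
      by (rule LIMSEQ_subseq_LIMSEQ[OF ptw]) (simp add: strict_mono_def)
    ultimately show "conv e e x = e x" using LIMSEQ_unique by metis
  qed
  have ke: "conv (u 1) e = (\<lambda>x. of_real c * e x)"
  proof
    fix x
    have "(\<lambda>n. conv (u 1) (v (Suc n)) x) \<longlonglongrightarrow> conv (u 1) e x"
      by (rule tendsto_conv[OF _ uc lim vc]) (simp add: uniform_limit_const)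
    moreover have "(\<lambda>n. conv (u 1) (v (Suc n)) x) \<longlonglongrightarrow> of_real c * e x"
      unfolding u1v by (intro tendsto_intros LIMSEQ_Suc[OF ptw])
    ultimately show "conv (u 1) e x = of_real c * e x" using LIMSEQ_unique by blast
  qed
  have "(\<lambda>n. b (Suc n)) \<longlonglongrightarrow> Re (e 0)"
    using tendsto_Re[OF ptw[of 0]] by (simp add: v0)
  then have "1 \<le> Re (e 0)" using b1 by (intro LIMSEQ_le_const[of _ _ 1]) auto
  then have "e 0 \<noteq> 0" by auto
  moreover have "u 1 = conv k k" by (simp add: u_def)
  ultimately show ?thesis
    by (intro that[of e "of_real c"]) (use ec ea ee ke cpos in \<open>simp_all add: idem_def\<close>)
qed

lemma conv_zero_right: "conv p (\<lambda>x. 0) = (\<lambda>x. 0)"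
  by (simp add: conv_def fun_eq_iff)

lemma idem_at_0: "idem e \<Longrightarrow> e 0 = of_real (l2sq e)"
  using conv_adj_0[of e] by (simp add: idem_def)

text \<open>From \<open>e = conv e e\<close> the supremum of \<open>e\<close> is at most
  \<open>l2sq e\<close>; as the mass of \<open>M\<close> is 1, integrating the square gives
  \<open>l2sq e \<le> (l2sq e)\<^sup>2\<close>. This gap makes descending chains of idempotents
  finite.\<close>

lemma idem_l2sq_ge_1:
  assumes e: "idem e" and nz: "e x \<noteq> 0"
  shows "1 \<le> l2sq e"
proof -
  have c: "cts e" and ee: "conv e e = e" using e by (auto simp: idem_def)
  have pos: "0 < l2sq e" using l2sq_pos[OF c nz] .
  have sup: "cmod (e y) \<le> l2sq e" for y
  proof (rule power2_le_imp_le)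
    show "(cmod (e y))\<^sup>2 \<le> (l2sq e)\<^sup>2" using norm_conv_le[OF c c, of y] by (simp add: ee power2_eq_square)
  qed simp
  have "l2sq e \<le> (\<integral>y. (l2sq e)\<^sup>2 \<partial>M)"
    unfolding l2sq_def[of e]
    using sup by (intro integral_mono integrable_continuous continuous_intros c power_mono)
      (auto simp flip: l2sq_def)
  then have "l2sq e \<le> (l2sq e)\<^sup>2" by (simp add: prob_space)
  then show ?thesis using pos by (simp add: power2_eq_square)
qed

text \<open>The condition \<open>conv e e' = e'\<close> says that \<open>e'\<close> projects onto a
  subspace of the range of \<open>e\<close>. The norms subtract because \<open>l2sq\<close> of an
  idempotent is its value at 0.\<close>

lemma idem_diff:
  assumes e: "idem e" and e': "idem e'" and "conv e e' = e'"
  shows "idem (\<lambda>x. e x - e' x)" "l2sq (\<lambda>x. e x - e' x) = l2sq e - l2sq e'"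
proof -
  have c: "cts e" "cts e'" "conv e e = e" "conv e' e' = e'" "adj e = e" "adj e' = e'"
    using e e' by (auto simp: idem_def)
  let ?d = "\<lambda>x. e x - e' x"
  have dc: "cts ?d" by (intro continuous_intros c)
  have e'e: "conv e' e = e'" using conv_commute[OF c(2,1)] assms(3) by simp
  have "conv ?d ?d = ?d"
    using c assms(3) e'e
    by (simp add: conv_diff_right[OF dc] conv_commute[OF dc] conv_diff_right)
  moreover have "adj ?d = ?d" using fun_cong[OF c(5)] fun_cong[OF c(6)] by (auto simp: adj_def fun_eq_iff)
  ultimately show d: "idem ?d" using dc by (simp add: idem_def)
  show "l2sq ?d = l2sq e - l2sq e'"
    using idem_at_0[OF d] idem_at_0[OF e] idem_at_0[OF e'] by (metis of_real_diff of_real_eq_iff)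
qed

text \<open>Minimality is expressed as one-dimensionality of the self-adjoint part of the range of
  \<open>e\<close>, not as absence of smaller idempotents: this is the form used to show that
  translates are multiples of \<open>e\<close>.\<close>

definition minimal_idem :: "('a \<Rightarrow> complex) \<Rightarrow> bool" where
  "minimal_idem e \<longleftrightarrow> idem e \<and> e 0 \<noteq> 0 \<and>
     (\<forall>t. cts t \<longrightarrow> adj t = t \<longrightarrow> conv e t = t \<longrightarrow> (\<exists>c. t = (\<lambda>x. c * e x)))"

text \<open>The powers of a nonzero self-adjoint \<open>r\<close> in the range of \<open>e\<close>
  produce an idempotent below \<open>e\<close>. If both \<open>t\<close> and \<open>t + e\<close>
  only give back \<open>e\<close> itself, then the convolution squares of both are multiples of
  \<open>e\<close>; expanding the second square shows that \<open>2 * t\<close> is such a multiple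
  as well, a contradiction.\<close>

lemma exists_smaller_idem:
  assumes e: "idem e" "e 0 \<noteq> 0" and t: "cts t" "adj t = t" "conv e t = t"
    and nt: "\<And>c. t \<noteq> (\<lambda>x. c * e x)"
  obtains e' where "idem e'" "e' 0 \<noteq> 0" "conv e e' = e'" "e' \<noteq> e"
proof -
  have c: "cts e" "conv e e = e" "adj e = e" using e by (auto simp: idem_def)
  let ?s = "\<lambda>x. t x + e x"
  have sc: "cts ?s" by (intro continuous_intros c t)
  have sa: "adj ?s = ?s" using fun_cong[OF c(3)] fun_cong[OF t(2)] by (auto simp: adj_def fun_eq_iff)
  have es: "conv e ?s = ?s" using c t by (simp add: conv_add_right)
  have main: "\<exists>e' c. idem e' \<and> e' 0 \<noteq> 0 \<and> conv e e' = e' \<and> conv (conv r r) e' = (\<lambda>x. c * e' x)"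
    if r: "cts r" "adj r = r" "conv e r = r" "\<And>c. r \<noteq> (\<lambda>x. c * e x)" for r
  proof -
    obtain x0 where "r x0 \<noteq> 0" using r(4)[of 0] by auto
    then obtain e' c' where e': "idem e'" "e' 0 \<noteq> 0" "c' \<noteq> 0" "conv (conv r r) e' = (\<lambda>x. c' * e' x)"
      using exists_idempotent[OF r(1,2)] by blast
    have e'c: "cts e'" using e'(1) by (simp add: idem_def)
    have rr: "conv e (conv r r) = conv r r"
      using conv_assoc[OF c(1) r(1) integrable_continuous[OF r(1)]] r(3) by simp
    have "conv e (conv (conv r r) e') = conv (conv r r) e'"
      using conv_assoc[OF c(1) cts_conv[OF r(1) r(1)] integrable_continuous[OF e'c]] rr by simp
    then have "(\<lambda>x. c' * conv e e' x) = (\<lambda>x. c' * e' x)" by (simp add: e'(4) conv_scale_right)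
    then have "conv e e' = e'" using e'(3) by (simp add: fun_eq_iff)
    then show ?thesis using e' by blast
  qed
  have ns: "?s \<noteq> (\<lambda>x. d * e x)" for d
  proof
    assume "?s = (\<lambda>x. d * e x)"
    then have "t x = (d - 1) * e x" for x
      using fun_cong[of ?s "\<lambda>x. d * e x" x] by (simp add: algebra_simps)
    then show False using nt[of "d - 1"] by auto
  qed
  obtain e1 c1 where e1: "idem e1" "e1 0 \<noteq> 0" "conv e e1 = e1" "conv (conv t t) e1 = (\<lambda>x. c1 * e1 x)"
    using main[OF t nt] by blast
  obtain e2 c2 where e2: "idem e2" "e2 0 \<noteq> 0" "conv e e2 = e2" "conv (conv ?s ?s) e2 = (\<lambda>x. c2 * e2 x)"
    using main[OF sc sa es ns] by blast
  show ?thesis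
  proof (cases "e1 = e \<and> e2 = e")
    case False
    then show ?thesis using that e1 e2 by blast
  next
    case True
    have fixed: "conv (conv r r) e = conv r r" if "cts r" "conv e r = r" for r
      using conv_commute[OF cts_conv[OF that(1,1)] c(1)]
        conv_assoc[OF c(1) that(1) integrable_continuous[OF that(1)]] that(2) by simp
    have tt: "conv t t = (\<lambda>x. c1 * e x)" using e1(4) True fixed[OF t(1,3)] by simp
    have ss: "conv ?s ?s = (\<lambda>x. c2 * e x)" using e2(4) True fixed[OF sc es] by simp
    have te: "conv t e = t" using conv_commute[OF t(1) c(1)] t(3) by simp
    have "conv ?s ?s = (\<lambda>x. conv t ?s x + conv e ?s x)"
      using conv_add_right[OF sc t(1) c(1)] conv_commute[OF sc t(1)] conv_commute[OF sc c(1)] by simp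
    also have "\<dots> = (\<lambda>x. c1 * e x + t x + (t x + e x))"
      by (simp add: conv_add_right[OF t(1) t(1) c(1)] tt te es)
    finally have "c2 * e x = c1 * e x + t x + (t x + e x)" for x
      using ss by (metis (no_types, lifting))
    then have "t x = ((c2 - c1 - 1) / 2) * e x" for x
      by (simp add: field_simps)
    then show ?thesis using nt[of "(c2 - c1 - 1) / 2"] by auto
  qed
qed

text \<open>Passing to a strictly smaller idempotent lowers \<open>l2sq\<close> by at least 1,
  because the difference is again a nonzero idempotent. The integer part of \<open>l2sq e\<close> is
  thus a termination measure.\<close>

lemma exists_minimal_idem:
  assumes "idem e" "e 0 \<noteq> 0"
  shows "\<exists>e'. minimal_idem e' \<and> conv e e' = e'"
  using assms
proof (induction "nat \<lfloor>l2sq e\<rfloor>" arbitrary: e rule: less_induct)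
  case less
  show ?case
  proof (cases "minimal_idem e")
    case True
    then show ?thesis using less.prems by (auto simp: idem_def)
  next
    case False
    then obtain t where t: "cts t" "adj t = t" "conv e t = t" "\<And>c. t \<noteq> (\<lambda>x. c * e x)"
      using less.prems by (auto simp: minimal_idem_def)
    obtain e1 where e1: "idem e1" "e1 0 \<noteq> 0" "conv e e1 = e1" "e1 \<noteq> e"
      using exists_smaller_idem[OF less.prems t] by blast
    note d = idem_diff[OF less.prems(1) e1(1,3)]
    obtain x where "e1 x \<noteq> e x" using e1(4) by blast
    then have "e x - e1 x \<noteq> 0" by simp
    then have "1 \<le> l2sq e - l2sq e1" using idem_l2sq_ge_1[OF d(1)] d(2) by auto
    moreover have "1 \<le> l2sq e1" using idem_l2sq_ge_1 e1 by blast
    ultimately have "nat \<lfloor>l2sq e1\<rfloor> < nat \<lfloor>l2sq e\<rfloor>" by linarith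
    from less.hyps[OF this e1(1,2)] obtain e' where e': "minimal_idem e'" "conv e1 e' = e'" by blast
    have c: "cts e" "cts e1" "cts e'" using less.prems(1) e1(1) e'(1) by (auto simp: idem_def minimal_idem_def)
    have "conv e e' = e'"
      using conv_assoc[OF c(1,2) integrable_continuous[OF c(3)]] e1(3) e'(2) by simp
    then show ?thesis using e'(1) by blast
  qed
qed

text \<open>Translates of a minimal idempotent are multiples of it, so it is a multiple of a character.\<close>

lemma minimal_idem_character:
  assumes "minimal_idem e"
  shows "\<exists>\<gamma>\<in>dual_group. \<forall>x. e x = e 0 * \<gamma> x"
proof -
  have e: "cts e" "conv e e = e" "adj e = e" "e 0 \<noteq> 0"
    and min: "\<And>t. cts t \<Longrightarrow> adj t = t \<Longrightarrow> conv e t = t \<Longrightarrow> \<exists>c. t = (\<lambda>x. c * e x)"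
    using assms by (auto simp: minimal_idem_def idem_def)
  \<comment> \<open>Minimality speaks of self-adjoint functions only, so \<open>q\<close> is split
    into the self-adjoint functions \<open>q + adj q\<close> and \<open>\<i> * (q - adj q)\<close>,
    both in the range of \<open>e\<close>.\<close>
  have mult: "\<exists>c. q = (\<lambda>x. c * e x)" if q: "cts q" "conv e q = q" for q
  proof -
    have aq: "cts (adj q)" using q by blast
    have eaq: "conv e (adj q) = adj q" using adj_conv[OF e(1) q(1)] q(2) e(3) by simp
    let ?s = "\<lambda>x. q x + adj q x" and ?d = "\<lambda>x. \<i> * (q x - adj q x)"
    have "\<exists>c. ?s = (\<lambda>x. c * e x)"
    proof (rule min)
      show "cts ?s" by (intro continuous_intros q aq)
      show "adj ?s = ?s" by (auto simp: adj_def fun_eq_iff)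
      show "conv e ?s = ?s" by (simp add: conv_add_right[OF e(1) q(1) aq] q(2) eaq)
    qed
    moreover have "\<exists>c. ?d = (\<lambda>x. c * e x)"
    proof (rule min)
      show "cts ?d" by (intro continuous_intros q aq)
      show "adj ?d = ?d" by (auto simp: adj_def fun_eq_iff algebra_simps)
      show "conv e ?d = ?d" by (simp add: conv_scale_right conv_diff_right[OF e(1) q(1) aq] q(2) eaq)
    qed
    ultimately obtain c d where cd: "?s = (\<lambda>x. c * e x)" "?d = (\<lambda>x. d * e x)" by blast
    have "q x = ((c - \<i> * d) / 2) * e x" for x
    proof -
      have "2 * q x = ?s x - \<i> * ?d x" by (simp add: algebra_simps)
      also have "\<dots> = (c - \<i> * d) * e x"
        using fun_cong[OF cd(1), of x] fun_cong[OF cd(2), of x] by (simp add: algebra_simps)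
      finally show ?thesis by (simp add: field_simps)
    qed
    then show ?thesis by blast
  qed
  have tr: "\<exists>c. \<forall>y. e (y + x) = c * e y" for x
  proof -
    let ?t = "\<lambda>y. e (y + x)"
    have tc: "cts ?t" by (intro continuous_on_comp_UNIV[OF e(1)] continuous_intros)
    have "conv e ?t = ?t"
    proof
      fix z
      have "conv ?t e z = conv e e (z + x)" by (simp add: conv_def algebra_simps)
      then show "conv e ?t z = ?t z" by (simp add: conv_commute[OF e(1) tc] e(2))
    qed
    from mult[OF tc this] show ?thesis by (metis)
  qed
  then obtain c where c: "\<And>x y. e (y + x) = c x * e y" by metis
  have ce: "e x = e 0 * c x" for x using c[of 0 x] by simp
  have cm: "c (x + y) = c x * c y" for x y
    using c[of x y] ce[of "x + y"] ce[of x] e(4) by simp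
  \<comment> \<open>Translation by \<open>x\<close> multiplies \<open>e\<close> by
    \<open>c x\<close> but preserves its positive \<open>L\<^sup>2\<close> norm.\<close>
  have c1: "cmod (c x) = 1" for x
  proof -
    have "cts (\<lambda>y. of_real ((cmod (e y))\<^sup>2))" by (intro continuous_intros e)
    from integral_translate[OF this, of x]
    have "l2sq e = (\<integral>y. (cmod (e (x + y)))\<^sup>2 \<partial>M)" by (simp add: l2sq_def del: of_real_power)
    also have "\<dots> = (cmod (c x))\<^sup>2 * l2sq e"
      using c[of _ x] by (simp add: l2sq_def add.commute[of x] norm_mult power_mult_distrib)
    finally have "(cmod (c x))\<^sup>2 = 1" using l2sq_pos[OF e(1,4)] by simp
    then show ?thesis by (simp add: power2_eq_1_iff) (metis norm_ge_zero not_one_le_zero neg_0_le_iff_le minus_le_iff)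
  qed
  have "c = (\<lambda>x. e x / e 0)" by (rule ext) (metis ce e(4) nonzero_mult_div_cancel_left)
  then have "cts c" using e(1) e(4) by (auto intro!: continuous_intros)
  then have "c \<in> dual_group" using c1 cm by (simp add: dual_group_def)
  then show ?thesis using ce by blast
qed

section \<open>Completeness of the dual group\<close>

lemma
  fixes \<gamma> :: "'a \<Rightarrow> complex"
  assumes "\<gamma> \<in> dual_group"
  shows char_cts: "cts \<gamma>" and char_norm: "cmod (\<gamma> x) = 1" and char_add: "\<gamma> (x + y) = \<gamma> x * \<gamma> y"
  using assms by (auto simp: dual_group_def)

lemma char_0: "(\<gamma> :: 'a \<Rightarrow> complex) \<in> dual_group \<Longrightarrow> \<gamma> 0 = 1"
  using char_add[of \<gamma> 0 0] char_norm[of \<gamma> 0] by (metis add_0 mult_cancel_right1 norm_zero zero_neq_one)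

lemma char_minus:
  fixes \<gamma> :: "'a \<Rightarrow> complex"
  assumes a: "\<gamma> \<in> dual_group"
  shows "\<gamma> (- x) = cnj (\<gamma> x)"
proof -
  have "\<gamma> (- x) * \<gamma> x = 1" using char_add[OF a, of "- x" x] char_0[OF a] by simp
  moreover have "cnj (\<gamma> x) * \<gamma> x = 1"
    using char_norm[OF a, of x] by (metis complex_norm_square mult.commute of_real_1 one_power2)
  moreover have "\<gamma> x \<noteq> 0" using char_norm[OF a, of x] by auto
  ultimately show ?thesis by (metis mult_right_cancel)
qed

lemma conv_char:
  assumes "\<gamma> \<in> dual_group"
  shows "conv \<gamma> u x = \<gamma> x * (\<integral>y. cnj (\<gamma> y) * u y \<partial>M)"
  using char_add[OF assms, of x "- _"] char_minus[OF assms]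
  by (simp add: conv_def mult.assoc)

text \<open>The self-adjoint function \<open>h = conv k (adj k)\<close> does not vanish at 0 and
  yields a minimal idempotent \<open>e'\<close> with \<open>conv (conv h h) e' = c * e'\<close> and
  \<open>c \<noteq> 0\<close>. If \<open>k\<close> had coefficient 0 at the character \<gamma>
  underlying \<open>e'\<close>, then convolving \<open>e'\<close> with \<open>k\<close>, hence with
  \<open>h\<close>, would give 0.\<close>

lemma exists_nonzero_fourier_coeff:
  assumes k: "cts k" and nz: "k x0 \<noteq> 0"
  shows "\<exists>\<gamma>\<in>dual_group. (\<integral>y. cnj (\<gamma> y) * k y \<partial>M) \<noteq> 0"
proof -
  define h where "h = conv k (adj k)"
  have ac: "cts (adj k)" using k by blast
  have hc: "cts h" using k by (auto simp: h_def)
  have ha: "adj h = h" by (simp add: h_def adj_conv[OF k ac] conv_commute[OF ac k])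
  have h0: "h 0 \<noteq> 0" using l2sq_pos[OF k nz] by (simp add: h_def conv_adj_0[OF k])
  obtain e c where e: "idem e" "e 0 \<noteq> 0" "c \<noteq> 0" "conv (conv h h) e = (\<lambda>x. c * e x)"
    using exists_idempotent[OF hc ha h0] by blast
  obtain e' where e': "minimal_idem e'" "conv e e' = e'" using exists_minimal_idem[OF e(1,2)] by blast
  have ec: "cts e" "cts e'" using e(1) e'(1) by (auto simp: idem_def minimal_idem_def)
  have hhc: "cts (conv h h)" using hc by blast
  have he': "conv (conv h h) e' = (\<lambda>x. c * e' x)"
    using conv_assoc[OF hhc ec(1) integrable_continuous[OF ec(2)]]
    by (simp add: e'(2) e(4) conv_scale_left)
  obtain \<gamma> where \<gamma>: "\<gamma> \<in> dual_group" "\<And>x. e' x = e' 0 * \<gamma> x"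
    using minimal_idem_character[OF e'(1)] by blast
  note xc = char_cts[OF \<gamma>(1)]
  have e'0: "e' 0 \<noteq> 0" using e'(1) by (simp add: minimal_idem_def)
  have "(\<integral>y. cnj (\<gamma> y) * k y \<partial>M) \<noteq> 0"
  proof
    assume z: "(\<integral>y. cnj (\<gamma> y) * k y \<partial>M) = 0"
    have "conv k \<gamma> = (\<lambda>x. 0)"
      using conv_char[OF \<gamma>(1), of k] z by (simp add: conv_commute[OF k xc] fun_eq_iff)
    moreover have "e' = (\<lambda>x. e' 0 * \<gamma> x)" using \<gamma>(2) by blast
    ultimately have ke: "conv k e' = (\<lambda>x. 0)" using conv_scale_right[of k "e' 0" \<gamma>] by simp
    have "conv h e' = conv (adj k) (conv k e')"
      unfolding h_def conv_commute[OF k ac] by (rule conv_assoc[OF ac k integrable_continuous[OF ec(2)]])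
    then have "conv h e' = (\<lambda>x. 0)" by (simp add: ke conv_zero_right)
    then have "conv (conv h h) e' = (\<lambda>x. 0)"
      using conv_assoc[OF hc hc integrable_continuous[OF ec(2)]] by (simp add: conv_zero_right)
    then show False using he' e(3) e'0 by (metis mult_eq_0_iff)
  qed
  then show ?thesis using \<gamma>(1) by blast
qed

text \<open>As \<open>f\<close> need not be continuous, it is smoothed: \<open>conv g f\<close> is
  continuous and inherits vanishing coefficients, so it is 0 everywhere. With \<open>g\<close> the
  reflection of \<open>h\<close>, its value at 0 is the integral of \<open>h * f\<close>.\<close>

theorem AE_eq_0_if_fourier_coeffs_0:
  fixes f :: "'a \<Rightarrow> complex"
  assumes f: "integrable M f" and zero: "\<And>\<gamma>. \<gamma> \<in> dual_group \<Longrightarrow> (\<integral>y. cnj (\<gamma> y) * f y \<partial>M) = 0"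
  shows "AE x in M. f x = 0"
proof (rule AE_eq_0_if_orthogonal_continuous[OF f])
  fix h :: "'a \<Rightarrow> real" assume h: "continuous_on UNIV h"
  define g where "g y = complex_of_real (h (- y))" for y
  have gc: "cts g" unfolding g_def by (intro continuous_intros continuous_on_comp_UNIV[OF h])
  have c: "cts (conv g f)" by (rule cts_conv_integrable[OF gc f])
  have "conv g f x = 0" for x
  proof (rule ccontr)
    assume "conv g f x \<noteq> 0"
    then obtain \<gamma> where \<gamma>: "\<gamma> \<in> dual_group" "(\<integral>y. cnj (\<gamma> y) * conv g f y \<partial>M) \<noteq> 0"
      using exists_nonzero_fourier_coeff[OF c] by blast
    note xc = char_cts[OF \<gamma>(1)]
    have "conv \<gamma> (conv g f) = conv (conv g \<gamma>) f"
      by (simp add: conv_assoc[OF xc gc f, symmetric] conv_commute[OF gc xc])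
    also have "\<dots> = conv g (conv \<gamma> f)" by (rule conv_assoc[OF gc xc f])
    also have "conv \<gamma> f = (\<lambda>x. 0)" by (simp add: conv_char[OF \<gamma>(1)] zero[OF \<gamma>(1)] fun_eq_iff)
    also have "conv g (\<lambda>x. 0) = (\<lambda>x. 0)" by (rule conv_zero_right)
    finally have "conv \<gamma> (conv g f) 0 = 0" by simp
    then show False using \<gamma>(2) by (simp add: conv_char[OF \<gamma>(1)] char_0[OF \<gamma>(1)])
  qed
  from this[of 0] show "(\<integral>x. complex_of_real (h x) * f x \<partial>M) = 0"
    by (simp add: conv_def g_def)
qed

end

section \<open>Mixing and balanced families of characters\<close>

lemma group_automorphism_id: "group_automorphism id"
  by (simp add: group_automorphism_def inv_id)

lemma group_automorphism_comp:
  assumes "group_automorphism S" "group_automorphism T"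
  shows "group_automorphism (S \<circ> T)"
proof -
  have "bij S" "bij T" using assms by (auto simp: group_automorphism_def)
  then have "inv (S \<circ> T) = inv T \<circ> inv S" by (rule o_inv_distrib)
  moreover have "bij (S \<circ> T)" using assms by (intro bij_comp) (auto simp: group_automorphism_def)
  moreover have "continuous_on UNIV (S \<circ> T)" "continuous_on UNIV (inv T \<circ> inv S)"
    using assms by (auto simp: group_automorphism_def o_def intro: continuous_on_comp_UNIV)
  ultimately show ?thesis using assms by (simp add: group_automorphism_def)
qed

lemma group_automorphism_inv:
  assumes "group_automorphism T"
  shows "group_automorphism (inv T)"
proof -
  have b: "bij T" and a: "\<And>x y. T (x + y) = T x + T y" using assms by (auto simp: group_automorphism_def)
  have "inv T (x + y) = inv T x + inv T y" for x y
  proof -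
    have "T (inv T x + inv T y) = x + y" using b by (simp add: a bij_is_surj surj_f_inv_f)
    then show ?thesis using b by (metis bij_inv_eq_iff)
  qed
  then show ?thesis using assms b by (simp add: group_automorphism_def bij_imp_bij_inv inv_inv_eq)
qed

lemma group_automorphism_funpow: "group_automorphism T \<Longrightarrow> group_automorphism (T ^^ n)"
  by (induction n) (auto intro: group_automorphism_comp group_automorphism_id simp flip: id_def)

lemma group_automorphism_int_iterate: "group_automorphism T \<Longrightarrow> group_automorphism (int_iterate T k)"
  by (simp add: int_iterate_def group_automorphism_funpow group_automorphism_inv)

lemma finite_int_vec_ball: "finite {m :: int ^ 'd::finite. norm (real_vec m) \<le> D}"
proof -
  have "{m :: int ^ 'd. norm (real_vec m) \<le> D} \<subseteq> vec_lambda ` (PiE UNIV (\<lambda>_. {- \<lfloor>D\<rfloor>..\<lfloor>D\<rfloor>}))"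
  proof
    fix m :: "int ^ 'd" assume "m \<in> {m. norm (real_vec m) \<le> D}"
    then have *: "\<bar>real_of_int (m $ i)\<bar> \<le> D" for i
      using component_le_norm_cart[of "real_vec m" i] by (simp add: real_vec_def)
    have "m $ i \<in> {- \<lfloor>D\<rfloor>..\<lfloor>D\<rfloor>}" for i
    proof -
      have "\<bar>m $ i\<bar> \<le> \<lfloor>D\<rfloor>" using *[of i] by (simp add: le_floor_iff)
      then show ?thesis by (simp add: abs_le_iff minus_le_iff)
    qed
    then have "vec_nth m \<in> PiE UNIV (\<lambda>_. {- \<lfloor>D\<rfloor>..\<lfloor>D\<rfloor>})" by auto
    then have "vec_lambda (vec_nth m) \<in> vec_lambda ` (PiE UNIV (\<lambda>_. {- \<lfloor>D\<rfloor>..\<lfloor>D\<rfloor>}))" by (rule imageI)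
    then show "m \<in> vec_lambda ` (PiE UNIV (\<lambda>_. {- \<lfloor>D\<rfloor>..\<lfloor>D\<rfloor>}))" by simp
  qed
  moreover have "finite (vec_lambda ` (PiE (UNIV :: 'd set) (\<lambda>_. {- \<lfloor>D\<rfloor>..\<lfloor>D\<rfloor>})))"
    by (intro finite_imageI finite_PiE) auto
  ultimately show ?thesis by (rule finite_subset)
qed

lemma real_vec_diff: "real_vec (l - m) = real_vec l - real_vec m"
  and real_vec_add: "real_vec (l + m) = real_vec l + real_vec m"
  and real_vec_0: "real_vec 0 = 0"
  by (simp_all add: real_vec_def vec_eq_iff)

section \<open>Characters under a mixing action\<close>

locale mixing_action = compact_haar_group M
  for M :: "'a::{topological_ab_group_add,t2_space} measure" +
  fixes A :: "'d::finite \<Rightarrow> 'a \<Rightarrow> 'a"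
  assumes aut: "group_automorphism (A i)" and comm: "A i \<circ> A j = A j \<circ> A i"
    and mix: "mixing_all_orders M A"
begin

sublocale commuting_bijections A
  by standard (use aut comm in \<open>auto simp: group_automorphism_def\<close>)

lemma act_automorphism: "group_automorphism (act A l)"
proof -
  have "group_automorphism (partial_act I l)" for I
  proof (induction I rule: finite_induct[OF finite])
    case 1
    have "partial_act {} l = id" by auto
    then show ?case by (simp only: group_automorphism_id)
  next
    case (2 i I)
    have "partial_act (insert i I) l = int_iterate (A i) (l $ i) \<circ> partial_act I l"
      using 2 by auto
    then show ?case
      using group_automorphism_comp[OF group_automorphism_int_iterate[OF aut] 2(3)] by (simp only:)
  qed
  then show ?thesis unfolding act_def partial_act_def[symmetric] .
qed

lemma act_cts: "continuous_on UNIV (act A l)"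
  using act_automorphism by (simp add: group_automorphism_def)

lemma act_measurable: "act A l \<in> M \<rightarrow>\<^sub>M M"
  using measurable_continuous[OF act_cts] measurable_cong_sets[OF refl sets_M] by blast

lemma act_surj: "\<exists>x. act A l x = y"
  using act_automorphism[of l] by (metis bij_pointE group_automorphism_def)

lemma act_add': "act A l (act A m x) = act A (l + m) x"
  by (simp add: act_add)

lemma dual_act: "\<gamma> \<in> dual_group \<Longrightarrow> (\<lambda>x. \<gamma> (act A l x)) \<in> dual_group"
  using act_automorphism[of l] by (auto simp: dual_group_def group_automorphism_def intro: continuous_on_comp_UNIV)

lemma dual_mult: "\<gamma> \<in> dual_group \<Longrightarrow> \<gamma>' \<in> dual_group \<Longrightarrow> (\<lambda>x::'a. \<gamma> x * \<gamma>' x) \<in> dual_group"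
  by (auto simp: dual_group_def norm_mult intro: continuous_on_mult)

lemma dual_cnj: "\<gamma> \<in> dual_group \<Longrightarrow> (\<lambda>x::'a. cnj (\<gamma> x)) \<in> dual_group"
  by (auto simp: dual_group_def intro: continuous_on_cnj)

lemma dual_1: "(\<lambda>x::'a. 1) \<in> dual_group"
  by (simp add: dual_group_def)

lemma dual_prod: "finite I \<Longrightarrow> (\<And>i. i \<in> I \<Longrightarrow> g i \<in> dual_group) \<Longrightarrow> (\<lambda>x::'a. \<Prod>i\<in>I. g i x) \<in> dual_group"
  by (induction I rule: finite_induct) (auto intro: dual_1 dual_mult)

lemma integral_char:
  assumes "\<gamma> \<in> dual_group"
  shows "(\<integral>x. \<gamma> x \<partial>M) = (if \<gamma> = (\<lambda>x. 1) then 1 else 0)"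
proof (cases "\<gamma> = (\<lambda>x. 1)")
  case True then show ?thesis by (simp add: prob_space)
next
  case False
  then obtain y where y: "\<gamma> y \<noteq> 1" by auto
  have "(\<integral>x. \<gamma> x \<partial>M) = (\<integral>x. \<gamma> (y + x) \<partial>M)" using integral_translate[OF char_cts[OF assms]] by simp
  also have "\<dots> = \<gamma> y * (\<integral>x. \<gamma> x \<partial>M)" by (simp add: char_add[OF assms])
  finally show ?thesis using y False by simp
qed

text \<open>Mixing is given for sets. Each \<open>g i\<close> is uniformly close to a function
  \<open>h i\<close> constant on the pieces of a finite Borel partition; products of the
  \<open>h i\<close> expand into finite combinations of indicators of intersections, to which mixing
  applies.\<close>

lemma tendsto_integral_prod_char:
  assumes r: "2 \<le> r" and g: "\<And>i. i \<in> {1..r} \<Longrightarrow> g i \<in> dual_group"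
  shows "((\<lambda>n. \<integral>x. (\<Prod>i\<in>{1..r}. g i (act A (n i) x)) \<partial>M) \<longlongrightarrow> (\<Prod>i\<in>{1..r}. \<integral>x. g i x \<partial>M))
    (filtercomap (min_gap r) at_top)" (is "(?X \<longlongrightarrow> ?L) ?F")
  unfolding tendsto_iff
proof (intro allI impI)
  fix e :: real assume e: "0 < e"
  \<comment> \<open>A product of \<open>r\<close> factors of modulus at most 1 changes by at most
    \<open>r * d = e / 4\<close>. This error occurs for the integral and for the limit, and a third
    \<open>e / 4\<close> comes from mixing.\<close>
  define d where "d = e / (4 * real r)"
  have d: "0 < d" "real r * d = e / 4" using e r by (auto simp: d_def)
  have "\<exists>\<pi>. \<pi> \<in> borel \<rightarrow>\<^sub>M count_space UNIV \<and> finite (range \<pi>) \<and> (\<forall>x. dist (g i x) (g i (\<pi> x)) < d)"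
    if "i \<in> {1..r}" for i
  proof -
    have "\<exists>U. open U \<and> p \<in> U \<and> (\<forall>x\<in>U. dist (g i x) (g i p) < d)" for p
    proof (intro exI conjI)
      have "continuous_on UNIV (\<lambda>x. dist (g i x) (g i p))"
        by (intro continuous_intros char_cts g that)
      then show "open {x. dist (g i x) (g i p) < d}"
        by (intro open_Collect_less continuous_on_const)
    qed (use d in auto)
    from finite_borel_selection[OF compact_UNIV this] show ?thesis by metis
  qed
  then obtain \<pi> where \<pi>: "\<And>i. i \<in> {1..r} \<Longrightarrow> \<pi> i \<in> borel \<rightarrow>\<^sub>M count_space UNIV"
    "\<And>i. i \<in> {1..r} \<Longrightarrow> finite (range (\<pi> i))"
    "\<And>i x. i \<in> {1..r} \<Longrightarrow> dist (g i x) (g i (\<pi> i x)) < d" by metis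
  define B where "B i p = \<pi> i -` {p}" for i p
  have B: "B i p \<in> sets M" if "i \<in> {1..r}" for i p
    using measurable_sets[OF \<pi>(1)[OF that], of "{p}"] by (simp add: B_def sets_M)
  define h where "h i x = (\<Sum>p\<in>range (\<pi> i). g i p * indicator (B i p) x)" for i x
  have h: "h i x = g i (\<pi> i x)" if "i \<in> {1..r}" for i x
  proof -
    have "h i x = (\<Sum>p\<in>range (\<pi> i). if p = \<pi> i x then g i p else 0)"
      unfolding h_def by (intro sum.cong) (auto simp: B_def indicator_def)
    then show ?thesis using \<pi>(2)[OF that] by simp
  qed
  have hn: "cmod (h i x) \<le> 1" if "i \<in> {1..r}" for i x using h[OF that] char_norm[OF g[OF that]] by simp
  have gn: "cmod (g i x) \<le> 1" if "i \<in> {1..r}" for i x using char_norm[OF g[OF that]] by simp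
  have indm: "(indicator (B i p) :: 'a \<Rightarrow> complex) \<in> borel_measurable M" if "i \<in> {1..r}" for i p
    using B[OF that] by simp
  have hm: "h i \<in> borel_measurable M" if "i \<in> {1..r}" for i
    unfolding h_def[abs_def] using indm[OF that] by (intro borel_measurable_sum borel_measurable_times) auto
  have hi: "integrable M (h i)" if "i \<in> {1..r}" for i
    by (rule integrable_const_bound[of _ 1]) (use hn[OF that] hm[OF that] in auto)
  have gi: "integrable M (g i)" if "i \<in> {1..r}" for i
    by (intro integrable_continuous char_cts g that)
  let ?P = "PiE {1..r} (\<lambda>i. range (\<pi> i))"
  have Pfin: "finite ?P" by (intro finite_PiE) (use \<pi>(2) in auto)
  let ?S = "\<lambda>n \<phi>. \<Inter>i\<in>{1..r}. act A (n i) -` B i (\<phi> i) \<inter> space M"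
  have Ssets: "?S n \<phi> \<in> sets M" for n \<phi>
    using r by (intro sets.countable_INT'' sets.finite_INT measurable_sets[OF act_measurable] B) auto
  have prodh: "(\<Prod>i\<in>{1..r}. h i (act A (n i) x)) = (\<Sum>\<phi>\<in>?P. (\<Prod>i\<in>{1..r}. g i (\<phi> i)) * indicator (?S n \<phi>) x)" for n x
  proof -
    have "(\<Prod>i\<in>{1..r}. h i (act A (n i) x))
        = (\<Sum>\<phi>\<in>?P. \<Prod>i\<in>{1..r}. g i (\<phi> i) * indicator (B i (\<phi> i)) (act A (n i) x))"
      unfolding h_def by (rule prod_sum_PiE) (use \<pi>(2) in auto)
    also have "\<dots> = (\<Sum>\<phi>\<in>?P. (\<Prod>i\<in>{1..r}. g i (\<phi> i)) * indicator (?S n \<phi>) x)"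
    proof (intro sum.cong refl)
      fix \<phi>
      have "(\<Prod>i\<in>{1..r}. indicator (B i (\<phi> i)) (act A (n i) x)) = (indicator (?S n \<phi>) x :: complex)"
        using r by (auto simp: indicator_def space_M prod_zero_iff)
      then show "(\<Prod>i\<in>{1..r}. g i (\<phi> i) * indicator (B i (\<phi> i)) (act A (n i) x))
          = (\<Prod>i\<in>{1..r}. g i (\<phi> i)) * indicator (?S n \<phi>) x" by (simp add: prod.distrib)
    qed
    finally show ?thesis .
  qed
  have intprodh: "(\<integral>x. (\<Prod>i\<in>{1..r}. h i (act A (n i) x)) \<partial>M)
      = (\<Sum>\<phi>\<in>?P. (\<Prod>i\<in>{1..r}. g i (\<phi> i)) * of_real (measure M (?S n \<phi>)))" for n
  proof -
    have i: "integrable M (\<lambda>x. indicator (?S n \<phi>) x :: complex)" for \<phi>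
      using Ssets by (intro integrable_const_bound[of _ 1]) (auto simp: indicator_def)
    have "(\<integral>x. indicator (?S n \<phi>) x \<partial>M) = complex_of_real (measure M (?S n \<phi>))" for \<phi>
    proof -
      have "(\<integral>x. indicator (?S n \<phi>) x \<partial>M) = (\<integral>x. complex_of_real (indicator (?S n \<phi>) x) \<partial>M)"
        by (intro Bochner_Integration.integral_cong) (auto simp: indicator_def)
      also have "\<dots> = complex_of_real (measure M (?S n \<phi>))"
        using Ssets[of n \<phi>] by (simp add: sets.Int_space_eq2)
      finally show ?thesis .
    qed
    then show ?thesis unfolding prodh using i by (simp add: Bochner_Integration.integral_sum)
  qed
  have inth: "(\<integral>x. h i x \<partial>M) = (\<Sum>p\<in>range (\<pi> i). g i p * of_real (measure M (B i p)))" if "i \<in> {1..r}" for i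
  proof -
    have i: "integrable M (\<lambda>x. indicator (B i p) x :: complex)" for p
      using B[OF that] by (intro integrable_const_bound[of _ 1]) (auto simp: indicator_def)
    have "(\<integral>x. indicator (B i p) x \<partial>M) = complex_of_real (measure M (B i p))" for p
    proof -
      have "(\<integral>x. indicator (B i p) x \<partial>M) = (\<integral>x. complex_of_real (indicator (B i p) x) \<partial>M)"
        by (intro Bochner_Integration.integral_cong) (auto simp: indicator_def)
      also have "\<dots> = complex_of_real (measure M (B i p))"
        using B[OF that, of p] by (simp add: sets.Int_space_eq2)
      finally show ?thesis .
    qed
    then show ?thesis unfolding h_def using i by (simp add: Bochner_Integration.integral_sum)
  qed
  have "((\<lambda>n. \<integral>x. (\<Prod>i\<in>{1..r}. h i (act A (n i) x)) \<partial>M) \<longlongrightarrow>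
      (\<Sum>\<phi>\<in>?P. (\<Prod>i\<in>{1..r}. g i (\<phi> i)) * of_real (\<Prod>i\<in>{1..r}. measure M (B i (\<phi> i))))) ?F"
    unfolding intprodh
  proof (intro tendsto_intros)
    fix \<phi>
    show "((\<lambda>n. measure M (?S n \<phi>)) \<longlongrightarrow> (\<Prod>i\<in>{1..r}. measure M (B i (\<phi> i)))) ?F"
      using mix r B unfolding mixing_all_orders_def by auto
  qed
  also have "(\<Sum>\<phi>\<in>?P. (\<Prod>i\<in>{1..r}. g i (\<phi> i)) * of_real (\<Prod>i\<in>{1..r}. measure M (B i (\<phi> i))))
      = (\<Prod>i\<in>{1..r}. \<integral>x. h i x \<partial>M)"
  proof -
    have "(\<Prod>i\<in>{1..r}. \<integral>x. h i x \<partial>M) = (\<Prod>i\<in>{1..r}. \<Sum>p\<in>range (\<pi> i). g i p * of_real (measure M (B i p)))"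
      by (intro prod.cong refl inth)
    also have "\<dots> = (\<Sum>\<phi>\<in>?P. \<Prod>i\<in>{1..r}. g i (\<phi> i) * of_real (measure M (B i (\<phi> i))))"
      by (rule prod_sum_PiE) (use \<pi>(2) in auto)
    finally show ?thesis by (simp add: prod.distrib)
  qed
  finally have lim: "((\<lambda>n. \<integral>x. (\<Prod>i\<in>{1..r}. h i (act A (n i) x)) \<partial>M) \<longlongrightarrow> (\<Prod>i\<in>{1..r}. \<integral>x. h i x \<partial>M)) ?F" .
  have err1: "dist (?X n) (\<integral>x. (\<Prod>i\<in>{1..r}. h i (act A (n i) x)) \<partial>M) \<le> e / 4" for n
  proof -
    have pg: "integrable M (\<lambda>x. \<Prod>i\<in>{1..r}. g i (act A (n i) x))"
      by (intro integrable_continuous continuous_intros continuous_on_comp_UNIV[OF char_cts] act_cts g)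
    have ph: "integrable M (\<lambda>x. \<Prod>i\<in>{1..r}. h i (act A (n i) x))"
    proof (rule integrable_const_bound[of _ 1])
      show "(\<lambda>x. \<Prod>i\<in>{1..r}. h i (act A (n i) x)) \<in> borel_measurable M"
        by (intro borel_measurable_prod measurable_compose[OF act_measurable hm])
    qed (auto simp: prod_norm[symmetric] intro!: prod_le_1 hn)
    have "dist (?X n) (\<integral>x. (\<Prod>i\<in>{1..r}. h i (act A (n i) x)) \<partial>M)
      = norm (\<integral>x. (\<Prod>i\<in>{1..r}. g i (act A (n i) x)) - (\<Prod>i\<in>{1..r}. h i (act A (n i) x)) \<partial>M)"
      by (simp only: dist_norm Bochner_Integration.integral_diff[OF pg ph])
    also have "\<dots> \<le> (\<integral>x. e / 4 \<partial>M)"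
    proof (rule norm_integral_le_integral)
      fix x
      have "norm ((\<Prod>i\<in>{1..r}. g i (act A (n i) x)) - (\<Prod>i\<in>{1..r}. h i (act A (n i) x)))
        \<le> (\<Sum>i\<in>{1..r}. norm (g i (act A (n i) x) - h i (act A (n i) x)))"
        by (rule norm_prod_diff) (auto intro: gn hn)
      also have "\<dots> \<le> (\<Sum>i\<in>{1..r}. d)"
        using \<pi>(3) by (intro sum_mono) (auto simp: h dist_norm intro: less_imp_le)
      finally show "norm ((\<Prod>i\<in>{1..r}. g i (act A (n i) x)) - (\<Prod>i\<in>{1..r}. h i (act A (n i) x))) \<le> e / 4"
        using d by simp
    qed (use pg ph in auto)
    finally show ?thesis by (simp add: prob_space)
  qed
  have err2: "dist ?L (\<Prod>i\<in>{1..r}. \<integral>x. h i x \<partial>M) \<le> e / 4"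
  proof -
    have "norm (?L - (\<Prod>i\<in>{1..r}. \<integral>x. h i x \<partial>M)) \<le> (\<Sum>i\<in>{1..r}. norm ((\<integral>x. g i x \<partial>M) - (\<integral>x. h i x \<partial>M)))"
    proof (rule norm_prod_diff)
      fix i assume i: "i \<in> {1..r}"
      have "norm (\<integral>x. g i x \<partial>M) \<le> (\<integral>x. 1 \<partial>M)" "norm (\<integral>x. h i x \<partial>M) \<le> (\<integral>x. 1 \<partial>M)"
        using i by (intro norm_integral_le_integral; auto intro: gi hi gn hn)+
      then show "norm (\<integral>x. g i x \<partial>M) \<le> 1" "norm (\<integral>x. h i x \<partial>M) \<le> 1" by (simp_all add: prob_space)
    qed
    also have "\<dots> \<le> (\<Sum>i\<in>{1..r}. d)"
    proof (rule sum_mono)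
      fix i assume i: "i \<in> {1..r}"
      have "norm ((\<integral>x. g i x \<partial>M) - (\<integral>x. h i x \<partial>M)) = norm (\<integral>x. g i x - h i x \<partial>M)"
        by (simp add: gi[OF i] hi[OF i])
      also have "\<dots> \<le> (\<integral>x. d \<partial>M)"
      proof (rule norm_integral_le_integral)
        show "integrable M (\<lambda>x. g i x - h i x)" by (intro Bochner_Integration.integrable_diff gi hi i)
        show "norm (g i x - h i x) \<le> d" for x
          using \<pi>(3)[OF i, of x] by (simp add: h[OF i] dist_norm)
      qed simp
      finally show "norm ((\<integral>x. g i x \<partial>M) - (\<integral>x. h i x \<partial>M)) \<le> d" by (simp add: prob_space)
    qed
    finally show ?thesis using d by (simp add: dist_norm)
  qed
  have "\<forall>\<^sub>F n in ?F. dist (\<integral>x. (\<Prod>i\<in>{1..r}. h i (act A (n i) x)) \<partial>M) (\<Prod>i\<in>{1..r}. \<integral>x. h i x \<partial>M) < e / 4"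
    by (rule tendstoD[OF lim]) (use e in simp)
  then show "\<forall>\<^sub>F n in ?F. dist (?X n) ?L < e"
  proof eventually_elim
    case (elim n)
    let ?Y = "\<integral>x. (\<Prod>i\<in>{1..r}. h i (act A (n i) x)) \<partial>M" and ?L' = "\<Prod>i\<in>{1..r}. \<integral>x. h i x \<partial>M"
    have "dist (?X n) ?L \<le> dist (?X n) ?Y + (dist ?Y ?L' + dist ?L' ?L)"
      using dist_triangle[of "?X n" ?L ?Y] dist_triangle[of ?Y ?L ?L'] by linarith
    then show ?case using err1[of n] err2 elim e by (simp add: dist_commute)
  qed
qed

text \<open>Vanishing of the sum of the translates \<open>g i \<circ> act A (l i)\<close> in the dual group, which is
  written multiplicatively here.\<close>

definition balanced :: "'i set \<Rightarrow> ('i \<Rightarrow> int ^ 'd) \<Rightarrow> ('i \<Rightarrow> 'a \<Rightarrow> complex) \<Rightarrow> bool" where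
  "balanced I l g \<longleftrightarrow> (\<forall>x. (\<Prod>i\<in>I. g i (act A (l i) x)) = 1)"

lemma balanced_cong:
  "(\<And>i. i \<in> I \<Longrightarrow> l i = l' i) \<Longrightarrow> (\<And>i. i \<in> I \<Longrightarrow> g i = g' i) \<Longrightarrow> balanced I l g = balanced I l' g'"
  by (simp add: balanced_def)

lemma balanced_reindex:
  "bij_betw h J I \<Longrightarrow> balanced J (\<lambda>i. l (h i)) (\<lambda>i. g (h i)) = balanced I l g"
  unfolding balanced_def by (subst prod.reindex_bij_betw[of h J I, symmetric]) auto

lemma balanced_singleton: "balanced {i} l g \<longleftrightarrow> g i = (\<lambda>x. 1)"
  using act_surj[of "l i"] by (auto simp: balanced_def fun_eq_iff) metis

lemma balanced_diff:
  assumes "finite I" "S \<subseteq> I" "balanced S l g"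
  shows "balanced (I - S) l g = balanced I l g"
proof -
  have "(\<Prod>i\<in>I. g i (act A (l i) x)) = (\<Prod>i\<in>I - S. g i (act A (l i) x))" for x
    using prod.subset_diff[OF assms(2,1), of "\<lambda>i. g i (act A (l i) x)"] assms(3) by (simp add: balanced_def)
  then show ?thesis by (simp add: balanced_def)
qed

lemma integral_prod_char:
  assumes "finite I" "\<And>i. i \<in> I \<Longrightarrow> g i \<in> dual_group"
  shows "(\<integral>x. (\<Prod>i\<in>I. g i (act A (l i) x)) \<partial>M) = (if balanced I l g then 1 else 0)"
proof -
  have "(\<lambda>x. \<Prod>i\<in>I. g i (act A (l i) x)) \<in> dual_group"
    using assms by (intro dual_prod dual_act) auto
  from integral_char[OF this] show ?thesis by (simp add: balanced_def fun_eq_iff)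
qed

text \<open>For widely spread \<open>l\<close> the integral of the product of the translates is
  close to the product of the integrals, which is 0 because of the factor \<open>g i0\<close>. For a
  balanced family this integral is 1, so its minimal gap is bounded.\<close>

lemma balanced_gap_aux:
  fixes r :: nat
  assumes r: "2 \<le> r" and g: "\<And>i. i \<in> {1..r} \<Longrightarrow> g i \<in> dual_group"
    and nt: "i0 \<in> {1..r}" "g i0 \<noteq> (\<lambda>x. 1)"
  shows "\<exists>D. \<forall>l. balanced {1..r} l g \<longrightarrow>
    (\<exists>i\<in>{1..r}. \<exists>j\<in>{1..r}. i \<noteq> j \<and> norm (real_vec (l i) - real_vec (l j)) < D)"
proof -
  have "(\<integral>x. g i0 x \<partial>M) = 0" using integral_char[OF g[OF nt(1)]] nt(2) by simp
  then have zero: "(\<Prod>i\<in>{1..r}. \<integral>x. g i x \<partial>M) = 0"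
    using nt(1) by (intro prod_zero) auto
  have "((\<lambda>l. \<integral>x. (\<Prod>i\<in>{1..r}. g i (act A (l i) x)) \<partial>M) \<longlongrightarrow> 0) (filtercomap (min_gap r) at_top)"
    using tendsto_integral_prod_char[where g = g, OF r g] by (simp only: zero)
  then have "\<forall>\<^sub>F l in filtercomap (min_gap r) at_top. dist (\<integral>x. (\<Prod>i\<in>{1..r}. g i (act A (l i) x)) \<partial>M) 0 < 1"
    by (rule tendstoD) simp
  then have "\<forall>\<^sub>F l in filtercomap (min_gap r) at_top. \<not> balanced {1..r} l g"
  proof (rule eventually_mono)
    fix l assume "dist (\<integral>x. (\<Prod>i\<in>{1..r}. g i (act A (l i) x)) \<partial>M) 0 < 1"
    moreover have "(\<integral>x. (\<Prod>i\<in>{1..r}. g i (act A (l i) x)) \<partial>M) = (if balanced {1..r} l g then 1 else 0)"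
      by (rule integral_prod_char) (use g in auto)
    ultimately show "\<not> balanced {1..r} l g" by (metis dist_0_norm dist_commute less_irrefl norm_one)
  qed
  then obtain D where D: "\<And>l. D \<le> min_gap r l \<Longrightarrow> \<not> balanced {1..r} l g"
    unfolding eventually_filtercomap eventually_at_top_linorder by metis
  show ?thesis
  proof (intro exI[of _ D] allI impI)
    fix l assume "balanced {1..r} l g"
    then have "min_gap r l < D" using D by (meson not_le)
    moreover let ?S = "{norm (real_vec (l i) - real_vec (l j)) |i j. i \<in> {1..r} \<and> j \<in> {1..r} \<and> i \<noteq> j}"
    have "?S \<subseteq> (\<lambda>(i, j). norm (real_vec (l i) - real_vec (l j))) ` ({1..r} \<times> {1..r})" by auto
    then have "finite ?S" by (rule finite_subset) auto
    moreover have "norm (real_vec (l 1) - real_vec (l 2)) \<in> ?S"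
      using r by (intro CollectI exI[of _ 1] exI[of _ 2]) auto
    then have "?S \<noteq> {}" by blast
    ultimately have "min_gap r l \<in> ?S" unfolding min_gap_def by (intro Min_in)
    then obtain i j where "min_gap r l = norm (real_vec (l i) - real_vec (l j))"
      "i \<in> {1..r}" "j \<in> {1..r}" "i \<noteq> j" by blast
    then show "\<exists>i\<in>{1..r}. \<exists>j\<in>{1..r}. i \<noteq> j \<and> norm (real_vec (l i) - real_vec (l j)) < D"
      using \<open>min_gap r l < D\<close> by metis
  qed
qed

text \<open>After reindexing by \<open>{1..r}\<close> only finitely many families over \<Lambda>
  occur, so that the sum of their bounds serves all of them.\<close>

lemma balanced_gap:
  assumes \<Lambda>: "finite \<Lambda>" "\<Lambda> \<subseteq> dual_group" and r: "2 \<le> r"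
  shows "\<exists>D\<ge>0. \<forall>(I::'i set) l g i0. card I = r \<longrightarrow> i0 \<in> I \<longrightarrow> g i0 \<noteq> (\<lambda>x. 1) \<longrightarrow> g \<in> I \<rightarrow> \<Lambda> \<longrightarrow>
    balanced I l g \<longrightarrow> (\<exists>i\<in>I. \<exists>j\<in>I. i \<noteq> j \<and> norm (real_vec (l i) - real_vec (l j)) < D)"
proof -
  let ?G = "{g \<in> PiE {1..r} (\<lambda>_. \<Lambda>). \<exists>i0\<in>{1..r}. g i0 \<noteq> (\<lambda>x. 1)}"
  have fin: "finite ?G" using \<Lambda>(1) by (intro finite_subset[OF _ finite_PiE[of "{1..r}" "\<lambda>_. \<Lambda>"]]) auto
  let ?Q = "\<lambda>g D. \<forall>l. balanced {1..r} l g \<longrightarrow>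
    (\<exists>i\<in>{1..r}. \<exists>j\<in>{1..r}. i \<noteq> j \<and> norm (real_vec (l i) - real_vec (l j)) < D)"
  have ex: "\<exists>D. ?Q g D" if gG: "g \<in> ?G" for g
  proof -
    obtain i0 where "i0 \<in> {1..r}" "g i0 \<noteq> (\<lambda>x. 1)" using gG by blast
    then show ?thesis using gG \<Lambda>(2) by (intro balanced_gap_aux[OF r]) auto
  qed
  define D where "D g = (SOME d. ?Q g d)" for g
  have D: "?Q g (D g)" if "g \<in> ?G" for g unfolding D_def by (rule someI_ex) (rule ex[OF that])
  define D' where "D' = (\<Sum>g\<in>?G. \<bar>D g\<bar>)"
  have D': "D g \<le> D'" if "g \<in> ?G" for g
    using member_le_sum[of g ?G "\<lambda>g. \<bar>D g\<bar>"] fin that unfolding D'_def by fastforce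
  show ?thesis
  proof (intro exI[of _ D'] conjI allI impI)
    show "0 \<le> D'" by (simp add: D'_def sum_nonneg)
    fix I :: "'i set" and l g i0
    assume I: "card I = r" "i0 \<in> I" "g i0 \<noteq> (\<lambda>x. 1)" "g \<in> I \<rightarrow> \<Lambda>" "balanced I l g"
    have "finite I" using I(1) r card.infinite by fastforce
    then obtain h where h: "bij_betw h {1..r} I"
      using I(1) by (metis card_atLeastAtMost diff_Suc_1 finite_atLeastAtMost finite_same_card_bij)
    obtain k where k: "k \<in> {1..r}" "h k = i0" using h I(2) unfolding bij_betw_def by blast
    define g' where "g' = restrict (\<lambda>i. g (h i)) {1..r}"
    have "g' \<in> ?G" using h I(3,4) k bij_betwE[OF h] unfolding g'_def by auto
    moreover have "balanced {1..r} (\<lambda>i. l (h i)) g'"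
      using I(5) balanced_reindex[OF h, of l g] balanced_cong[of "{1..r}" "\<lambda>i. l (h i)" "\<lambda>i. l (h i)" g' "\<lambda>i. g (h i)"]
      by (simp add: g'_def)
    ultimately obtain i j where ij: "i \<in> {1..r}" "j \<in> {1..r}" "i \<noteq> j"
      "norm (real_vec (l (h i)) - real_vec (l (h j))) < D g'" using D[of g'] by blast
    have "h i \<in> I" "h j \<in> I" using ij(1,2) bij_betwE[OF h] by blast+
    moreover have "h i \<noteq> h j" using inj_on_eq_iff[OF bij_betw_imp_inj_on[OF h] ij(1,2)] ij(3) by simp
    moreover have "norm (real_vec (l (h i)) - real_vec (l (h j))) < D'"
      using ij(4) D'[OF \<open>g' \<in> ?G\<close>] by linarith
    ultimately show "\<exists>i\<in>I. \<exists>j\<in>I. i \<noteq> j \<and> norm (real_vec (l i) - real_vec (l j)) < D'"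
      by blast
  qed
qed

text \<open>By mixing, two members of a balanced family are close to each other; they are merged into
  one, which is an induction on the size of the family.\<close>

lemma balanced_cluster:
  assumes "finite \<Lambda>" "\<Lambda> \<subseteq> dual_group"
  shows "\<exists>D\<ge>0. \<forall>(I::'i set) l g i0. finite I \<longrightarrow> card I = q \<longrightarrow> i0 \<in> I \<longrightarrow> g \<in> I \<rightarrow> \<Lambda> \<longrightarrow> balanced I l g \<longrightarrow>
    (\<exists>S\<subseteq>I. i0 \<in> S \<and> balanced S l g \<and> (\<forall>i\<in>S. norm (real_vec (l i) - real_vec (l i0)) \<le> D))"
  using assms
proof (induction q arbitrary: \<Lambda>)
  case 0
  then show ?case by (intro exI[of _ 0]) auto
next
  case (Suc q)
  show ?case
  proof (cases "q = 0")
    case True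
    have "\<exists>S\<subseteq>I. i0 \<in> S \<and> balanced S l g \<and> (\<forall>i\<in>S. norm (real_vec (l i) - real_vec (l i0)) \<le> 0)"
      if "card I = Suc q" "i0 \<in> I" "balanced I l g" for I :: "'i set" and l g i0
    proof -
      obtain k where "I = {k}" using \<open>card I = Suc q\<close> True card_1_singletonE by auto
      then show ?thesis using that by (intro exI[of _ I]) auto
    qed
    then show ?thesis by (intro exI[of _ 0]) auto
  next
    case False
    then have r: "2 \<le> Suc q" by simp
    obtain D1 where D1: "D1 \<ge> 0" "\<And>(I::'i set) l g i0. card I = Suc q \<Longrightarrow> i0 \<in> I \<Longrightarrow> g i0 \<noteq> (\<lambda>x. 1) \<Longrightarrow>
      g \<in> I \<rightarrow> \<Lambda> \<Longrightarrow> balanced I l g \<Longrightarrow> \<exists>i\<in>I. \<exists>j\<in>I. i \<noteq> j \<and> norm (real_vec (l i) - real_vec (l j)) < D1"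
      using balanced_gap[OF Suc.prems r, where 'i = 'i] by blast
    \<comment> \<open>All characters that merging two members at distance at most \<open>D1\<close>
      can produce. The set is finite since balls contain finitely many lattice points; the induction
      is over arbitrary \<Lambda> so that the hypothesis covers it.\<close>
    define \<Lambda>' where "\<Lambda>' = \<Lambda> \<union> (\<lambda>(\<gamma>, \<gamma>', m) x. \<gamma> x * \<gamma>' (act A m x)) ` (\<Lambda> \<times> \<Lambda> \<times> {m. norm (real_vec m) \<le> D1})"
    have "finite \<Lambda>'" unfolding \<Lambda>'_def using Suc.prems(1) finite_int_vec_ball by auto
    moreover have "\<Lambda>' \<subseteq> dual_group"
      unfolding \<Lambda>'_def using Suc.prems(2) by (auto intro!: dual_mult dual_act)
    ultimately obtain D2 where D2: "D2 \<ge> 0" "\<And>(I::'i set) l g i0. finite I \<Longrightarrow> card I = q \<Longrightarrow> i0 \<in> I \<Longrightarrow>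
      g \<in> I \<rightarrow> \<Lambda>' \<Longrightarrow> balanced I l g \<Longrightarrow>
      \<exists>S\<subseteq>I. i0 \<in> S \<and> balanced S l g \<and> (\<forall>i\<in>S. norm (real_vec (l i) - real_vec (l i0)) \<le> D2)"
      using Suc.IH[of \<Lambda>'] by blast
    show ?thesis
    proof (intro exI[of _ "D1 + D2"] conjI allI impI)
      show "0 \<le> D1 + D2" using D1 D2 by simp
      fix I :: "'i set" and l g i0
      assume I: "finite I" "card I = Suc q" "i0 \<in> I" "g \<in> I \<rightarrow> \<Lambda>" "balanced I l g"
      \<comment> \<open>The constant character cannot be excluded here, because merging may create
        it; \<open>{i0}\<close> is then a cluster by itself.\<close>
      show "\<exists>S\<subseteq>I. i0 \<in> S \<and> balanced S l g \<and> (\<forall>i\<in>S. norm (real_vec (l i) - real_vec (l i0)) \<le> D1 + D2)"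
      proof (cases "g i0 = (\<lambda>x. 1)")
        case True
        then show ?thesis using I(3) D1(1) D2(1) by (intro exI[of _ "{i0}"]) (auto simp: balanced_singleton)
      next
        case False
        \<comment> \<open>The member \<open>j\<close> that is merged away must differ from
          \<open>i0\<close>, around which the cluster is sought; exchanging the two close members
          achieves this.\<close>
        obtain i j where ij: "i \<in> I" "j \<in> I" "i \<noteq> j" "j \<noteq> i0" "norm (real_vec (l i) - real_vec (l j)) < D1"
        proof -
          obtain i j where "i \<in> I" "j \<in> I" "i \<noteq> j" "norm (real_vec (l i) - real_vec (l j)) < D1"
            using D1(2)[OF I(2,3) False I(4,5)] by blast
          then show ?thesis using that[of i j] that[of j i] by (cases "j = i0") (auto simp: norm_minus_commute)
        qed
        define g' where "g' = g(i := \<lambda>x. g i x * g j (act A (l j - l i) x))"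
        have g'i: "g' i (act A (l i) x) = g i (act A (l i) x) * g j (act A (l j) x)" for x
          by (simp add: g'_def act_add')
        have fT: "finite (T - {i})" "i \<notin> T - {i}" if "T \<subseteq> I" for T using I(1) that finite_subset by auto
        have split: "(\<Prod>k\<in>T. g' k (act A (l k) x)) = (\<Prod>k\<in>insert j T. g k (act A (l k) x))"
          if T: "T \<subseteq> I - {j}" "i \<in> T" for T x
        proof -
          have fin: "finite T" using T I(1) finite_subset by blast
          have "(\<Prod>k\<in>T. g' k (act A (l k) x)) = g' i (act A (l i) x) * (\<Prod>k\<in>T - {i}. g' k (act A (l k) x))"
            by (rule prod.remove[OF fin T(2)])
          also have "(\<Prod>k\<in>T - {i}. g' k (act A (l k) x)) = (\<Prod>k\<in>T - {i}. g k (act A (l k) x))"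
            by (intro prod.cong) (auto simp: g'_def)
          also have "g' i (act A (l i) x) * \<dots> = g j (act A (l j) x) * (\<Prod>k\<in>T. g k (act A (l k) x))"
            by (simp add: g'i prod.remove[OF fin T(2), of "\<lambda>k. g k (act A (l k) x)"])
          also have "\<dots> = (\<Prod>k\<in>insert j T. g k (act A (l k) x))"
            using fin T(1) by (subst prod.insert) auto
          finally show ?thesis .
        qed
        have "g' \<in> I - {j} \<rightarrow> \<Lambda>'"
        proof
          fix k assume k: "k \<in> I - {j}"
          show "g' k \<in> \<Lambda>'"
          proof (cases "k = i")
            case True
            have "norm (real_vec (l j - l i)) \<le> D1" using ij(5) by (simp add: real_vec_diff norm_minus_commute)
            then show ?thesis using I(4) ij(1,2) True unfolding g'_def \<Lambda>'_def
              by (auto intro!: image_eqI[of _ _ "(g i, g j, l j - l i)"])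
          next
            case False
            then show ?thesis using I(4) k by (auto simp: g'_def \<Lambda>'_def)
          qed
        qed
        moreover have "balanced (I - {j}) l g'"
          using I(5) split[of "I - {j}"] ij by (simp add: balanced_def insert_absorb)
        ultimately obtain S where S: "S \<subseteq> I - {j}" "i0 \<in> S" "balanced S l g'"
          "\<And>k. k \<in> S \<Longrightarrow> norm (real_vec (l k) - real_vec (l i0)) \<le> D2"
          using D2(2)[of "I - {j}" i0 g' l] I ij by auto
        show ?thesis
        \<comment> \<open>If the cluster of the merged family contains \<open>i\<close>, undoing the
          merge adds \<open>j\<close>, at distance less than \<open>D1\<close> from
          \<open>i\<close>. Otherwise \<open>g'\<close> and \<open>g\<close> agree on the
          cluster.\<close>
        proof (cases "i \<in> S")
          case True
          have "balanced (insert j S) l g" using S(3) split[OF S(1) True] by (simp add: balanced_def)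
          moreover have "norm (real_vec (l j) - real_vec (l i0)) \<le> D1 + D2"
            using norm_triangle_ineq[of "real_vec (l j) - real_vec (l i)" "real_vec (l i) - real_vec (l i0)"]
              S(4)[OF True] ij(5) by (simp add: norm_minus_commute)
          moreover have "norm (real_vec (l k) - real_vec (l i0)) \<le> D1 + D2" if "k \<in> S" for k
            using S(4)[OF that] D1(1) by simp
          ultimately show ?thesis using S(1,2) ij(2) by (intro exI[of _ "insert j S"]) auto
        next
          case False
          have "balanced S l g = balanced S l g'"
            by (rule balanced_cong) (use False in \<open>auto simp: g'_def\<close>)
          then have "balanced S l g" using S(3) by simp
          moreover have "norm (real_vec (l k) - real_vec (l i0)) \<le> D1 + D2" if "k \<in> S" for k
            using S(4)[OF that] D1(1) by simp
          ultimately show ?thesis using S(1,2) by (intro exI[of _ S]) auto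
        qed
      qed
    qed
  qed
qed

text \<open>If a nontrivial \<gamma> were fixed by \<open>act A m\<close> with
  \<open>m \<noteq> 0\<close>, then \<gamma> placed at any multiple of \<open>m\<close> would
  balance its conjugate placed at 0, and these pairs are arbitrarily far apart, against
  \<open>balanced_gap\<close>.\<close>

lemma act_orbit_free:
  assumes \<gamma>: "\<gamma> \<in> dual_group" "\<gamma> \<noteq> (\<lambda>x. 1)" and eq: "\<And>x. \<gamma> (act A l x) = \<gamma> (act A l' x)"
  shows "l = l'"
proof (rule ccontr)
  assume "l \<noteq> l'"
  define m where "m = l - l'"
  have inv: "\<gamma> (act A m x) = \<gamma> x" for x
  proof -
    obtain y where "x = act A l' y" using act_surj by metis
    then show ?thesis using eq[of y] by (simp add: act_add' m_def)
  qed
  have pw: "\<gamma> (act A (int k *s m) x) = \<gamma> x" for k x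
  proof (induction k)
    case 0 then show ?case by (simp add: act_0)
  next
    case (Suc k)
    have "int (Suc k) *s m = m + int k *s m" by (simp add: vec_eq_iff algebra_simps)
    then show ?case using Suc inv by (simp flip: act_add')
  qed
  let ?\<Lambda> = "{\<gamma>, \<lambda>x. cnj (\<gamma> x)}"
  have "finite ?\<Lambda>" "?\<Lambda> \<subseteq> dual_group" using \<gamma>(1) dual_cnj[OF \<gamma>(1)] by auto
  from balanced_gap[OF this order_refl, where 'i = nat]
  obtain D where D: "\<And>(I::nat set) l g i0. card I = 2 \<Longrightarrow> i0 \<in> I \<Longrightarrow> g i0 \<noteq> (\<lambda>x. 1) \<Longrightarrow> g \<in> I \<rightarrow> ?\<Lambda> \<Longrightarrow>
    balanced I l g \<Longrightarrow> (\<exists>i\<in>I. \<exists>j\<in>I. i \<noteq> j \<and> norm (real_vec (l i) - real_vec (l j)) < D)"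
    by blast
  obtain i where i: "m $ i \<noteq> 0" using \<open>l \<noteq> l'\<close> by (auto simp: m_def vec_eq_iff)
  obtain k :: nat where k: "D < real k" using reals_Archimedean2 by blast
  let ?l = "\<lambda>j::nat. if j = 0 then int k *s m else 0" and ?g = "\<lambda>j::nat. if j = 0 then \<gamma> else (\<lambda>x. cnj (\<gamma> x))"
  have "\<gamma> x * cnj (\<gamma> x) = 1" for x
    using char_norm[OF \<gamma>(1), of x] by (metis complex_norm_square of_real_1 one_power2)
  then have "balanced {0, 1} ?l ?g" by (simp add: balanced_def pw act_0)
  then have "\<exists>i\<in>{0, 1::nat}. \<exists>j\<in>{0, 1}. i \<noteq> j \<and> norm (real_vec (?l i) - real_vec (?l j)) < D"
    by (intro D[of "{0, 1}" 0 ?g]) (use \<gamma>(2) in auto)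
  then have "norm (real_vec (int k *s m)) < D" by (auto simp: real_vec_0)
  moreover have "real k \<le> norm (real_vec (int k *s m))"
  proof -
    have "real k * 1 \<le> real k * \<bar>real_of_int (m $ i)\<bar>" using i by (intro mult_left_mono) auto
    also have "\<dots> = \<bar>real_vec (int k *s m) $ i\<bar>" by (simp add: real_vec_def abs_mult)
    also have "\<dots> \<le> norm (real_vec (int k *s m))" by (rule component_le_norm_cart)
    finally show ?thesis by simp
  qed
  ultimately show False using k by simp
qed

end

section \<open>Recursion for balanced sums\<close>

lemma sum_PiE_split:
  fixes F G :: "('i \<Rightarrow> 'j) \<Rightarrow> 'b::comm_semiring_0"
  assumes I: "finite I" "S \<subseteq> I"
    and F: "\<And>\<tau> \<tau>'. (\<And>i. i \<in> S \<Longrightarrow> \<tau> i = \<tau>' i) \<Longrightarrow> F \<tau> = F \<tau>'"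
    and G: "\<And>\<tau> \<tau>'. (\<And>i. i \<in> I - S \<Longrightarrow> \<tau> i = \<tau>' i) \<Longrightarrow> G \<tau> = G \<tau>'"
  shows "(\<Sum>\<tau>\<in>PiE I (\<lambda>_. J). F \<tau> * G \<tau>) = (\<Sum>\<tau>\<in>PiE S (\<lambda>_. J). F \<tau>) * (\<Sum>\<tau>\<in>PiE (I - S) (\<lambda>_. J). G \<tau>)"
proof -
  have "(\<Sum>\<tau>\<in>PiE I (\<lambda>_. J). F \<tau> * G \<tau>)
      = (\<Sum>(\<sigma>, \<rho>)\<in>PiE S (\<lambda>_. J) \<times> PiE (I - S) (\<lambda>_. J). F \<sigma> * G \<rho>)"
  proof (rule sum.reindex_bij_witness[where j = "\<lambda>\<tau>. (restrict \<tau> S, restrict \<tau> (I - S))"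
        and i = "\<lambda>(\<sigma>, \<rho>) k. if k \<in> S then \<sigma> k else \<rho> k"])
    fix \<tau> assume \<tau>: "\<tau> \<in> PiE I (\<lambda>_. J)"
    show "(case (restrict \<tau> S, restrict \<tau> (I - S)) of (\<sigma>, \<rho>) \<Rightarrow> \<lambda>k. if k \<in> S then \<sigma> k else \<rho> k) = \<tau>"
      using \<tau> I(2) by (auto simp: fun_eq_iff PiE_def extensional_def)
    show "(restrict \<tau> S, restrict \<tau> (I - S)) \<in> PiE S (\<lambda>_. J) \<times> PiE (I - S) (\<lambda>_. J)"
      using \<tau> I(2) by auto
    show "(case (restrict \<tau> S, restrict \<tau> (I - S)) of (\<sigma>, \<rho>) \<Rightarrow> F \<sigma> * G \<rho>) = F \<tau> * G \<tau>"
      using F[of "restrict \<tau> S" \<tau>] G[of "restrict \<tau> (I - S)" \<tau>] by simp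
  next
    fix b assume b: "b \<in> PiE S (\<lambda>_. J) \<times> PiE (I - S) (\<lambda>_. J)"
    then obtain \<sigma> \<rho> where [simp]: "b = (\<sigma>, \<rho>)" and s: "\<sigma> \<in> PiE S (\<lambda>_. J)" "\<rho> \<in> PiE (I - S) (\<lambda>_. J)" by auto
    show "(restrict (case b of (\<sigma>, \<rho>) \<Rightarrow> \<lambda>k. if k \<in> S then \<sigma> k else \<rho> k) S,
        restrict (case b of (\<sigma>, \<rho>) \<Rightarrow> \<lambda>k. if k \<in> S then \<sigma> k else \<rho> k) (I - S)) = b"
      using s by (auto simp: fun_eq_iff PiE_def extensional_def)
    show "(case b of (\<sigma>, \<rho>) \<Rightarrow> \<lambda>k. if k \<in> S then \<sigma> k else \<rho> k) \<in> PiE I (\<lambda>_. J)"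
      using s I(2) by (auto simp: PiE_def extensional_def Pi_def)
  qed
  also have "\<dots> = (\<Sum>\<tau>\<in>PiE S (\<lambda>_. J). F \<tau>) * (\<Sum>\<tau>\<in>PiE (I - S) (\<lambda>_. J). G \<tau>)"
    by (simp add: sum_product sum.cartesian_product)
  finally show ?thesis .
qed

text \<open>The pair \<open>(l, \<gamma>)\<close> stands for the character \<open>\<gamma> \<circ> act A l\<close>.\<close>

type_synonym ('a, 'd) orbit_char = "(int ^ 'd) \<times> ('a \<Rightarrow> complex)"

context mixing_action
begin

definition bal :: "'i set \<Rightarrow> ('i \<Rightarrow> ('a, 'd) orbit_char) \<Rightarrow> bool" where
  "bal I \<tau> = balanced I (\<lambda>i. fst (\<tau> i)) (\<lambda>i. snd (\<tau> i))"

text \<open>The moment of order \<open>card I\<close> of \<open>trig_poly J w\<close>. The index set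
  itself is kept, so that subfamilies can be split off without renumbering.\<close>

definition bal_sum :: "('a, 'd) orbit_char set \<Rightarrow> (('a, 'd) orbit_char \<Rightarrow> 'b) \<Rightarrow> 'i set \<Rightarrow> 'b::real_normed_field" where
  "bal_sum J w I = (\<Sum>\<tau>\<in>PiE I (\<lambda>_. J). (\<Prod>i\<in>I. w (\<tau> i)) * of_bool (bal I \<tau>))"

definition near :: "real \<Rightarrow> 'i \<Rightarrow> 'i set \<Rightarrow> ('i \<Rightarrow> ('a, 'd) orbit_char) \<Rightarrow> bool" where
  "near D i0 S \<tau> \<longleftrightarrow> (\<forall>i\<in>S. norm (real_vec (fst (\<tau> i)) - real_vec (fst (\<tau> i0))) \<le> D)"

text \<open>Measures the contribution of clusters around \<open>i0\<close>; balance is dropped, as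
  closeness alone makes large clusters negligible.\<close>

definition near_sum :: "real \<Rightarrow> 'i \<Rightarrow> ('a, 'd) orbit_char set \<Rightarrow> (('a, 'd) orbit_char \<Rightarrow> real) \<Rightarrow> 'i set \<Rightarrow> real" where
  "near_sum D i0 J w S = (\<Sum>\<tau>\<in>PiE S (\<lambda>_. J). (\<Prod>i\<in>S. w (\<tau> i)) * of_bool (near D i0 S \<tau>))"

definition trig_poly :: "('a, 'd) orbit_char set \<Rightarrow> (('a, 'd) orbit_char \<Rightarrow> complex) \<Rightarrow> 'a \<Rightarrow> complex" where
  "trig_poly J w x = (\<Sum>j\<in>J. w j * snd j (act A (fst j) x))"

lemma bal_cong: "(\<And>i. i \<in> S \<Longrightarrow> \<tau> i = \<tau>' i) \<Longrightarrow> bal S \<tau> = bal S \<tau>'"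
  unfolding bal_def by (rule balanced_cong) auto

lemma bal_diff: "finite I \<Longrightarrow> S \<subseteq> I \<Longrightarrow> bal S \<tau> \<Longrightarrow> bal (I - S) \<tau> = bal I \<tau>"
  unfolding bal_def by (rule balanced_diff)

lemma trig_poly_cts:
  assumes "J \<subseteq> UNIV \<times> dual_group"
  shows "cts (trig_poly J w)"
  unfolding trig_poly_def[abs_def]
proof (intro continuous_intros)
  fix j assume "j \<in> J"
  then show "cts (\<lambda>x. snd j (act A (fst j) x))"
    using assms by (intro continuous_on_comp_UNIV[OF char_cts act_cts]) auto
qed

lemma integral_trig_poly_power:
  assumes J: "finite J" "J \<subseteq> UNIV \<times> dual_group" and I: "finite I"
  shows "(\<integral>x. trig_poly J w x ^ card I \<partial>M) = bal_sum J w I"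
proof -
  have fin: "finite (PiE I (\<lambda>_. J))" using J I by (intro finite_PiE)
  have dg: "snd (\<tau> i) \<in> dual_group" if "\<tau> \<in> PiE I (\<lambda>_. J)" "i \<in> I" for \<tau> i
  proof -
    have "\<tau> i \<in> J" using that by auto
    then show ?thesis using J(2) by (auto simp: mem_Times_iff)
  qed
  have "trig_poly J w x ^ card I = (\<Sum>\<tau>\<in>PiE I (\<lambda>_. J). (\<Prod>i\<in>I. w (\<tau> i)) * (\<Prod>i\<in>I. snd (\<tau> i) (act A (fst (\<tau> i)) x)))" for x
  proof -
    have "trig_poly J w x ^ card I = (\<Prod>i\<in>I. \<Sum>j\<in>J. w j * snd j (act A (fst j) x))"
      by (simp add: trig_poly_def)
    also have "\<dots> = (\<Sum>\<tau>\<in>PiE I (\<lambda>_. J). \<Prod>i\<in>I. w (\<tau> i) * snd (\<tau> i) (act A (fst (\<tau> i)) x))"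
      by (rule prod_sum_PiE) (use J I in auto)
    finally show ?thesis by (simp add: prod.distrib)
  qed
  moreover have "integrable M (\<lambda>x. (\<Prod>i\<in>I. snd (\<tau> i) (act A (fst (\<tau> i)) x)))" if "\<tau> \<in> PiE I (\<lambda>_. J)" for \<tau>
  proof (intro integrable_continuous continuous_on_prod)
    fix i assume "i \<in> I"
    show "cts (\<lambda>x. snd (\<tau> i) (act A (fst (\<tau> i)) x))"
      by (rule continuous_on_comp_UNIV[OF char_cts act_cts]) (rule dg[OF that \<open>i \<in> I\<close>])
  qed
  ultimately have "(\<integral>x. trig_poly J w x ^ card I \<partial>M)
      = (\<Sum>\<tau>\<in>PiE I (\<lambda>_. J). (\<Prod>i\<in>I. w (\<tau> i)) * (\<integral>x. (\<Prod>i\<in>I. snd (\<tau> i) (act A (fst (\<tau> i)) x)) \<partial>M))"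
    by (simp add: Bochner_Integration.integral_sum)
  also have "\<dots> = bal_sum J w I"
    unfolding bal_sum_def
  proof (intro sum.cong refl)
    fix \<tau> assume \<tau>: "\<tau> \<in> PiE I (\<lambda>_. J)"
    have "(\<integral>x. (\<Prod>i\<in>I. snd (\<tau> i) (act A (fst (\<tau> i)) x)) \<partial>M) = (if bal I \<tau> then 1 else 0)"
      unfolding bal_def by (rule integral_prod_char[OF I dg[OF \<tau>]])
    then show "(\<Prod>i\<in>I. w (\<tau> i)) * (\<integral>x. (\<Prod>i\<in>I. snd (\<tau> i) (act A (fst (\<tau> i)) x)) \<partial>M)
        = (\<Prod>i\<in>I. w (\<tau> i)) * of_bool (bal I \<tau>)" by simp
  qed
  finally show ?thesis .
qed

text \<open>One radius for all sizes up to \<open>q\<close>, since the clusters of subfamilies are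
  needed along with those of the whole family.\<close>

lemma bal_cluster_exists:
  assumes "finite \<Lambda>" "\<Lambda> \<subseteq> dual_group"
  shows "\<exists>D\<ge>0. \<forall>(I::'i set) \<tau> i0. finite I \<longrightarrow> card I \<le> q \<longrightarrow> i0 \<in> I \<longrightarrow> \<tau> \<in> I \<rightarrow> UNIV \<times> \<Lambda> \<longrightarrow> bal I \<tau> \<longrightarrow>
    (\<exists>S\<subseteq>I. i0 \<in> S \<and> bal S \<tau> \<and> near D i0 S \<tau>)"
proof -
  let ?Q = "\<lambda>p D. D \<ge> 0 \<and> (\<forall>(I::'i set) l g i0. finite I \<longrightarrow> card I = p \<longrightarrow> i0 \<in> I \<longrightarrow> g \<in> I \<rightarrow> \<Lambda> \<longrightarrow> balanced I l g \<longrightarrow>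
    (\<exists>S\<subseteq>I. i0 \<in> S \<and> balanced S l g \<and> (\<forall>i\<in>S. norm (real_vec (l i) - real_vec (l i0)) \<le> D)))"
  define D where "D p = (SOME d. ?Q p d)" for p
  have D: "?Q p (D p)" for p
    unfolding D_def by (rule someI_ex) (use balanced_cluster[OF assms, of p, where 'i = 'i] in blast)
  show ?thesis
  proof (intro exI[of _ "\<Sum>p\<le>q. D p"] conjI allI impI)
    show "0 \<le> (\<Sum>p\<le>q. D p)" using D by (simp add: sum_nonneg)
    fix I :: "'i set" and \<tau> i0
    assume I: "finite I" "card I \<le> q" "i0 \<in> I" "\<tau> \<in> I \<rightarrow> UNIV \<times> \<Lambda>" "bal I \<tau>"
    have sI: "(\<lambda>i. snd (\<tau> i)) \<in> I \<rightarrow> \<Lambda>" using I(4) by (auto simp: Pi_def mem_Times_iff)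
    obtain S where S: "S \<subseteq> I" "i0 \<in> S" "bal S \<tau>"
      "\<And>i. i \<in> S \<Longrightarrow> norm (real_vec (fst (\<tau> i)) - real_vec (fst (\<tau> i0))) \<le> D (card I)"
      using D[of "card I", THEN conjunct2, rule_format, OF I(1) refl I(3) sI I(5)[unfolded bal_def]]
      unfolding bal_def by blast
    have "D (card I) \<le> (\<Sum>p\<le>q. D p)" using D I(2) by (intro member_le_sum) auto
    then have "near (\<Sum>p\<le>q. D p) i0 S \<tau>" unfolding near_def using S(4) by force
    then show "\<exists>S\<subseteq>I. i0 \<in> S \<and> bal S \<tau> \<and> near (\<Sum>p\<le>q. D p) i0 S \<tau>" using S by blast
  qed
qed

text \<open>If \<open>i0\<close> does not have exactly one partner, then it belongs to a cluster of at least three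
  members whose complement is still balanced.\<close>

lemma large_cluster:
  assumes nt: "(\<lambda>x. 1) \<notin> \<Lambda>" and D: "0 \<le> D"
    and cl: "\<And>(I::'i set) \<tau> i0. finite I \<Longrightarrow> card I \<le> q \<Longrightarrow> i0 \<in> I \<Longrightarrow> \<tau> \<in> I \<rightarrow> UNIV \<times> \<Lambda> \<Longrightarrow> bal I \<tau> \<Longrightarrow>
      \<exists>S\<subseteq>I. i0 \<in> S \<and> bal S \<tau> \<and> near D i0 S \<tau>"
    and I: "finite (I::'i set)" "card I \<le> q" "i0 \<in> I" "\<tau> \<in> I \<rightarrow> UNIV \<times> \<Lambda>" "bal I \<tau>"
    and N: "card {j \<in> I - {i0}. bal {i0, j} \<tau>} \<noteq> 1"
  shows "\<exists>S\<subseteq>I. i0 \<in> S \<and> 3 \<le> card S \<and> near (2 * D) i0 S \<tau> \<and> bal (I - S) \<tau>"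
proof -
  have single: "\<not> bal {i} \<tau>" if "i \<in> I" for i
    using I(4) that nt by (auto simp: bal_def balanced_singleton Pi_def mem_Times_iff)
  have pair: "norm (real_vec (fst (\<tau> j)) - real_vec (fst (\<tau> i0))) \<le> D" if j: "j \<in> I" "j \<noteq> i0" "bal {i0, j} \<tau>" for j
  proof -
    have "card {i0, j} \<le> card I" using I j by (intro card_mono) auto
    then obtain S where S: "S \<subseteq> {i0, j}" "i0 \<in> S" "bal S \<tau>" "near D i0 S \<tau>"
      using cl[of "{i0, j}" i0 \<tau>] I j by auto
    have "S \<noteq> {i0}" using S(3) single[OF I(3)] by auto
    then have "j \<in> S" using S(1,2) by auto
    then show ?thesis using S(4) by (simp add: near_def)
  qed
  show ?thesis
  \<comment> \<open>Without a partner, the cluster around \<open>i0\<close> cannot have one member,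
    because the characters are nontrivial, nor two.\<close>
  proof (cases "{j \<in> I - {i0}. bal {i0, j} \<tau>} = {}")
    case True
    obtain S where S: "S \<subseteq> I" "i0 \<in> S" "bal S \<tau>" "near D i0 S \<tau>" using cl[OF I] by blast
    have fS: "finite S" using S(1) I(1) finite_subset by blast
    have "card S \<noteq> 0" using S(2) fS by auto
    moreover have "card S \<noteq> 1"
      using S(2,3) single[OF I(3)] by (metis card_1_singletonE singletonD)
    moreover have "card S \<noteq> 2"
    proof
      assume "card S = 2"
      then obtain j where "S = {i0, j}" "j \<noteq> i0" using S(2) by (metis card_2_iff doubleton_eq_iff insertE singletonD)
      then show False using S(1,3) True by auto
    qed
    ultimately have "3 \<le> card S" by linarith
    moreover have "near (2 * D) i0 S \<tau>" using S(4) D by (fastforce simp: near_def)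
    ultimately show ?thesis using S bal_diff[OF I(1) S(1,3)] I(5) by blast
  next
    case False
    then obtain j where j: "j \<in> I" "j \<noteq> i0" "bal {i0, j} \<tau>" by blast
    let ?P = "{j \<in> I - {i0}. bal {i0, j} \<tau>}"
    have "?P \<noteq> {j}"
    proof
      assume "?P = {j}"
      then have "card ?P = card {j}" by (rule arg_cong)
      then show False using N by simp
    qed
    moreover have "j \<in> ?P" using j by simp
    ultimately obtain k where "k \<in> ?P" and kj: "k \<noteq> j" by blast
    then have k: "k \<in> I" "k \<noteq> i0" "bal {i0, k} \<tau>" by auto
    \<comment> \<open>With two partners \<open>j\<close> and \<open>k\<close>, a cluster around
      \<open>k\<close> in the balanced remainder is united with the pair \<open>{i0, j}\<close>. Its
      members are within \<open>D\<close> of \<open>k\<close>, and \<open>k\<close> is within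
      \<open>D\<close> of \<open>i0\<close>, whence \<open>2 * D\<close>.\<close>
    let ?I = "I - {i0, j}"
    have bI: "bal ?I \<tau>" using bal_diff[OF I(1) _ j(3)] I(3,5) j(1) by auto
    have "card ?I \<le> card I" using I(1) by (intro card_mono) auto
    then obtain T where T: "T \<subseteq> ?I" "k \<in> T" "bal T \<tau>" "near D k T \<tau>"
      using cl[of ?I k \<tau>] I k(1,2) kj bI by (auto simp: Pi_def)
    have fT: "finite T" using T(1) I(1) finite_subset by blast
    let ?S = "insert i0 (insert j T)"
    have "I - ?S = ?I - T" by auto
    then have "bal (I - ?S) \<tau>" using bal_diff[OF _ T(1,3)] I(1) bI by simp
    moreover have "3 \<le> card ?S"
    proof -
      have "card {i0, j, k} \<le> card ?S" using T(2) fT by (intro card_mono) auto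
      then show ?thesis using j(2) k(2) kj by simp
    qed
    moreover have "near (2 * D) i0 ?S \<tau>"
    proof -
      have "norm (real_vec (fst (\<tau> i)) - real_vec (fst (\<tau> i0))) \<le> 2 * D" if "i \<in> T" for i
      proof -
        have "norm (real_vec (fst (\<tau> i)) - real_vec (fst (\<tau> k))) \<le> D" using T(4) that by (simp add: near_def)
        then show ?thesis
          using pair[OF k(1-3)] norm_triangle_ineq[of "real_vec (fst (\<tau> i)) - real_vec (fst (\<tau> k))"
              "real_vec (fst (\<tau> k)) - real_vec (fst (\<tau> i0))"] by simp
      qed
      then show ?thesis using pair[OF j] D by (auto simp: near_def)
    qed
    moreover have "?S \<subseteq> I" using T(1) I(3) j(1) by auto
    ultimately show ?thesis by blast
  qed
qed

text \<open>The sum over \<open>j\<close> counts a balanced family once for every partner of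
  \<open>i0\<close>, so in the difference it has the factor \<open>1 - N \<tau>\<close>. This
  vanishes for exactly one partner; in the other cases its modulus is at most \<open>card I\<close>
  and \<open>large_cluster\<close> supplies a set \<open>S\<close>. The field is left open because
  the estimate is applied to complex weights and to their absolute values.\<close>

lemma bal_sum_recursion:
  fixes w :: "('a, 'd) orbit_char \<Rightarrow> 'b::real_normed_field"
  assumes nt: "(\<lambda>x. 1) \<notin> \<Lambda>" and D: "0 \<le> D"
    and cl: "\<And>(I::'i set) \<tau> i0. finite I \<Longrightarrow> card I \<le> q \<Longrightarrow> i0 \<in> I \<Longrightarrow> \<tau> \<in> I \<rightarrow> UNIV \<times> \<Lambda> \<Longrightarrow> bal I \<tau> \<Longrightarrow>
      \<exists>S\<subseteq>I. i0 \<in> S \<and> bal S \<tau> \<and> near D i0 S \<tau>"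
    and I: "finite (I::'i set)" "card I \<le> q" "i0 \<in> I"
    and J: "finite J" "J \<subseteq> UNIV \<times> \<Lambda>"
  shows "norm (bal_sum J w I - (\<Sum>j\<in>I - {i0}. bal_sum J w {i0, j} * bal_sum J w (I - {i0, j})))
    \<le> real (card I) * (\<Sum>S\<in>{S. S \<subseteq> I \<and> i0 \<in> S \<and> 3 \<le> card S}.
        near_sum (2 * D) i0 J (\<lambda>j. norm (w j)) S * bal_sum J (\<lambda>j. norm (w j)) (I - S))"
proof -
  let ?P = "PiE I (\<lambda>_. J)"
  let ?C = "{S. S \<subseteq> I \<and> i0 \<in> S \<and> 3 \<le> card S}"
  have finC: "finite ?C" using I(1) by (intro finite_subset[of ?C "Pow I"]) auto
  define N where "N \<tau> = card {j \<in> I - {i0}. bal {i0, j} \<tau>}" for \<tau> :: "'i \<Rightarrow> ('a, 'd) orbit_char"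
  have prodcong: "(\<Prod>i\<in>S. v (\<tau> i)) = (\<Prod>i\<in>S. v (\<tau>' i))" if "\<And>i. i \<in> S \<Longrightarrow> \<tau> i = \<tau>' i"
    for S :: "'i set" and \<tau> \<tau>' and v :: "('a, 'd) orbit_char \<Rightarrow> 'c::comm_monoid_mult"
    using that by (intro prod.cong) auto
  have pairs: "bal_sum J w {i0, j} * bal_sum J w (I - {i0, j})
      = (\<Sum>\<tau>\<in>?P. (\<Prod>i\<in>I. w (\<tau> i)) * of_bool (bal {i0, j} \<tau> \<and> bal I \<tau>))" if j: "j \<in> I - {i0}" for j
  proof -
    have sub: "{i0, j} \<subseteq> I" using j I(3) by auto
    have "bal_sum J w {i0, j} * bal_sum J w (I - {i0, j})
      = (\<Sum>\<tau>\<in>?P. ((\<Prod>i\<in>{i0, j}. w (\<tau> i)) * of_bool (bal {i0, j} \<tau>)) *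
          ((\<Prod>i\<in>I - {i0, j}. w (\<tau> i)) * of_bool (bal (I - {i0, j}) \<tau>)))"
      unfolding bal_sum_def
      by (rule sum_PiE_split[OF I(1) sub, symmetric])
        (intro arg_cong2[of _ _ _ _ "(*)"] prodcong arg_cong[of _ _ of_bool] bal_cong; blast)+
    also have "\<dots> = (\<Sum>\<tau>\<in>?P. (\<Prod>i\<in>I. w (\<tau> i)) * of_bool (bal {i0, j} \<tau> \<and> bal I \<tau>))"
      using bal_diff[OF I(1) sub] by (intro sum.cong refl) (auto simp: prod.subset_diff[OF sub I(1)] mult.commute)
    finally show ?thesis .
  qed
  have near_cong: "near (2 * D) i0 S \<tau> = near (2 * D) i0 S \<tau>'"
    if "i0 \<in> S" "\<And>i. i \<in> S \<Longrightarrow> \<tau> i = \<tau>' i" for S \<tau> \<tau>'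
    using that by (simp add: near_def)
  have clusters: "near_sum (2 * D) i0 J (\<lambda>j. norm (w j)) S * bal_sum J (\<lambda>j. norm (w j)) (I - S)
      = (\<Sum>\<tau>\<in>?P. (\<Prod>i\<in>I. norm (w (\<tau> i))) * of_bool (near (2 * D) i0 S \<tau> \<and> bal (I - S) \<tau>))" if S: "S \<in> ?C" for S
  proof -
    have sub: "S \<subseteq> I" and i0: "i0 \<in> S" using S by auto
    have "near_sum (2 * D) i0 J (\<lambda>j. norm (w j)) S * bal_sum J (\<lambda>j. norm (w j)) (I - S)
      = (\<Sum>\<tau>\<in>?P. ((\<Prod>i\<in>S. norm (w (\<tau> i))) * of_bool (near (2 * D) i0 S \<tau>)) *
          ((\<Prod>i\<in>I - S. norm (w (\<tau> i))) * of_bool (bal (I - S) \<tau>)))"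
      unfolding bal_sum_def near_sum_def
      by (rule sum_PiE_split[OF I(1) sub, symmetric])
        (intro arg_cong2[of _ _ _ _ "(*)"] prodcong arg_cong[of _ _ of_bool] bal_cong near_cong[OF i0]; blast)+
    also have "\<dots> = (\<Sum>\<tau>\<in>?P. (\<Prod>i\<in>I. norm (w (\<tau> i))) * of_bool (near (2 * D) i0 S \<tau> \<and> bal (I - S) \<tau>))"
      by (intro sum.cong refl) (auto simp: prod.subset_diff[OF sub I(1)] mult.commute)
    finally show ?thesis .
  qed
  have sumN: "(\<Sum>j\<in>I - {i0}. of_bool (bal {i0, j} \<tau> \<and> bal I \<tau>)) = (of_nat (N \<tau>) * of_bool (bal I \<tau>) :: 'b)" for \<tau>
    using I(1) by (cases "bal I \<tau>") (auto simp: N_def sum_of_bool_eq Int_def)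
  have "(\<Sum>j\<in>I - {i0}. bal_sum J w {i0, j} * bal_sum J w (I - {i0, j}))
      = (\<Sum>j\<in>I - {i0}. \<Sum>\<tau>\<in>?P. (\<Prod>i\<in>I. w (\<tau> i)) * of_bool (bal {i0, j} \<tau> \<and> bal I \<tau>))"
    by (intro sum.cong refl pairs)
  also have "\<dots> = (\<Sum>\<tau>\<in>?P. (\<Prod>i\<in>I. w (\<tau> i)) * (of_nat (N \<tau>) * of_bool (bal I \<tau>)))"
    by (subst sum.swap) (simp only: sum_distrib_left[symmetric] sumN)
  finally have "bal_sum J w I - (\<Sum>j\<in>I - {i0}. bal_sum J w {i0, j} * bal_sum J w (I - {i0, j}))
      = (\<Sum>\<tau>\<in>?P. (\<Prod>i\<in>I. w (\<tau> i)) * ((1 - of_nat (N \<tau>)) * of_bool (bal I \<tau>)))"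
    by (simp add: bal_sum_def sum_subtractf[symmetric] algebra_simps)
  then have "norm (bal_sum J w I - (\<Sum>j\<in>I - {i0}. bal_sum J w {i0, j} * bal_sum J w (I - {i0, j})))
      \<le> (\<Sum>\<tau>\<in>?P. norm ((\<Prod>i\<in>I. w (\<tau> i)) * ((1 - of_nat (N \<tau>)) * of_bool (bal I \<tau>))))"
    by (simp add: norm_sum)
  also have "\<dots> \<le> (\<Sum>\<tau>\<in>?P. (\<Prod>i\<in>I. norm (w (\<tau> i))) *
      (real (card I) * (\<Sum>S\<in>?C. of_bool (near (2 * D) i0 S \<tau> \<and> bal (I - S) \<tau>))))"
  proof (rule sum_mono)
    fix \<tau> assume \<tau>: "\<tau> \<in> ?P"
    have "norm ((1 - of_nat (N \<tau>)) * of_bool (bal I \<tau>) :: 'b)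
      \<le> real (card I) * (\<Sum>S\<in>?C. of_bool (near (2 * D) i0 S \<tau> \<and> bal (I - S) \<tau>))"
    proof (cases "bal I \<tau> \<and> N \<tau> \<noteq> 1")
      case False
      then show ?thesis by (auto simp: sum_nonneg)
    next
      case True
      have "\<tau> \<in> I \<rightarrow> UNIV \<times> \<Lambda>" using \<tau> J(2) by (auto simp: PiE_def Pi_def)
      then obtain S where S: "S \<in> ?C" "near (2 * D) i0 S \<tau>" "bal (I - S) \<tau>"
        using large_cluster[OF nt D cl I] True unfolding N_def by blast
      have "(1::real) = of_bool (near (2 * D) i0 S \<tau> \<and> bal (I - S) \<tau>)" using S by simp
      also have "\<dots> \<le> (\<Sum>S\<in>?C. of_bool (near (2 * D) i0 S \<tau> \<and> bal (I - S) \<tau>))"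
        using S(1) finC by (intro member_le_sum) auto
      finally have 1: "1 \<le> (\<Sum>S\<in>?C. of_bool (near (2 * D) i0 S \<tau> \<and> bal (I - S) \<tau>) :: real)" .
      have "N \<tau> \<le> card (I - {i0})" unfolding N_def using I(1) by (intro card_mono) auto
      moreover have "card (I - {i0}) = card I - 1" "0 < card I"
        using I(1,3) by (auto simp: card_gt_0_iff)
      ultimately have N: "N \<tau> + 1 \<le> card I" by linarith
      have "norm (1 - of_nat (N \<tau>) :: 'b) \<le> 1 + real (N \<tau>)"
        using norm_triangle_ineq4[of "1::'b" "of_nat (N \<tau>)"] by simp
      also have "\<dots> \<le> real (card I) * 1" using N by linarith
      also have "\<dots> \<le> real (card I) * (\<Sum>S\<in>?C. of_bool (near (2 * D) i0 S \<tau> \<and> bal (I - S) \<tau>))"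
        using 1 by (intro mult_left_mono) auto
      finally show ?thesis using True by simp
    qed
    then show "norm ((\<Prod>i\<in>I. w (\<tau> i)) * ((1 - of_nat (N \<tau>)) * of_bool (bal I \<tau>)))
      \<le> (\<Prod>i\<in>I. norm (w (\<tau> i))) * (real (card I) * (\<Sum>S\<in>?C. of_bool (near (2 * D) i0 S \<tau> \<and> bal (I - S) \<tau>)))"
      unfolding norm_mult[of "\<Prod>i\<in>I. w (\<tau> i)"] prod_norm[symmetric] by (intro mult_left_mono prod_nonneg) auto
  qed
  also have "\<dots> = real (card I) * (\<Sum>S\<in>?C. \<Sum>\<tau>\<in>?P. (\<Prod>i\<in>I. norm (w (\<tau> i))) * of_bool (near (2 * D) i0 S \<tau> \<and> bal (I - S) \<tau>))"
    by (subst sum.swap) (simp only: sum_distrib_left mult.left_commute)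
  also have "\<dots> = real (card I) * (\<Sum>S\<in>?C. near_sum (2 * D) i0 J (\<lambda>j. norm (w j)) S * bal_sum J (\<lambda>j. norm (w j)) (I - S))"
    using clusters by (intro arg_cong2[of _ _ _ _ "(*)"] sum.cong refl) auto
  finally show ?thesis .
qed

end

section \<open>Moments and characteristic functions\<close>

text \<open>The moments of the centered normal law of variance \<open>v\<close>, in the recursive
  form given by integration by parts, which is the one that \<open>bal_sum_recursion\<close>
  reproduces.\<close>

fun gauss_moment :: "real \<Rightarrow> nat \<Rightarrow> real" where
  "gauss_moment v 0 = 1"
| "gauss_moment v (Suc 0) = 0"
| "gauss_moment v (Suc (Suc q)) = real (q + 1) * v * gauss_moment v q"

lemma gauss_moment_odd: "gauss_moment v (2 * k + 1) = 0"
  by (induction k) auto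

lemma gauss_moment_even: "gauss_moment v (2 * k) = fact (2 * k) / fact k * (v / 2) ^ k"
proof (induction k)
  case (Suc k)
  have "gauss_moment v (2 * Suc k) = real (2 * k + 1) * v * gauss_moment v (2 * k)" by simp
  also have "\<dots> = real (2 * k + 1) * v * (fact (2 * k) / fact k * (v / 2) ^ k)" by (simp only: Suc)
  also have "\<dots> = fact (2 * Suc k) / fact (Suc k) * (v / 2) ^ Suc k"
    by (simp add: divide_simps)
  finally show ?case .
qed simp

text \<open>Odd moments vanish and the factorials in the even ones cancel, so the moment expansion
  of the Gaussian characteristic function is a partial sum of an exponential series.\<close>

lemma sum_gauss_moment:
  "(\<Sum>q\<le>2 * k. (\<i> * complex_of_real t) ^ q / fact q * complex_of_real (gauss_moment v q))
    = complex_of_real (\<Sum>j\<le>k. (- (t\<^sup>2 * v / 2)) ^ j / fact j)"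
proof (induction k)
  case (Suc k)
  have "(\<i> * complex_of_real t) ^ (2 * Suc k) = complex_of_real ((- (t\<^sup>2)) ^ Suc k)"
    unfolding power_mult by (simp add: power_mult_distrib)
  then have "(\<i> * complex_of_real t) ^ (2 * Suc k) / fact (2 * Suc k) * complex_of_real (gauss_moment v (2 * Suc k))
    = complex_of_real ((- (t\<^sup>2)) ^ Suc k / fact (2 * Suc k) * gauss_moment v (2 * Suc k))"
    by (simp del: fact_Suc power_Suc gauss_moment.simps mult_Suc_right of_real_power)
  also have "(- (t\<^sup>2)) ^ Suc k / fact (2 * Suc k) * gauss_moment v (2 * Suc k) = (- (t\<^sup>2 * v / 2)) ^ Suc k / fact (Suc k)"
    unfolding gauss_moment_even
    by (simp add: power_mult_distrib[symmetric] del: fact_Suc power_Suc mult_Suc_right)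
  finally have e: "(\<i> * complex_of_real t) ^ (2 * Suc k) / fact (2 * Suc k) * complex_of_real (gauss_moment v (2 * Suc k))
    = complex_of_real ((- (t\<^sup>2 * v / 2)) ^ Suc k / fact (Suc k))" .
  have two: "(\<Sum>q\<le>2 * Suc k. f q) = f (2 * Suc k) + (f (2 * k + 1) + (\<Sum>q\<le>2 * k. f q))" for f :: "nat \<Rightarrow> complex"
    by (simp add: add_ac)
  have "(\<Sum>q\<le>2 * Suc k. (\<i> * complex_of_real t) ^ q / fact q * complex_of_real (gauss_moment v q))
    = (\<i> * complex_of_real t) ^ (2 * Suc k) / fact (2 * Suc k) * complex_of_real (gauss_moment v (2 * Suc k))
      + (\<Sum>q\<le>2 * k. (\<i> * complex_of_real t) ^ q / fact q * complex_of_real (gauss_moment v q))"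
    by (subst two) (simp only: gauss_moment_odd of_real_0 mult_zero_right add_0)
  then show ?case unfolding Suc e by (simp add: add.commute del: fact_Suc power_Suc)
qed simp

lemma exp_taylor_tail:
  fixes x Y :: real
  assumes "\<bar>x\<bar> \<le> Y"
  shows "\<bar>exp x - (\<Sum>j\<le>k. x ^ j / fact j)\<bar> \<le> exp Y * (Y ^ Suc k / fact (Suc k))"
proof -
  obtain t where t: "\<bar>t\<bar> \<le> \<bar>x\<bar>" "exp x = (\<Sum>m<Suc k. x ^ m / fact m) + exp t / fact (Suc k) * x ^ Suc k"
    using Maclaurin_exp_le[of x "Suc k"] by blast
  have "\<bar>exp x - (\<Sum>j\<le>k. x ^ j / fact j)\<bar> = exp t * (\<bar>x\<bar> ^ Suc k / fact (Suc k))"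
    unfolding t(2) lessThan_Suc_atMost by (simp add: abs_mult power_abs del: fact_Suc power_Suc)
  also have "\<dots> \<le> exp Y * (Y ^ Suc k / fact (Suc k))"
    using t(1) assms by (intro mult_mono divide_right_mono power_mono) auto
  finally show ?thesis .
qed

text \<open>The variances are only required to be bounded, so the Gaussian law to which the \<open>X n\<close> are
  compared depends on \<open>n\<close>.\<close>

lemma (in prob_space) char_close_to_gauss:
  fixes X :: "nat \<Rightarrow> 'a \<Rightarrow> real"
  assumes X: "\<And>n. random_variable borel (X n)" "\<And>n q. integrable M (\<lambda>x. X n x ^ q)"
    and mean: "\<And>n. expectation (X n) = 0"
    and V: "\<And>n. expectation (\<lambda>x. (X n x)\<^sup>2) \<le> V"
    and rec: "\<And>q. (\<lambda>n. expectation (\<lambda>x. X n x ^ (q + 2))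
        - real (q + 1) * expectation (\<lambda>x. (X n x)\<^sup>2) * expectation (\<lambda>x. X n x ^ q)) \<longlonglongrightarrow> 0"
  shows "(\<lambda>n. char (distr M borel (X n)) t
      - complex_of_real (exp (- (t\<^sup>2 * expectation (\<lambda>x. (X n x)\<^sup>2) / 2)))) \<longlonglongrightarrow> 0"
proof -
  define e where "e q n = expectation (\<lambda>x. X n x ^ q)" for q n
  have e2: "e 2 n = expectation (\<lambda>x. (X n x)\<^sup>2)" for n by (simp add: e_def)
  have e2b: "0 \<le> e 2 n" "e 2 n \<le> V" for n using V by (auto simp: e2)
  then have V0: "0 \<le> V" using order_trans by blast
  \<comment> \<open>The coefficient \<open>real (p + 1) * e 2 n\<close> in the passage from
    \<open>p\<close> to \<open>p + 2\<close> is bounded in \<open>n\<close>, which suffices to carry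
    a null sequence along.\<close>
  have D: "(\<lambda>n. e q n - gauss_moment (e 2 n) q) \<longlonglongrightarrow> 0" for q
  proof (induction q rule: less_induct)
    case (less q)
    consider "q = 0" | "q = 1" | p where "q = p + 2"
      by (metis One_nat_def Suc_1 add_2_eq_Suc' not0_implies_Suc)
    then show ?case
    proof cases
      case 1 then show ?thesis by (simp add: e_def prob_space)
    next
      case 2 then show ?thesis by (simp add: e_def mean)
    next
      case 3
      have "(\<lambda>n. e p n - gauss_moment (e 2 n) p) \<longlonglongrightarrow> 0" using less[of p] 3 by simp
      moreover have "norm (real (p + 1) * e 2 n) \<le> real (p + 1) * V" for n
        using e2b by (simp add: abs_mult mult_left_mono)
      ultimately have "(\<lambda>n. (real (p + 1) * e 2 n) * (e p n - gauss_moment (e 2 n) p)) \<longlonglongrightarrow> 0"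
        by (intro lim_null_mult_left_bounded[of _ "real (p + 1) * V"]) auto
      from tendsto_add[OF rec[of p] this] show ?thesis
        using 3 by (simp add: e_def[of "Suc (Suc p)"] e_def[of p] e2 algebra_simps)
    qed
  qed
  define Y where "Y = t\<^sup>2 * V / 2"
  have Y0: "0 \<le> Y" using V0 by (simp add: Y_def)
  show ?thesis
    unfolding LIMSEQ_iff e2[symmetric]
  proof (intro allI impI)
    fix r :: real assume r: "0 < r"
    have z: "(\<lambda>k. Y ^ k / fact k) \<longlonglongrightarrow> 0"
      using summable_LIMSEQ_zero[OF summable_exp[of Y]] by (simp add: field_simps)
    have "(\<lambda>k. 2 * (Y ^ k / fact k)) \<longlonglongrightarrow> 2 * 0" by (intro tendsto_mult_left z)
    then have ev1: "\<forall>\<^sub>F k in sequentially. 2 * (Y ^ k / fact k) < r / 4"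
      using r by (intro order_tendstoD(2)) auto
    have "(\<lambda>k. exp Y * (Y ^ Suc k / fact (Suc k))) \<longlonglongrightarrow> exp Y * 0" by (intro tendsto_mult_left LIMSEQ_Suc[OF z])
    then have ev2: "\<forall>\<^sub>F k in sequentially. exp Y * (Y ^ Suc k / fact (Suc k)) < r / 4"
      using r by (intro order_tendstoD(2)) auto
    \<comment> \<open>The order \<open>2 * k\<close> of the Taylor expansion is fixed before
      \<open>n\<close>. Being even, it turns the absolute moment in the remainder into a moment,
      which is close to a Gaussian one for large \<open>n\<close>; the latter contributes at most
      \<open>2 * (Y ^ k / fact k)\<close>, whatever the variance below \<open>V\<close>.\<close>
    obtain k where k: "2 * (Y ^ k / fact k) < r / 4" "exp Y * (Y ^ Suc k / fact (Suc k)) < r / 4"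
      using eventually_happens[OF eventually_conj[OF ev1 ev2]] by auto
    let ?a = "\<lambda>q. (\<i> * complex_of_real t) ^ q / fact q"
    have "(\<lambda>n. \<Sum>q\<le>2 * k. ?a q * complex_of_real (e q n - gauss_moment (e 2 n) q)) \<longlonglongrightarrow> (\<Sum>q\<le>2 * k. ?a q * complex_of_real 0)"
      by (intro tendsto_sum tendsto_mult_left tendsto_of_real D)
    then have ev3: "\<forall>\<^sub>F n in sequentially. norm (\<Sum>q\<le>2 * k. ?a q * complex_of_real (e q n - gauss_moment (e 2 n) q)) < r / 4"
      using r by (intro order_tendstoD(2)[OF tendsto_norm]) auto
    let ?b = "2 * \<bar>t\<bar> ^ (2 * k) / fact (2 * k)"
    have "(\<lambda>n. ?b * (e (2 * k) n - gauss_moment (e 2 n) (2 * k))) \<longlonglongrightarrow> 0"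
      by (rule tendsto_mult_right_zero[OF D])
    then have ev4: "\<forall>\<^sub>F n in sequentially. ?b * (e (2 * k) n - gauss_moment (e 2 n) (2 * k)) < r / 4"
      by (rule order_tendstoD(2)) (use r in simp)
    have "\<forall>\<^sub>F n in sequentially. norm (char (distr M borel (X n)) t - complex_of_real (exp (- (t\<^sup>2 * e 2 n / 2))) - 0) < r"
      using ev3 ev4
    proof eventually_elim
      case (elim n)
      let ?v = "e 2 n"
      have y: "\<bar>- (t\<^sup>2 * ?v / 2)\<bar> \<le> Y"
        using e2b[of n] by (simp add: Y_def abs_mult mult_left_mono)
      have "norm (char (distr M borel (X n)) t - (\<Sum>q\<le>2 * k. ?a q * e q n)) \<le> ?b * expectation (\<lambda>x. \<bar>X n x\<bar> ^ (2 * k))"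
        unfolding e_def by (rule char_approx1'[OF X(2) X(1) refl])
      also have "\<dots> = ?b * (e (2 * k) n - gauss_moment ?v (2 * k)) + ?b * gauss_moment ?v (2 * k)"
        by (simp add: e_def power_even_abs right_diff_distrib)
      also have "?b * gauss_moment ?v (2 * k) = 2 * (\<bar>t\<^sup>2 * ?v / 2\<bar> ^ k / fact k)"
        using e2b(1)[of n] by (simp add: gauss_moment_even power_mult power_mult_distrib[symmetric] power_divide)
      also have "\<dots> \<le> 2 * (Y ^ k / fact k)"
        using y by (intro mult_left_mono divide_right_mono power_mono) auto
      finally have 1: "norm (char (distr M borel (X n)) t - (\<Sum>q\<le>2 * k. ?a q * e q n)) < r / 4 + r / 4"
        using elim(2) k(1) by linarith
      have "(\<Sum>q\<le>2 * k. ?a q * e q n) - (\<Sum>q\<le>2 * k. ?a q * gauss_moment ?v q)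
          = (\<Sum>q\<le>2 * k. ?a q * complex_of_real (e q n - gauss_moment ?v q))"
        by (simp add: sum_subtractf[symmetric] right_diff_distrib)
      then have 2: "norm ((\<Sum>q\<le>2 * k. ?a q * e q n) - (\<Sum>q\<le>2 * k. ?a q * gauss_moment ?v q)) < r / 4"
        using elim(1) by simp
      have "norm ((\<Sum>q\<le>2 * k. ?a q * gauss_moment ?v q) - complex_of_real (exp (- (t\<^sup>2 * ?v / 2))))
        = \<bar>exp (- (t\<^sup>2 * ?v / 2)) - (\<Sum>j\<le>k. (- (t\<^sup>2 * ?v / 2)) ^ j / fact j)\<bar>"
        unfolding sum_gauss_moment of_real_diff[symmetric] norm_of_real by (rule abs_minus_commute)
      also have "\<dots> \<le> exp Y * (Y ^ Suc k / fact (Suc k))" by (rule exp_taylor_tail[OF y])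
      finally have 3: "norm ((\<Sum>q\<le>2 * k. ?a q * gauss_moment ?v q) - complex_of_real (exp (- (t\<^sup>2 * ?v / 2)))) < r / 4"
        using k(2) by linarith
      show ?case
        using norm_triangle_ineq[of "char (distr M borel (X n)) t - (\<Sum>q\<le>2 * k. ?a q * e q n)"
            "(\<Sum>q\<le>2 * k. ?a q * e q n) - complex_of_real (exp (- (t\<^sup>2 * ?v / 2)))"]
          norm_triangle_ineq[of "(\<Sum>q\<le>2 * k. ?a q * e q n) - (\<Sum>q\<le>2 * k. ?a q * gauss_moment ?v q)"
            "(\<Sum>q\<le>2 * k. ?a q * gauss_moment ?v q) - complex_of_real (exp (- (t\<^sup>2 * ?v / 2)))"] 1 2 3
        by simp
    qed
    then show "\<exists>no. \<forall>n\<ge>no. norm (char (distr M borel (X n)) t - complex_of_real (exp (- (t\<^sup>2 * e 2 n / 2))) - 0) < r"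
      by (simp add: eventually_sequentially)
  qed
qed


section \<open>Estimates of clusters and pairs, and the Gaussian limit for trigonometric
  polynomials\<close>

context mixing_action
begin

text \<open>Once the value at \<open>i0\<close> is chosen, each of the other
  \<open>card S - 1\<close> members has at most as many choices as there are lattice points in a
  ball times characters, each of weight at most \<open>u\<close>. This is the shape of the growth
  condition with \<open>r = card S\<close>.\<close>

lemma near_sum_le:
  assumes J: "finite J" "J \<subseteq> UNIV \<times> \<Lambda>" and \<Lambda>: "finite \<Lambda>" and S: "finite S" "i0 \<in> S"
    and w: "\<And>j. j \<in> J \<Longrightarrow> 0 \<le> w j" "\<And>j. j \<in> J \<Longrightarrow> w j \<le> u"
  shows "near_sum D i0 J w S
    \<le> (\<Sum>j\<in>J. w j) * (u * real (card {m :: int ^ 'd. norm (real_vec m) \<le> D} * card \<Lambda>)) ^ (card S - 1)"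
    (is "_ \<le> _ * (u * real ?N) ^ _")
proof -
  define T where "T = S - {i0}"
  have T: "finite T" "i0 \<notin> T" "S = insert i0 T" "card T = card S - 1" using S by (auto simp: T_def)
  have inner: "(\<Sum>j\<in>J. w j * of_bool (norm (real_vec (fst j) - real_vec (fst y)) \<le> D)) \<le> u * real ?N" if "y \<in> J" for y
  proof -
    let ?B = "{j \<in> J. norm (real_vec (fst j) - real_vec (fst y)) \<le> D}"
    have u0: "0 \<le> u" using w[OF that] by linarith
    have "?B \<subseteq> (\<lambda>(m, \<gamma>). (m + fst y, \<gamma>)) ` ({m. norm (real_vec m) \<le> D} \<times> \<Lambda>)"
    proof
      fix j assume j: "j \<in> ?B"
      have "j = (\<lambda>(m, \<gamma>). (m + fst y, \<gamma>)) (fst j - fst y, snd j)" by simp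
      moreover have "(fst j - fst y, snd j) \<in> {m. norm (real_vec m) \<le> D} \<times> \<Lambda>"
        using j J(2) by (auto simp: real_vec_diff)
      ultimately show "j \<in> (\<lambda>(m, \<gamma>). (m + fst y, \<gamma>)) ` ({m. norm (real_vec m) \<le> D} \<times> \<Lambda>)" by (rule image_eqI)
    qed
    then have "card ?B \<le> card ({m :: int ^ 'd. norm (real_vec m) \<le> D} \<times> \<Lambda>)"
      using \<Lambda> finite_int_vec_ball by (intro surj_card_le) auto
    then have cB: "real (card ?B) \<le> real ?N" by (simp only: card_cartesian_product of_nat_le_iff)
    have "(\<Sum>j\<in>J. w j * of_bool (norm (real_vec (fst j) - real_vec (fst y)) \<le> D)) = (\<Sum>j\<in>?B. w j)"
      using J(1) by (intro sum.mono_neutral_cong_right) auto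
    also have "\<dots> \<le> (\<Sum>j\<in>?B. u)" using w by (intro sum_mono) auto
    also have "\<dots> \<le> u * real ?N" using mult_right_mono[OF cB u0] by (simp add: mult.commute)
    finally show ?thesis .
  qed
  have "near_sum D i0 J w S = (\<Sum>(y, g)\<in>J \<times> PiE T (\<lambda>_. J).
      (\<Prod>i\<in>S. w ((g(i0 := y)) i)) * of_bool (near D i0 S (g(i0 := y))))"
    unfolding near_sum_def T(3) PiE_insert_eq
    by (subst sum.reindex[OF inj_combinator[OF T(2)]]) (simp add: o_def case_prod_unfold)
  also have "\<dots> \<le> (\<Sum>(y, g)\<in>J \<times> PiE T (\<lambda>_. J).
      w y * (\<Prod>i\<in>T. w (g i) * of_bool (norm (real_vec (fst (g i)) - real_vec (fst y)) \<le> D)))"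
  proof (rule sum_mono)
    fix p assume "p \<in> J \<times> PiE T (\<lambda>_. J)"
    then obtain y1 y2 g where p': "p = ((y1, y2), g)" and yg: "(y1, y2) \<in> J" "g \<in> PiE T (\<lambda>_. J)" by auto
    let ?y = "(y1, y2)"
    have p: "(\<Prod>i\<in>S. w ((g(i0 := ?y)) i)) = w ?y * (\<Prod>i\<in>T. w (g i))"
      unfolding T(3) using T(1,2) by (subst prod.insert) (auto intro!: prod.cong arg_cong2[of _ _ _ _ "(*)"])
    have "(\<Prod>i\<in>T. of_bool (norm (real_vec (fst (g i)) - real_vec y1) \<le> D)) = (1::real)"
      if "near D i0 S (g(i0 := ?y))"
      using that T(2,3) unfolding near_def by (intro prod.neutral) (auto split: if_splits)
    moreover have "0 \<le> w (g i)" if "i \<in> T" for i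
      by (rule w(1)) (use yg(2) that in auto)
    then have "0 \<le> w ?y * (\<Prod>i\<in>T. w (g i))" using w(1)[OF yg(1)] by (intro mult_nonneg_nonneg prod_nonneg) auto
    moreover have "0 \<le> (\<Prod>i\<in>T. of_bool (norm (real_vec (fst (g i)) - real_vec y1) \<le> D) :: real)"
      by (intro prod_nonneg) auto
    ultimately have "(\<Prod>i\<in>S. w ((g(i0 := ?y)) i)) * of_bool (near D i0 S (g(i0 := ?y)))
      \<le> w ?y * (\<Prod>i\<in>T. w (g i) * of_bool (norm (real_vec (fst (g i)) - real_vec (fst ?y)) \<le> D))"
      unfolding p prod.distrib fst_conv mult.assoc[symmetric]
      by (cases "near D i0 S (g(i0 := ?y))") auto
    then show "(case p of (y, g) \<Rightarrow> (\<Prod>i\<in>S. w ((g(i0 := y)) i)) * of_bool (near D i0 S (g(i0 := y))))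
      \<le> (case p of (y, g) \<Rightarrow> w y * (\<Prod>i\<in>T. w (g i) * of_bool (norm (real_vec (fst (g i)) - real_vec (fst y)) \<le> D)))"
      unfolding p' by simp
  qed
  also have "\<dots> = (\<Sum>y\<in>J. w y * (\<Prod>i\<in>T. \<Sum>j\<in>J. w j * of_bool (norm (real_vec (fst j) - real_vec (fst y)) \<le> D)))"
  proof -
    have "(\<Prod>i\<in>T. \<Sum>j\<in>J. F j) = (\<Sum>g\<in>PiE T (\<lambda>_. J). \<Prod>i\<in>T. F (g i))" for F :: "('a, 'd) orbit_char \<Rightarrow> real"
      by (rule prod_sum_PiE) (use J(1) T(1) in auto)
    then show ?thesis by (simp only: sum.cartesian_product[symmetric] sum_distrib_left)
  qed
  also have "\<dots> \<le> (\<Sum>y\<in>J. w y * (u * real ?N) ^ (card S - 1))"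
    using inner w unfolding T(4)[symmetric]
    by (intro sum_mono mult_left_mono) (auto intro!: power_mono sum_nonneg)
  finally show ?thesis by (simp add: sum_distrib_right)
qed

text \<open>Orbits of nontrivial characters are free, so a partner of a given element is determined
  by its character alone and there are at most \<open>card \<Lambda>\<close> partners. The products
  of weights are bounded by half the sums of squares.\<close>

lemma bal_sum_pair_le:
  assumes J: "finite J" "J \<subseteq> UNIV \<times> \<Lambda>" and \<Lambda>: "finite \<Lambda>" "\<Lambda> \<subseteq> dual_group" "(\<lambda>x. 1) \<notin> \<Lambda>"
    and ij: "i \<noteq> j" and w: "\<And>k. 0 \<le> w k"
  shows "bal_sum J w {i, j} \<le> real (card \<Lambda>) * (\<Sum>k\<in>J. (w k)\<^sup>2)"
proof -
  define Q where "Q a b \<longleftrightarrow> (\<forall>x. snd a (act A (fst a) x) * snd b (act A (fst b) x) = 1)" for a b :: "('a, 'd) orbit_char"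
  have Qsym: "Q a b = Q b a" for a b by (simp add: Q_def mult.commute)
  have Qcard: "real (card {b \<in> J. Q a b}) \<le> real (card \<Lambda>)" for a
  proof -
    have "inj_on snd {b \<in> J. Q a b}"
    proof (rule inj_onI)
      fix b b' assume b: "b \<in> {b \<in> J. Q a b}" "b' \<in> {b \<in> J. Q a b}" "snd b = snd b'"
      have "snd b (act A (fst b) x) = snd b (act A (fst b') x)" for x
      proof -
        have "snd a (act A (fst a) x) * snd b (act A (fst b) x) = snd a (act A (fst a) x) * snd b (act A (fst b') x)"
          using b by (simp add: Q_def)
        moreover have "snd a (act A (fst a) x) \<noteq> 0" using b(1) by (auto simp: Q_def) (metis mult_zero_left zero_neq_one)
        ultimately show ?thesis by simp
      qed
      moreover have "snd b \<in> \<Lambda>" using b(1) J(2) by auto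
      ultimately have "fst b = fst b'" by (intro act_orbit_free[of "snd b"]) (use \<Lambda>(2,3) in auto)
      then show "b = b'" using b(3) by (simp add: prod_eq_iff)
    qed
    moreover have "snd ` {b \<in> J. Q a b} \<subseteq> \<Lambda>" using J(2) by auto
    ultimately show ?thesis using card_inj_on_le[OF _ _ \<Lambda>(1)] by (metis of_nat_le_iff)
  qed
  have "bal_sum J w {i, j} = (\<Sum>(a, b)\<in>J \<times> J. w a * w b * of_bool (Q a b))"
    unfolding bal_sum_def
  proof (rule sum.reindex_bij_witness[where j = "\<lambda>\<tau>. (\<tau> i, \<tau> j)"
        and i = "\<lambda>(a, b) k. if k = i then a else if k = j then b else undefined"])
    fix \<tau> assume \<tau>: "\<tau> \<in> PiE {i, j} (\<lambda>_. J)"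
    show "(case (\<tau> i, \<tau> j) of (a, b) \<Rightarrow> \<lambda>k. if k = i then a else if k = j then b else undefined) = \<tau>"
      using \<tau> by (auto simp: fun_eq_iff PiE_def extensional_def)
    show "(\<tau> i, \<tau> j) \<in> J \<times> J" using \<tau> by auto
    show "(case (\<tau> i, \<tau> j) of (a, b) \<Rightarrow> w a * w b * of_bool (Q a b)) = (\<Prod>i\<in>{i, j}. w (\<tau> i)) * of_bool (bal {i, j} \<tau>)"
      using ij by (simp add: bal_def balanced_def Q_def)
  next
    fix b assume b: "b \<in> J \<times> J"
    then show "(\<lambda>\<tau>. (\<tau> i, \<tau> j)) (case b of (a, b) \<Rightarrow> \<lambda>k. if k = i then a else if k = j then b else undefined) = b"
      using ij by auto
    show "(case b of (a, b) \<Rightarrow> \<lambda>k. if k = i then a else if k = j then b else undefined) \<in> PiE {i, j} (\<lambda>_. J)"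
      using b by (auto simp: PiE_def extensional_def)
  qed
  also have "\<dots> \<le> (\<Sum>(a, b)\<in>J \<times> J. ((w a)\<^sup>2 / 2 * of_bool (Q a b) + (w b)\<^sup>2 / 2 * of_bool (Q a b)))"
  proof (intro sum_mono, clarsimp)
    fix a b :: "('a, 'd) orbit_char"
    show "w a * w b \<le> (w a)\<^sup>2 / 2 + (w b)\<^sup>2 / 2" for a b
      using sum_squares_ge_zero[of "w a - w b" 0] by (simp add: power2_eq_square algebra_simps)
  qed
  also have "\<dots> = (\<Sum>a\<in>J. \<Sum>b\<in>J. (w a)\<^sup>2 / 2 * of_bool (Q a b)) + (\<Sum>a\<in>J. \<Sum>b\<in>J. (w b)\<^sup>2 / 2 * of_bool (Q a b))"
    by (simp add: sum.cartesian_product[symmetric] sum.distrib)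
  also have "(\<Sum>a\<in>J. \<Sum>b\<in>J. (w b)\<^sup>2 / 2 * of_bool (Q a b)) = (\<Sum>a\<in>J. \<Sum>b\<in>J. (w a)\<^sup>2 / 2 * of_bool (Q a b))"
    by (subst sum.swap) (simp add: Qsym)
  also have "(\<Sum>a\<in>J. \<Sum>b\<in>J. (w a)\<^sup>2 / 2 * of_bool (Q a b)) \<le> (\<Sum>a\<in>J. (w a)\<^sup>2 / 2 * real (card \<Lambda>))"
  proof (rule sum_mono)
    fix a
    have "(\<Sum>b\<in>J. (w a)\<^sup>2 / 2 * of_bool (Q a b)) = (w a)\<^sup>2 / 2 * real (card {b \<in> J. Q a b})"
      unfolding sum_distrib_left[symmetric] using J(1) by (simp add: sum_of_bool_eq Int_def)
    also have "\<dots> \<le> (w a)\<^sup>2 / 2 * real (card \<Lambda>)" by (intro mult_left_mono Qcard) auto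
    finally show "(\<Sum>b\<in>J. (w a)\<^sup>2 / 2 * of_bool (Q a b)) \<le> (w a)\<^sup>2 / 2 * real (card \<Lambda>)" .
  qed
  also have "(\<Sum>a\<in>J. (w a)\<^sup>2 / 2 * real (card \<Lambda>)) = real (card \<Lambda>) * (\<Sum>k\<in>J. (w k)\<^sup>2) / 2"
    by (simp add: sum_distrib_left sum_divide_distrib mult.commute)
  finally show ?thesis by simp
qed

end

context mixing_action
begin

lemma bal_sum_nonneg: "(\<And>j. 0 \<le> (w j :: real)) \<Longrightarrow> 0 \<le> bal_sum J w I"
  unfolding bal_sum_def by (intro sum_nonneg mult_nonneg_nonneg prod_nonneg) auto

lemma norm_bal_sum_le: "norm (bal_sum J w I) \<le> bal_sum J (\<lambda>j. norm (w j)) I"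
  unfolding bal_sum_def
  by (rule order_trans[OF norm_sum]) (auto simp: norm_mult prod_norm intro!: sum_mono)

lemma bal_sum_empty: "bal_sum J w {} = 1"
  by (simp add: bal_sum_def bal_def balanced_def)

lemma near_sum_nonneg: "(\<And>j. 0 \<le> w j) \<Longrightarrow> 0 \<le> near_sum D i0 J w S"
  unfolding near_sum_def by (intro sum_nonneg mult_nonneg_nonneg prod_nonneg) auto

end

text \<open>The assumption \<open>small\<close> is the growth condition for normalized weights, with
  \<open>s\<close> the size of a cluster; \<open>sq\<close> is the normalization and controls the
  pairs.\<close>

locale asymptotically_small_weights = mixing_action M A
  for M :: "'a::{topological_ab_group_add,t2_space} measure" and A :: "'d::finite \<Rightarrow> 'a \<Rightarrow> 'a" +
  fixes \<Lambda> :: "('a \<Rightarrow> complex) set" and J :: "nat \<Rightarrow> ('a, 'd) orbit_char set"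
    and w :: "nat \<Rightarrow> ('a, 'd) orbit_char \<Rightarrow> complex" and u :: "nat \<Rightarrow> real" and B :: real
  assumes \<Lambda>: "finite \<Lambda>" "\<Lambda> \<subseteq> dual_group" "(\<lambda>x. 1) \<notin> \<Lambda>"
    and J: "finite (J n)" "J n \<subseteq> UNIV \<times> \<Lambda>"
    and u: "j \<in> J n \<Longrightarrow> norm (w n j) \<le> u n"
    and small: "3 \<le> s \<Longrightarrow> (\<lambda>n. (\<Sum>j\<in>J n. norm (w n j)) * u n ^ (s - 1)) \<longlonglongrightarrow> 0"
    and sq: "(\<Sum>j\<in>J n. (norm (w n j))\<^sup>2) \<le> B"
begin

abbreviation abs_w :: "nat \<Rightarrow> ('a, 'd) orbit_char \<Rightarrow> real" where
  "abs_w n \<equiv> \<lambda>j. norm (w n j)"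

lemma near_sum_tendsto:
  assumes S: "finite S" "i0 \<in> S" "3 \<le> card S"
  shows "(\<lambda>n. near_sum D i0 (J n) (abs_w n) S) \<longlonglongrightarrow> 0"
proof -
  let ?N = "real (card {m :: int ^ 'd. norm (real_vec m) \<le> D} * card \<Lambda>)"
  have "(\<lambda>n. (\<Sum>j\<in>J n. abs_w n j) * u n ^ (card S - 1) * ?N ^ (card S - 1)) \<longlonglongrightarrow> 0 * ?N ^ (card S - 1)"
    by (intro tendsto_intros small S)
  then have lim: "(\<lambda>n. (\<Sum>j\<in>J n. abs_w n j) * (u n * ?N) ^ (card S - 1)) \<longlonglongrightarrow> 0"
    by (simp add: power_mult_distrib mult.assoc)
  have le: "\<forall>\<^sub>F n in sequentially. near_sum D i0 (J n) (abs_w n) S \<le> (\<Sum>j\<in>J n. abs_w n j) * (u n * ?N) ^ (card S - 1)"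
    by (intro always_eventually allI near_sum_le[OF J \<Lambda>(1) S(1,2)]) (auto intro: u)
  have "\<forall>\<^sub>F n in sequentially. 0 \<le> near_sum D i0 (J n) (abs_w n) S"
    by (intro always_eventually allI near_sum_nonneg) auto
  from tendsto_sandwich[OF this le tendsto_const lim] show ?thesis .
qed

lemma pair_le: "i \<noteq> j \<Longrightarrow> bal_sum (J n) (abs_w n) {i, j} \<le> real (card \<Lambda>) * B"
  using bal_sum_pair_le[OF J \<Lambda>, of i j "abs_w n" n] mult_left_mono[OF sq[of n], of "real (card \<Lambda>)"]
  by fastforce

text \<open>Induction over proper subsets by the recursion for the absolute weights: pairs are
  bounded by \<open>pair_le\<close>, large clusters because they tend to 0, and the complements by
  the induction hypothesis.\<close>

lemma bal_sum_bounded: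
  assumes "finite (I :: 'i set)"
  shows "\<exists>K. \<forall>n. bal_sum (J n) (abs_w n) I \<le> K"
  using assms
proof (induction I rule: finite_psubset_induct)
  case (psubset I)
  show ?case
  proof (cases "I = {}")
    case True
    then show ?thesis by (auto simp: bal_sum_empty)
  next
    case False
    then obtain i0 where i0: "i0 \<in> I" by blast
    define K where "K C = (SOME k. \<forall>n. bal_sum (J n) (abs_w n) C \<le> k)" for C :: "'i set"
    have K: "bal_sum (J n) (abs_w n) C \<le> K C" if "C \<subset> I" for C n
      using someI_ex[OF psubset.IH[OF that]] unfolding K_def by blast
    obtain D where D: "0 \<le> D" "\<And>(I'::'i set) \<tau> i0. finite I' \<Longrightarrow> card I' \<le> card I \<Longrightarrow> i0 \<in> I' \<Longrightarrow>
        \<tau> \<in> I' \<rightarrow> UNIV \<times> \<Lambda> \<Longrightarrow> bal I' \<tau> \<Longrightarrow> \<exists>S\<subseteq>I'. i0 \<in> S \<and> bal S \<tau> \<and> near D i0 S \<tau>"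
      using bal_cluster_exists[OF \<Lambda>(1,2), of "card I", where 'i = 'i] by blast
    let ?C = "{S. S \<subseteq> I \<and> i0 \<in> S \<and> 3 \<le> card S}"
    have "\<exists>k. \<forall>n. norm (near_sum (2 * D) i0 (J n) (abs_w n) S) \<le> k" if "S \<in> ?C" for S
    proof -
      have "finite S" using that psubset.hyps finite_subset by blast
      then have "Bseq (\<lambda>n. near_sum (2 * D) i0 (J n) (abs_w n) S)"
        using near_sum_tendsto[of S i0 "2 * D"] that by (intro convergent_imp_Bseq convergentI) auto
      then show ?thesis unfolding Bseq_def by blast
    qed
    note ex = this
    define N where "N S = (SOME k. \<forall>n. norm (near_sum (2 * D) i0 (J n) (abs_w n) S) \<le> k)" for S
    have N: "near_sum (2 * D) i0 (J n) (abs_w n) S \<le> N S" if "S \<in> ?C" for S n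
    proof -
      have "norm (near_sum (2 * D) i0 (J n) (abs_w n) S) \<le> N S"
        using someI_ex[OF ex[OF that]] unfolding N_def by blast
      then show ?thesis by simp
    qed
    have "bal_sum (J n) (abs_w n) I \<le> (\<Sum>j\<in>I - {i0}. real (card \<Lambda>) * B * K (I - {i0, j}))
        + real (card I) * (\<Sum>S\<in>?C. N S * K (I - S))" for n
    proof -
      have "norm (bal_sum (J n) (abs_w n) I
          - (\<Sum>j\<in>I - {i0}. bal_sum (J n) (abs_w n) {i0, j} * bal_sum (J n) (abs_w n) (I - {i0, j})))
        \<le> real (card I) * (\<Sum>S\<in>?C. near_sum (2 * D) i0 (J n) (\<lambda>j. norm (abs_w n j)) S
            * bal_sum (J n) (\<lambda>j. norm (abs_w n j)) (I - S))"
        by (rule bal_sum_recursion[OF \<Lambda>(3) D psubset.hyps order_refl i0 J])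
      then have "bal_sum (J n) (abs_w n) I
        \<le> (\<Sum>j\<in>I - {i0}. bal_sum (J n) (abs_w n) {i0, j} * bal_sum (J n) (abs_w n) (I - {i0, j}))
          + real (card I) * (\<Sum>S\<in>?C. near_sum (2 * D) i0 (J n) (abs_w n) S * bal_sum (J n) (abs_w n) (I - S))"
        by (simp add: abs_le_iff)
      also have "\<dots> \<le> (\<Sum>j\<in>I - {i0}. real (card \<Lambda>) * B * K (I - {i0, j}))
        + real (card I) * (\<Sum>S\<in>?C. N S * K (I - S))"
      proof (intro add_mono sum_mono mult_left_mono[OF _ of_nat_0_le_iff] mult_mono)
        fix j assume j: "j \<in> I - {i0}"
        show "bal_sum (J n) (abs_w n) {i0, j} \<le> real (card \<Lambda>) * B" using j by (intro pair_le) auto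
        then show "0 \<le> real (card \<Lambda>) * B" using bal_sum_nonneg[of "abs_w n" "J n" "{i0, j}"] by simp
        show "bal_sum (J n) (abs_w n) (I - {i0, j}) \<le> K (I - {i0, j})" using i0 by (intro K) auto
      next
        fix S assume S: "S \<in> ?C"
        show "near_sum (2 * D) i0 (J n) (abs_w n) S \<le> N S" by (rule N[OF S])
        then show "0 \<le> N S" using near_sum_nonneg[of "abs_w n" "2 * D" i0 "J n" S] by simp
        show "bal_sum (J n) (abs_w n) (I - S) \<le> K (I - S)" using S i0 by (intro K) auto
      qed (auto intro: bal_sum_nonneg)
      finally show ?thesis .
    qed
    then show ?thesis by blast
  qed
qed

text \<open>In each error term of the recursion a null sequence from a large cluster meets a bounded
  moment of its complement.\<close>

lemma bal_sum_error_tendsto: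
  assumes I: "finite (I :: 'i set)" "i0 \<in> I"
  shows "(\<lambda>n. bal_sum (J n) (w n) I
    - (\<Sum>j\<in>I - {i0}. bal_sum (J n) (w n) {i0, j} * bal_sum (J n) (w n) (I - {i0, j}))) \<longlonglongrightarrow> 0"
proof -
  obtain D where D: "0 \<le> D" "\<And>(I'::'i set) \<tau> i0. finite I' \<Longrightarrow> card I' \<le> card I \<Longrightarrow> i0 \<in> I' \<Longrightarrow>
      \<tau> \<in> I' \<rightarrow> UNIV \<times> \<Lambda> \<Longrightarrow> bal I' \<tau> \<Longrightarrow> \<exists>S\<subseteq>I'. i0 \<in> S \<and> bal S \<tau> \<and> near D i0 S \<tau>"
    using bal_cluster_exists[OF \<Lambda>(1,2), of "card I", where 'i = 'i] by blast
  let ?C = "{S. S \<subseteq> I \<and> i0 \<in> S \<and> 3 \<le> card S}"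
  have "(\<lambda>n. near_sum (2 * D) i0 (J n) (abs_w n) S * bal_sum (J n) (abs_w n) (I - S)) \<longlonglongrightarrow> 0" if S: "S \<in> ?C" for S
  proof -
    have "finite S" using S I(1) finite_subset by blast
    then have "(\<lambda>n. near_sum (2 * D) i0 (J n) (abs_w n) S) \<longlonglongrightarrow> 0" using S by (intro near_sum_tendsto) auto
    moreover obtain K where "\<And>n. bal_sum (J n) (abs_w n) (I - S) \<le> K"
      using bal_sum_bounded[of "I - S"] I(1) by auto
    then have "\<forall>\<^sub>F n in sequentially. norm (bal_sum (J n) (abs_w n) (I - S)) \<le> K"
      using bal_sum_nonneg[of "abs_w _" _ "I - S"] by (intro always_eventually) simp
    ultimately show ?thesis by (rule lim_null_mult_right_bounded)
  qed
  then have "(\<lambda>n. real (card I) * (\<Sum>S\<in>?C. near_sum (2 * D) i0 (J n) (abs_w n) S * bal_sum (J n) (abs_w n) (I - S)))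
      \<longlonglongrightarrow> real (card I) * (\<Sum>S\<in>?C. 0)"
    by (intro tendsto_mult_left tendsto_sum)
  then have lim: "(\<lambda>n. real (card I) * (\<Sum>S\<in>?C. near_sum (2 * D) i0 (J n) (abs_w n) S * bal_sum (J n) (abs_w n) (I - S))) \<longlonglongrightarrow> 0"
    by simp
  have le: "norm (bal_sum (J n) (w n) I
      - (\<Sum>j\<in>I - {i0}. bal_sum (J n) (w n) {i0, j} * bal_sum (J n) (w n) (I - {i0, j})))
    \<le> real (card I) * (\<Sum>S\<in>?C. near_sum (2 * D) i0 (J n) (abs_w n) S * bal_sum (J n) (abs_w n) (I - S))" for n
    by (rule bal_sum_recursion[OF \<Lambda>(3) D I(1) order_refl I(2) J])
  show ?thesis by (rule Lim_null_comparison[OF always_eventually[OF allI[OF le]] lim])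
qed

text \<open>For \<open>I = {..<q + 2}\<close> and \<open>i0 = 0\<close>, the moments depend on
  cardinalities only, so the \<open>q + 1\<close> choices of \<open>j\<close> give equal terms. This
  is the factor \<open>q + 1\<close> of the Gaussian recursion. The mean is 0 because the constant
  character is excluded.\<close>

lemma char_trig_poly_close_to_gauss:
  fixes X :: "nat \<Rightarrow> 'a \<Rightarrow> real"
  assumes X: "\<And>n x. complex_of_real (X n x) = trig_poly (J n) (w n) x"
  shows "(\<lambda>n. char (distr M borel (X n)) t
      - complex_of_real (exp (- (t\<^sup>2 * expectation (\<lambda>x. (X n x)\<^sup>2) / 2)))) \<longlonglongrightarrow> 0"
proof -
  have JD: "J n \<subseteq> UNIV \<times> dual_group" for n using J(2)[of n] \<Lambda>(2) by auto
  have "X n = (\<lambda>x. Re (trig_poly (J n) (w n) x))" for n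
    using X by (metis Re_complex_of_real)
  then have Xc: "continuous_on UNIV (X n)" for n
    using continuous_on_Re[OF trig_poly_cts[OF JD[of n], of "w n"]] by simp
  have Xi: "integrable M (\<lambda>x. X n x ^ q)" for n q
    by (intro integrable_continuous continuous_intros Xc)
  have moment: "complex_of_real (expectation (\<lambda>x. X n x ^ card I)) = bal_sum (J n) (w n) I" if "finite I" for n and I :: "nat set"
    using integral_trig_poly_power[OF J(1) JD that, of n "w n"]
    by (simp add: X[symmetric] of_real_power[symmetric] del: of_real_power)
  have two: "card {0::nat, j} = 2" if "j \<noteq> 0" for j using that by simp
  have m2: "complex_of_real (expectation (\<lambda>x. (X n x)\<^sup>2)) = bal_sum (J n) (w n) {0, j}" if "j \<noteq> 0" for n and j :: nat
    using moment[of "{0, j}" n] two[OF that] by simp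
  show ?thesis
  proof (rule char_close_to_gauss)
    show "random_variable borel (X n)" for n by (rule measurable_continuous[OF Xc])
    show "integrable M (\<lambda>x. X n x ^ q)" for n q by (rule Xi)
    show "expectation (X n) = 0" for n
    proof -
      have "\<not> bal {0::nat} \<tau>" if "\<tau> \<in> PiE {0} (\<lambda>_. J n)" for \<tau>
      proof -
        have "\<tau> 0 \<in> J n" using that by auto
        then have "snd (\<tau> 0) \<in> \<Lambda>" using J(2)[of n] by auto
        then show ?thesis using \<Lambda>(3) by (auto simp: bal_def balanced_singleton)
      qed
      then have "bal_sum (J n) (w n) {0::nat} = 0" by (simp add: bal_sum_def)
      then show ?thesis using moment[of "{0}" n] by simp
    qed
    show "expectation (\<lambda>x. (X n x)\<^sup>2) \<le> real (card \<Lambda>) * B" for n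
    proof -
      have "norm (complex_of_real (expectation (\<lambda>x. (X n x)\<^sup>2))) \<le> bal_sum (J n) (abs_w n) {0::nat, 1}"
        unfolding m2[of 1 n, simplified] using norm_bal_sum_le by simp
      then show ?thesis using pair_le[of "0::nat" 1 n] by simp
    qed
    fix q :: nat
    let ?I = "{..<q + 2}"
    have "(\<Sum>j\<in>?I - {0}. bal_sum (J n) (w n) {0, j} * bal_sum (J n) (w n) (?I - {0, j}))
      = complex_of_real (real (q + 1) * expectation (\<lambda>x. (X n x)\<^sup>2) * expectation (\<lambda>x. X n x ^ q))" for n
    proof -
      have "bal_sum (J n) (w n) {0, j} * bal_sum (J n) (w n) (?I - {0, j})
        = complex_of_real (expectation (\<lambda>x. (X n x)\<^sup>2) * expectation (\<lambda>x. X n x ^ q))" if "j \<in> ?I - {0}" for j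
      proof -
        have "card (?I - {0, j}) = q" using that by (subst card_Diff_subset) auto
        then show ?thesis using moment[of "?I - {0, j}" n] m2[of j n] that by simp
      qed
      then show ?thesis by simp
    qed
    then have eq: "bal_sum (J n) (w n) ?I - (\<Sum>j\<in>?I - {0}. bal_sum (J n) (w n) {0, j} * bal_sum (J n) (w n) (?I - {0, j}))
      = complex_of_real (expectation (\<lambda>x. X n x ^ (q + 2)) - real (q + 1) * expectation (\<lambda>x. (X n x)\<^sup>2) * expectation (\<lambda>x. X n x ^ q))" for n
      using moment[of ?I n] by simp
    have "(\<lambda>n. complex_of_real (expectation (\<lambda>x. X n x ^ (q + 2))
        - real (q + 1) * expectation (\<lambda>x. (X n x)\<^sup>2) * expectation (\<lambda>x. X n x ^ q))) \<longlonglongrightarrow> 0"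
      using bal_sum_error_tendsto[of ?I 0] unfolding eq by simp
    from tendsto_Re[OF this]
    show "(\<lambda>n. expectation (\<lambda>x. X n x ^ (q + 2))
        - real (q + 1) * expectation (\<lambda>x. (X n x)\<^sup>2) * expectation (\<lambda>x. X n x ^ q)) \<longlonglongrightarrow> 0"
      by simp
  qed
qed

end

section \<open>Fourier analysis on the torus\<close>

lemma lborel_integral_prod:
  fixes f :: "'a::euclidean_space \<Rightarrow> real \<Rightarrow> complex"
  assumes f: "\<And>b. b \<in> Basis \<Longrightarrow> integrable lborel (f b)"
  shows "(\<integral>x. (\<Prod>b\<in>Basis. f b (x \<bullet> b)) \<partial>lborel) = (\<Prod>b\<in>Basis. \<integral>y. f b y \<partial>lborel)"
proof -
  interpret product_sigma_finite "\<lambda>_::'a. lborel :: real measure"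
    by standard
  have fm: "f b \<in> borel_measurable borel" if "b \<in> Basis" for b
    using borel_measurable_integrable[OF f[OF that]] by simp
  have m: "(\<lambda>x. \<Prod>b\<in>Basis. f b (x \<bullet> b)) \<in> borel_measurable borel"
    by (intro borel_measurable_prod measurable_compose[OF _ fm]) auto
  have m': "(\<lambda>g. \<Sum>b\<in>Basis. g b *\<^sub>R b) \<in> PiM Basis (\<lambda>_. lborel :: real measure) \<rightarrow>\<^sub>M (borel :: 'a measure)"
    by measurable
  have "(lborel :: 'a measure) = distr (PiM Basis (\<lambda>_. lborel)) borel (\<lambda>g. \<Sum>b\<in>Basis. g b *\<^sub>R b)"
    unfolding lborel_eq_real by (rule lborel_def)
  then have "(\<integral>x. (\<Prod>b\<in>Basis. f b (x \<bullet> b)) \<partial>lborel)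
      = (\<integral>g. (\<Prod>b\<in>Basis. f b ((\<Sum>b\<in>Basis. g b *\<^sub>R b) \<bullet> b)) \<partial>PiM Basis (\<lambda>_. lborel))"
    using integral_distr[OF m' m] by simp
  also have "\<dots> = (\<integral>g. (\<Prod>b\<in>Basis. f b (g b)) \<partial>PiM Basis (\<lambda>_. lborel))"
    by (intro Bochner_Integration.integral_cong prod.cong refl) simp
  also have "\<dots> = (\<Prod>b\<in>Basis. \<integral>y. f b y \<partial>lborel)"
    by (rule product_integral_prod[OF finite_Basis f])
  finally show ?thesis .
qed

lemma integral_unit_interval_cis:
  fixes k :: int
  shows "integrable lborel (\<lambda>y. indicator {0..<1::real} y *\<^sub>R cis (2 * pi * (real_of_int k * y)))"
    and "(\<integral>y. indicator {0..<1::real} y *\<^sub>R cis (2 * pi * (real_of_int k * y)) \<partial>lborel) = of_bool (k = 0)"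
proof -
  let ?g = "\<lambda>y::real. cis (2 * pi * (real_of_int k * y))"
  have gc: "continuous_on S ?g" for S by (intro continuous_intros)
  show int: "integrable lborel (\<lambda>y. indicator {0..<1::real} y *\<^sub>R ?g y)"
  proof (rule Bochner_Integration.integrable_bound)
    show "integrable lborel (indicat_real {0..<1::real})" by (intro integrable_real_indicator) auto
    show "(\<lambda>y. indicator {0..<1::real} y *\<^sub>R ?g y) \<in> borel_measurable lborel"
      using borel_measurable_continuous_onI[OF gc] by measurable
  qed (auto simp: indicator_def)
  have "(\<integral>y. indicator {0..<1::real} y *\<^sub>R ?g y \<partial>lborel) = (\<integral>y. indicator {0..1::real} y *\<^sub>R ?g y \<partial>lborel)"
  proof (rule integral_cong_AE)
    show "AE y in lborel. indicator {0..<1::real} y *\<^sub>R ?g y = indicator {0..1::real} y *\<^sub>R ?g y"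
      using AE_lborel_singleton[of 1] by eventually_elim (auto simp: indicator_def)
  qed (use borel_measurable_continuous_onI[OF gc] in measurable)
  also have "\<dots> = of_bool (k = 0)"
  proof (cases "k = 0")
    case True
    then show ?thesis by simp
  next
    case False
    define c where "c = \<i> * complex_of_real (2 * pi * real_of_int k)"
    have c: "c \<noteq> 0" using False by (simp add: c_def)
    have g: "?g y = exp (c * complex_of_real y)" for y by (simp add: cis_conv_exp c_def mult_ac)
    have "(\<integral>y. indicator {0..1::real} y *\<^sub>R ?g y \<partial>lborel) = exp (c * complex_of_real 1) / c - exp (c * complex_of_real 0) / c"
    proof (rule integral_FTC_Icc)
      fix x :: real
      have "((\<lambda>z. exp (c * z) / c) has_field_derivative exp (c * complex_of_real x)) (at (complex_of_real x))"
        using c by (auto intro!: derivative_eq_intros)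
      then show "((\<lambda>y. exp (c * complex_of_real y) / c) has_vector_derivative ?g x) (at x within {0..1})"
        unfolding g by (rule has_vector_derivative_real_field)
    qed (use gc in auto)
    also have "exp (c * complex_of_real 1) = 1"
      unfolding exp_eq_1 by (auto simp: c_def)
    finally show ?thesis using False by simp
  qed
  finally show "(\<integral>y. indicator {0..<1::real} y *\<^sub>R ?g y \<partial>lborel) = of_bool (k = 0)" .
qed

lemma prod_Basis_vec:
  fixes F :: "real ^ 'd::finite \<Rightarrow> 'b::comm_monoid_mult"
  shows "(\<Prod>b\<in>Basis. F b) = (\<Prod>i\<in>UNIV. F (axis i 1))"
proof -
  have "(Basis :: (real ^ 'd) set) = (\<lambda>i. axis i 1) ` UNIV" by (auto simp: Basis_vec_def)
  moreover have "inj (\<lambda>i. axis i (1::real) :: real ^ 'd)" by (auto simp: inj_def axis_eq_axis)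
  ultimately show ?thesis using prod.reindex[of "\<lambda>i. axis i (1::real) :: real ^ 'd" UNIV F] by (simp add: o_def)
qed

lemma torus_char_prod: "torus_char l t = (\<Prod>i\<in>UNIV. cis (2 * pi * (real_of_int (l $ i) * t $ i)))"
proof -
  have "cis (\<Sum>i\<in>I. g i) = (\<Prod>i\<in>I. cis (g i))" if "finite I" for I :: "'a set" and g
    using that by (induction I rule: finite_induct) (auto simp: cis_mult[symmetric])
  from this[OF finite] show ?thesis
    by (simp add: torus_char_def real_vec_def inner_vec_def sum_distrib_left)
qed

lemma torus_borel: "torus \<in> sets borel"
proof -
  have "torus = (\<Inter>i\<in>UNIV. {t. 0 \<le> t $ i} \<inter> {t. t $ i < 1})" by (auto simp: torus_def)
  also have "\<dots> \<in> sets borel"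
    by (intro sets.finite_INT sets.Int borel_closed borel_open closed_Collect_le open_Collect_less
        continuous_intros) auto
  finally show ?thesis .
qed

lemma integral_torus_haar:
  fixes f :: "real ^ 'd::finite \<Rightarrow> 'b::{banach,second_countable_topology}"
  shows "(\<integral>t. f t \<partial>torus_haar) = (\<integral>t. indicator torus t *\<^sub>R f t \<partial>lborel)"
  unfolding torus_haar_def using torus_borel by (intro integral_restrict_space) auto

lemma integral_torus_char: "(\<integral>t. torus_char n t \<partial>torus_haar) = of_bool (n = 0)"
proof -
  let ?f = "\<lambda>b y. indicator {0..<1::real} y *\<^sub>R cis (2 * pi * ((real_vec n \<bullet> b) * y))"
  have "indicat_real torus t = (\<Prod>i\<in>UNIV. indicator {0..<1} (t $ i))" for t :: "real ^ 'a"
    by (auto simp: indicator_def torus_def prod_zero_iff not_le not_less)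
  then have "indicator torus t *\<^sub>R torus_char n t = (\<Prod>b\<in>Basis. ?f b (t \<bullet> b))" for t
    unfolding prod_Basis_vec
    by (simp add: torus_char_prod inner_axis prod.distrib scaleR_conv_of_real real_vec_def)
  then have "(\<integral>t. torus_char n t \<partial>torus_haar) = (\<integral>t. (\<Prod>b\<in>Basis. ?f b (t \<bullet> b)) \<partial>lborel)"
    by (simp add: integral_torus_haar)
  also have "\<dots> = (\<Prod>b\<in>Basis. \<integral>y. ?f b y \<partial>lborel)"
  proof (rule lborel_integral_prod)
    fix b :: "real ^ 'a" assume "b \<in> Basis"
    then obtain i where "b = axis i 1" by (auto simp: Basis_vec_def)
    then show "integrable lborel (?f b)"
      using integral_unit_interval_cis(1)[of "n $ i"] by (simp add: inner_axis real_vec_def)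
  qed
  also have "\<dots> = (\<Prod>i\<in>UNIV. of_bool (n $ i = 0))"
    unfolding prod_Basis_vec by (simp add: inner_axis real_vec_def integral_unit_interval_cis(2))
  also have "\<dots> = of_bool (n = 0)"
    by (auto simp: vec_eq_iff prod_zero_iff)
  finally show ?thesis .
qed

lemma finite_measure_torus_haar: "finite_measure (torus_haar :: (real ^ 'd::finite) measure)"
proof
  have "(torus :: (real ^ 'd) set) \<subseteq> cbox 0 1"
    by (auto simp: torus_def mem_box_cart less_imp_le)
  then have "emeasure lborel (torus :: (real ^ 'd) set) \<le> emeasure lborel (cbox 0 1 :: (real ^ 'd) set)"
    by (intro emeasure_mono) auto
  also have "\<dots> < \<infinity>" by (rule emeasure_lborel_cbox_finite)
  finally show "emeasure torus_haar (space (torus_haar :: (real ^ 'd) measure)) \<noteq> (\<infinity> :: ennreal)"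
    unfolding torus_haar_def using torus_borel
    by (subst emeasure_restrict_space) (auto simp: space_restrict_space)
qed

interpretation torus_haar: finite_measure "torus_haar :: (real ^ 'd::finite) measure"
  by (rule finite_measure_torus_haar)

lemma measurable_torus_haar:
  "continuous_on UNIV f \<Longrightarrow> f \<in> borel_measurable torus_haar"
  unfolding torus_haar_def by (intro measurable_restrict_space1) (simp add: borel_measurable_continuous_onI)

lemma integrable_torus_haar:
  fixes f :: "real ^ 'd::finite \<Rightarrow> 'b::{banach,second_countable_topology}"
  assumes "continuous_on UNIV f"
  shows "integrable torus_haar f"
proof -
  have "bounded (f ` cbox 0 1)"
    by (intro compact_imp_bounded compact_continuous_image continuous_on_subset[OF assms]) auto
  then obtain B where B: "\<And>t. t \<in> cbox 0 1 \<Longrightarrow> norm (f t) \<le> B" by (auto simp: bounded_iff)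
  have "AE t in torus_haar. norm (f t) \<le> B"
  proof (rule AE_I2)
    fix t assume "t \<in> space (torus_haar :: (real ^ 'd) measure)"
    then have "t \<in> torus" using torus_borel by (simp add: torus_haar_def space_restrict_space)
    then show "norm (f t) \<le> B" by (intro B) (auto simp: torus_def mem_box_cart less_imp_le)
  qed
  then show ?thesis by (rule torus_haar.integrable_const_bound) (rule measurable_torus_haar[OF assms])
qed

lemma torus_char_cts: "continuous_on UNIV (torus_char l)"
  unfolding torus_char_def[abs_def] by (intro continuous_intros)

lemma torus_char_norm: "cmod (torus_char l t) = 1"
  by (simp add: torus_char_def)

lemma torus_char_mult: "torus_char l t * torus_char m t = torus_char (l + m) t"
  by (simp add: torus_char_def cis_mult real_vec_add inner_add_left distrib_left)

lemma torus_char_cnj: "cnj (torus_char l t) = torus_char (- l) t"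
  by (simp add: torus_char_def cis_cnj real_vec_def inner_vec_def sum_negf)

lemma torus_char_0: "torus_char 0 t = 1"
  by (simp add: torus_char_def real_vec_0)

lemma torus_char_periodic: "torus_char l (t + axis i 1) = torus_char l t"
proof -
  have "torus_char l (t + axis i 1) = torus_char l t * cis (2 * pi * real_of_int (l $ i))"
    by (simp add: torus_char_def inner_add_right distrib_left cis_mult[symmetric] inner_axis real_vec_def)
  then show ?thesis using cis_multiple_2pi[of "real_of_int (l $ i)"] by (simp add: mult_ac)
qed

text \<open>An inductive description in place of explicit finite sums makes closure under products a
  double induction without index sets.\<close>

inductive trig_sum :: "(real ^ 'd::finite \<Rightarrow> complex) \<Rightarrow> bool" where
  char: "trig_sum (\<lambda>t. c * torus_char n t)"
| add: "trig_sum f \<Longrightarrow> trig_sum g \<Longrightarrow> trig_sum (\<lambda>t. f t + g t)"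

lemma trig_sum_cts: "trig_sum f \<Longrightarrow> continuous_on UNIV f"
  by (induction rule: trig_sum.induct) (auto intro!: continuous_intros torus_char_cts)

lemma trig_sum_mult:
  assumes "trig_sum f" "trig_sum g"
  shows "trig_sum (\<lambda>t. f t * g t)"
  using assms(1)
proof (induction rule: trig_sum.induct)
  case (char c n)
  from assms(2) show ?case
  proof (induction rule: trig_sum.induct)
    case (char c' n')
    have "(\<lambda>t. c * torus_char n t * (c' * torus_char n' t)) = (\<lambda>t. (c * c') * torus_char (n + n') t)"
      by (simp add: torus_char_mult[symmetric] mult_ac)
    then show ?case by (simp add: trig_sum.char)
  next
    case (add f g)
    then show ?case using trig_sum.add[OF add.IH] by (simp add: distrib_left)
  qed
next
  case (add f g')
  then show ?case using trig_sum.add[OF add.IH] by (simp add: distrib_right)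
qed

lemma trig_sum_cnj: "trig_sum f \<Longrightarrow> trig_sum (\<lambda>t. cnj (f t))"
proof (induction rule: trig_sum.induct)
  case (char c n)
  then show ?case using trig_sum.char[of "cnj c" "- n"] by (simp add: torus_char_cnj)
next
  case (add f g)
  then show ?case using trig_sum.add[OF add.IH] by simp
qed

lemma trig_sum_scale: "trig_sum f \<Longrightarrow> trig_sum (\<lambda>t. c * f t)"
  using trig_sum_mult[OF trig_sum.char[of c 0]] by (simp add: torus_char_0)

lemma torus_continuous_translate:
  assumes "torus_continuous \<phi>"
  shows "\<phi> (t + real_vec m) = \<phi> t"
proof -
  have per: "\<phi> (t + axis i 1) = \<phi> t" for t i using assms by (simp add: torus_continuous_def)
  have one: "\<phi> (t + of_int k *\<^sub>R axis i 1) = \<phi> t" for t i and k :: int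
  proof (induction k rule: int_induct[where k = 0])
    case base then show ?case by simp
  next
    case (step1 k)
    have "t + of_int (k + 1) *\<^sub>R axis i 1 = (t + of_int k *\<^sub>R axis i 1) + axis i 1"
      by (simp add: scaleR_add_left)
    then show ?case using step1 per by metis
  next
    case (step2 k)
    have "t + of_int k *\<^sub>R axis i 1 = (t + of_int (k - 1) *\<^sub>R axis i 1) + axis i 1"
      by (simp add: scaleR_diff_left)
    then show ?case using step2 per by metis
  qed
  have "\<phi> (t + (\<Sum>i\<in>I. of_int (m $ i) *\<^sub>R axis i 1)) = \<phi> t" for I t
  proof (induction I arbitrary: t rule: finite_induct[OF finite])
    case 1 then show ?case by simp
  next
    case (2 i I)
    have "t + (\<Sum>i\<in>insert i I. of_int (m $ i) *\<^sub>R axis i 1)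
        = (t + of_int (m $ i) *\<^sub>R axis i 1) + (\<Sum>i\<in>I. of_int (m $ i) *\<^sub>R axis i 1)"
      using 2 by (simp add: add.assoc)
    then show ?case using 2(3)[of "t + of_int (m $ i) *\<^sub>R axis i 1"] one by metis
  qed
  from this[of t UNIV] show ?thesis
  proof -
    have "(\<Sum>i\<in>UNIV. of_int (m $ i) *\<^sub>R axis i 1) = real_vec m"
      by (simp add: vec_eq_iff real_vec_def sum_component axis_def if_distrib cong: if_cong)
    then show ?thesis using \<open>\<phi> (t + (\<Sum>i\<in>UNIV. of_int (m $ i) *\<^sub>R axis i 1)) = \<phi> t\<close> by simp
  qed
qed

text \<open>Stone-Weierstrass on the image of the cube in \<open>complex ^ 'd\<close>, to which a periodic function
  descends as a continuous function because the cube is compact.\<close>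

lemma trig_sum_dense:
  fixes \<phi> :: "real ^ 'd::finite \<Rightarrow> real"
  assumes \<phi>: "torus_continuous \<phi>" and e: "0 < e"
  obtains f where "trig_sum f" "\<And>t. \<bar>\<phi> t - Re (f t)\<bar> < e"
proof -
  have \<phi>c: "continuous_on S \<phi>" for S using \<phi> continuous_on_subset by (auto simp: torus_continuous_def)
  define E where "E t = (\<chi> i. cis (2 * pi * t $ i))" for t :: "real ^ 'd"
  have Ec: "continuous_on S E" for S
    unfolding E_def[abs_def] by (intro continuous_intros continuous_on_vec_lambda)
  define K where "K = E ` cbox 0 1"
  have K: "compact K" unfolding K_def by (intro compact_continuous_image Ec) auto
  have Eint: "E (t + real_vec m) = E t" for t m
    by (simp add: E_def vec_eq_iff real_vec_def distrib_left cis_mult[symmetric])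
  have Eeq: "\<phi> t = \<phi> s" if "E t = E s" for t s
  proof -
    have "\<exists>k::int. t $ i = s $ i + of_int k" for i
    proof -
      have "cis (2 * pi * t $ i) = cis (2 * pi * s $ i)" using that by (simp add: E_def vec_eq_iff)
      then have "sin (2 * pi * t $ i) = sin (2 * pi * s $ i) \<and> cos (2 * pi * t $ i) = cos (2 * pi * s $ i)"
        by (simp add: complex_eq_iff)
      then obtain k :: int where "2 * pi * t $ i = 2 * pi * s $ i + 2 * pi * of_int k"
        unfolding sin_cos_eq_iff by blast
      then have "2 * pi * (t $ i) = 2 * pi * (s $ i + of_int k)" by (simp add: algebra_simps)
      then show ?thesis by (metis mult_left_cancel mult_eq_0_iff pi_neq_zero zero_neq_numeral)
    qed
    then obtain k where "\<And>i. t $ i = s $ i + of_int (k i)" by metis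
    then have "t = s + real_vec (\<chi> i. k i)" by (simp add: vec_eq_iff real_vec_def)
    then show ?thesis using torus_continuous_translate[OF \<phi>] by metis
  qed
  have EK: "\<exists>s\<in>cbox 0 1. E s = E t" for t
  proof
    let ?m = "\<chi> i. - \<lfloor>t $ i\<rfloor>"
    show "E (t + real_vec ?m) = E t" by (rule Eint)
    show "t + real_vec ?m \<in> cbox 0 1"
      by (auto simp: mem_box_cart real_vec_def) linarith
  qed
  define \<psi> where "\<psi> z = \<phi> (SOME t. E t = z)" for z
  have \<psi>: "\<psi> (E t) = \<phi> t" for t
    unfolding \<psi>_def by (rule Eeq) (rule someI[of "\<lambda>s. E s = E t"], rule refl)
  \<comment> \<open>The preimage of a closed \<open>C\<close> is the image under \<open>E\<close> of
    the part of the cube where \<phi> takes values in \<open>C\<close>, and this part is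
    compact.\<close>
  have \<psi>c: "continuous_on K \<psi>"
    unfolding continuous_on_closed_invariant
  proof (intro allI impI)
    fix C :: "real set" assume C: "closed C"
    have "closed (cbox 0 1 \<inter> \<phi> -` C)"
      using continuous_closed_vimage[OF C, of \<phi>] \<phi>c[of UNIV]
      by (intro closed_Int) (auto simp: continuous_on_eq_continuous_at)
    then have "compact (cbox 0 1 \<inter> (cbox 0 1 \<inter> \<phi> -` C))" by (intro compact_Int_closed) auto
    then have "compact (E ` (cbox 0 1 \<inter> \<phi> -` C))"
      by (intro compact_continuous_image Ec) (simp add: Int_assoc[symmetric])
    then have "closed (E ` (cbox 0 1 \<inter> \<phi> -` C))" by (rule compact_imp_closed)
    moreover have "E ` (cbox 0 1 \<inter> \<phi> -` C) \<inter> K = \<psi> -` C \<inter> K"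
    proof (intro set_eqI iffI)
      fix z assume "z \<in> E ` (cbox 0 1 \<inter> \<phi> -` C) \<inter> K"
      then obtain t where "\<phi> t \<in> C" "z = E t" "z \<in> K" by auto
      then show "z \<in> \<psi> -` C \<inter> K" by (simp add: \<psi>)
    next
      fix z assume z: "z \<in> \<psi> -` C \<inter> K"
      then obtain t where t: "t \<in> cbox 0 1" "z = E t" unfolding K_def by blast
      then have "\<phi> t \<in> C" using z by (simp add: \<psi>)
      then show "z \<in> E ` (cbox 0 1 \<inter> \<phi> -` C) \<inter> K" using t z by blast
    qed
    ultimately show "\<exists>A. closed A \<and> A \<inter> K = \<psi> -` C \<inter> K" by blast
  qed
  define P where "P h \<longleftrightarrow> continuous_on K h \<and> (\<exists>f. trig_sum f \<and> (\<forall>t. h (E t) = Re (f t)))" for h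
  have "\<exists>g. P g \<and> (\<forall>z\<in>K. \<bar>\<psi> z - g z\<bar> < e)"
  proof (rule Stone_Weierstrass_HOL[OF K])
    show "P (\<lambda>x. c)" for c
      unfolding P_def using trig_sum.char[of "of_real c" 0] by (auto simp: torus_char_0 intro!: exI[of _ "\<lambda>t. of_real c"])
    show "P f \<Longrightarrow> continuous_on K f" for f by (simp add: P_def)
    show "P f \<and> P g \<Longrightarrow> P (\<lambda>x. f x + g x)" for f g
    proof -
      assume "P f \<and> P g"
      then obtain f' g' where "continuous_on K f" "continuous_on K g" "trig_sum f'" "trig_sum g'"
        "\<forall>t. f (E t) = Re (f' t)" "\<forall>t. g (E t) = Re (g' t)" unfolding P_def by blast
      then show ?thesis unfolding P_def
        by (intro conjI continuous_on_add exI[of _ "\<lambda>t. f' t + g' t"] trig_sum.add) auto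
    qed
    show "P f \<and> P g \<Longrightarrow> P (\<lambda>x. f x * g x)" for f g
    proof -
      assume "P f \<and> P g"
      then obtain f' g' where fg: "continuous_on K f" "continuous_on K g" "trig_sum f'" "trig_sum g'"
        "\<forall>t. f (E t) = Re (f' t)" "\<forall>t. g (E t) = Re (g' t)" unfolding P_def by blast
      \<comment> \<open>Real parts are not multiplicative, but \<open>?h\<close> equals
        \<open>f'\<close> times the real part of \<open>g'\<close>, so its real part is the required
        product.\<close>
      let ?h = "\<lambda>t. (1 / 2) * (f' t * g' t + f' t * cnj (g' t))"
      have "trig_sum ?h"
        by (intro trig_sum_scale trig_sum.add trig_sum_mult trig_sum_cnj fg)
      moreover have "?h t = f' t * complex_of_real (Re (g' t))" for t
        by (simp add: distrib_left[symmetric] complex_add_cnj)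
      then have "Re (?h t) = Re (f' t) * Re (g' t)" for t by simp
      ultimately show ?thesis unfolding P_def using fg by (intro conjI continuous_on_mult exI[of _ ?h]) auto
    qed
    show "\<exists>f. P f \<and> f x \<noteq> f y" if "x \<in> K \<and> y \<in> K \<and> x \<noteq> y" for x y
    proof -
      obtain i where i: "x $ i \<noteq> y $ i" using \<open>x \<in> K \<and> y \<in> K \<and> x \<noteq> y\<close> by (auto simp: vec_eq_iff)
      have "real_vec (axis i 1) = axis i 1" by (simp add: real_vec_def axis_def vec_eq_iff)
      then have Ei: "E t $ i = torus_char (axis i 1) t" for t
        by (simp add: E_def torus_char_def inner_commute[of _ t] inner_axis)
      have "P (\<lambda>z. Re (z $ i))"
        unfolding P_def using trig_sum.char[of 1 "axis i 1"] Ei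
        by (intro conjI continuous_intros exI[of _ "\<lambda>t. 1 * torus_char (axis i 1) t"]) auto
      \<comment> \<open>Multiplication by \<open>- \<i>\<close> turns the imaginary part into a real
        part.\<close>
      moreover have "P (\<lambda>z. Im (z $ i))"
        unfolding P_def using trig_sum.char[of "- \<i>" "axis i 1"] Ei
        by (intro conjI continuous_intros exI[of _ "\<lambda>t. - \<i> * torus_char (axis i 1) t"]) auto
      ultimately show ?thesis using i by (auto simp: complex_eq_iff)
    qed
  qed (use \<psi>c e in auto)
  then obtain g f where "\<And>z. z \<in> K \<Longrightarrow> \<bar>\<psi> z - g z\<bar> < e" "trig_sum f" "\<And>t. g (E t) = Re (f t)"
    unfolding P_def by blast
  moreover have "E t \<in> K" for t using EK[of t] unfolding K_def by (metis imageI)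
  ultimately show ?thesis using that[of f] \<psi> by metis
qed

text \<open>Comparing \<phi> with a uniform approximation by trigonometric sums, to which it is
  orthogonal, bounds the integral of its square by \<open>e\<close> times the integral of its
  modulus. Hence \<phi> is 0 almost everywhere on the cube; continuity gives the open box and then
  its closure, periodicity the whole space.\<close>

lemma torus_continuous_eq_0:
  fixes \<phi> :: "real ^ 'd::finite \<Rightarrow> real"
  assumes \<phi>: "torus_continuous \<phi>"
    and coeff: "\<And>n. (\<integral>t. of_real (\<phi> t) * cnj (torus_char n t) \<partial>torus_haar) = (0 :: complex)"
  shows "\<phi> t = 0"
proof -
  have \<phi>c: "continuous_on S \<phi>" for S using \<phi> continuous_on_subset by (auto simp: torus_continuous_def)
  have orth: "(\<integral>t. of_real (\<phi> t) * f t \<partial>torus_haar) = 0" if "trig_sum f" for f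
    using that
  proof (induction rule: trig_sum.induct)
    case (char c n)
    have "(\<integral>t. of_real (\<phi> t) * (c * torus_char n t) \<partial>torus_haar)
        = c * (\<integral>t. of_real (\<phi> t) * cnj (torus_char (- n) t) \<partial>torus_haar)"
      by (simp add: torus_char_cnj mult.left_commute)
    then show ?case using coeff[of "- n"] by simp
  next
    case (add f g)
    have "integrable torus_haar (\<lambda>t. complex_of_real (\<phi> t) * f t)"
      "integrable torus_haar (\<lambda>t. complex_of_real (\<phi> t) * g t)"
      using add trig_sum_cts \<phi>c by (auto intro!: integrable_torus_haar continuous_intros)
    then show ?case using add by (simp add: distrib_left)
  qed
  let ?I = "\<integral>t. \<bar>\<phi> t\<bar> \<partial>torus_haar"
  have i: "integrable torus_haar (\<lambda>t. (\<phi> t)\<^sup>2)" "integrable torus_haar (\<lambda>t. \<bar>\<phi> t\<bar>)"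
    by (intro integrable_torus_haar continuous_intros \<phi>c)+
  have "(\<integral>t. (\<phi> t)\<^sup>2 \<partial>torus_haar) \<le> e * ?I" if e: "0 < e" for e
  proof -
    obtain f where f: "trig_sum f" "\<And>t. \<bar>\<phi> t - Re (f t)\<bar> < e" using trig_sum_dense[OF \<phi> e] by blast
    have fi: "integrable torus_haar (\<lambda>t. complex_of_real (\<phi> t) * f t)"
      by (intro integrable_torus_haar continuous_intros \<phi>c trig_sum_cts f)
    have "(\<integral>t. Re (complex_of_real (\<phi> t) * f t) \<partial>torus_haar) = 0"
      using orth[OF f(1)] integral_Re[OF fi] by simp
    then have z: "(\<integral>t. \<phi> t * Re (f t) \<partial>torus_haar) = 0" by simp
    have ri: "integrable torus_haar (\<lambda>t. \<phi> t * Re (f t))"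
      by (intro integrable_torus_haar continuous_intros \<phi>c trig_sum_cts f)
    have "(\<integral>t. (\<phi> t)\<^sup>2 \<partial>torus_haar) = (\<integral>t. (\<phi> t)\<^sup>2 - \<phi> t * Re (f t) \<partial>torus_haar)"
      using i ri z by simp
    also have "\<dots> \<le> (\<integral>t. e * \<bar>\<phi> t\<bar> \<partial>torus_haar)"
    proof (rule integral_mono)
      fix t
      have "(\<phi> t)\<^sup>2 - \<phi> t * Re (f t) = \<phi> t * (\<phi> t - Re (f t))" by (simp add: power2_eq_square right_diff_distrib)
      also have "\<dots> \<le> \<bar>\<phi> t\<bar> * \<bar>\<phi> t - Re (f t)\<bar>" by (metis abs_ge_self abs_mult)
      also have "\<dots> \<le> \<bar>\<phi> t\<bar> * e" using f(2)[of t] by (intro mult_left_mono) auto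
      finally show "(\<phi> t)\<^sup>2 - \<phi> t * Re (f t) \<le> e * \<bar>\<phi> t\<bar>" by (simp add: mult.commute)
    qed (use i ri in auto)
    finally show ?thesis by simp
  qed
  note bound = this
  have "(\<integral>t. (\<phi> t)\<^sup>2 \<partial>torus_haar) \<le> 0 + d" if d: "0 < d" for d
  proof -
    have I: "0 \<le> ?I" by simp
    have "(\<integral>t. (\<phi> t)\<^sup>2 \<partial>torus_haar) \<le> d / (?I + 1) * ?I" using I d by (intro bound) (simp add: add_nonneg_pos)
    also have "\<dots> \<le> d"
    proof -
      have "d / (c + 1) * c \<le> d" if "0 \<le> c" for c :: real using that d by (simp add: field_simps add_nonneg_pos)
      then show ?thesis using I by blast
    qed
    finally show ?thesis by simp
  qed
  then have "(\<integral>t. (\<phi> t)\<^sup>2 \<partial>torus_haar) \<le> 0" by (rule field_le_epsilon)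
  then have "(\<integral>t. (\<phi> t)\<^sup>2 \<partial>torus_haar) = 0" by (simp add: order_antisym)
  then have "AE t in torus_haar. (\<phi> t)\<^sup>2 = 0"
    by (subst (asm) integral_nonneg_eq_0_iff_AE[OF i(1)]) auto
  then have "AE t in lborel. t \<in> torus \<longrightarrow> \<phi> t = 0"
    unfolding torus_haar_def using torus_borel by (subst (asm) AE_restrict_space_iff) auto
  then have ae: "AE t in lborel. t \<in> box 0 1 \<longrightarrow> \<phi> t = 0"
    by eventually_elim (auto simp: torus_def mem_box_cart less_imp_le)
  have open0: "\<phi> t = 0" if "t \<in> box 0 1" for t
  proof (rule ccontr)
    assume "\<phi> t \<noteq> 0"
    let ?U = "box 0 1 \<inter> {t. \<phi> t \<noteq> 0}"
    have U: "open ?U" by (intro open_Int open_box open_Collect_neq \<phi>c continuous_on_const)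
    have "AE t in lborel. t \<notin> ?U" using ae by eventually_elim auto
    then have "?U \<in> null_sets lborel" using U by (subst AE_iff_null_sets) auto
    then have "negligible ?U" using negligible_iff_null_sets null_sets_completionI by blast
    then show False using open_not_negligible[OF U] that \<open>\<phi> t \<noteq> 0\<close> by blast
  qed
  have closed0: "\<phi> t = 0" if "t \<in> cbox 0 1" for t
  proof -
    have "(\<chi> i. 1 / 2) \<in> box 0 (1 :: real ^ 'd)" by (simp add: mem_box_cart)
    then have "cbox 0 1 = closure (box 0 (1 :: real ^ 'd))" using closure_box by blast
    moreover have "\<phi> t = 0" if "t \<in> closure (box 0 1)" for t
      by (rule continuous_constant_on_closure[OF \<phi>c open0 that])
    ultimately show ?thesis using that by simp
  qed
  let ?m = "\<chi> i. - \<lfloor>t $ i\<rfloor>"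
  have "\<phi> (t + real_vec ?m) = 0" by (rule closed0) (auto simp: mem_box_cart real_vec_def; linarith)
  then show ?thesis using torus_continuous_translate[OF \<phi>] by metis
qed

section \<open>Absolutely convergent series and identification of the spectral density\<close>

lemma uniform_limit_series:
  fixes c :: "'i \<Rightarrow> complex" and g :: "'i \<Rightarrow> 'x \<Rightarrow> complex"
  assumes "(\<lambda>i. cmod (c i)) summable_on X" "\<And>i x. i \<in> X \<Longrightarrow> cmod (g i x) \<le> 1"
  shows "uniform_limit UNIV (\<lambda>S x. \<Sum>i\<in>S. c i * g i x) (\<lambda>x. \<Sum>\<^sub>\<infinity>i\<in>X. c i * g i x) (finite_subsets_at_top X)"
  by (rule Weierstrass_m_test_general[OF _ assms(1)])
    (use assms(2) in \<open>auto simp: norm_mult intro: mult_left_le\<close>)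

text \<open>The second clause, smallness of all absolute sums outside \<open>S0\<close>, later
  controls \<open>L\<^sup>2\<close> norms of differences of partial sums.\<close>

lemma series_approx:
  fixes c :: "'i \<Rightarrow> complex" and g :: "'i \<Rightarrow> 'x \<Rightarrow> complex"
  assumes c: "(\<lambda>i. cmod (c i)) summable_on X" and g: "\<And>i x. i \<in> X \<Longrightarrow> cmod (g i x) \<le> 1" and e: "0 < e"
  shows "\<exists>S0. finite S0 \<and> S0 \<subseteq> X \<and>
    (\<forall>S x. finite S \<longrightarrow> S0 \<subseteq> S \<longrightarrow> S \<subseteq> X \<longrightarrow> cmod ((\<Sum>i\<in>S. c i * g i x) - (\<Sum>\<^sub>\<infinity>i\<in>X. c i * g i x)) < e) \<and>
    (\<forall>S. finite S \<longrightarrow> S \<subseteq> X - S0 \<longrightarrow> (\<Sum>i\<in>S. cmod (c i)) \<le> e)"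
proof -
  have "\<forall>\<^sub>F S in finite_subsets_at_top X. \<forall>x\<in>UNIV. dist (\<Sum>i\<in>S. c i * g i x) (\<Sum>\<^sub>\<infinity>i\<in>X. c i * g i x) < e"
    using uniform_limit_series[where g = g, OF c g] e unfolding uniform_limit_iff by blast
  then obtain S1 where S1: "finite S1 \<and> S1 \<subseteq> X \<and> (\<forall>S. finite S \<and> S1 \<subseteq> S \<and> S \<subseteq> X \<longrightarrow>
      (\<forall>x\<in>UNIV. dist (\<Sum>i\<in>S. c i * g i x) (\<Sum>\<^sub>\<infinity>i\<in>X. c i * g i x) < e))"
    unfolding eventually_finite_subsets_at_top ..
  have "((\<lambda>S. \<Sum>i\<in>S. cmod (c i)) \<longlongrightarrow> (\<Sum>\<^sub>\<infinity>i\<in>X. cmod (c i))) (finite_subsets_at_top X)"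
    using infsum_tendsto[OF c] .
  then have "\<forall>\<^sub>F S in finite_subsets_at_top X. dist (\<Sum>i\<in>S. cmod (c i)) (\<Sum>\<^sub>\<infinity>i\<in>X. cmod (c i)) < e"
    using e by (rule tendstoD)
  then obtain S2 where S2: "finite S2 \<and> S2 \<subseteq> X \<and> (\<forall>S. finite S \<and> S2 \<subseteq> S \<and> S \<subseteq> X \<longrightarrow>
      dist (\<Sum>i\<in>S. cmod (c i)) (\<Sum>\<^sub>\<infinity>i\<in>X. cmod (c i)) < e)"
    unfolding eventually_finite_subsets_at_top ..
  show ?thesis
  proof (intro exI[of _ "S1 \<union> S2"] conjI allI impI)
    fix S assume S: "finite S" "S \<subseteq> X - (S1 \<union> S2)"
    have "(\<Sum>i\<in>S2. cmod (c i)) + (\<Sum>i\<in>S. cmod (c i)) = (\<Sum>i\<in>S2 \<union> S. cmod (c i))"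
      using S S2 by (intro sum.union_disjoint[symmetric]) auto
    also have "\<dots> \<le> (\<Sum>\<^sub>\<infinity>i\<in>X. cmod (c i))"
      using S S2 by (intro finite_sum_le_infsum[OF c]) auto
    finally have "(\<Sum>i\<in>S2. cmod (c i)) + (\<Sum>i\<in>S. cmod (c i)) \<le> (\<Sum>\<^sub>\<infinity>i\<in>X. cmod (c i))" .
    moreover have "dist (\<Sum>i\<in>S2. cmod (c i)) (\<Sum>\<^sub>\<infinity>i\<in>X. cmod (c i)) < e"
      using S2 by blast
    ultimately show "(\<Sum>i\<in>S. cmod (c i)) \<le> e" unfolding dist_real_def by linarith
  next
    fix S x assume S: "finite S" "S1 \<union> S2 \<subseteq> S" "S \<subseteq> X"
    show "cmod ((\<Sum>i\<in>S. c i * g i x) - (\<Sum>\<^sub>\<infinity>i\<in>X. c i * g i x)) < e"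
      using S1[THEN conjunct2, THEN conjunct2, rule_format, of S x] S by (simp add: dist_norm)
  qed (use S1 S2 in simp_all)
qed

lemma continuous_on_series:
  fixes c :: "'i \<Rightarrow> complex" and g :: "'i \<Rightarrow> 'x::topological_space \<Rightarrow> complex"
  assumes c: "(\<lambda>i. cmod (c i)) summable_on X" and g: "\<And>i x. i \<in> X \<Longrightarrow> cmod (g i x) \<le> 1"
    and cont: "\<And>i. i \<in> X \<Longrightarrow> continuous_on UNIV (g i)"
  shows "continuous_on UNIV (\<lambda>x. \<Sum>\<^sub>\<infinity>i\<in>X. c i * g i x)"
proof (rule uniform_limit_theorem[OF _ uniform_limit_series[where g = g, OF c g]])
  show "\<forall>\<^sub>F S in finite_subsets_at_top X. continuous_on UNIV (\<lambda>x. \<Sum>i\<in>S. c i * g i x)"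
    using cont by (intro eventually_finite_subsets_at_top_weakI continuous_intros) auto
qed auto

lemma series_summable:
  fixes c :: "'i \<Rightarrow> complex" and g :: "'i \<Rightarrow> complex"
  assumes "(\<lambda>i. cmod (c i)) summable_on X" "\<And>i. i \<in> X \<Longrightarrow> cmod (g i) \<le> 1"
  shows "(\<lambda>i. c i * g i) summable_on X"
proof (rule abs_summable_summable)
  show "(\<lambda>i. cmod (c i * g i)) summable_on X"
    by (rule summable_on_comparison_test[OF assms(1)]) (use assms(2) in \<open>auto simp: norm_mult intro: mult_left_le\<close>)
qed

text \<open>Evenness makes the sum of the series real, so taking \<open>Re\<close> loses nothing.
  The coefficients are computed on partial sums, which are uniformly close.\<close>

lemma torus_series:
  fixes \<gamma> :: "int ^ 'd::finite \<Rightarrow> real"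
  assumes sum: "(\<lambda>m. \<bar>\<gamma> m\<bar>) summable_on UNIV" and even: "\<And>m. \<gamma> (- m) = \<gamma> m"
  defines "\<phi> \<equiv> \<lambda>t. Re (\<Sum>\<^sub>\<infinity>m. of_real (\<gamma> m) * torus_char m t)"
  shows "torus_continuous \<phi>"
    and "(\<integral>t. of_real (\<phi> t) * cnj (torus_char n t) \<partial>torus_haar) = complex_of_real (\<gamma> n)"
proof -
  let ?c = "\<lambda>m. complex_of_real (\<gamma> m)"
  let ?F = "\<lambda>t. \<Sum>\<^sub>\<infinity>m. ?c m * torus_char m t"
  have c: "(\<lambda>m. cmod (?c m)) summable_on UNIV" using sum by simp
  have g: "cmod (torus_char m t) \<le> 1" for m and t :: "real ^ 'd" by (simp add: torus_char_norm)
  have Fc: "continuous_on UNIV ?F" by (rule continuous_on_series[where g = torus_char, OF c g torus_char_cts])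
  then have "continuous_on UNIV \<phi>" unfolding \<phi>_def by (intro continuous_intros)
  moreover have "\<phi> (t + axis i 1) = \<phi> t" for t i by (simp add: \<phi>_def torus_char_periodic)
  ultimately show "torus_continuous \<phi>" by (simp add: torus_continuous_def)
  have "cnj (?F t) = ?F t" for t
  proof -
    have "cnj (?F t) = (\<Sum>\<^sub>\<infinity>m. ?c (- m) * torus_char (- m) t)"
      by (simp add: infsum_cnj[symmetric] torus_char_cnj even)
    also have "\<dots> = ?F t"
      by (rule infsum_reindex_bij_betw[of uminus UNIV UNIV "\<lambda>m. ?c m * torus_char m t"]) (simp add: bij_uminus)
    finally show ?thesis .
  qed
  then have F\<phi>: "complex_of_real (\<phi> t) = ?F t" for t
    unfolding \<phi>_def by (metis Reals_cnj_iff of_real_Re)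
  let ?m = "measure (torus_haar :: (real ^ 'd) measure) (space torus_haar)"
  have "dist (\<integral>t. of_real (\<phi> t) * cnj (torus_char n t) \<partial>torus_haar) (?c n) \<le> 0 + e" if e: "0 < e" for e
  proof -
    define d where "d = e / (?m + 1)"
    have d: "0 < d" "d * ?m \<le> e" using e by (auto simp: d_def field_simps add_pos_nonneg)
    obtain S0 where S0: "finite S0" "S0 \<subseteq> UNIV"
      "\<forall>S t. finite S \<longrightarrow> S0 \<subseteq> S \<longrightarrow> S \<subseteq> UNIV \<longrightarrow> cmod ((\<Sum>m\<in>S. ?c m * torus_char m t) - ?F t) < d"
      using series_approx[where g = torus_char, OF c g d(1)] by (elim exE conjE) (rule that)
    \<comment> \<open>The index \<open>n\<close> is added so that the coefficient of the partial sum
      at \<open>n\<close> is already the exact one.\<close>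
    let ?S = "insert n S0"
    have Sc: "continuous_on UNIV (\<lambda>t. \<Sum>m\<in>?S. ?c m * torus_char m t)"
      by (intro continuous_intros torus_char_cts)
    have "(\<integral>t. (\<Sum>m\<in>?S. ?c m * torus_char m t) * cnj (torus_char n t) \<partial>torus_haar)
        = (\<integral>t. (\<Sum>m\<in>?S. ?c m * torus_char (m - n) t) \<partial>torus_haar)"
      by (simp add: sum_distrib_right mult.assoc torus_char_cnj torus_char_mult)
    also have "\<dots> = (\<Sum>m\<in>?S. ?c m * of_bool (m - n = 0))"
      by (subst Bochner_Integration.integral_sum)
        (auto simp: integral_torus_char intro!: integrable_torus_haar continuous_intros torus_char_cts)
    also have "\<dots> = (\<Sum>m\<in>?S. if m = n then ?c m else 0)" by (intro sum.cong) auto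
    also have "\<dots> = ?c n" using S0(1) by (simp add: sum.delta)
    finally have "dist (\<integral>t. of_real (\<phi> t) * cnj (torus_char n t) \<partial>torus_haar) (?c n)
      = norm (\<integral>t. ?F t * cnj (torus_char n t) - (\<Sum>m\<in>?S. ?c m * torus_char m t) * cnj (torus_char n t) \<partial>torus_haar)"
      unfolding F\<phi> dist_norm
      by (subst Bochner_Integration.integral_diff)
        (auto intro!: integrable_torus_haar continuous_on_mult continuous_on_cnj torus_char_cts Fc Sc simp del: sum.insert)
    also have "\<dots> \<le> (\<integral>t. d \<partial>(torus_haar :: (real ^ 'd) measure))"
    proof (rule norm_integral_le_integral)
      show "integrable torus_haar (\<lambda>t. ?F t * cnj (torus_char n t) - (\<Sum>m\<in>?S. ?c m * torus_char m t) * cnj (torus_char n t))"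
        by (intro integrable_torus_haar continuous_on_diff continuous_on_mult continuous_on_cnj torus_char_cts Fc Sc)
      fix t
      have "cmod ((\<Sum>m\<in>?S. ?c m * torus_char m t) - ?F t) < d" by (rule S0(3)[rule_format]) (use S0(1) in auto)
      then show "norm (?F t * cnj (torus_char n t) - (\<Sum>m\<in>?S. ?c m * torus_char m t) * cnj (torus_char n t)) \<le> d"
        unfolding left_diff_distrib[symmetric] norm_mult by (simp add: torus_char_norm norm_minus_commute)
    qed simp
    also have "\<dots> \<le> e" using d(2) by (simp add: mult.commute)
    finally show ?thesis by simp
  qed
  then have "dist (\<integral>t. of_real (\<phi> t) * cnj (torus_char n t) \<partial>torus_haar) (?c n) \<le> 0" by (rule field_le_epsilon)
  then show "(\<integral>t. of_real (\<phi> t) * cnj (torus_char n t) \<partial>torus_haar) = ?c n" by simp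
qed

text \<open>The definite description is resolved by uniqueness: the difference of two candidates has
  vanishing Fourier coefficients.\<close>

lemma spectral_density_eqI:
  assumes \<phi>: "torus_continuous \<phi>"
    and coeff: "\<And>n. (\<integral>t. of_real (\<phi> t) * cnj (torus_char n t) \<partial>torus_haar)
      = complex_of_real (\<integral>x. f (act A n x) * f x \<partial>M)"
  shows "spectral_density M A f = \<phi>"
  unfolding spectral_density_def
proof (rule the_equality)
  fix \<psi>
  assume *: "torus_continuous \<psi> \<and> (\<forall>n. (\<integral>t. of_real (\<psi> t) * cnj (torus_char n t) \<partial>torus_haar)
      = complex_of_real (\<integral>x. f (act A n x) * f x \<partial>M))"
  have d: "torus_continuous (\<lambda>t. \<psi> t - \<phi> t)"
    using * \<phi> by (auto simp: torus_continuous_def intro: continuous_on_diff)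
  have i: "integrable torus_haar (\<lambda>t. complex_of_real (\<eta> t) * cnj (torus_char n t))" if "torus_continuous \<eta>" for \<eta> n
    using that by (intro integrable_torus_haar continuous_intros torus_char_cts) (simp_all add: torus_continuous_def)
  have "(\<integral>t. of_real (\<psi> t - \<phi> t) * cnj (torus_char n t) \<partial>torus_haar) = (0 :: complex)" for n
    using * coeff[of n] i[OF \<phi>, of n] i[of \<psi> n] by (simp add: left_diff_distrib)
  from torus_continuous_eq_0[OF d this] show "\<psi> = \<phi>" by (simp add: fun_eq_iff)
qed (use \<phi> coeff in auto)

text \<open>The same quadratic form is the variance of a finite weighted sum when \<gamma> is the
  correlation sequence; this is how regularity of the kernels says something about
  variances.\<close>

lemma integral_kernel_finite:
  fixes \<rho> :: "int ^ 'd::finite \<Rightarrow> real"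
  assumes \<phi>: "torus_continuous \<phi>"
    and coeff: "\<And>n. (\<integral>t. of_real (\<phi> t) * cnj (torus_char n t) \<partial>torus_haar) = complex_of_real (\<gamma> n)"
  shows "(\<integral>t. (cmod (\<Sum>l\<in>L. of_real (\<rho> l) * torus_char l t))\<^sup>2 * \<phi> t \<partial>torus_haar)
    = (\<Sum>l\<in>L. \<Sum>m\<in>L. \<rho> l * \<rho> m * \<gamma> (m - l))"
proof -
  have \<phi>c: "continuous_on UNIV \<phi>" using \<phi> by (simp add: torus_continuous_def)
  have "complex_of_real ((cmod (\<Sum>l\<in>L. of_real (\<rho> l) * torus_char l t))\<^sup>2 * \<phi> t)
      = (\<Sum>l\<in>L. \<Sum>m\<in>L. of_real (\<rho> l * \<rho> m) * (of_real (\<phi> t) * cnj (torus_char (m - l) t)))" for t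
  proof -
    have "complex_of_real ((cmod (\<Sum>l\<in>L. of_real (\<rho> l) * torus_char l t))\<^sup>2)
      = (\<Sum>l\<in>L. of_real (\<rho> l) * torus_char l t) * cnj (\<Sum>m\<in>L. of_real (\<rho> m) * torus_char m t)"
      by (rule complex_norm_square)
    also have "\<dots> = (\<Sum>l\<in>L. \<Sum>m\<in>L. of_real (\<rho> l * \<rho> m) * cnj (torus_char (m - l) t))"
    proof -
      have "cnj (torus_char (m - l) t) = torus_char l t * cnj (torus_char m t)" for l m
        by (simp add: torus_char_cnj torus_char_mult)
      then show ?thesis by (simp add: sum_product mult_ac)
    qed
    finally show ?thesis by (simp add: sum_distrib_right sum_distrib_left mult_ac)
  qed
  then have "complex_of_real (\<integral>t. (cmod (\<Sum>l\<in>L. of_real (\<rho> l) * torus_char l t))\<^sup>2 * \<phi> t \<partial>torus_haar)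
    = (\<integral>t. (\<Sum>l\<in>L. \<Sum>m\<in>L. of_real (\<rho> l * \<rho> m) * (of_real (\<phi> t) * cnj (torus_char (m - l) t))) \<partial>torus_haar)"
    by (simp flip: integral_complex_of_real)
  also have "\<dots> = (\<Sum>l\<in>L. \<Sum>m\<in>L. of_real (\<rho> l * \<rho> m) * (\<integral>t. of_real (\<phi> t) * cnj (torus_char (m - l) t) \<partial>torus_haar))"
  proof -
    have i: "integrable torus_haar (\<lambda>t. complex_of_real (\<phi> t) * cnj (torus_char k t))" for k
      by (intro integrable_torus_haar continuous_intros \<phi>c torus_char_cts)
    have i2: "integrable torus_haar (\<lambda>t. c * (complex_of_real (\<phi> t) * cnj (torus_char k t)))" for c k
      by (rule integrable_mult_right[OF i])
    show ?thesis by (simp add: Bochner_Integration.integral_sum i i2 del: of_real_mult)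
  qed
  also have "\<dots> = complex_of_real (\<Sum>l\<in>L. \<Sum>m\<in>L. \<rho> l * \<rho> m * \<gamma> (m - l))"
    by (simp add: coeff)
  finally show ?thesis by (simp only: of_real_eq_iff)
qed

section \<open>Absolutely convergent Fourier series\<close>

context compact_haar_group
begin

lemma uniform_limit_cts: "uniform_limit UNIV p p' sequentially \<Longrightarrow> (\<And>n. cts (p n)) \<Longrightarrow> cts p'"
  by (rule uniform_limit_theorem) auto

lemma bounded_range_cts: "cts p \<Longrightarrow> bounded (range p)"
  using compact_continuous_image[OF _ compact_UNIV] compact_imp_bounded by blast

lemma uniform_limit_mult_cts:
  assumes p: "uniform_limit UNIV p p' sequentially" "\<And>n. cts (p n)"
    and q: "uniform_limit UNIV q q' sequentially" "\<And>n. cts (q n)"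
  shows "uniform_limit UNIV (\<lambda>n x. p n x * q n x) (\<lambda>x. p' x * q' x) sequentially"
  by (rule uniform_lim_mult[OF p(1) q(1)]) (intro bounded_range_cts uniform_limit_cts[OF p] uniform_limit_cts[OF q])+

lemma uniform_limit_cnj:
  fixes p :: "nat \<Rightarrow> 'a \<Rightarrow> complex"
  shows "uniform_limit UNIV p p' sequentially \<Longrightarrow> uniform_limit UNIV (\<lambda>n x. cnj (p n x)) (\<lambda>x. cnj (p' x)) sequentially"
  by (rule bounded_linear.uniform_limit[OF bounded_linear_cnj])

lemma of_real_l2sq: "complex_of_real (l2sq p) = (\<integral>x. p x * cnj (p x) \<partial>M)"
  unfolding l2sq_def integral_complex_of_real[symmetric] complex_norm_square ..

lemma tendsto_l2sq:
  assumes p: "uniform_limit UNIV p p' sequentially" "\<And>n. cts (p n)"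
  shows "(\<lambda>n. l2sq (p n)) \<longlonglongrightarrow> l2sq p'"
proof -
  have c: "cts (\<lambda>x. cnj (p n x))" for n by (intro continuous_intros p)
  have "(\<lambda>n. complex_of_real (l2sq (p n))) \<longlonglongrightarrow> complex_of_real (l2sq p')"
    unfolding of_real_l2sq
    by (rule tendsto_integral_uniform[OF uniform_limit_mult_cts[OF p uniform_limit_cnj[OF p(1)] c]])
      (intro continuous_intros p)
  from tendsto_Re[OF this] show ?thesis by simp
qed

lemma integral_cnj_char_mult:
  assumes "\<gamma> \<in> dual_group" "\<gamma>' \<in> dual_group"
  shows "(\<integral>x. cnj (\<gamma> x) * \<gamma>' x \<partial>M) = of_bool (\<gamma> = \<gamma>')"
proof (cases "\<gamma> = \<gamma>'")
  case True
  have "cnj (\<gamma> x) * \<gamma> x = 1" for x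
    using complex_norm_square[of "\<gamma> x"] char_norm[OF assms(1), of x] by (simp add: mult.commute)
  then show ?thesis using True by (simp add: prob_space)
next
  case False
  then obtain y where y: "\<gamma> y \<noteq> \<gamma>' y" by auto
  have "cnj (\<gamma> y) * \<gamma>' y \<noteq> 1"
  proof
    assume "cnj (\<gamma> y) * \<gamma>' y = 1"
    then have "\<gamma> y * (cnj (\<gamma> y) * \<gamma>' y) = \<gamma> y" by simp
    moreover have "\<gamma> y * cnj (\<gamma> y) = 1"
      using complex_norm_square[of "\<gamma> y"] char_norm[OF assms(1), of y] by simp
    ultimately show False using y by (simp add: mult.assoc[symmetric])
  qed
  moreover have "cts (\<lambda>x. cnj (\<gamma> x) * \<gamma>' x)" by (intro continuous_intros char_cts assms)
  from integral_translate[OF this, of y]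
  have "cnj (\<gamma> y) * \<gamma>' y * (\<integral>x. cnj (\<gamma> x) * \<gamma>' x \<partial>M) = (\<integral>x. cnj (\<gamma> x) * \<gamma>' x \<partial>M)"
    by (simp add: char_add[OF assms(1)] char_add[OF assms(2)] mult_ac flip: integral_mult_right_zero)
  ultimately show ?thesis using False by simp
qed

end

locale ac0_function = mixing_action M A
  for M :: "'a::{topological_ab_group_add,t2_space} measure" and A :: "'d::finite \<Rightarrow> 'a \<Rightarrow> 'a" +
  fixes f :: "'a \<Rightarrow> real"
  assumes f: "f \<in> AC0 M"
begin

definition D :: "('a \<Rightarrow> complex) set" where "D = dual_group - {\<lambda>x. 1}"
definition c :: "('a \<Rightarrow> complex) \<Rightarrow> complex" where "c = fourier_coeff M f"
definition C :: real where "C = (\<Sum>\<^sub>\<infinity>\<gamma>\<in>D. cmod (c \<gamma>))"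
text \<open>A continuous version of \<open>f\<close>, with values that turn out to be real;
  everything except the transfer to \<open>f\<close> is done with it and its real form
  \<open>fr\<close>.\<close>

definition fc :: "'a \<Rightarrow> complex" where "fc x = (\<Sum>\<^sub>\<infinity>\<gamma>\<in>D. c \<gamma> * \<gamma> x)"
definition fr :: "'a \<Rightarrow> real" where "fr x = Re (fc x)"

lemma D_dual: "D \<subseteq> dual_group" "\<gamma> \<in> D \<Longrightarrow> \<gamma> \<in> dual_group" "(\<lambda>x. 1) \<notin> D"
  by (auto simp: D_def)

lemma f_integrable: "integrable M f"
  using f by (simp add: AC0_def)

lemma c_summable: "(\<lambda>\<gamma>. cmod (c \<gamma>)) summable_on D"
  using f D_dual(1) unfolding AC0_def c_def by (auto intro: summable_on_subset_banach)

lemma D_norm: "\<gamma> \<in> D \<Longrightarrow> cmod (\<gamma> x) \<le> 1"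
  using char_norm[of \<gamma> x] D_dual by simp

lemma sum_c_le: "finite S \<Longrightarrow> S \<subseteq> D \<Longrightarrow> (\<Sum>\<gamma>\<in>S. cmod (c \<gamma>)) \<le> C"
  unfolding C_def by (rule finite_sum_le_infsum[OF c_summable]) auto

lemma C_nonneg: "0 \<le> C" unfolding C_def by (rule infsum_nonneg) simp

lemma c_1: "c (\<lambda>x. 1) = 0"
  using f by (simp add: c_def fourier_coeff_def AC0_def)

lemma D_cnj: "\<gamma> \<in> D \<Longrightarrow> (\<lambda>x. cnj (\<gamma> x)) \<in> D"
  using dual_cnj[of \<gamma>] by (auto simp: D_def fun_eq_iff)

lemma c_cnj: "c (\<lambda>x. cnj (\<gamma> x)) = cnj (c \<gamma>)"
  unfolding c_def fourier_coeff_def by (subst Bochner_Integration.integral_cnj[symmetric]) simp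

lemma fc_cts: "cts fc"
  unfolding fc_def[abs_def]
  by (rule continuous_on_series[where g = "\<lambda>\<gamma>. \<gamma>" and c = c and X = D])
    (auto intro: c_summable D_norm char_cts D_dual)

lemma approx:
  assumes "0 < e"
  shows "\<exists>S0. finite S0 \<and> S0 \<subseteq> D \<and>
    (\<forall>S x. finite S \<longrightarrow> S0 \<subseteq> S \<longrightarrow> S \<subseteq> D \<longrightarrow> cmod ((\<Sum>\<gamma>\<in>S. c \<gamma> * \<gamma> x) - fc x) < e) \<and>
    (\<forall>S. finite S \<longrightarrow> S \<subseteq> D - S0 \<longrightarrow> (\<Sum>\<gamma>\<in>S. cmod (c \<gamma>)) \<le> e)"
  unfolding fc_def
  by (rule series_approx[where g = "\<lambda>\<gamma>. \<gamma>" and c = c and X = D])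
    (auto intro: c_summable D_norm assms)

definition S0 :: "nat \<Rightarrow> ('a \<Rightarrow> complex) set" where
  "S0 k = (SOME S0. finite S0 \<and> S0 \<subseteq> D \<and>
    (\<forall>S x. finite S \<longrightarrow> S0 \<subseteq> S \<longrightarrow> S \<subseteq> D \<longrightarrow> cmod ((\<Sum>\<gamma>\<in>S. c \<gamma> * \<gamma> x) - fc x) < 1 / real (Suc k)) \<and>
    (\<forall>S. finite S \<longrightarrow> S \<subseteq> D - S0 \<longrightarrow> (\<Sum>\<gamma>\<in>S. cmod (c \<gamma>)) \<le> 1 / real (Suc k)))"

lemma S0: "finite (S0 k)" "S0 k \<subseteq> D"
    "finite S \<Longrightarrow> S0 k \<subseteq> S \<Longrightarrow> S \<subseteq> D \<Longrightarrow> cmod ((\<Sum>\<gamma>\<in>S. c \<gamma> * \<gamma> x) - fc x) < 1 / real (Suc k)"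
    "finite S \<Longrightarrow> S \<subseteq> D - S0 k \<Longrightarrow> (\<Sum>\<gamma>\<in>S. cmod (c \<gamma>)) \<le> 1 / real (Suc k)"
proof -
  have "0 < 1 / real (Suc k)" by simp
  note P = someI_ex[OF approx[OF this], folded S0_def]
  show "finite (S0 k)" using P by (rule conjunct1)
  note P2 = P[THEN conjunct2]
  show "S0 k \<subseteq> D" using P2 by (rule conjunct1)
  note P3 = P2[THEN conjunct2]
  show "finite S \<Longrightarrow> S0 k \<subseteq> S \<Longrightarrow> S \<subseteq> D \<Longrightarrow> cmod ((\<Sum>\<gamma>\<in>S. c \<gamma> * \<gamma> x) - fc x) < 1 / real (Suc k)"
    by (rule P3[THEN conjunct1, rule_format])
  show "finite S \<Longrightarrow> S \<subseteq> D - S0 k \<Longrightarrow> (\<Sum>\<gamma>\<in>S. cmod (c \<gamma>)) \<le> 1 / real (Suc k)"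
    by (rule P3[THEN conjunct2, rule_format])
qed

text \<open>Closure under conjugation makes \<open>g k\<close> real-valued. The union over all
  \<open>i \<le> k\<close> makes the sets increase, so that \<open>g j - g k\<close> is again a
  partial sum of the series.\<close>

definition S :: "nat \<Rightarrow> ('a \<Rightarrow> complex) set" where
  "S k = (\<Union>i\<le>k. S0 i \<union> (\<lambda>\<gamma> x. cnj (\<gamma> x)) ` S0 i)"

definition g :: "nat \<Rightarrow> 'a \<Rightarrow> complex" where
  "g k x = (\<Sum>\<gamma>\<in>S k. c \<gamma> * \<gamma> x)"

lemma S_finite: "finite (S k)" and S_D: "S k \<subseteq> D" and S_mono: "j \<le> k \<Longrightarrow> S j \<subseteq> S k"
    and S_cnj: "\<gamma> \<in> S k \<Longrightarrow> (\<lambda>x. cnj (\<gamma> x)) \<in> S k" and S0_S: "S0 k \<subseteq> S k"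
proof -
  show "finite (S k)" unfolding S_def using S0(1) by auto
  show "S k \<subseteq> D" unfolding S_def using S0(2) D_cnj by blast
  show "j \<le> k \<Longrightarrow> S j \<subseteq> S k" unfolding S_def by (rule UN_mono) auto
  show "S0 k \<subseteq> S k" unfolding S_def by auto
  show "\<gamma> \<in> S k \<Longrightarrow> (\<lambda>x. cnj (\<gamma> x)) \<in> S k"
    unfolding S_def by auto
qed

lemma S_dual: "S k \<subseteq> dual_group" using S_D D_dual by blast

lemma g_cts: "cts (g k)"
  unfolding g_def[abs_def] by (intro continuous_intros char_cts) (use S_dual in blast)

lemma g_uniform: "uniform_limit UNIV g fc sequentially"
  unfolding uniform_limit_iff
proof (intro allI impI)
  fix e :: real assume "0 < e"
  then obtain N where N: "1 / real (Suc N) < e" using nat_approx_posE by metis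
  have "\<forall>x\<in>UNIV. dist (g n x) (fc x) < e" if "N \<le> n" for n
  proof
    fix x
    have "dist (g n x) (fc x) < 1 / real (Suc n)"
      unfolding g_def dist_norm by (rule S0(3)[OF S_finite S0_S S_D])
    also have "\<dots> \<le> 1 / real (Suc N)" using that by (intro divide_left_mono) auto
    finally show "dist (g n x) (fc x) < e" using N by simp
  qed
  then show "\<forall>\<^sub>F n in sequentially. \<forall>x\<in>UNIV. dist (g n x) (fc x) < e"
    unfolding eventually_sequentially by blast
qed

lemma g_real: "g k x \<in> \<real>"
proof -
  let ?h = "\<lambda>\<gamma> x. cnj (\<gamma> x) :: complex"
  have "bij_betw ?h (S k) (S k)"
    by (rule bij_betw_byWitness[of _ ?h]) (auto intro: S_cnj)
  from sum.reindex_bij_betw[OF this, of "\<lambda>\<gamma>. c \<gamma> * \<gamma> x"]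
  have "cnj (g k x) = g k x" by (simp add: g_def c_cnj)
  then show ?thesis by (simp add: Reals_cnj_iff)
qed

lemma fc_real: "complex_of_real (fr x) = fc x"
proof -
  have "(\<lambda>k. g k x) \<longlonglongrightarrow> fc x" using tendsto_uniform_limitI[OF g_uniform] by simp
  then have "(\<lambda>k. Im (g k x)) \<longlonglongrightarrow> Im (fc x)" by (rule tendsto_Im)
  moreover have "Im (g k x) = 0" for k using g_real[of k x] by (simp add: complex_is_Real_iff)
  ultimately have "Im (fc x) = 0" by (simp add: LIMSEQ_const_iff)
  then show ?thesis by (simp add: fr_def complex_eq_iff)
qed

lemma fr_cts: "continuous_on UNIV fr"
  unfolding fr_def[abs_def] by (intro continuous_intros fc_cts)

lemma fourier_coeff_fc:
  assumes \<gamma>: "\<gamma> \<in> dual_group"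
  shows "(\<integral>x. cnj (\<gamma> x) * fc x \<partial>M) = c \<gamma>"
proof -
  have gk: "(\<integral>x. cnj (\<gamma> x) * g k x \<partial>M) = (if \<gamma> \<in> S k then c \<gamma> else 0)" for k
  proof -
    have "(\<integral>x. cnj (\<gamma> x) * g k x \<partial>M) = (\<Sum>\<gamma>'\<in>S k. \<integral>x. c \<gamma>' * (cnj (\<gamma> x) * \<gamma>' x) \<partial>M)"
      unfolding g_def sum_distrib_left mult.left_commute[of "cnj _"]
    proof (rule Bochner_Integration.integral_sum)
      fix \<gamma>' assume "\<gamma>' \<in> S k"
      then have "\<gamma>' \<in> dual_group" using S_dual by blast
      then show "integrable M (\<lambda>x. c \<gamma>' * (cnj (\<gamma> x) * \<gamma>' x))"
        by (intro integrable_continuous continuous_intros char_cts \<gamma>)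
    qed
    also have "\<dots> = (\<Sum>\<gamma>'\<in>S k. if \<gamma>' = \<gamma> then c \<gamma>' else 0)"
    proof (rule sum.cong[OF refl])
      fix \<gamma>' assume "\<gamma>' \<in> S k"
      then have "\<gamma>' \<in> dual_group" using S_dual by blast
      from integral_cnj_char_mult[OF \<gamma> this]
      show "(\<integral>x. c \<gamma>' * (cnj (\<gamma> x) * \<gamma>' x) \<partial>M) = (if \<gamma>' = \<gamma> then c \<gamma>' else 0)" by auto
    qed
    also have "\<dots> = (if \<gamma> \<in> S k then c \<gamma> else 0)" using S_finite by simp
    finally show ?thesis .
  qed
  have "(\<lambda>k. \<integral>x. cnj (\<gamma> x) * g k x \<partial>M) \<longlonglongrightarrow> (\<integral>x. cnj (\<gamma> x) * fc x \<partial>M)"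
    by (intro tendsto_integral_uniform uniform_limit_mult_cts uniform_limit_const g_uniform continuous_intros char_cts \<gamma> g_cts)
  moreover have "(\<lambda>k. if \<gamma> \<in> S k then c \<gamma> else 0) \<longlonglongrightarrow> c \<gamma>"
  proof (cases "\<gamma> \<in> D")
    case False
    then have "\<gamma> = (\<lambda>x. 1)" using \<gamma> by (simp add: D_def)
    then have "c \<gamma> = 0" using c_1 by simp
    then show ?thesis by (simp cong: if_cong)
  next
    case True
    have "dist (if \<gamma> \<in> S k then c \<gamma> else 0) (c \<gamma>) \<le> 1 / real (Suc k)" for k
    proof (cases "\<gamma> \<in> S k")
      case False
      \<comment> \<open>The tail bound for finite subsets of \<open>D - S0 k\<close>, applied to a
        singleton, bounds a single missing coefficient.\<close>
      then have "{\<gamma>} \<subseteq> D - S0 k" using True S0_S by auto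
      from S0(4)[OF _ this] show ?thesis using False by simp
    qed simp
    then show ?thesis
      by (intro metric_tendsto_imp_tendsto[OF LIMSEQ_inverse_real_of_nat] always_eventually allI)
        (simp add: dist_real_def inverse_eq_divide)
  qed
  ultimately show ?thesis unfolding gk by (rule LIMSEQ_unique)
qed

text \<open>Both functions have the same Fourier coefficients, also at the constant character, which
  the series omits: there the coefficient is the mean of \<open>f\<close>.\<close>

lemma f_eq_fr: "AE x in M. f x = fr x"
proof -
  have "AE x in M. complex_of_real (f x) - fc x = 0"
  proof (rule AE_eq_0_if_fourier_coeffs_0)
    show "integrable M (\<lambda>x. complex_of_real (f x) - fc x)"
      using f_integrable integrable_continuous[OF fc_cts] by simp
    fix \<gamma> :: "'a \<Rightarrow> complex" assume \<gamma>: "\<gamma> \<in> dual_group"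
    have i1: "integrable M (\<lambda>x. cnj (\<gamma> x) * complex_of_real (f x))"
      using f_integrable by (intro integrable_continuous_mult[OF compact_UNIV _ sets_M] continuous_intros char_cts \<gamma>) simp
    have i2: "integrable M (\<lambda>x. cnj (\<gamma> x) * fc x)"
      by (intro integrable_continuous continuous_intros char_cts \<gamma> fc_cts)
    show "(\<integral>x. cnj (\<gamma> x) * (complex_of_real (f x) - fc x) \<partial>M) = 0"
      using fourier_coeff_fc[OF \<gamma>] i1 i2 by (simp add: right_diff_distrib c_def fourier_coeff_def)
  qed
  then show ?thesis by eventually_elim (simp add: fc_real[symmetric])
qed

text \<open>One null set has to serve all translates, as the weighted sum runs over the whole
  lattice; invariance of \<open>M\<close> gives each translate and countability their
  conjunction.\<close>

lemma f_act_eq_fr: "AE x in M. \<forall>l. f (act A l x) = fr (act A l x)"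
proof -
  have "AE x in M. f (act A l x) = fr (act A l x)" for l
  proof -
    have eq: "distr M M (act A l) = M"
      using distr_automorphism[OF act_automorphism[of l]] distr_cong[of M M M borel "act A l" "act A l"]
      by (simp add: sets_M)
    have "AE x in distr M M (act A l). f x = fr x" unfolding eq by (rule f_eq_fr)
    then show ?thesis by (rule AE_distrD[OF act_measurable])
  qed
  then show ?thesis by (simp add: AE_all_countable)
qed

lemma fr_le_C: "\<bar>fr x\<bar> \<le> C"
proof -
  have "cmod (fc x) \<le> C"
    unfolding fc_def C_def
  proof (rule norm_infsum_le)
    show "((\<lambda>\<gamma>. c \<gamma> * \<gamma> x) has_sum (\<Sum>\<^sub>\<infinity>\<gamma>\<in>D. c \<gamma> * \<gamma> x)) D"
      by (intro has_sum_infsum series_summable[OF c_summable] D_norm)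
    show "((\<lambda>\<gamma>. cmod (c \<gamma>)) has_sum (\<Sum>\<^sub>\<infinity>\<gamma>\<in>D. cmod (c \<gamma>))) D"
      by (intro has_sum_infsum c_summable)
  qed (auto simp: norm_mult intro: mult_left_le D_norm)
  then show ?thesis unfolding fc_real[symmetric] by simp
qed

end

section \<open>Finite weighted sums\<close>

context mixing_action
begin

definition wsum :: "(int ^ 'd) set \<Rightarrow> (int ^ 'd \<Rightarrow> real) \<Rightarrow> ('a \<Rightarrow> complex) \<Rightarrow> 'a \<Rightarrow> complex" where
  "wsum L \<rho> h x = (\<Sum>l\<in>L. of_real (\<rho> l) * h (act A l x))"

lemma wsum_cts: "cts h \<Longrightarrow> cts (wsum L \<rho> h)"
  unfolding wsum_def[abs_def] by (intro continuous_intros continuous_on_comp_UNIV[OF _ act_cts])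

lemma wsum_diff: "wsum L \<rho> (\<lambda>x. h x - k x) x = wsum L \<rho> h x - wsum L \<rho> k x"
  by (simp add: wsum_def sum_subtractf right_diff_distrib)

lemma wsum_uniform:
  assumes "uniform_limit UNIV h h' sequentially"
  shows "uniform_limit UNIV (\<lambda>n. wsum L \<rho> (h n)) (wsum L \<rho> h') sequentially"
  unfolding wsum_def[abs_def]
proof (induction L rule: infinite_finite_induct)
  case (insert l L)
  have "uniform_limit UNIV (\<lambda>n x. of_real (\<rho> l) * h n (act A l x)) (\<lambda>x. of_real (\<rho> l) * h' (act A l x)) sequentially"
    by (rule bounded_linear.uniform_limit[OF bounded_linear_mult_right uniform_limit_comp[OF assms]])
  from uniform_limit_add[OF this insert.IH] show ?case using insert.hyps by simp
qed (simp_all add: uniform_limit_const)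

lemma integral_orbit_pair:
  assumes "\<gamma> \<in> dual_group" "\<gamma> \<noteq> (\<lambda>x. 1)"
  shows "(\<integral>x. \<gamma> (act A l x) * cnj (\<gamma> (act A m x)) \<partial>M) = of_bool (l = m)"
proof -
  have "(\<integral>x. cnj (\<gamma> (act A m x)) * \<gamma> (act A l x) \<partial>M)
      = of_bool ((\<lambda>x. \<gamma> (act A m x)) = (\<lambda>x. \<gamma> (act A l x)))"
    by (rule integral_cnj_char_mult) (intro dual_act assms)+
  moreover have "(\<lambda>x. \<gamma> (act A m x)) = (\<lambda>x. \<gamma> (act A l x)) \<longleftrightarrow> l = m"
    using act_orbit_free[OF assms, of l m] by (auto simp: fun_eq_iff)
  ultimately show ?thesis by (simp add: mult.commute)
qed

text \<open>The translates of a nontrivial character along the action are pairwise distinct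
  characters, hence orthonormal.\<close>

lemma l2sq_wsum_char:
  assumes \<gamma>: "\<gamma> \<in> dual_group" "\<gamma> \<noteq> (\<lambda>x. 1)" and L: "finite L"
  shows "l2sq (wsum L \<rho> \<gamma>) = (\<Sum>l\<in>L. (\<rho> l)\<^sup>2)"
proof -
  have "wsum L \<rho> \<gamma> x * cnj (wsum L \<rho> \<gamma> x)
      = (\<Sum>l\<in>L. \<Sum>m\<in>L. of_real (\<rho> l * \<rho> m) * (\<gamma> (act A l x) * cnj (\<gamma> (act A m x))))" for x
    by (simp add: wsum_def sum_product mult_ac)
  then have "complex_of_real (l2sq (wsum L \<rho> \<gamma>))
      = (\<integral>x. (\<Sum>l\<in>L. \<Sum>m\<in>L. of_real (\<rho> l * \<rho> m) * (\<gamma> (act A l x) * cnj (\<gamma> (act A m x)))) \<partial>M)"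
    unfolding of_real_l2sq by simp
  also have "\<dots> = (\<Sum>l\<in>L. \<Sum>m\<in>L. of_real (\<rho> l * \<rho> m) * (\<integral>x. \<gamma> (act A l x) * cnj (\<gamma> (act A m x)) \<partial>M))"
  proof -
    have i: "integrable M (\<lambda>x. z * (\<gamma> (act A l x) * cnj (\<gamma> (act A m x))))" for z l m
      by (intro integrable_continuous continuous_intros continuous_on_comp_UNIV[OF char_cts[OF \<gamma>(1)] act_cts])
    show ?thesis by (simp add: Bochner_Integration.integral_sum i del: of_real_mult)
  qed
  also have "\<dots> = (\<Sum>l\<in>L. \<Sum>m\<in>L. if m = l then of_real (\<rho> l * \<rho> m) else 0)"
    unfolding integral_orbit_pair[OF \<gamma>] by (intro sum.cong) auto
  also have "\<dots> = complex_of_real (\<Sum>l\<in>L. (\<rho> l)\<^sup>2)"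
    using L by (simp add: power2_eq_square)
  finally show ?thesis by (simp only: of_real_eq_iff)
qed

text \<open>The pointwise Cauchy-Schwarz inequality with weights \<open>cmod (b \<gamma>)\<close> replaces the triangle
  inequality in \<open>L\<^sup>2\<close>.\<close>

lemma l2sq_wsum_le:
  assumes S: "finite S" "S \<subseteq> dual_group" "(\<lambda>x. 1) \<notin> S" and L: "finite L"
  shows "l2sq (wsum L \<rho> (\<lambda>x. \<Sum>\<gamma>\<in>S. b \<gamma> * \<gamma> x)) \<le> (\<Sum>\<gamma>\<in>S. cmod (b \<gamma>))\<^sup>2 * (\<Sum>l\<in>L. (\<rho> l)\<^sup>2)"
proof -
  let ?b = "\<Sum>\<gamma>\<in>S. cmod (b \<gamma>)"
  have gc: "cts \<gamma>" if "\<gamma> \<in> S" for \<gamma> using that S(2) by (auto intro: char_cts)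
  have bound: "(cmod (wsum L \<rho> (\<lambda>x. \<Sum>\<gamma>\<in>S. b \<gamma> * \<gamma> x) x))\<^sup>2
      \<le> ?b * (\<Sum>\<gamma>\<in>S. cmod (b \<gamma>) * (cmod (wsum L \<rho> \<gamma> x))\<^sup>2)" for x
  proof -
    have "wsum L \<rho> (\<lambda>x. \<Sum>\<gamma>\<in>S. b \<gamma> * \<gamma> x) x = (\<Sum>\<gamma>\<in>S. b \<gamma> * wsum L \<rho> \<gamma> x)"
      unfolding wsum_def sum_distrib_left by (subst sum.swap) (simp add: mult.left_commute)
    then have "cmod (wsum L \<rho> (\<lambda>x. \<Sum>\<gamma>\<in>S. b \<gamma> * \<gamma> x) x) \<le> (\<Sum>\<gamma>\<in>S. cmod (b \<gamma>) * cmod (wsum L \<rho> \<gamma> x))"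
      by (simp add: sum_norm_le norm_mult)
    also have "\<dots> = (\<Sum>\<gamma>\<in>S. sqrt (cmod (b \<gamma>)) * (sqrt (cmod (b \<gamma>)) * cmod (wsum L \<rho> \<gamma> x)))"
      by (simp add: mult.assoc[symmetric])
    finally have "(cmod (wsum L \<rho> (\<lambda>x. \<Sum>\<gamma>\<in>S. b \<gamma> * \<gamma> x) x))\<^sup>2
      \<le> (\<Sum>\<gamma>\<in>S. sqrt (cmod (b \<gamma>)) * (sqrt (cmod (b \<gamma>)) * cmod (wsum L \<rho> \<gamma> x)))\<^sup>2"
      by (intro power_mono) auto
    also have "\<dots> \<le> (\<Sum>\<gamma>\<in>S. (sqrt (cmod (b \<gamma>)))\<^sup>2) * (\<Sum>\<gamma>\<in>S. (sqrt (cmod (b \<gamma>)) * cmod (wsum L \<rho> \<gamma> x))\<^sup>2)"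
      by (rule Cauchy_Schwarz_ineq_sum)
    finally show ?thesis by (simp add: power_mult_distrib)
  qed
  have "l2sq (wsum L \<rho> (\<lambda>x. \<Sum>\<gamma>\<in>S. b \<gamma> * \<gamma> x)) \<le> (\<integral>x. ?b * (\<Sum>\<gamma>\<in>S. cmod (b \<gamma>) * (cmod (wsum L \<rho> \<gamma> x))\<^sup>2) \<partial>M)"
    unfolding l2sq_def
    by (intro integral_mono integrable_continuous continuous_intros wsum_cts gc bound)
  also have "\<dots> = ?b * (\<Sum>\<gamma>\<in>S. cmod (b \<gamma>) * l2sq (wsum L \<rho> \<gamma>))"
  proof -
    have i: "integrable M (\<lambda>x. cmod (b \<gamma>) * (cmod (wsum L \<rho> \<gamma> x))\<^sup>2)" if "\<gamma> \<in> S" for \<gamma>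
      by (intro integrable_continuous continuous_intros wsum_cts gc that)
    have "(\<integral>x. (\<Sum>\<gamma>\<in>S. cmod (b \<gamma>) * (cmod (wsum L \<rho> \<gamma> x))\<^sup>2) \<partial>M) = (\<Sum>\<gamma>\<in>S. cmod (b \<gamma>) * l2sq (wsum L \<rho> \<gamma>))"
      by (subst Bochner_Integration.integral_sum[OF i]) (simp_all add: l2sq_def)
    then show ?thesis by simp
  qed
  also have "(\<Sum>\<gamma>\<in>S. cmod (b \<gamma>) * l2sq (wsum L \<rho> \<gamma>)) = ?b * (\<Sum>l\<in>L. (\<rho> l)\<^sup>2)"
    unfolding sum_distrib_right
  proof (rule sum.cong[OF refl])
    fix \<gamma> assume "\<gamma> \<in> S"
    then have "\<gamma> \<in> dual_group" "\<gamma> \<noteq> (\<lambda>x. 1)" using S by auto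
    from l2sq_wsum_char[OF this L] show "cmod (b \<gamma>) * l2sq (wsum L \<rho> \<gamma>) = cmod (b \<gamma>) * (\<Sum>l\<in>L. (\<rho> l)\<^sup>2)" by simp
  qed
  finally show ?thesis by (simp add: power2_eq_square mult.assoc)
qed

end

text \<open>The function \<open>cis\<close> is 1-Lipschitz. The bound serves both the passage from
  \<open>fc\<close> to \<open>g k\<close> and the truncation of the weights.\<close>

lemma (in prob_space) char_dist_le:
  assumes X: "random_variable borel X" and Y: "random_variable borel Y"
    and XY: "integrable M (\<lambda>x. \<bar>X x - Y x\<bar>)"
  shows "cmod (char (distr M borel X) t - char (distr M borel Y) t) \<le> \<bar>t\<bar> * expectation (\<lambda>x. \<bar>X x - Y x\<bar>)"
proof -
  have ex: "char (distr M borel Z) t = (\<integral>x. cis (t * Z x) \<partial>M)" if Z: "random_variable borel Z" for Z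
    unfolding char_def using Z by (subst integral_distr) (auto simp: cis_conv_exp)
  have ei: "integrable M (\<lambda>x. cis (t * Z x))" if Z: "random_variable borel Z" for Z
  proof (rule integrable_const_bound[of _ 1])
    have "continuous_on UNIV (\<lambda>z. cis (t * z))" by (intro continuous_intros)
    from measurable_compose[OF Z borel_measurable_continuous_onI[OF this]]
    show "random_variable borel (\<lambda>x. cis (t * Z x))" .
  qed simp
  have lip: "cmod (cis a - cis b) \<le> \<bar>a - b\<bar>" for a b :: real
  proof -
    have "cis a - cis b = cis b * (cis (a - b) - 1)" by (simp add: right_diff_distrib cis_mult)
    then have "cmod (cis a - cis b) = cmod (cis (a - b) - 1)" by (simp add: norm_mult)
    also have "\<dots> \<le> \<bar>a - b\<bar>" using iexp_approx1[of "a - b" 0] by (simp add: cis_conv_exp)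
    finally show ?thesis .
  qed
  have "cmod (char (distr M borel X) t - char (distr M borel Y) t) = cmod (\<integral>x. cis (t * X x) - cis (t * Y x) \<partial>M)"
    by (simp add: ex X Y ei)
  also have "\<dots> \<le> (\<integral>x. \<bar>t\<bar> * \<bar>X x - Y x\<bar> \<partial>M)"
  proof (rule norm_integral_le_integral)
    fix x show "cmod (cis (t * X x) - cis (t * Y x)) \<le> \<bar>t\<bar> * \<bar>X x - Y x\<bar>"
      using lip[of "t * X x" "t * Y x"] by (simp add: right_diff_distrib[symmetric] abs_mult)
  qed (use ei X Y XY in auto)
  finally show ?thesis by simp
qed

section \<open>Correlations and approximation by trigonometric polynomials in
  \<open>L\<^sup>2\<close>\<close>

context ac0_function
begin

definition corr :: "int ^ 'd \<Rightarrow> real" where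
  "corr m = (\<integral>x. f (act A m x) * f x \<partial>M)"

lemma corr_fr: "corr m = (\<integral>x. fr (act A m x) * fr x \<partial>M)"
  unfolding corr_def
proof (rule integral_cong_AE)
  have fm: "f \<in> borel_measurable M" using f_integrable by simp
  show "(\<lambda>x. f (act A m x) * f x) \<in> borel_measurable M"
    by (intro borel_measurable_times measurable_compose[OF act_measurable] fm)
  show "(\<lambda>x. fr (act A m x) * fr x) \<in> borel_measurable M"
    by (intro measurable_continuous continuous_intros continuous_on_comp_UNIV[OF fr_cts act_cts] fr_cts)
  show "AE x in M. f (act A m x) * f x = fr (act A m x) * fr x"
    using f_act_eq_fr f_eq_fr by eventually_elim simp
qed

lemma integral_fr_shift: "(\<integral>x. fr (act A l x) * fr (act A m x) \<partial>M) = corr (l - m)"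
proof -
  have "(\<integral>x. fr (act A (l - m) x) * fr x \<partial>M) = (\<integral>x. fr (act A (l - m) (act A m x)) * fr (act A m x) \<partial>M)"
    by (rule integral_automorphism[OF act_automorphism, symmetric])
      (intro measurable_continuous continuous_intros continuous_on_comp_UNIV[OF fr_cts act_cts] fr_cts)
  then show ?thesis by (simp add: corr_fr act_add')
qed

lemma corr_even: "corr (- m) = corr m"
  using integral_fr_shift[of 0 m] by (simp add: corr_fr[of m] act_0 mult.commute)

text \<open>The correlations of \<open>g k\<close> are double sums over pairs of characters, and a
  pair contributes for at most one \<open>m\<close>. Summing over any finite set of \<open>m\<close>
  first bounds the total by \<open>C\<^sup>2\<close>, uniformly in \<open>k\<close>.\<close>

lemma corr_summable: "(\<lambda>m. \<bar>corr m\<bar>) summable_on UNIV"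
proof (rule nonneg_bounded_partial_sums_imp_summable_on)
  let ?G = "\<lambda>k m. \<integral>x. g k (act A m x) * cnj (g k x) \<partial>M"
  have lim: "(\<lambda>k. ?G k m) \<longlonglongrightarrow> complex_of_real (corr m)" for m
  proof -
    have "(\<lambda>k. ?G k m) \<longlonglongrightarrow> (\<integral>x. fc (act A m x) * cnj (fc x) \<partial>M)"
      by (intro tendsto_integral_uniform uniform_limit_mult_cts uniform_limit_comp[OF g_uniform] uniform_limit_cnj
          g_uniform continuous_intros g_cts continuous_on_comp_UNIV[OF g_cts act_cts])
    also have "(\<integral>x. fc (act A m x) * cnj (fc x) \<partial>M) = complex_of_real (corr m)"
      by (simp add: fc_real[symmetric] corr_fr del: of_real_mult flip: of_real_mult)
    finally show ?thesis .
  qed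
  show "\<forall>\<^sub>F F in finite_subsets_at_top UNIV. (\<Sum>m\<in>F. \<bar>corr m\<bar>) \<le> C\<^sup>2"
  proof (rule eventually_finite_subsets_at_top_weakI)
    fix F :: "(int ^ 'd) set" assume F: "finite F"
    have "(\<Sum>m\<in>F. cmod (?G k m)) \<le> C\<^sup>2" for k
    proof -
      let ?Q = "\<lambda>\<gamma> \<gamma>' m. (\<lambda>x. \<gamma> (act A m x)) = (\<gamma>' :: 'a \<Rightarrow> complex)"
      have G: "?G k m = (\<Sum>\<gamma>\<in>S k. \<Sum>\<gamma>'\<in>S k. c \<gamma> * cnj (c \<gamma>') * of_bool (?Q \<gamma> \<gamma>' m))" for m
      proof -
        have dg: "\<gamma> \<in> dual_group" if "\<gamma> \<in> S k" for \<gamma> using that S_dual by blast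
        have "?G k m = (\<integral>x. (\<Sum>\<gamma>\<in>S k. \<Sum>\<gamma>'\<in>S k. c \<gamma> * cnj (c \<gamma>') * (cnj (\<gamma>' x) * \<gamma> (act A m x))) \<partial>M)"
          unfolding g_def cnj_sum sum_product complex_cnj_mult by (simp only: mult_ac)
        also have "\<dots> = (\<Sum>\<gamma>\<in>S k. \<Sum>\<gamma>'\<in>S k. c \<gamma> * cnj (c \<gamma>') * (\<integral>x. cnj (\<gamma>' x) * \<gamma> (act A m x) \<partial>M))"
        proof -
          have i: "integrable M (\<lambda>x. z * (cnj (\<gamma>' x) * \<gamma> (act A m x)))" if "\<gamma> \<in> S k" "\<gamma>' \<in> S k" for z \<gamma> \<gamma>'
            by (intro integrable_continuous continuous_intros continuous_on_comp_UNIV[OF char_cts act_cts] char_cts dg that)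
          show ?thesis by (simp add: Bochner_Integration.integral_sum i)
        qed
        also have "\<dots> = (\<Sum>\<gamma>\<in>S k. \<Sum>\<gamma>'\<in>S k. c \<gamma> * cnj (c \<gamma>') * of_bool (?Q \<gamma> \<gamma>' m))"
        proof (intro sum.cong refl)
          fix \<gamma> \<gamma>' assume "\<gamma> \<in> S k" "\<gamma>' \<in> S k"
          then show "c \<gamma> * cnj (c \<gamma>') * (\<integral>x. cnj (\<gamma>' x) * \<gamma> (act A m x) \<partial>M) = c \<gamma> * cnj (c \<gamma>') * of_bool (?Q \<gamma> \<gamma>' m)"
            using integral_cnj_char_mult[OF dg dual_act[OF dg]] by (auto simp: eq_commute)
        qed
        finally show ?thesis .
      qed
      have "(\<Sum>m\<in>F. cmod (?G k m)) \<le> (\<Sum>m\<in>F. \<Sum>\<gamma>\<in>S k. \<Sum>\<gamma>'\<in>S k. cmod (c \<gamma>) * cmod (c \<gamma>') * of_bool (?Q \<gamma> \<gamma>' m))"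
      proof (rule sum_mono)
        fix m
        have "cmod (?G k m) \<le> (\<Sum>\<gamma>\<in>S k. cmod (\<Sum>\<gamma>'\<in>S k. c \<gamma> * cnj (c \<gamma>') * of_bool (?Q \<gamma> \<gamma>' m)))"
          unfolding G by (rule norm_sum)
        also have "\<dots> \<le> (\<Sum>\<gamma>\<in>S k. \<Sum>\<gamma>'\<in>S k. cmod (c \<gamma>) * cmod (c \<gamma>') * of_bool (?Q \<gamma> \<gamma>' m))"
          by (intro sum_mono order_trans[OF norm_sum]) (auto simp: norm_mult intro!: sum_mono)
        finally show "cmod (?G k m) \<le> (\<Sum>\<gamma>\<in>S k. \<Sum>\<gamma>'\<in>S k. cmod (c \<gamma>) * cmod (c \<gamma>') * of_bool (?Q \<gamma> \<gamma>' m))" .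
      qed
      also have "\<dots> = (\<Sum>\<gamma>\<in>S k. \<Sum>\<gamma>'\<in>S k. \<Sum>m\<in>F. cmod (c \<gamma>) * cmod (c \<gamma>') * of_bool (?Q \<gamma> \<gamma>' m))"
        by (subst sum.swap) (intro sum.cong refl, rule sum.swap)
      also have "\<dots> \<le> (\<Sum>\<gamma>\<in>S k. \<Sum>\<gamma>'\<in>S k. cmod (c \<gamma>) * cmod (c \<gamma>') * 1)"
      proof (intro sum_mono)
        fix \<gamma> \<gamma>' assume \<gamma>: "\<gamma> \<in> S k" "\<gamma>' \<in> S k"
        have nt: "\<gamma> \<in> dual_group" "\<gamma> \<noteq> (\<lambda>x. 1)" using \<gamma> S_D[of k] D_dual by auto
        \<comment> \<open>Two such \<open>m\<close> would give equal translates of \<gamma>, against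
          freeness of its orbit.\<close>
        have "card {m \<in> F. ?Q \<gamma> \<gamma>' m} \<le> 1"
          unfolding card_le_Suc0_iff_eq[OF finite_subset[OF _ F], of "{m \<in> F. ?Q \<gamma> \<gamma>' m}", simplified] One_nat_def
          using act_orbit_free[OF nt] by (metis (mono_tags, lifting) mem_Collect_eq)
        moreover have "(\<Sum>m\<in>F. of_bool (?Q \<gamma> \<gamma>' m)) = real (card {m \<in> F. ?Q \<gamma> \<gamma>' m})"
          using F by (simp add: sum_of_bool_eq Int_def)
        ultimately have "(\<Sum>m\<in>F. of_bool (?Q \<gamma> \<gamma>' m)) \<le> (1 :: real)" by simp
        then show "(\<Sum>m\<in>F. cmod (c \<gamma>) * cmod (c \<gamma>') * of_bool (?Q \<gamma> \<gamma>' m)) \<le> cmod (c \<gamma>) * cmod (c \<gamma>') * 1"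
          unfolding sum_distrib_left[symmetric] by (rule mult_left_mono) simp
      qed
      also have "\<dots> = (\<Sum>\<gamma>\<in>S k. cmod (c \<gamma>))\<^sup>2" by (simp add: power2_eq_square sum_product)
      also have "\<dots> \<le> C\<^sup>2" by (intro power_mono sum_c_le S_finite S_D sum_nonneg) auto
      finally show ?thesis .
    qed
    moreover have "(\<lambda>k. \<Sum>m\<in>F. cmod (?G k m)) \<longlonglongrightarrow> (\<Sum>m\<in>F. cmod (complex_of_real (corr m)))"
      by (intro tendsto_sum tendsto_norm lim)
    ultimately have "(\<Sum>m\<in>F. cmod (complex_of_real (corr m))) \<le> C\<^sup>2"
      by (intro LIMSEQ_le_const2) auto
    then show "(\<Sum>m\<in>F. \<bar>corr m\<bar>) \<le> C\<^sup>2" by simp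
  qed
qed auto

lemma wsum_real: "wsum L \<rho> fc x = of_real (\<Sum>l\<in>L. \<rho> l * fr (act A l x))"
  by (simp add: wsum_def fc_real[symmetric])

lemma wsum_g_real: "wsum L \<rho> (g k) x = of_real (Re (wsum L \<rho> (g k) x))"
proof -
  have "wsum L \<rho> (g k) x \<in> \<real>" unfolding wsum_def by (intro sum_in_Reals Reals_mult g_real) auto
  then show ?thesis by simp
qed

lemma l2sq_wsum_g_le:
  assumes "finite L" "(\<Sum>l\<in>L. (\<rho> l)\<^sup>2) = 1"
  shows "l2sq (wsum L \<rho> (g k)) \<le> C\<^sup>2"
proof -
  have "l2sq (wsum L \<rho> (g k)) \<le> (\<Sum>\<gamma>\<in>S k. cmod (c \<gamma>))\<^sup>2 * (\<Sum>l\<in>L. (\<rho> l)\<^sup>2)"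
    unfolding g_def[abs_def] by (rule l2sq_wsum_le[OF S_finite S_dual _ assms(1)]) (use S_D D_dual in blast)
  also have "\<dots> \<le> C\<^sup>2" unfolding assms(2) by (auto intro!: power_mono sum_c_le S_finite S_D sum_nonneg)
  finally show ?thesis .
qed

lemma l2sq_wsum_fc_le:
  assumes "finite L" "(\<Sum>l\<in>L. (\<rho> l)\<^sup>2) = 1"
  shows "l2sq (wsum L \<rho> fc) \<le> C\<^sup>2"
  by (rule LIMSEQ_le_const2[OF tendsto_l2sq[OF wsum_uniform[OF g_uniform] wsum_cts[OF g_cts]]])
    (auto intro: l2sq_wsum_g_le[OF assms])

text \<open>For \<open>j \<ge> k\<close> the difference \<open>g j - g k\<close> is a finite sum
  over characters outside \<open>S0 k\<close>, whose coefficients have absolute sum at most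
  \<open>1 / real (Suc k)\<close>; then \<open>j\<close> tends to infinity. The bound depends
  neither on \<open>L\<close> nor on \<rho>, which makes the approximation uniform in
  \<open>n\<close>.\<close>

lemma l2sq_wsum_diff_le:
  assumes L: "finite L" "(\<Sum>l\<in>L. (\<rho> l)\<^sup>2) = 1"
  shows "l2sq (\<lambda>x. wsum L \<rho> fc x - wsum L \<rho> (g k) x) \<le> (1 / real (Suc k))\<^sup>2"
proof -
  have le: "l2sq (wsum L \<rho> (\<lambda>x. g j x - g k x)) \<le> (1 / real (Suc k))\<^sup>2" if "k \<le> j" for j
  proof -
    have "(\<lambda>x. g j x - g k x) = (\<lambda>x. \<Sum>\<gamma>\<in>S j - S k. c \<gamma> * \<gamma> x)"
      unfolding g_def using S_mono[OF that] S_finite by (simp add: sum_diff)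
    then have "l2sq (wsum L \<rho> (\<lambda>x. g j x - g k x)) \<le> (\<Sum>\<gamma>\<in>S j - S k. cmod (c \<gamma>))\<^sup>2 * (\<Sum>l\<in>L. (\<rho> l)\<^sup>2)"
      using l2sq_wsum_le[of "S j - S k" L \<rho> c] S_finite S_dual S_D[of j] D_dual(3) L(1) by auto
    also have "\<dots> \<le> (1 / real (Suc k))\<^sup>2"
      unfolding L(2) mult_1_right
      using S_finite S_D[of j] S0_S[of k] by (intro power_mono S0(4) sum_nonneg) auto
    finally show ?thesis .
  qed
  have "uniform_limit UNIV (\<lambda>j x. g j x - g k x) (\<lambda>x. fc x - g k x) sequentially"
    by (intro uniform_limit_minus g_uniform uniform_limit_const)
  from tendsto_l2sq[OF wsum_uniform[OF this] wsum_cts]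
  have "(\<lambda>j. l2sq (wsum L \<rho> (\<lambda>x. g j x - g k x))) \<longlonglongrightarrow> l2sq (wsum L \<rho> (\<lambda>x. fc x - g k x))"
    by (simp add: continuous_on_diff g_cts)
  then have "l2sq (wsum L \<rho> (\<lambda>x. fc x - g k x)) \<le> (1 / real (Suc k))\<^sup>2"
    by (rule LIMSEQ_le_const2) (use le in blast)
  then show ?thesis by (simp add: wsum_diff[abs_def])
qed

lemma expectation_abs_mult_le:
  fixes p q :: "'a \<Rightarrow> real"
  assumes "continuous_on UNIV p" "continuous_on UNIV q" "0 \<le> a" "0 \<le> b"
    and "l2sq (\<lambda>x. of_real (p x)) \<le> a\<^sup>2" "l2sq (\<lambda>x. of_real (q x)) \<le> b\<^sup>2"
  shows "expectation (\<lambda>x. \<bar>p x\<bar> * \<bar>q x\<bar>) \<le> a * b"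
proof (rule power2_le_imp_le)
  have "(expectation (\<lambda>x. \<bar>p x\<bar> * \<bar>q x\<bar>))\<^sup>2 \<le> l2sq (\<lambda>x. of_real (p x)) * l2sq (\<lambda>x. of_real (q x))"
    using Cauchy_Schwarz_cts[of "\<lambda>x. of_real (p x)" "\<lambda>x. of_real (q x)"] assms(1,2)
    by (simp add: continuous_on_of_real)
  also have "\<dots> \<le> a\<^sup>2 * b\<^sup>2" using assms by (intro mult_mono) auto
  finally show "(expectation (\<lambda>x. \<bar>p x\<bar> * \<bar>q x\<bar>))\<^sup>2 \<le> (a * b)\<^sup>2" by (simp add: power_mult_distrib)
qed (use assms in simp)

text \<open>An instance of \<open>asymptotically_small_weights\<close> with index set
  \<open>L n \<times> S k\<close>: the weight of the pair of \<open>l\<close> and \<gamma> is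
  \<open>\<rho> n l * c \<gamma>\<close>, and single coefficients are bounded by
  \<open>C\<close>.\<close>

lemma char_wsum_g:
  assumes L: "\<And>n. finite (L n)" and \<rho>: "\<And>n l. 0 \<le> \<rho> n l" "\<And>n. (\<Sum>l\<in>L n. (\<rho> n l)\<^sup>2) = 1"
    and U: "\<And>n l. l \<in> L n \<Longrightarrow> \<rho> n l \<le> U n"
    and small: "\<And>s. 3 \<le> s \<Longrightarrow> (\<lambda>n. (\<Sum>l\<in>L n. \<rho> n l) * U n ^ (s - 1)) \<longlonglongrightarrow> 0"
  shows "(\<lambda>n. char (distr M borel (\<lambda>x. Re (wsum (L n) (\<rho> n) (g k) x))) t
      - complex_of_real (exp (- (t\<^sup>2 * expectation (\<lambda>x. (Re (wsum (L n) (\<rho> n) (g k) x))\<^sup>2) / 2)))) \<longlonglongrightarrow> 0"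
proof -
  let ?J = "\<lambda>n. L n \<times> S k"
  define w where "w n j = complex_of_real (\<rho> n (fst j)) * c (snd j)" for n and j :: "('a, 'd) orbit_char"
  have wn: "cmod (w n j) = \<rho> n (fst j) * cmod (c (snd j))" for n j by (simp add: w_def norm_mult \<rho>(1))
  have sw: "(\<Sum>j\<in>?J n. cmod (w n j)) = (\<Sum>l\<in>L n. \<rho> n l) * (\<Sum>\<gamma>\<in>S k. cmod (c \<gamma>))" for n
    unfolding sum_product sum.cartesian_product by (intro sum.cong) (auto simp: wn)
  have sw2: "(\<Sum>j\<in>?J n. (cmod (w n j))\<^sup>2) = (\<Sum>\<gamma>\<in>S k. (cmod (c \<gamma>))\<^sup>2)" for n
  proof -
    have "(\<Sum>j\<in>?J n. (cmod (w n j))\<^sup>2) = (\<Sum>l\<in>L n. (\<rho> n l)\<^sup>2) * (\<Sum>\<gamma>\<in>S k. (cmod (c \<gamma>))\<^sup>2)"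
      unfolding sum_product sum.cartesian_product by (intro sum.cong) (auto simp: wn power_mult_distrib)
    then show ?thesis by (simp add: \<rho>(2))
  qed
  interpret asymptotically_small_weights M A "S k" ?J w "\<lambda>n. U n * C" "\<Sum>\<gamma>\<in>S k. (cmod (c \<gamma>))\<^sup>2"
  proof
    show "finite (S k)" "S k \<subseteq> dual_group" by (rule S_finite S_dual)+
    show "(\<lambda>x. 1) \<notin> S k" using S_D D_dual(3) by blast
    show "finite (?J n)" "?J n \<subseteq> UNIV \<times> S k" for n using L S_finite by auto
    show "cmod (w n j) \<le> U n * C" if j: "j \<in> ?J n" for n j
    proof -
      have "cmod (c (snd j)) \<le> C" using sum_c_le[of "{snd j}"] S_D[of k] j by auto
      moreover have "0 \<le> U n" using \<rho>(1)[of n "fst j"] U[of "fst j" n] j by (auto intro: order_trans)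
      ultimately show ?thesis unfolding wn using U[of "fst j" n] j \<rho>(1) by (intro mult_mono) auto
    qed
    show "(\<lambda>n. (\<Sum>j\<in>?J n. cmod (w n j)) * (U n * C) ^ (s - 1)) \<longlonglongrightarrow> 0" if s: "3 \<le> s" for s
    proof -
      have "(\<lambda>n. (\<Sum>l\<in>L n. \<rho> n l) * U n ^ (s - 1) * ((\<Sum>\<gamma>\<in>S k. cmod (c \<gamma>)) * C ^ (s - 1))) \<longlonglongrightarrow> 0"
        by (rule tendsto_mult_left_zero[OF small[OF s]])
      then show ?thesis by (simp add: sw power_mult_distrib mult_ac)
    qed
    show "(\<Sum>j\<in>?J n. (cmod (w n j))\<^sup>2) \<le> (\<Sum>\<gamma>\<in>S k. (cmod (c \<gamma>))\<^sup>2)" for n by (simp add: sw2)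
  qed
  show ?thesis
  proof (rule char_trig_poly_close_to_gauss)
    fix n x
    have "trig_poly (?J n) (w n) x = (\<Sum>l\<in>L n. \<Sum>\<gamma>\<in>S k. of_real (\<rho> n l) * (c \<gamma> * \<gamma> (act A l x)))"
      unfolding trig_poly_def sum.cartesian_product by (intro sum.cong) (auto simp: w_def mult_ac)
    then have "trig_poly (?J n) (w n) x = wsum (L n) (\<rho> n) (g k) x"
      by (simp add: wsum_def g_def sum_distrib_left)
    then show "complex_of_real (Re (wsum (L n) (\<rho> n) (g k) x)) = trig_poly (?J n) (w n) x"
      by (simp add: wsum_g_real[symmetric])
  qed
qed

text \<open>Replacing the full series by \<open>g k\<close> changes the characteristic function and
  the variance by multiples of \<open>1 / real (Suc k)\<close> that do not depend on
  \<open>n\<close>. For fixed \<open>k\<close> the polynomial case applies, and the convergence of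
  the variances of the full sums is inserted only at the end.\<close>

theorem char_finite_sums:
  assumes L: "\<And>n. finite (L n)" and \<rho>: "\<And>n l. 0 \<le> \<rho> n l" "\<And>n. (\<Sum>l\<in>L n. (\<rho> n l)\<^sup>2) = 1"
    and U: "\<And>n l. l \<in> L n \<Longrightarrow> \<rho> n l \<le> U n"
    and small: "\<And>s. 3 \<le> s \<Longrightarrow> (\<lambda>n. (\<Sum>l\<in>L n. \<rho> n l) * U n ^ (s - 1)) \<longlonglongrightarrow> 0"
    and v: "(\<lambda>n. expectation (\<lambda>x. (\<Sum>l\<in>L n. \<rho> n l * fr (act A l x))\<^sup>2)) \<longlonglongrightarrow> v"
  shows "(\<lambda>n. char (distr M borel (\<lambda>x. \<Sum>l\<in>L n. \<rho> n l * fr (act A l x))) t)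
    \<longlonglongrightarrow> complex_of_real (exp (- (t\<^sup>2 * v / 2)))"
proof -
  define F where "F n x = (\<Sum>l\<in>L n. \<rho> n l * fr (act A l x))" for n x
  define G where "G k n x = Re (wsum (L n) (\<rho> n) (g k) x)" for k n x
  have Fw: "complex_of_real (F n x) = wsum (L n) (\<rho> n) fc x" for n x by (simp add: F_def wsum_real)
  have Gw: "complex_of_real (G k n x) = wsum (L n) (\<rho> n) (g k) x" for k n x by (simp add: G_def wsum_g_real[symmetric])
  have Fc: "continuous_on UNIV (F n)" for n
    unfolding F_def[abs_def] by (intro continuous_intros continuous_on_comp_UNIV[OF fr_cts act_cts])
  have Gc: "continuous_on UNIV (G k n)" for k n
    unfolding G_def[abs_def] by (intro continuous_intros wsum_cts g_cts)
  have FGl: "l2sq (\<lambda>x. of_real (F n x - G k n x)) \<le> (1 / real (Suc k))\<^sup>2" for n k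
    using l2sq_wsum_diff_le[OF L \<rho>(2), of n k] by (simp add: Fw Gw)
  have FGd: "expectation (\<lambda>x. \<bar>F n x - G k n x\<bar>) \<le> 1 / real (Suc k)" for n k
    using expectation_abs_mult_le[of "\<lambda>x. F n x - G k n x" "\<lambda>_. 1" "1 / real (Suc k)" 1] FGl Fc Gc
    by (simp add: continuous_on_diff l2sq_def prob_space)
  have Fl: "l2sq (\<lambda>x. of_real (F n x)) \<le> C\<^sup>2" for n
    using l2sq_wsum_fc_le[OF L \<rho>(2), of n] by (simp add: Fw)
  have Gl: "l2sq (\<lambda>x. of_real (G k n x)) \<le> C\<^sup>2" for n k
    using l2sq_wsum_g_le[OF L \<rho>(2), of n k] by (simp add: Gw)
  have var: "\<bar>expectation (\<lambda>x. (F n x)\<^sup>2) - expectation (\<lambda>x. (G k n x)\<^sup>2)\<bar> \<le> 2 * C / real (Suc k)" for n k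
  proof -
    have i: "integrable M (\<lambda>x. (F n x)\<^sup>2)" "integrable M (\<lambda>x. (G k n x)\<^sup>2)"
      "integrable M (\<lambda>x. \<bar>F n x - G k n x\<bar> * \<bar>F n x\<bar>)" "integrable M (\<lambda>x. \<bar>F n x - G k n x\<bar> * \<bar>G k n x\<bar>)"
      by (intro integrable_continuous continuous_intros Fc Gc)+
    have "\<bar>expectation (\<lambda>x. (F n x)\<^sup>2) - expectation (\<lambda>x. (G k n x)\<^sup>2)\<bar> = norm (expectation (\<lambda>x. (F n x)\<^sup>2 - (G k n x)\<^sup>2))"
      using i by simp
    also have "\<dots> \<le> expectation (\<lambda>x. \<bar>F n x - G k n x\<bar> * \<bar>F n x\<bar> + \<bar>F n x - G k n x\<bar> * \<bar>G k n x\<bar>)"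
    proof (rule norm_integral_le_integral)
      fix x
      have "(F n x)\<^sup>2 - (G k n x)\<^sup>2 = (F n x - G k n x) * (F n x + G k n x)" by (simp add: power2_eq_square algebra_simps)
      then have "norm ((F n x)\<^sup>2 - (G k n x)\<^sup>2) = \<bar>F n x - G k n x\<bar> * \<bar>F n x + G k n x\<bar>" by (simp add: abs_mult)
      also have "\<dots> \<le> \<bar>F n x - G k n x\<bar> * (\<bar>F n x\<bar> + \<bar>G k n x\<bar>)" by (intro mult_left_mono) auto
      finally show "norm ((F n x)\<^sup>2 - (G k n x)\<^sup>2) \<le> \<bar>F n x - G k n x\<bar> * \<bar>F n x\<bar> + \<bar>F n x - G k n x\<bar> * \<bar>G k n x\<bar>"
        by (simp add: distrib_left)
    qed (use i in auto)
    also have "\<dots> = expectation (\<lambda>x. \<bar>F n x - G k n x\<bar> * \<bar>F n x\<bar>) + expectation (\<lambda>x. \<bar>F n x - G k n x\<bar> * \<bar>G k n x\<bar>)"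
      using i by simp
    also have "\<dots> \<le> 1 / real (Suc k) * C + 1 / real (Suc k) * C"
      using FGl Fl Gl C_nonneg
      by (intro add_mono expectation_abs_mult_le continuous_on_diff Fc Gc) auto
    finally show ?thesis by (simp add: algebra_simps)
  qed
  have exp_lip: "\<bar>exp (- a) - exp (- b)\<bar> \<le> \<bar>a - b\<bar>" if "0 \<le> a" "0 \<le> b" for a b :: real
  proof -
    have *: "exp (- a) - exp (- b) \<le> b - a" if "0 \<le> a" "a \<le> b" for a b :: real
    proof -
      have "1 - exp (- (b - a)) \<le> b - a" using exp_ge_add_one_self[of "- (b - a)"] by linarith
      moreover have "exp (- a) * (1 - exp (- (b - a))) \<le> 1 * (1 - exp (- (b - a)))"
        using that by (intro mult_right_mono) auto
      ultimately show ?thesis by (simp add: right_diff_distrib flip: exp_add)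
    qed
    show ?thesis
    proof (cases "a \<le> b")
      case True
      then show ?thesis using *[OF that(1) True] by simp
    next
      case False
      then show ?thesis using *[OF that(2), of a] by simp
    qed
  qed
  let ?e = "\<lambda>n. expectation (\<lambda>x. (F n x)\<^sup>2)"
  have diff: "(\<lambda>n. char (distr M borel (F n)) t - complex_of_real (exp (- (t\<^sup>2 * ?e n / 2)))) \<longlonglongrightarrow> 0"
    unfolding LIMSEQ_iff
  proof (intro allI impI)
    fix r :: real assume r: "0 < r"
    \<comment> \<open>The first term comes from the change of the characteristic function, the
      second from the change of variance by at most \<open>2 * C / real (Suc k)\<close> in the
      Gaussian exponent.\<close>
    define K where "K = \<bar>t\<bar> + t\<^sup>2 * C"
    have K: "0 \<le> K" using C_nonneg by (simp add: K_def)
    obtain k where k: "1 / real (Suc k) < r / (2 * (K + 1))"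
      using nat_approx_posE[of "r / (2 * (K + 1))"] r K by auto
    have Kk: "K * (1 / real (Suc k)) < r / 2"
    proof -
      have "K * (1 / real (Suc k)) \<le> (K + 1) * (1 / real (Suc k))" by (intro mult_right_mono) auto
      also have "\<dots> < (K + 1) * (r / (2 * (K + 1)))" using k K by (intro mult_strict_left_mono) auto
      also have "\<dots> = r / 2" using K by (simp add: field_simps add_nonneg_eq_0_iff)
      finally show ?thesis .
    qed
    let ?eG = "\<lambda>n. expectation (\<lambda>x. (G k n x)\<^sup>2)"
    have "(\<lambda>n. char (distr M borel (G k n)) t - complex_of_real (exp (- (t\<^sup>2 * ?eG n / 2)))) \<longlonglongrightarrow> 0"
      unfolding G_def[abs_def] by (rule char_wsum_g[OF L \<rho> U small])
    then obtain N where N: "\<And>n. n \<ge> N \<Longrightarrow>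
        norm (char (distr M borel (G k n)) t - complex_of_real (exp (- (t\<^sup>2 * ?eG n / 2)))) < r / 2"
      using r unfolding LIMSEQ_iff by (metis diff_zero half_gt_zero)
    show "\<exists>no. \<forall>n\<ge>no. norm (char (distr M borel (F n)) t - complex_of_real (exp (- (t\<^sup>2 * ?e n / 2))) - 0) < r"
    proof (intro exI[of _ N] allI impI)
      fix n assume n: "N \<le> n"
      have 1: "norm (char (distr M borel (F n)) t - char (distr M borel (G k n)) t) \<le> \<bar>t\<bar> * (1 / real (Suc k))"
        by (rule order_trans[OF char_dist_le mult_left_mono[OF FGd]])
          (auto intro!: measurable_continuous integrable_continuous continuous_intros Fc Gc)
      have 2: "norm (complex_of_real (exp (- (t\<^sup>2 * ?eG n / 2))) - complex_of_real (exp (- (t\<^sup>2 * ?e n / 2))))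
        \<le> t\<^sup>2 * C * (1 / real (Suc k))"
      proof -
        have "norm (complex_of_real (exp (- (t\<^sup>2 * ?eG n / 2))) - complex_of_real (exp (- (t\<^sup>2 * ?e n / 2))))
          = \<bar>exp (- (t\<^sup>2 * ?eG n / 2)) - exp (- (t\<^sup>2 * ?e n / 2))\<bar>"
          unfolding of_real_diff[symmetric] norm_of_real ..
        also have "\<dots> \<le> \<bar>t\<^sup>2 * ?eG n / 2 - t\<^sup>2 * ?e n / 2\<bar>" by (rule exp_lip) auto
        also have "\<dots> = t\<^sup>2 / 2 * \<bar>?e n - ?eG n\<bar>"
          by (simp add: abs_mult abs_minus_commute flip: diff_divide_distrib right_diff_distrib)
        also have "\<dots> \<le> t\<^sup>2 / 2 * (2 * C / real (Suc k))" by (intro mult_left_mono var) auto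
        finally show ?thesis by simp
      qed
      have "norm (char (distr M borel (F n)) t - complex_of_real (exp (- (t\<^sup>2 * ?e n / 2))))
        \<le> \<bar>t\<bar> * (1 / real (Suc k)) + norm (char (distr M borel (G k n)) t - complex_of_real (exp (- (t\<^sup>2 * ?eG n / 2))))
          + t\<^sup>2 * C * (1 / real (Suc k))"
        using 1 2 norm_triangle_ineq[of "char (distr M borel (F n)) t - char (distr M borel (G k n)) t"
            "char (distr M borel (G k n)) t - complex_of_real (exp (- (t\<^sup>2 * ?e n / 2)))"]
          norm_triangle_ineq[of "char (distr M borel (G k n)) t - complex_of_real (exp (- (t\<^sup>2 * ?eG n / 2)))"
            "complex_of_real (exp (- (t\<^sup>2 * ?eG n / 2))) - complex_of_real (exp (- (t\<^sup>2 * ?e n / 2)))"]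
        by simp
      moreover have "\<bar>t\<bar> * (1 / real (Suc k)) + t\<^sup>2 * C * (1 / real (Suc k)) = K * (1 / real (Suc k))"
        by (simp add: K_def add_divide_distrib distrib_right)
      ultimately show "norm (char (distr M borel (F n)) t - complex_of_real (exp (- (t\<^sup>2 * ?e n / 2))) - 0) < r"
        unfolding diff_zero using N[OF n] Kk by linarith
    qed
  qed
  have "(\<lambda>n. complex_of_real (exp (- (t\<^sup>2 * ?e n / 2)))) \<longlonglongrightarrow> complex_of_real (exp (- (t\<^sup>2 * v / 2)))"
    using v unfolding F_def by (intro tendsto_intros) auto
  from tendsto_add[OF diff this] show ?thesis by (simp add: F_def[abs_def])
qed

end

section \<open>Summation sequences\<close>

lemma real_distribution_centered_normal:
  assumes "0 \<le> v"
  shows "real_distribution (centered_normal v)"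
proof (cases "v = 0")
  case True
  then show ?thesis
    by (simp add: centered_normal_def real_distribution_def real_distribution_axioms_def prob_space_return)
next
  case False
  then show ?thesis
    using assms by (simp add: centered_normal_def real_distribution_def real_distribution_axioms_def prob_space_normal_density)
qed

lemma char_centered_normal:
  assumes "0 \<le> v"
  shows "char (centered_normal v) t = complex_of_real (exp (- (t\<^sup>2 * v / 2)))"
proof (cases "v = 0")
  case True
  then show ?thesis by (simp add: centered_normal_def char_def integral_return)
next
  case False
  interpret std: prob_space std_normal_distribution
    by (rule prob_space_normal_density) simp
  have "distributed std_normal_distribution lborel (\<lambda>x. x) (normal_density 0 1)"
    by (auto simp: distributed_def distr_id2)
  then have "distributed std_normal_distribution lborel (\<lambda>x. 0 + sqrt v * x) (normal_density (0 + sqrt v * 0) (\<bar>sqrt v\<bar> * 1))"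
    using False by (intro std.normal_density_affine) auto
  then have "distributed std_normal_distribution lborel (\<lambda>x. sqrt v * x) (normal_density 0 (sqrt v))"
    using assms by simp
  from distributed_distr_eq_density[OF this]
  have "centered_normal v = distr std_normal_distribution lborel (\<lambda>x. sqrt v * x)"
    using False by (simp add: centered_normal_def)
  also have "\<dots> = distr std_normal_distribution borel (\<lambda>x. sqrt v * x)"
    by (rule distr_cong) auto
  finally have "char (centered_normal v) t = char std_normal_distribution (t * sqrt v)"
    unfolding char_def by (simp add: integral_distr mult_ac)
  then show ?thesis
    using assms by (simp add: char_std_normal_distribution power_mult_distrib)
qed

text \<open>The sum is the integral over the counting measure, also for families that are not
  summable, where both sides have the default value 0; measurability then follows from that of
  parameter integrals.\<close>

lemma borel_measurable_infsum:
  fixes h :: "'i::countable \<Rightarrow> 'x \<Rightarrow> real"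
  assumes h: "\<And>i. h i \<in> borel_measurable M"
  shows "(\<lambda>x. \<Sum>\<^sub>\<infinity>i. h i x) \<in> borel_measurable M"
proof -
  have eq: "(\<Sum>\<^sub>\<infinity>i. k i) = (\<integral>i. k i \<partial>count_space UNIV)" for k :: "'i \<Rightarrow> real"
  proof (cases "k summable_on UNIV")
    case True
    then have "Infinite_Set_Sum.abs_summable_on k UNIV"
      using abs_summable_equivalent summable_on_iff_abs_summable_on_real by blast
    then show ?thesis using infsetsum_infsum[of k UNIV] by (simp add: infsetsum_def)
  next
    case False
    then have "\<not> Infinite_Set_Sum.abs_summable_on k UNIV"
      using abs_summable_equivalent summable_on_iff_abs_summable_on_real by blast
    then show ?thesis
      using False by (simp add: infsum_not_exists not_integrable_integral_eq Infinite_Set_Sum.abs_summable_on_def)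
  qed
  interpret sigma_finite_measure "count_space (UNIV :: 'i set)"
    by (rule sigma_finite_measure_count_space_countable) simp
  have "(\<lambda>(i, x). h i x) \<in> borel_measurable (count_space UNIV \<Otimes>\<^sub>M M)"
    by (rule measurable_pair_measure_countable1) (use h in auto)
  from measurable_compose[OF measurable_pair_swap' this]
  have "(\<lambda>(x, i). h i x) \<in> borel_measurable (M \<Otimes>\<^sub>M count_space UNIV)"
    by (simp add: case_prod_unfold)
  from borel_measurable_lebesgue_integral[OF this] show ?thesis unfolding eq by simp
qed

text \<open>The partial sums converge uniformly and are bounded by the total weight
  \<open>B\<close>, so the squared moduli differ by at most \<open>2 * B\<close> times the uniform
  distance. This reaches the kernel of an infinite weight function through finite quadratic
  forms.\<close>

lemma tendsto_torus_kernel: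
  fixes \<rho> :: "int ^ 'd::finite \<Rightarrow> real"
  assumes \<rho>: "\<And>l. 0 \<le> \<rho> l" "\<rho> summable_on UNIV" and \<phi>: "torus_continuous \<phi>"
  shows "((\<lambda>L. \<integral>t. (cmod (\<Sum>l\<in>L. of_real (\<rho> l) * torus_char l t))\<^sup>2 * \<phi> t \<partial>torus_haar)
    \<longlongrightarrow> (\<integral>t. (cmod (\<Sum>\<^sub>\<infinity>l. of_real (\<rho> l) * torus_char l t))\<^sup>2 * \<phi> t \<partial>torus_haar)) (finite_subsets_at_top UNIV)"
proof -
  let ?a = "\<lambda>L t. \<Sum>l\<in>L. complex_of_real (\<rho> l) * torus_char l t"
  let ?b = "\<lambda>t. \<Sum>\<^sub>\<infinity>l. complex_of_real (\<rho> l) * torus_char l t"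
  define B where "B = (\<Sum>\<^sub>\<infinity>l. \<rho> l)"
  have B0: "0 \<le> B" unfolding B_def by (rule infsum_nonneg) (rule \<rho>)
  have c: "(\<lambda>l. cmod (complex_of_real (\<rho> l))) summable_on UNIV" using \<rho> by simp
  have \<phi>c: "continuous_on UNIV \<phi>" using \<phi> by (simp add: torus_continuous_def)
  have ac: "continuous_on UNIV (?a L)" for L by (intro continuous_intros torus_char_cts)
  have bc: "continuous_on UNIV ?b"
    by (rule continuous_on_series[where g = torus_char and X = UNIV, OF c]) (auto simp: torus_char_norm torus_char_cts)
  have abd: "cmod (?a L t) \<le> B" if "finite L" for L t
  proof -
    have "cmod (?a L t) \<le> (\<Sum>l\<in>L. cmod (of_real (\<rho> l) * torus_char l t))" by (rule norm_sum)
    also have "\<dots> = (\<Sum>l\<in>L. \<rho> l)" using \<rho> by (simp add: norm_mult torus_char_norm)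
    also have "\<dots> \<le> B" unfolding B_def using \<rho> that by (intro finite_sum_le_infsum) auto
    finally show ?thesis .
  qed
  have ul: "uniform_limit UNIV ?a ?b (finite_subsets_at_top UNIV)"
    by (rule uniform_limit_series[where g = torus_char and X = UNIV, OF c]) (auto simp: torus_char_norm)
  have bbd: "cmod (?b t) \<le> B" for t
  proof (rule tendsto_upperbound[OF tendsto_norm[OF tendsto_uniform_limitI[OF ul UNIV_I]]])
    show "\<forall>\<^sub>F L in finite_subsets_at_top UNIV. cmod (?a L t) \<le> B"
      by (rule eventually_finite_subsets_at_top_weakI) (rule abd)
  qed simp
  let ?I = "\<integral>t. \<bar>\<phi> t\<bar> \<partial>torus_haar"
  show ?thesis
    unfolding tendsto_iff
  proof (intro allI impI)
    fix e :: real assume e: "0 < e"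
    define d where "d = e / (2 * B * ?I + 1)"
    have pos: "0 \<le> 2 * B * ?I" using B0 by simp
    have d: "0 < d" using e pos by (simp add: d_def add_nonneg_pos)
    have "e / (x + 1) * x < e" if "0 \<le> x" for x using e that by (simp add: field_simps add_nonneg_pos)
    from this[OF pos] have dI: "d * (2 * B * ?I) < e" unfolding d_def .
    have "\<forall>\<^sub>F L in finite_subsets_at_top UNIV. \<forall>t\<in>UNIV. dist (?a L t) (?b t) < d"
      using ul d unfolding uniform_limit_iff by blast
    moreover have "\<forall>\<^sub>F L in finite_subsets_at_top (UNIV :: (int ^ 'd) set). finite L"
      by (rule eventually_finite_subsets_at_top_weakI)
    ultimately show "\<forall>\<^sub>F L in finite_subsets_at_top UNIV.
      dist (\<integral>t. (cmod (?a L t))\<^sup>2 * \<phi> t \<partial>torus_haar) (\<integral>t. (cmod (?b t))\<^sup>2 * \<phi> t \<partial>torus_haar) < e"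
    proof eventually_elim
      case (elim L)
      have i: "integrable torus_haar (\<lambda>t. (cmod (?a L t))\<^sup>2 * \<phi> t)" "integrable torus_haar (\<lambda>t. (cmod (?b t))\<^sup>2 * \<phi> t)"
        "integrable torus_haar (\<lambda>t. \<bar>\<phi> t\<bar>)"
        by (intro integrable_torus_haar continuous_on_mult continuous_on_power continuous_on_norm continuous_on_rabs ac bc \<phi>c)+
      have "dist (\<integral>t. (cmod (?a L t))\<^sup>2 * \<phi> t \<partial>torus_haar) (\<integral>t. (cmod (?b t))\<^sup>2 * \<phi> t \<partial>torus_haar)
        = norm (\<integral>t. (cmod (?a L t))\<^sup>2 * \<phi> t - (cmod (?b t))\<^sup>2 * \<phi> t \<partial>torus_haar)"
        using i by (simp add: dist_norm)
      also have "\<dots> \<le> (\<integral>t. d * (2 * B) * \<bar>\<phi> t\<bar> \<partial>torus_haar)"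
      proof (rule norm_integral_le_integral)
        fix t
        have "\<bar>(cmod (?a L t))\<^sup>2 - (cmod (?b t))\<^sup>2\<bar> = \<bar>cmod (?a L t) - cmod (?b t)\<bar> * \<bar>cmod (?a L t) + cmod (?b t)\<bar>"
          unfolding power2_eq_square square_diff_square_factored abs_mult by (simp add: mult.commute)
        also have "\<dots> \<le> d * (2 * B)"
        proof (rule mult_mono)
          have "dist (?a L t) (?b t) < d" using elim(1) by blast
          then show "\<bar>cmod (?a L t) - cmod (?b t)\<bar> \<le> d"
            using norm_triangle_ineq3[of "?a L t" "?b t"] by (simp add: dist_norm)
          show "\<bar>cmod (?a L t) + cmod (?b t)\<bar> \<le> 2 * B" using abd[OF elim(2), of t] bbd[of t] by simp
        qed (use d in auto)
        finally have "\<bar>(cmod (?a L t))\<^sup>2 - (cmod (?b t))\<^sup>2\<bar> \<le> d * (2 * B)" .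
        from mult_right_mono[OF this, of "\<bar>\<phi> t\<bar>"]
        show "norm ((cmod (?a L t))\<^sup>2 * \<phi> t - (cmod (?b t))\<^sup>2 * \<phi> t) \<le> d * (2 * B) * \<bar>\<phi> t\<bar>"
          by (simp add: left_diff_distrib[symmetric] abs_mult)
      qed (use i in auto)
      also have "\<dots> < e" using dI by (simp add: mult.assoc)
      finally show ?case .
    qed
  qed
qed

section \<open>Truncation of the weights and passage to the limit\<close>

context ac0_function
begin

text \<open>The explicit form of the spectral density; since the correlations are even,
  \<open>Re\<close> only changes the type.\<close>

definition corr_density :: "real ^ 'd \<Rightarrow> real" where
  "corr_density t = Re (\<Sum>\<^sub>\<infinity>m. of_real (corr m) * torus_char m t)"

lemma corr_density_continuous: "torus_continuous corr_density"
  using torus_series(1)[OF corr_summable corr_even] by (simp add: corr_density_def[abs_def])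

lemma corr_density_coeff: "(\<integral>t. of_real (corr_density t) * cnj (torus_char n t) \<partial>torus_haar) = complex_of_real (corr n)"
  using torus_series(2)[OF corr_summable corr_even, of n] by (simp add: corr_density_def[abs_def])

lemma spectral_density_eq: "spectral_density M A f = corr_density"
  by (rule spectral_density_eqI[OF corr_density_continuous]) (simp add: corr_density_coeff corr_def)

lemma variance_finite_sum:
  "expectation (\<lambda>x. (\<Sum>l\<in>L. \<rho> l * fr (act A l x))\<^sup>2) = (\<Sum>l\<in>L. \<Sum>m\<in>L. \<rho> l * \<rho> m * corr (m - l))"
proof -
  have i: "integrable M (\<lambda>x. fr (act A m x) * fr (act A l x))" for l m
    by (intro integrable_continuous continuous_intros continuous_on_comp_UNIV[OF fr_cts act_cts])
  have "(\<Sum>l\<in>L. \<rho> l * fr (act A l x))\<^sup>2 = (\<Sum>l\<in>L. \<Sum>m\<in>L. \<rho> l * \<rho> m * (fr (act A m x) * fr (act A l x)))" for x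
    by (simp add: power2_eq_square sum_product mult_ac)
  then have "expectation (\<lambda>x. (\<Sum>l\<in>L. \<rho> l * fr (act A l x))\<^sup>2)
      = (\<Sum>l\<in>L. \<Sum>m\<in>L. \<rho> l * \<rho> m * (\<integral>x. fr (act A m x) * fr (act A l x) \<partial>M))"
    by (simp add: Bochner_Integration.integral_sum i)
  then show ?thesis by (simp add: integral_fr_shift)
qed

text \<open>Every quantity converges along the finite subsets of the lattice, so a single
  \<open>L\<close> meets all conditions. They control in turn the smallness of the truncated
  weights, the change of normalization, the discarded tail, and the variance. The bound
  \<open>Q / 4\<close> is taken because its root is half of \<open>sqrt Q\<close>.\<close>

lemma truncation:
  assumes \<rho>: "\<And>l. 0 \<le> \<rho> l" "\<rho> summable_on UNIV" "0 < (\<Sum>\<^sub>\<infinity>l. \<rho> l)" and d: "0 < d"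
  defines "Q \<equiv> \<Sum>\<^sub>\<infinity>l. (\<rho> l)\<^sup>2"
  shows "0 < Q" "\<exists>L. finite L \<and> Q / 4 < (\<Sum>l\<in>L. (\<rho> l)\<^sup>2) \<and>
      \<bar>1 / sqrt Q - 1 / sqrt (\<Sum>l\<in>L. (\<rho> l)\<^sup>2)\<bar> * (\<Sum>\<^sub>\<infinity>l. \<rho> l) < d \<and>
      ((\<Sum>\<^sub>\<infinity>l. \<rho> l) - (\<Sum>l\<in>L. \<rho> l)) / sqrt Q < d \<and>
      \<bar>(\<Sum>l\<in>L. \<Sum>m\<in>L. \<rho> l * \<rho> m * corr (m - l)) / (\<Sum>l\<in>L. (\<rho> l)\<^sup>2)
        - (\<integral>t. normalized_kernel \<rho> t * corr_density t \<partial>torus_haar)\<bar> < d"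
proof -
  let ?F = "finite_subsets_at_top (UNIV :: (int ^ 'd) set)"
  let ?s = "\<Sum>\<^sub>\<infinity>l. \<rho> l"
  have le: "\<rho> l \<le> ?s" for l using finite_sum_le_infsum[OF \<rho>(2), of "{l}"] \<rho>(1) by simp
  have sq: "(\<lambda>l. (\<rho> l)\<^sup>2) summable_on UNIV"
  proof (rule summable_on_comparison_test)
    show "(\<lambda>l. ?s * \<rho> l) summable_on UNIV" by (rule summable_on_cmult_right[OF \<rho>(2)])
    show "(\<rho> l)\<^sup>2 \<le> ?s * \<rho> l" for l using le[of l] \<rho>(1)[of l] by (simp add: power2_eq_square mult_right_mono)
  qed simp
  obtain l0 where l0: "0 < \<rho> l0"
  proof (rule ccontr)
    assume "\<not> thesis"
    then have "\<rho> l = 0" for l using \<rho>(1)[of l] that by (metis order_le_less)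
    then show False using \<rho>(3) by simp
  qed
  have "(\<Sum>l\<in>{l0}. (\<rho> l)\<^sup>2) \<le> Q" unfolding Q_def by (rule finite_sum_le_infsum[OF sq]) auto
  then show Q: "0 < Q" using l0 by (simp add: less_le_trans[OF zero_less_power])
  have tq: "((\<lambda>L. \<Sum>l\<in>L. (\<rho> l)\<^sup>2) \<longlongrightarrow> Q) ?F" unfolding Q_def by (rule infsum_tendsto[OF sq])
  have ts: "((\<lambda>L. \<Sum>l\<in>L. \<rho> l) \<longlongrightarrow> ?s) ?F" by (rule infsum_tendsto[OF \<rho>(2)])
  have tk: "((\<lambda>L. \<Sum>l\<in>L. \<Sum>m\<in>L. \<rho> l * \<rho> m * corr (m - l))
      \<longlongrightarrow> (\<integral>t. (cmod (\<Sum>\<^sub>\<infinity>l. of_real (\<rho> l) * torus_char l t))\<^sup>2 * corr_density t \<partial>torus_haar)) ?F"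
    using tendsto_torus_kernel[OF \<rho>(1,2) corr_density_continuous]
    unfolding integral_kernel_finite[OF corr_density_continuous corr_density_coeff] .
  have e0: "\<forall>\<^sub>F L in ?F. Q / 4 < (\<Sum>l\<in>L. (\<rho> l)\<^sup>2)"
    by (rule order_tendstoD(1)[OF tq]) (use Q in simp)
  have "((\<lambda>L. \<bar>1 / sqrt Q - 1 / sqrt (\<Sum>l\<in>L. (\<rho> l)\<^sup>2)\<bar> * ?s) \<longlongrightarrow> \<bar>1 / sqrt Q - 1 / sqrt Q\<bar> * ?s) ?F"
    using Q by (intro tendsto_intros tq) auto
  then have e1: "\<forall>\<^sub>F L in ?F. \<bar>1 / sqrt Q - 1 / sqrt (\<Sum>l\<in>L. (\<rho> l)\<^sup>2)\<bar> * ?s < d"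
    by (rule order_tendstoD(2)) (use d in simp)
  have "((\<lambda>L. (?s - (\<Sum>l\<in>L. \<rho> l)) / sqrt Q) \<longlongrightarrow> (?s - ?s) / sqrt Q) ?F"
    using Q by (intro tendsto_intros ts) auto
  then have e2: "\<forall>\<^sub>F L in ?F. (?s - (\<Sum>l\<in>L. \<rho> l)) / sqrt Q < d"
    by (rule order_tendstoD(2)) (use d in simp)
  have "(\<integral>t. normalized_kernel \<rho> t * corr_density t \<partial>torus_haar)
      = (\<integral>t. (cmod (\<Sum>\<^sub>\<infinity>l. of_real (\<rho> l) * torus_char l t))\<^sup>2 * corr_density t \<partial>torus_haar) / Q"
    unfolding normalized_kernel_def Q_def[symmetric] by (simp flip: integral_divide_zero)
  then have "((\<lambda>L. (\<Sum>l\<in>L. \<Sum>m\<in>L. \<rho> l * \<rho> m * corr (m - l)) / (\<Sum>l\<in>L. (\<rho> l)\<^sup>2))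
      \<longlongrightarrow> (\<integral>t. normalized_kernel \<rho> t * corr_density t \<partial>torus_haar)) ?F"
    using tendsto_divide[OF tk tq] Q by simp
  from tendstoD[OF this d] have e3: "\<forall>\<^sub>F L in ?F. \<bar>(\<Sum>l\<in>L. \<Sum>m\<in>L. \<rho> l * \<rho> m * corr (m - l)) / (\<Sum>l\<in>L. (\<rho> l)\<^sup>2)
        - (\<integral>t. normalized_kernel \<rho> t * corr_density t \<partial>torus_haar)\<bar> < d"
    unfolding dist_real_def .
  have e4: "\<forall>\<^sub>F L in ?F. finite L" by (rule eventually_finite_subsets_at_top_weakI)
  show "\<exists>L. finite L \<and> Q / 4 < (\<Sum>l\<in>L. (\<rho> l)\<^sup>2) \<and>
      \<bar>1 / sqrt Q - 1 / sqrt (\<Sum>l\<in>L. (\<rho> l)\<^sup>2)\<bar> * ?s < d \<and>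
      (?s - (\<Sum>l\<in>L. \<rho> l)) / sqrt Q < d \<and>
      \<bar>(\<Sum>l\<in>L. \<Sum>m\<in>L. \<rho> l * \<rho> m * corr (m - l)) / (\<Sum>l\<in>L. (\<rho> l)\<^sup>2)
        - (\<integral>t. normalized_kernel \<rho> t * corr_density t \<partial>torus_haar)\<bar> < d"
    by (rule eventually_happens'[OF _ eventually_conj[OF e4 eventually_conj[OF e0 eventually_conj[OF e1 eventually_conj[OF e2 e3]]]]])
      simp
qed

text \<open>Here \<open>p\<close> and \<open>q\<close> are the normalizations before and after
  truncation. The difference consists of the tail with factor \<open>p\<close> and of the head with
  factor \<open>p - q\<close>; as \<open>h\<close> is bounded by \<open>C\<close>, each part is at
  most \<open>C * d\<close>.\<close>

lemma truncation_error:
  fixes \<rho> :: "'i \<Rightarrow> real"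
  assumes \<rho>: "\<And>l. 0 \<le> \<rho> l" "\<rho> summable_on UNIV" and L: "finite L"
    and p: "0 \<le> p" and e1: "\<bar>p - q\<bar> * (\<Sum>\<^sub>\<infinity>l. \<rho> l) \<le> d" and e2: "((\<Sum>\<^sub>\<infinity>l. \<rho> l) - (\<Sum>l\<in>L. \<rho> l)) * p \<le> d"
    and h: "\<And>l. \<bar>h l\<bar> \<le> C"
  shows "\<bar>p * (\<Sum>\<^sub>\<infinity>l. \<rho> l * h l) - (\<Sum>l\<in>L. \<rho> l * q * h l)\<bar> \<le> 2 * C * d"
proof -
  let ?s = "\<Sum>\<^sub>\<infinity>l. \<rho> l"
  have s1: "(\<lambda>l. C * \<rho> l) summable_on UNIV" by (rule summable_on_cmult_right[OF \<rho>(2)])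
  have b: "norm (\<rho> l * h l) \<le> C * \<rho> l" for l
    using mult_left_mono[OF h \<rho>(1), of l l] \<rho>(1)[of l] by (simp add: abs_mult mult.commute)
  have s2: "(\<lambda>l. norm (\<rho> l * h l)) summable_on UNIV"
    by (rule summable_on_comparison_test[OF s1 b]) simp
  then have s: "(\<lambda>l. \<rho> l * h l) summable_on UNIV" by (rule abs_summable_summable)
  have sub: "\<rho> summable_on (- L)" "(\<lambda>l. \<rho> l * h l) summable_on (- L)"
    using \<rho>(2) s by (auto intro: summable_on_subset_banach)
  have split: "infsum k UNIV = sum k L + infsum k (- L)" if "k summable_on UNIV" for k :: "'i \<Rightarrow> real"
  proof -
    have "infsum k (L \<union> - L) = infsum k L + infsum k (- L)"
      using that L by (intro infsum_Un_disjoint) (auto intro: summable_on_subset_banach)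
    then show ?thesis using L by simp
  qed
  have tail: "\<bar>infsum (\<lambda>l. \<rho> l * h l) (- L)\<bar> \<le> C * (?s - (\<Sum>l\<in>L. \<rho> l))"
  proof -
    have "norm (infsum (\<lambda>l. \<rho> l * h l) (- L)) \<le> infsum (\<lambda>l. C * \<rho> l) (- L)"
    proof (rule norm_infsum_le)
      show "((\<lambda>l. \<rho> l * h l) has_sum infsum (\<lambda>l. \<rho> l * h l) (- L)) (- L)" using sub(2) by (rule has_sum_infsum)
      show "((\<lambda>l. C * \<rho> l) has_sum infsum (\<lambda>l. C * \<rho> l) (- L)) (- L)"
        by (intro has_sum_infsum summable_on_cmult_right sub)
    qed (rule b)
    also have "\<dots> = C * infsum \<rho> (- L)" by (rule infsum_cmult_right) (use sub in auto)
    also have "infsum \<rho> (- L) = ?s - (\<Sum>l\<in>L. \<rho> l)" using split[OF \<rho>(2)] by simp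
    finally show ?thesis by simp
  qed
  have head: "\<bar>\<Sum>l\<in>L. \<rho> l * h l\<bar> \<le> C * ?s"
  proof -
    have "\<bar>\<Sum>l\<in>L. \<rho> l * h l\<bar> \<le> (\<Sum>l\<in>L. C * \<rho> l)"
      by (rule order_trans[OF sum_abs]) (use b in \<open>auto intro!: sum_mono\<close>)
    also have "\<dots> = C * (\<Sum>l\<in>L. \<rho> l)" by (simp add: sum_distrib_left)
    also have "\<dots> \<le> C * ?s"
      using C_nonneg \<rho> L by (intro mult_left_mono finite_sum_le_infsum) auto
    finally show ?thesis .
  qed
  have "(\<Sum>l\<in>L. \<rho> l * q * h l) = q * (\<Sum>l\<in>L. \<rho> l * h l)" by (simp add: sum_distrib_left mult_ac)
  then have "p * (\<Sum>\<^sub>\<infinity>l. \<rho> l * h l) - (\<Sum>l\<in>L. \<rho> l * q * h l)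
      = p * infsum (\<lambda>l. \<rho> l * h l) (- L) + (p - q) * (\<Sum>l\<in>L. \<rho> l * h l)"
    unfolding split[OF s] by (simp add: distrib_left left_diff_distrib)
  also have "\<bar>\<dots>\<bar>
      \<le> p * \<bar>infsum (\<lambda>l. \<rho> l * h l) (- L)\<bar> + \<bar>p - q\<bar> * \<bar>\<Sum>l\<in>L. \<rho> l * h l\<bar>"
    by (rule order_trans[OF abs_triangle_ineq]) (simp only: abs_mult abs_of_nonneg[OF p] order_refl)
  also have "\<dots> \<le> p * (C * (?s - (\<Sum>l\<in>L. \<rho> l))) + \<bar>p - q\<bar> * (C * ?s)"
    using p tail head by (intro add_mono mult_left_mono) auto
  also have "\<dots> = C * ((?s - (\<Sum>l\<in>L. \<rho> l)) * p) + C * (\<bar>p - q\<bar> * ?s)" by (simp add: mult_ac)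
  also have "\<dots> \<le> C * d + C * d" using e1 e2 C_nonneg by (intro add_mono mult_left_mono) auto
  finally show ?thesis by (simp add: mult_ac)
qed

lemma weighted_sum_measurable:
  "(\<lambda>x. p * (\<Sum>\<^sub>\<infinity>l. \<rho> l * f (act A l x))) \<in> borel_measurable M"
proof -
  have "(\<lambda>x. \<rho> l * f (act A l x)) \<in> borel_measurable M" for l
    using measurable_compose[OF act_measurable borel_measurable_integrable[OF f_integrable]] by simp
  from borel_measurable_infsum[of "\<lambda>l x. \<rho> l * f (act A l x)", OF this] show ?thesis by (rule borel_measurable_times[OF borel_measurable_const])
qed

lemma char_weighted_sums:
  fixes R :: "nat \<Rightarrow> int ^ 'd \<Rightarrow> real"
  assumes R: "summation_sequence R" and reg: "zeta_regular R \<zeta>"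
    and small: "\<And>r::nat. r \<ge> 3 \<Longrightarrow> (\<lambda>n. (SUP l. R n l) ^ (r - 1) * (\<Sum>\<^sub>\<infinity>l. R n l))
             \<in> o(\<lambda>n. (\<Sum>\<^sub>\<infinity>l. (R n l)\<^sup>2) powr (real r / 2))"
  defines "v \<equiv> \<integral>t. corr_density t \<partial>\<zeta>"
  shows "0 \<le> v"
    "(\<lambda>n. char (distr M borel (\<lambda>x. (\<Sum>\<^sub>\<infinity>l. (R n l)\<^sup>2) powr (- 1 / 2) * (\<Sum>\<^sub>\<infinity>l. R n l * f (act A l x)))) t)
      \<longlonglongrightarrow> complex_of_real (exp (- (t\<^sup>2 * v / 2)))"
proof -
  define Q where "Q n = (\<Sum>\<^sub>\<infinity>l. (R n l)\<^sup>2)" for n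
  define s where "s n = (\<Sum>\<^sub>\<infinity>l. R n l)" for n
  define u where "u n = (SUP l. R n l)" for n
  have R0: "0 \<le> R n l" and Rs: "R n summable_on UNIV" and Rp: "0 < (\<Sum>\<^sub>\<infinity>l. R n l)" for n l
    using R by (auto simp: summation_sequence_def)
  have spos: "0 < s n" for n using Rp by (simp add: s_def)
  have "bdd_above (range (R n))" for n
    using finite_sum_le_infsum[OF Rs, of "{l}" n for l] R0 by (intro bdd_aboveI2[of _ _ "s n"]) (simp add: s_def)
  then have Ru: "R n l \<le> u n" for n l unfolding u_def by (rule cSUP_upper[OF UNIV_I])
  have u0: "0 \<le> u n" for n using R0 Ru order_trans by blast
  have d: "0 < 1 / real (Suc n)" for n by simp
  note trunc = truncation[OF R0 Rs Rp d, folded Q_def s_def]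
  have Qpos: "0 < Q n" for n by (rule trunc(1))
  define L where "L n = (SOME L. finite L \<and> Q n / 4 < (\<Sum>l\<in>L. (R n l)\<^sup>2) \<and>
      \<bar>1 / sqrt (Q n) - 1 / sqrt (\<Sum>l\<in>L. (R n l)\<^sup>2)\<bar> * s n < 1 / real (Suc n) \<and>
      (s n - (\<Sum>l\<in>L. R n l)) / sqrt (Q n) < 1 / real (Suc n) \<and>
      \<bar>(\<Sum>l\<in>L. \<Sum>m\<in>L. R n l * R n m * corr (m - l)) / (\<Sum>l\<in>L. (R n l)\<^sup>2)
        - (\<integral>t. normalized_kernel (R n) t * corr_density t \<partial>torus_haar)\<bar> < 1 / real (Suc n))" for n
  define q where "q n = (\<Sum>l\<in>L n. (R n l)\<^sup>2)" for n
  have LL: "finite (L n)" "Q n / 4 < q n" "\<bar>1 / sqrt (Q n) - 1 / sqrt (q n)\<bar> * s n < 1 / real (Suc n)"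
      "(s n - (\<Sum>l\<in>L n. R n l)) / sqrt (Q n) < 1 / real (Suc n)"
      "\<bar>(\<Sum>l\<in>L n. \<Sum>m\<in>L n. R n l * R n m * corr (m - l)) / q n
        - (\<integral>t. normalized_kernel (R n) t * corr_density t \<partial>torus_haar)\<bar> < 1 / real (Suc n)" for n
    using someI_ex[OF trunc(2)[of n n], folded L_def] unfolding q_def by blast+
  have qpos: "0 < q n" for n using LL(2)[of n] Qpos[of n] by linarith
  \<comment> \<open>The weights are normalized by the truncated sum of squares, so that their
    squares add up to exactly 1 on \<open>L n\<close>.\<close>
  define \<rho> where "\<rho> n l = R n l * (1 / sqrt (q n))" for n l
  have \<rho>0: "0 \<le> \<rho> n l" for n l using R0 qpos[of n] by (simp add: \<rho>_def)
  have \<rho>1: "(\<Sum>l\<in>L n. (\<rho> n l)\<^sup>2) = 1" for n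
  proof -
    have "(\<Sum>l\<in>L n. (\<rho> n l)\<^sup>2) = q n / q n"
      using qpos[of n] by (simp add: \<rho>_def power_divide sum_divide_distrib[symmetric] q_def[symmetric])
    then show ?thesis using qpos[of n] by simp
  qed
  have \<rho>u: "\<rho> n l \<le> u n / sqrt (q n)" for n l
    using Ru[of n l] qpos[of n] by (simp add: \<rho>_def divide_right_mono)
  \<comment> \<open>The normalization occurs \<open>r\<close> times in total. Replacing
    \<open>q n\<close> by \<open>Q n\<close> costs a factor 2 each time, since
    \<open>Q n / 4 < q n\<close>; the constant \<open>2 ^ r\<close> is harmless in the growth
    condition.\<close>
  have \<rho>small: "(\<lambda>n. (\<Sum>l\<in>L n. \<rho> n l) * (u n / sqrt (q n)) ^ (r - 1)) \<longlonglongrightarrow> 0" if r: "3 \<le> r" for r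
  proof -
    have "(\<lambda>n. u n ^ (r - 1) * s n / Q n powr (real r / 2)) \<longlonglongrightarrow> 0"
      using smalloD_tendsto[OF small[OF r]] by (simp add: u_def s_def Q_def)
    from tendsto_mult_right_zero[OF this, of "2 ^ r"]
    have lim: "(\<lambda>n. 2 ^ r * (u n ^ (r - 1) * s n / Q n powr (real r / 2))) \<longlonglongrightarrow> 0" .
    have le: "(\<Sum>l\<in>L n. \<rho> n l) * (u n / sqrt (q n)) ^ (r - 1) \<le> 2 ^ r * (u n ^ (r - 1) * s n / Q n powr (real r / 2))" for n
    proof -
      have "(\<Sum>l\<in>L n. R n l) \<le> s n" unfolding s_def using LL(1) R0 Rs by (intro finite_sum_le_infsum) auto
      then have "(\<Sum>l\<in>L n. \<rho> n l) \<le> s n / sqrt (q n)"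
        using qpos[of n] by (simp add: \<rho>_def sum_divide_distrib[symmetric] divide_right_mono)
      then have "(\<Sum>l\<in>L n. \<rho> n l) * (u n / sqrt (q n)) ^ (r - 1) \<le> s n / sqrt (q n) * (u n / sqrt (q n)) ^ (r - 1)"
        using u0 qpos[of n] by (intro mult_right_mono) auto
      also have "\<dots> = u n ^ (r - 1) * s n / sqrt (q n) ^ r"
        using r by (cases r) (simp_all add: power_divide)
      also have "\<dots> \<le> u n ^ (r - 1) * s n / (sqrt (Q n) / 2) ^ r"
      proof (intro divide_left_mono power_mono)
        have "sqrt (Q n / 4) \<le> sqrt (q n)" using LL(2)[of n] by simp
        then show "sqrt (Q n) / 2 \<le> sqrt (q n)" by (simp add: real_sqrt_divide)
        show "0 \<le> u n ^ (r - 1) * s n" using u0[of n] spos[of n] by simp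
      qed (use Qpos[of n] qpos[of n] in auto)
      also have "\<dots> = 2 ^ r * (u n ^ (r - 1) * s n / sqrt (Q n) ^ r)" by (simp add: power_divide)
      also have "sqrt (Q n) ^ r = Q n powr (real r / 2)"
        using Qpos[of n] by (simp add: powr_half_sqrt[symmetric] powr_realpow[symmetric] powr_powr)
      finally show ?thesis .
    qed
    have ge: "0 \<le> (\<Sum>l\<in>L n. \<rho> n l) * (u n / sqrt (q n)) ^ (r - 1)" for n
      using \<rho>0 u0 qpos[of n] by (intro mult_nonneg_nonneg sum_nonneg zero_le_power divide_nonneg_pos) auto
    show ?thesis
      by (rule tendsto_sandwich[OF always_eventually[OF allI[OF ge]] always_eventually[OF allI[OF le]] tendsto_const lim])
  qed
  have reg': "(\<lambda>n. \<integral>t. normalized_kernel (R n) t * corr_density t \<partial>torus_haar) \<longlonglongrightarrow> v"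
    using reg corr_density_continuous unfolding zeta_regular_def v_def by blast
  let ?X = "\<lambda>n x. \<Sum>l\<in>L n. \<rho> n l * fr (act A l x)"
  \<comment> \<open>By the choice of \<open>L n\<close> the variance is within
    \<open>1 / real (Suc n)\<close> of the kernel integral, whose limit is given by regularity. The
    sign of \<open>v\<close> below is then that of a limit of variances.\<close>
  have var: "(\<lambda>n. expectation (\<lambda>x. (?X n x)\<^sup>2)) \<longlonglongrightarrow> v"
  proof -
    have eq: "expectation (\<lambda>x. (?X n x)\<^sup>2) = (\<Sum>l\<in>L n. \<Sum>m\<in>L n. R n l * R n m * corr (m - l)) / q n" for n
    proof -
      have "\<rho> n l * \<rho> n m = R n l * R n m / q n" for l m
        using qpos[of n] by (simp add: \<rho>_def)
      then show ?thesis unfolding variance_finite_sum by (simp add: sum_divide_distrib)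
    qed
    have "(\<lambda>n. expectation (\<lambda>x. (?X n x)\<^sup>2) - (\<integral>t. normalized_kernel (R n) t * corr_density t \<partial>torus_haar)) \<longlonglongrightarrow> 0"
    proof (rule Lim_null_comparison[OF always_eventually[OF allI]])
      show "norm (expectation (\<lambda>x. (?X n x)\<^sup>2) - (\<integral>t. normalized_kernel (R n) t * corr_density t \<partial>torus_haar)) \<le> inverse (real (Suc n))" for n
        using LL(5)[of n] unfolding eq by (simp add: inverse_eq_divide)
    qed (rule LIMSEQ_inverse_real_of_nat)
    from tendsto_add[OF this reg'] show ?thesis by simp
  qed
  show "0 \<le> v" by (rule LIMSEQ_le_const[OF var]) auto
  have lim: "(\<lambda>n. char (distr M borel (?X n)) t) \<longlonglongrightarrow> complex_of_real (exp (- (t\<^sup>2 * v / 2)))"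
    by (rule char_finite_sums[OF LL(1) \<rho>0 \<rho>1 \<rho>u \<rho>small var])
  let ?Y = "\<lambda>n x. Q n powr (- 1 / 2) * (\<Sum>\<^sub>\<infinity>l. R n l * f (act A l x))"
  have Qp: "Q n powr (- 1 / 2) = 1 / sqrt (Q n)" for n
    using Qpos[of n] by (simp add: powr_minus powr_half_sqrt inverse_eq_divide flip: minus_divide_left)
  \<comment> \<open>Here the continuous version pays off: it is bounded by \<open>C\<close>
    everywhere, so the truncation error is uniform outside one null set.\<close>
  have XY: "AE x in M. \<bar>?Y n x - ?X n x\<bar> \<le> 2 * C * (1 / real (Suc n))" for n
    using f_act_eq_fr
  proof eventually_elim
    case (elim x)
    have "?Y n x = 1 / sqrt (Q n) * (\<Sum>\<^sub>\<infinity>l. R n l * fr (act A l x))" unfolding Qp using elim by simp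
    moreover have "\<bar>1 / sqrt (Q n) * (\<Sum>\<^sub>\<infinity>l. R n l * fr (act A l x)) - (\<Sum>l\<in>L n. R n l * (1 / sqrt (q n)) * fr (act A l x))\<bar>
        \<le> 2 * C * (1 / real (Suc n))"
    proof (rule truncation_error[OF R0 Rs LL(1) _ _ _ fr_le_C])
      show "0 \<le> 1 / sqrt (Q n)" using Qpos[of n] by simp
      show "\<bar>1 / sqrt (Q n) - 1 / sqrt (q n)\<bar> * (\<Sum>\<^sub>\<infinity>l. R n l) \<le> 1 / real (Suc n)"
        using LL(3)[of n] by (simp add: s_def)
      show "((\<Sum>\<^sub>\<infinity>l. R n l) - (\<Sum>l\<in>L n. R n l)) * (1 / sqrt (Q n)) \<le> 1 / real (Suc n)"
        using LL(4)[of n] by (simp add: s_def)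
    qed
    ultimately show ?case by (simp add: \<rho>_def)
  qed
  have Ym: "?Y n \<in> borel_measurable M" for n by (rule weighted_sum_measurable)
  have Xm: "?X n \<in> borel_measurable M" for n
    by (intro measurable_continuous continuous_intros continuous_on_comp_UNIV[OF fr_cts act_cts])
  have XYi: "integrable M (\<lambda>x. \<bar>?Y n x - ?X n x\<bar>)" for n
  proof (rule integrable_const_bound)
    show "AE x in M. norm \<bar>?Y n x - ?X n x\<bar> \<le> 2 * C * (1 / real (Suc n))" using XY[of n] by (simp only: real_norm_def abs_idempotent)
    show "(\<lambda>x. \<bar>?Y n x - ?X n x\<bar>) \<in> borel_measurable M" by (intro borel_measurable_abs borel_measurable_diff Ym Xm)
  qed
  have cd: "norm (char (distr M borel (?Y n)) t - char (distr M borel (?X n)) t) \<le> \<bar>t\<bar> * (2 * C) * inverse (real (Suc n))" for n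
  proof -
    have "expectation (\<lambda>x. \<bar>?Y n x - ?X n x\<bar>) \<le> (\<integral>x. 2 * C * (1 / real (Suc n)) \<partial>M)"
      by (rule integral_mono_AE[OF XYi _ XY]) simp
    also have "(\<integral>x. 2 * C * (1 / real (Suc n)) \<partial>M) = 2 * C * (1 / real (Suc n))" by (simp add: prob_space)
    finally have "expectation (\<lambda>x. \<bar>?Y n x - ?X n x\<bar>) \<le> 2 * C * (1 / real (Suc n))" .
    then have "\<bar>t\<bar> * expectation (\<lambda>x. \<bar>?Y n x - ?X n x\<bar>) \<le> \<bar>t\<bar> * (2 * C * (1 / real (Suc n)))" by (rule mult_left_mono) simp
    with char_dist_le[OF Ym Xm XYi] have "norm (char (distr M borel (?Y n)) t - char (distr M borel (?X n)) t)
        \<le> \<bar>t\<bar> * (2 * C * (1 / real (Suc n)))" by (rule order_trans)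
    then show ?thesis by (simp only: inverse_eq_divide mult.assoc)
  qed
  have "(\<lambda>n. \<bar>t\<bar> * (2 * C) * inverse (real (Suc n))) \<longlonglongrightarrow> 0"
    by (rule tendsto_mult_right_zero[OF LIMSEQ_inverse_real_of_nat])
  then have "(\<lambda>n. char (distr M borel (?Y n)) t - char (distr M borel (?X n)) t) \<longlonglongrightarrow> 0"
    by (rule Lim_null_comparison[OF always_eventually[OF allI[OF cd]]])
  from tendsto_add[OF this lim]
  show "(\<lambda>n. char (distr M borel (\<lambda>x. (\<Sum>\<^sub>\<infinity>l. (R n l)\<^sup>2) powr (- 1 / 2) * (\<Sum>\<^sub>\<infinity>l. R n l * f (act A l x)))) t)
      \<longlonglongrightarrow> complex_of_real (exp (- (t\<^sup>2 * v / 2)))"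
    unfolding Q_def by simp
qed

end

theorem theorem4p3:
  fixes M :: "'a::{topological_ab_group_add,t2_space} measure"
    and A :: "'d::finite \<Rightarrow> 'a \<Rightarrow> 'a"
    and R :: "nat \<Rightarrow> int ^ 'd \<Rightarrow> real"
    and \<zeta> :: "(real ^ 'd) measure"
    and f :: "'a \<Rightarrow> real"
  assumes "compact (UNIV :: 'a set)"
    and "haar_probability M"
    and "\<And>i. group_automorphism (A i)"
    and "\<And>i j. A i \<circ> A j = A j \<circ> A i"
    and "totally_ergodic M A"
    and "mixing_all_orders M A"
    and "summation_sequence R"
    and "zeta_regular R \<zeta>"
    and "f \<in> AC0 M"
    and "\<And>r::nat. r \<ge> 3 \<Longrightarrow>
           (\<lambda>n. (SUP l. R n l) ^ (r - 1) * (\<Sum>\<^sub>\<infinity>l. R n l))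
             \<in> o(\<lambda>n. (\<Sum>\<^sub>\<infinity>l. (R n l)\<^sup>2) powr (real r / 2))"
  shows "weak_conv_m
           (\<lambda>n. distr M borel
              (\<lambda>x. (\<Sum>\<^sub>\<infinity>l. (R n l)\<^sup>2) powr (- 1 / 2) * (\<Sum>\<^sub>\<infinity>l. R n l * f (act A l x))))
           (centered_normal (\<integral>t. spectral_density M A f t \<partial>\<zeta>))"
proof -
  interpret ac0_function M A f
    by standard (use assms in auto)
  note lim = char_weighted_sums[OF assms(7,8,10)]
  show ?thesis
    unfolding spectral_density_eq
  proof (rule levy_continuity)
    show "real_distribution (centered_normal (\<integral>t. corr_density t \<partial>\<zeta>))"
      by (rule real_distribution_centered_normal[OF lim(1)])
    show "real_distribution (distr M borel
        (\<lambda>x. (\<Sum>\<^sub>\<infinity>l. (R n l)\<^sup>2) powr (- 1 / 2) * (\<Sum>\<^sub>\<infinity>l. R n l * f (act A l x))))" for n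
      by (rule real_distribution_distr[OF weighted_sum_measurable])
    show "(\<lambda>n. char (distr M borel
        (\<lambda>x. (\<Sum>\<^sub>\<infinity>l. (R n l)\<^sup>2) powr (- 1 / 2) * (\<Sum>\<^sub>\<infinity>l. R n l * f (act A l x)))) t)
      \<longlonglongrightarrow> char (centered_normal (\<integral>t. corr_density t \<partial>\<zeta>)) t" for t
      by (subst char_centered_normal[OF lim(1)], assumption, rule lim(2))
  qed
qed

end
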